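(* Let $\mathcal V$ be a rigid braided monoidal category. Then the 2-functor $P:\mathcal V\mathbf{MonCat}\to\mathcal V\mathbf{ModTens}$, given on 0-cells by $P(\mathcal A)=(A,\mathcal F_A^Z)$, on 1-cells by $P(\mathcal R,\rho^R)=(R,\rho,r)$ and on 2-cells by $P(\theta)=\Theta$, is a 2-equivalence.
   Context: Conventions. $\mathcal V$ is a rigid braided monoidal category with unit $1_{\mathcal V}$ and braiding $\beta_{u,v}:uv\to vu$. Tensor products are written by juxtaposition and associators/unitors are suppressed (monoidal categories are treated as strict). $g\circ f$ means first $f$, then $g$. Enriched notions. A $\mathcal V$-category $\mathcal A$ has objects, hom objects $\mathcal A(a\to b)\in\mathcal V$, identities $j_a:1_{\mathcal V}\to\mathcal A(a\to a)$ and compositions $\circ_{\mathcal A}:\mathcal A(a\to b)\mathcal A(b\to c)\to\mathcal A(a\to c)$, unital and associative. Its underlying category $A=\mathcal A^{\mathcal V}$ has the same objects and $A(a\to b)=\mathcal V(1_{\mathcal V}\to\mathcal A(a\to b))$. A $\mathcal V$-monoidal category has in addition a unit object $1_{\mathcal A}$, a strictly associative and unital product $ab$ on objects, and morphisms $\otimes_{\mathcal A}:\mathcal A(a\to c)\mathcal A(b\to d)\to\mathcal A(ab\to cd)$ that are associative, unital with respect to $j_{1_{\mathcal A}}$, satisfy $\otimes_{\mathcal A}\circ(j_aj_b)=j_{ab}$, and satisfy the braided interchange law $\circ_{\mathcal A}\circ(\otimes_{\mathcal A}\,\otimes_{\mathcal A})=\otimes_{\mathcal A}\circ(\circ_{\mathcal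 A}\,\circ_{\mathcal A})\circ(\mathrm{id}\,\beta_{\mathcal A(d\to e),\mathcal A(b\to c)}\,\mathrm{id})$ as maps $\mathcal A(a\to b)\mathcal A(d\to e)\mathcal A(b\to c)\mathcal A(e\to f)\to\mathcal A(ad\to cf)$. Then $A$ is an ordinary monoidal category; $\mathcal A$ is rigid if $A$ is. A $\mathcal V$-functor $\mathcal R:\mathcal A\to\mathcal B$ is a map on objects with morphisms $\mathcal R_{a\to b}:\mathcal A(a\to b)\to\mathcal B(\mathcal R(a)\to\mathcal R(b))$ preserving composition and identities; its underlying functor $R:A\to B$ has $R(a)=\mathcal R(a)$, $R(f)=\mathcal R_{a\to b}\circ f$. A strictly unital lax $\mathcal V$-monoidal functor $(\mathcal R,\rho^R)$ is a $\mathcal V$-functor with $\mathcal R(1_{\mathcal A})=1_{\mathcal B}$ and morphisms $\rho^R_{a,b}:1_{\mathcal V}\to\mathcal B(\mathcal R(a)\mathcal R(b)\to\mathcal R(ab))$ with: naturality $\circ_{\mathcal B}\circ(\rho^R_{a,b}\;(\mathcal R_{ab\to cd}\circ\otimes_{\mathcal A}))=\circ_{\mathcal B}\circ((\otimes_{\mathcal B}\circ(\mathcal R_{a\to c}\mathcal R_{b\to d}))\;\rho^R_{c,d})$ on $\mathcal A(a\to c)\mathcal A(b\to d)$; associativity $\rho^R_{a,bc}\circ(\mathrm{id}\,\rho^R_{b,c})=\rho^R_{ab,c}\circ(\rho^R_{a,b}\,\mathrm{id})$ in $B$; unitality $\rho^R_{1,a}=j_{\mathcal R(a)}=\rho^R_{a,1}$.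 A $1_{\mathcal V}$-graded monoidal natural transformation $\theta:(\mathcal R,\rho^R)\Rightarrow(\mathcal S,\sigma^S)$ consists of $\theta_a\in B(\mathcal R(a)\to\mathcal S(a))$ with $\circ_{\mathcal B}\circ(\theta_a\,\mathcal S_{a\to b})=\circ_{\mathcal B}\circ(\mathcal R_{a\to b}\,\theta_b)$ on $\mathcal A(a\to b)$, and in $B$: $\theta_{ab}\circ\rho^R_{a,b}=\sigma^S_{a,b}\circ(\theta_a\theta_b)$ and $\theta_{1_{\mathcal A}}=\mathrm{id}$. $\mathcal V\mathbf{MonCat}$. 0-cells: rigid $\mathcal V$-monoidal categories $\mathcal A$ such that the functor $A\to\mathcal V$, $x\mapsto\mathcal A(1_{\mathcal A}\to x)$ admits a left adjoint. 1-cells: strictly unital lax $\mathcal V$-monoidal functors; the composite of $(\mathcal R,\rho^R):\mathcal A\to\mathcal B$ and $(\mathcal S,\sigma^S):\mathcal B\to\mathcal C$ is the composite $\mathcal V$-functor with laxitor $S(\rho^R_{a,b})\circ\sigma^S_{R(a),R(b)}$. 2-cells: $1_{\mathcal V}$-graded monoidal natural transformations with usual vertical and horizontal composition. Units are the evident identities. $\mathcal V\mathbf{ModTens}$. For a monoidal category $A$, objects of the Drinfeld center $Z(A)$ are pairs of $z\in A$ and a half-braiding $e_{a,z}:az\to za$; the braiding of $x,z\in Z(A)$ is $e_{x,z}$. 0-cells: pairs $(A,\mathcal F_A^Z)$ with $A$ a rigid monoidal category and $\mathcal F_A^Z:\mathcal V\to Z(A)$ a braided oplax monoidal functor, with oplaxitor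 $\mu^{\mathcal F_A}_{u,v}:\mathcal F_A(uv)\to\mathcal F_A(u)\mathcal F_A(v)$, strictly unital ($\mathcal F_A(1_{\mathcal V})=1_A$ and $\mu_{1,v},\mu_{v,1}$ are identities), such that its composite $\mathcal F_A:\mathcal V\to A$ with the forgetful functor admits a right adjoint. 1-cells $(A,\mathcal F_A^Z)\to(B,\mathcal F_B^Z)$: triples $(R,\rho,r)$ with $(R,\rho):A\to B$ a strictly unital lax monoidal functor ($R(1_A)=1_B$, $\rho_{1,a}=\mathrm{id}=\rho_{a,1}$) and $r$ a natural transformation with components $r_v:\mathcal F_B(v)\to R(\mathcal F_A(v))$, $r_{1_{\mathcal V}}=\mathrm{id}_{1_B}$, satisfying half-braiding coherence $\rho_{\mathcal F_A(v),a}\circ(r_v\,\mathrm{id}_{R(a)})\circ e_{R(a),\mathcal F_B(v)}=R(e_{a,\mathcal F_A(v)})\circ\rho_{a,\mathcal F_A(v)}\circ(\mathrm{id}_{R(a)}\,r_v)$ and action coherence $R(\mu^{\mathcal F_A}_{u,v})\circ r_{uv}=\rho_{\mathcal F_A(u),\mathcal F_A(v)}\circ(r_ur_v)\circ\mu^{\mathcal F_B}_{u,v}$. 2-cells $(R,\rho,r)\Rightarrow(S,\sigma,s)$: monoidal natural transformations $\Theta:(R,\rho)\Rightarrow(S,\sigma)$ with $\Theta_{\mathcal F_A(v)}\circ r_v=s_v$ for all $v$. The composite of $(R,\rho,r):A\to B$ and $(S,\sigma,s):B\to C$ is the composite functor with laxitor $S(\rho_{a,b})\circ\sigma_{R(a),R(b)}$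 and coherence $S(r_v)\circ s_v$. 2-cells compose vertically and horizontally as usual; units are the evident identities. The 2-functor $P$. For a 0-cell $\mathcal A$ let $\mathcal F_A$ be a (chosen) left adjoint of $\mathcal A(1_{\mathcal A}\to-):A\to\mathcal V$, with unit $\eta^{\mathcal F_A}_v:v\to\mathcal A(1_{\mathcal A}\to\mathcal F_A(v))$, chosen so that $\mathcal F_A(1_{\mathcal V})=1_{\mathcal A}$, $\eta_{1_{\mathcal V}}=j_{1_{\mathcal A}}$. By rigidity there are natural bijections $A(a\mathcal F_A(v)\to b)\cong\mathcal V(v\to\mathcal A(a\to b))$, sending $f$ to $\circ_{\mathcal A}\circ((\otimes_{\mathcal A}\circ(j_a\,\eta_v))\,f)$; corresponding morphisms are called mates. The oplaxitor $\mu_{u,v}$ is the mate of $\otimes_{\mathcal A}\circ(\eta_u\eta_v)$, and the half-braiding $e_{a,\mathcal F_A(v)}:a\mathcal F_A(v)\to\mathcal F_A(v)a$ is the mate of $\otimes_{\mathcal A}\circ(\eta_v\,j_a):v\to\mathcal A(a\to\mathcal F_A(v)a)$; this lifts $\mathcal F_A$ to $\mathcal F_A^Z:\mathcal V\to Z(A)$, and $P(\mathcal A)=(A,\mathcal F_A^Z)$. For a 1-cell $(\mathcal R,\rho^R):\mathcal A\to\mathcal B$, $P(\mathcal R,\rho^R)=(R,\rho,r)$ with $R$ the underlying functor, $\rho_{a,b}=\rho^R_{a,b}$ viewed in $B(R(a)R(b)\to R(ab))$, and $r_v:\mathcal F_B(v)\to R(\mathcal F_A(v))$ the mate of $\mathcal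 R_{1_{\mathcal A}\to\mathcal F_A(v)}\circ\eta^{\mathcal F_A}_v:v\to\mathcal B(1_{\mathcal B}\to R(\mathcal F_A(v)))$. On 2-cells $P(\theta)=\Theta$ with $\Theta_a=\theta_a$ viewed in $B(R(a)\to S(a))$. A 2-functor (strict) $P:\mathscr A\to\mathscr B$ is a 2-equivalence if every 0-cell of $\mathscr B$ is equivalent in $\mathscr B$ to some $P(A)$, and every $P_{A\to B}:\mathscr A(A\to B)\to\mathscr B(P(A)\to P(B))$ is an equivalence of categories. *)

theory Defs
  imports "HOL-Library.FuncSet"
begin

section \<open>Categories, functors, adjunctions\<close>

text \<open>
  Categories have a carrier of objects and a carrier of arrows, and every arrow knows its source and
  target.  Composition is written in the usual order: \<open>g \<cdot> f\<close> is first \<open>f\<close>, then \<open>g\<close>.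
\<close>

record ('o, 'm) cat =
  Obj :: "'o set"
  Arr :: "'m set"
  Dom :: "'m \<Rightarrow> 'o"
  Cod :: "'m \<Rightarrow> 'o"
  Ide :: "'o \<Rightarrow> 'm"
  Cmp :: "'m \<Rightarrow> 'm \<Rightarrow> 'm" (infixl "\<cdot>\<index>" 70)

definition hom :: "('o, 'm, 'x) cat_scheme \<Rightarrow> 'o \<Rightarrow> 'o \<Rightarrow> 'm set" where
  "hom C a b = {f \<in> Arr C. Dom C f = a \<and> Cod C f = b}"

locale category =
  fixes C :: "('o, 'm, 'x) cat_scheme" (structure)
  assumes dom_in: "f \<in> Arr C \<Longrightarrow> Dom C f \<in> Obj C"
    and cod_in: "f \<in> Arr C \<Longrightarrow> Cod C f \<in> Obj C"
    and ide_in: "a \<in> Obj C \<Longrightarrow> Ide C a \<in> hom C a a"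
    and cmp_in: "f \<in> hom C a b \<Longrightarrow> g \<in> hom C b c \<Longrightarrow> g \<cdot> f \<in> hom C a c"
    and cmp_ide: "f \<in> hom C a b \<Longrightarrow> f \<cdot> Ide C a = f"
    and ide_cmp: "f \<in> hom C a b \<Longrightarrow> Ide C b \<cdot> f = f"
    and cmp_assoc: "f \<in> hom C a b \<Longrightarrow> g \<in> hom C b c \<Longrightarrow> h \<in> hom C c d \<Longrightarrow>
                      (h \<cdot> g) \<cdot> f = h \<cdot> (g \<cdot> f)"

definition is_iso :: "('o, 'm, 'x) cat_scheme \<Rightarrow> 'm \<Rightarrow> bool" where
  "is_iso C f \<longleftrightarrow> f \<in> Arr C \<and>
     (\<exists>g \<in> hom C (Cod C f) (Dom C f).
        g \<cdot>\<^bsub>C\<^esub> f = Ide C (Dom C f) \<and> f \<cdot>\<^bsub>C\<^esub> g = Ide C (Cod C f))"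

definition isomorphic :: "('o, 'm, 'x) cat_scheme \<Rightarrow> 'o \<Rightarrow> 'o \<Rightarrow> bool" where
  "isomorphic C a b \<longleftrightarrow> (\<exists>f \<in> hom C a b. is_iso C f)"

record ('o, 'm, 'p, 'n) fctr =
  FO :: "'o \<Rightarrow> 'p"
  FA :: "'m \<Rightarrow> 'n"

locale cfunctor = C: category C + D: category D
  for C :: "('o, 'm, 'x) cat_scheme" and D :: "('p, 'n, 'y) cat_scheme" +
  fixes F :: "('o, 'm, 'p, 'n) fctr"
  assumes FO_in: "a \<in> Obj C \<Longrightarrow> FO F a \<in> Obj D"
    and FA_in: "f \<in> hom C a b \<Longrightarrow> FA F f \<in> hom D (FO F a) (FO F b)"
    and FA_ide: "a \<in> Obj C \<Longrightarrow> FA F (Ide C a) = Ide D (FO F a)"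
    and FA_cmp: "f \<in> hom C a b \<Longrightarrow> g \<in> hom C b c \<Longrightarrow> FA F (g \<cdot>\<^bsub>C\<^esub> f) = FA F g \<cdot>\<^bsub>D\<^esub> FA F f"

text \<open>
  Identities and composites are cut down to the carriers (\<open>restrict\<close>), so that equality of functors
  that are extensional on a carrier is equality of functors in the mathematical sense.
\<close>

definition fid :: "('o, 'm, 'x) cat_scheme \<Rightarrow> ('o, 'm, 'o, 'm) fctr" where
  "fid C = \<lparr>FO = (\<lambda>a\<in>Obj C. a), FA = (\<lambda>f\<in>Arr C. f)\<rparr>"

definition fcomp ::
  "('o, 'm, 'x) cat_scheme \<Rightarrow> ('p, 'n, 'q, 'k) fctr \<Rightarrow> ('o, 'm, 'p, 'n) fctr \<Rightarrow> ('o, 'm, 'q, 'k) fctr"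
where
  "fcomp C G F = \<lparr>FO = (\<lambda>a\<in>Obj C. FO G (FO F a)), FA = (\<lambda>f\<in>Arr C. FA G (FA F f))\<rparr>"

definition nat_trans ::
  "('o, 'm, 'x) cat_scheme \<Rightarrow> ('p, 'n, 'y) cat_scheme \<Rightarrow>
   ('o, 'm, 'p, 'n) fctr \<Rightarrow> ('o, 'm, 'p, 'n) fctr \<Rightarrow> ('o \<Rightarrow> 'n) \<Rightarrow> bool"
where
  "nat_trans C D F G \<tau> \<longleftrightarrow>
     (\<forall>a \<in> Obj C. \<tau> a \<in> hom D (FO F a) (FO G a)) \<and>
     (\<forall>f \<in> Arr C. FA G f \<cdot>\<^bsub>D\<^esub> \<tau> (Dom C f) = \<tau> (Cod C f) \<cdot>\<^bsub>D\<^esub> FA F f)"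

definition nat_iso ::
  "('o, 'm, 'x) cat_scheme \<Rightarrow> ('p, 'n, 'y) cat_scheme \<Rightarrow>
   ('o, 'm, 'p, 'n) fctr \<Rightarrow> ('o, 'm, 'p, 'n) fctr \<Rightarrow> ('o \<Rightarrow> 'n) \<Rightarrow> bool"
where
  "nat_iso C D F G \<tau> \<longleftrightarrow> nat_trans C D F G \<tau> \<and> (\<forall>a \<in> Obj C. is_iso D (\<tau> a))"

definition equivalence_of_categories ::
  "('o, 'm, 'x) cat_scheme \<Rightarrow> ('p, 'n, 'y) cat_scheme \<Rightarrow> ('o, 'm, 'p, 'n) fctr \<Rightarrow> bool"
where
  "equivalence_of_categories C D F \<longleftrightarrow> cfunctor C D F \<and>
     (\<exists>G \<eta> \<epsilon>. cfunctor D C G \<and>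
        nat_iso C C (fid C) (fcomp C G F) \<eta> \<and> nat_iso D D (fcomp D F G) (fid D) \<epsilon>)"

text \<open>\<open>F\<close> is left adjoint to \<open>G\<close> with unit \<open>\<eta>\<close> and counit \<open>\<epsilon>\<close>.\<close>

locale adjunction = F: cfunctor C D F + G: cfunctor D C G
  for C :: "('o, 'm, 'x) cat_scheme" and D :: "('p, 'n, 'y) cat_scheme" and F and G +
  fixes \<eta> :: "'o \<Rightarrow> 'm" and \<epsilon> :: "'p \<Rightarrow> 'n"
  assumes unit_nat: "nat_trans C C (fid C) (fcomp C G F) \<eta>"
    and counit_nat: "nat_trans D D (fcomp D F G) (fid D) \<epsilon>"
    and triangle_left: "c \<in> Obj C \<Longrightarrow> \<epsilon> (FO F c) \<cdot>\<^bsub>D\<^esub> FA F (\<eta> c) = Ide D (FO F c)"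
    and triangle_right: "d \<in> Obj D \<Longrightarrow> FA G (\<epsilon> d) \<cdot>\<^bsub>C\<^esub> \<eta> (FO G d) = Ide C (FO G d)"

definition has_left_adjoint ::
  "('o, 'm, 'x) cat_scheme \<Rightarrow> ('p, 'n, 'y) cat_scheme \<Rightarrow> ('p, 'n, 'o, 'm) fctr \<Rightarrow> bool"
where
  "has_left_adjoint C D G \<longleftrightarrow> (\<exists>F \<eta> \<epsilon>. adjunction C D F G \<eta> \<epsilon>)"

definition has_right_adjoint ::
  "('o, 'm, 'x) cat_scheme \<Rightarrow> ('p, 'n, 'y) cat_scheme \<Rightarrow> ('o, 'm, 'p, 'n) fctr \<Rightarrow> bool"
where
  "has_right_adjoint C D F \<longleftrightarrow> (\<exists>G \<eta> \<epsilon>. adjunction C D F G \<eta> \<epsilon>)"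


section \<open>Monoidal categories\<close>

text \<open>All monoidal categories are strict.  \<open>\<odot>\<close> is the product of objects, \<open>\<otimes>\<close> that of arrows.\<close>

record ('o, 'm) moncat = "('o, 'm) cat" +
  Unit :: "'o" ("\<one>\<index>")
  TenO :: "'o \<Rightarrow> 'o \<Rightarrow> 'o" (infixl "\<odot>\<index>" 75)
  TenM :: "'m \<Rightarrow> 'm \<Rightarrow> 'm" (infixl "\<otimes>\<index>" 75)

record ('o, 'm) braided_moncat = "('o, 'm) moncat" +
  Braid :: "'o \<Rightarrow> 'o \<Rightarrow> 'm"

locale strict_monoidal_category = category C
  for C :: "('o, 'm, 'x) moncat_scheme" (structure) +
  assumes unit_in: "\<one> \<in> Obj C"
    and tenO_in: "a \<in> Obj C \<Longrightarrow> b \<in> Obj C \<Longrightarrow> a \<odot> b \<in> Obj C"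
    and tenM_in: "f \<in> hom C a c \<Longrightarrow> g \<in> hom C b d \<Longrightarrow> f \<otimes> g \<in> hom C (a \<odot> b) (c \<odot> d)"
    and tenM_ide: "a \<in> Obj C \<Longrightarrow> b \<in> Obj C \<Longrightarrow> Ide C a \<otimes> Ide C b = Ide C (a \<odot> b)"
    and tenM_cmp: "f \<in> hom C a b \<Longrightarrow> f' \<in> hom C b c \<Longrightarrow> g \<in> hom C d e \<Longrightarrow> g' \<in> hom C e k \<Longrightarrow>
                     (f' \<cdot> f) \<otimes> (g' \<cdot> g) = (f' \<otimes> g') \<cdot> (f \<otimes> g)"
    and tenO_assoc: "a \<in> Obj C \<Longrightarrow> b \<in> Obj C \<Longrightarrow> c \<in> Obj C \<Longrightarrow> (a \<odot> b) \<odot> c = a \<odot> (b \<odot> c)"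
    and tenO_unit: "a \<in> Obj C \<Longrightarrow> \<one> \<odot> a = a" "a \<in> Obj C \<Longrightarrow> a \<odot> \<one> = a"
    and tenM_assoc: "f \<in> Arr C \<Longrightarrow> g \<in> Arr C \<Longrightarrow> h \<in> Arr C \<Longrightarrow> (f \<otimes> g) \<otimes> h = f \<otimes> (g \<otimes> h)"
    and tenM_unit: "f \<in> Arr C \<Longrightarrow> Ide C \<one> \<otimes> f = f" "f \<in> Arr C \<Longrightarrow> f \<otimes> Ide C \<one> = f"

text \<open>\<open>d\<close> is a left dual of \<open>a\<close> (equivalently, \<open>a\<close> is a right dual of \<open>d\<close>).\<close>

definition dual_pair :: "('o, 'm, 'x) moncat_scheme \<Rightarrow> 'o \<Rightarrow> 'o \<Rightarrow> bool" where
  "dual_pair C d a \<longleftrightarrow>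
     (\<exists>ev \<in> hom C (d \<odot>\<^bsub>C\<^esub> a) \<one>\<^bsub>C\<^esub>. \<exists>coev \<in> hom C \<one>\<^bsub>C\<^esub> (a \<odot>\<^bsub>C\<^esub> d).
        (Ide C a \<otimes>\<^bsub>C\<^esub> ev) \<cdot>\<^bsub>C\<^esub> (coev \<otimes>\<^bsub>C\<^esub> Ide C a) = Ide C a \<and>
        (ev \<otimes>\<^bsub>C\<^esub> Ide C d) \<cdot>\<^bsub>C\<^esub> (Ide C d \<otimes>\<^bsub>C\<^esub> coev) = Ide C d)"

locale rigid_monoidal_category = strict_monoidal_category C
  for C :: "('o, 'm, 'x) moncat_scheme" (structure) +
  assumes left_dual: "a \<in> Obj C \<Longrightarrow> \<exists>d \<in> Obj C. dual_pair C d a"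
    and right_dual: "a \<in> Obj C \<Longrightarrow> \<exists>d \<in> Obj C. dual_pair C a d"

locale braided_monoidal_category = strict_monoidal_category C
  for C :: "('o, 'm, 'x) braided_moncat_scheme" (structure) +
  assumes braid_in: "a \<in> Obj C \<Longrightarrow> b \<in> Obj C \<Longrightarrow> Braid C a b \<in> hom C (a \<odot> b) (b \<odot> a)"
    and braid_iso: "a \<in> Obj C \<Longrightarrow> b \<in> Obj C \<Longrightarrow> is_iso C (Braid C a b)"
    and braid_nat: "f \<in> hom C a c \<Longrightarrow> g \<in> hom C b d \<Longrightarrow>
                      Braid C c d \<cdot> (f \<otimes> g) = (g \<otimes> f) \<cdot> Braid C a b"
    and hexagon_left: "a \<in> Obj C \<Longrightarrow> b \<in> Obj C \<Longrightarrow> c \<in> Obj C \<Longrightarrow>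
          Braid C (a \<odot> b) c = (Braid C a c \<otimes> Ide C b) \<cdot> (Ide C a \<otimes> Braid C b c)"
    and hexagon_right: "a \<in> Obj C \<Longrightarrow> b \<in> Obj C \<Longrightarrow> c \<in> Obj C \<Longrightarrow>
          Braid C a (b \<odot> c) = (Ide C b \<otimes> Braid C a c) \<cdot> (Braid C a b \<otimes> Ide C c)"

locale rigid_braided_monoidal_category =
  rigid_monoidal_category C + braided_monoidal_category C
  for C :: "('o, 'm, 'x) braided_moncat_scheme" (structure)

definition strict_lax_monoidal_functor ::
  "('o, 'm, 'x) moncat_scheme \<Rightarrow> ('p, 'n, 'y) moncat_scheme \<Rightarrow>
   ('o, 'm, 'p, 'n) fctr \<Rightarrow> ('o \<Rightarrow> 'o \<Rightarrow> 'n) \<Rightarrow> bool"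
where
  "strict_lax_monoidal_functor C D F \<rho> \<longleftrightarrow> cfunctor C D F \<and>
     FO F \<one>\<^bsub>C\<^esub> = \<one>\<^bsub>D\<^esub> \<and>
     (\<forall>a \<in> Obj C. \<forall>b \<in> Obj C. \<rho> a b \<in> hom D (FO F a \<odot>\<^bsub>D\<^esub> FO F b) (FO F (a \<odot>\<^bsub>C\<^esub> b))) \<and>
     (\<forall>f \<in> Arr C. \<forall>g \<in> Arr C.
        FA F (f \<otimes>\<^bsub>C\<^esub> g) \<cdot>\<^bsub>D\<^esub> \<rho> (Dom C f) (Dom C g) =
        \<rho> (Cod C f) (Cod C g) \<cdot>\<^bsub>D\<^esub> (FA F f \<otimes>\<^bsub>D\<^esub> FA F g)) \<and>
     (\<forall>a \<in> Obj C. \<forall>b \<in> Obj C. \<forall>c \<in> Obj C.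
        \<rho> a (b \<odot>\<^bsub>C\<^esub> c) \<cdot>\<^bsub>D\<^esub> (Ide D (FO F a) \<otimes>\<^bsub>D\<^esub> \<rho> b c) =
        \<rho> (a \<odot>\<^bsub>C\<^esub> b) c \<cdot>\<^bsub>D\<^esub> (\<rho> a b \<otimes>\<^bsub>D\<^esub> Ide D (FO F c))) \<and>
     (\<forall>a \<in> Obj C. \<rho> \<one>\<^bsub>C\<^esub> a = Ide D (FO F a) \<and> \<rho> a \<one>\<^bsub>C\<^esub> = Ide D (FO F a))"

definition strict_oplax_monoidal_functor ::
  "('o, 'm, 'x) moncat_scheme \<Rightarrow> ('p, 'n, 'y) moncat_scheme \<Rightarrow>
   ('o, 'm, 'p, 'n) fctr \<Rightarrow> ('o \<Rightarrow> 'o \<Rightarrow> 'n) \<Rightarrow> bool"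
where
  "strict_oplax_monoidal_functor C D F \<mu> \<longleftrightarrow> cfunctor C D F \<and>
     FO F \<one>\<^bsub>C\<^esub> = \<one>\<^bsub>D\<^esub> \<and>
     (\<forall>u \<in> Obj C. \<forall>v \<in> Obj C. \<mu> u v \<in> hom D (FO F (u \<odot>\<^bsub>C\<^esub> v)) (FO F u \<odot>\<^bsub>D\<^esub> FO F v)) \<and>
     (\<forall>f \<in> Arr C. \<forall>g \<in> Arr C.
        (FA F f \<otimes>\<^bsub>D\<^esub> FA F g) \<cdot>\<^bsub>D\<^esub> \<mu> (Dom C f) (Dom C g) =
        \<mu> (Cod C f) (Cod C g) \<cdot>\<^bsub>D\<^esub> FA F (f \<otimes>\<^bsub>C\<^esub> g)) \<and>
     (\<forall>u \<in> Obj C. \<forall>v \<in> Obj C. \<forall>w \<in> Obj C.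
        (Ide D (FO F u) \<otimes>\<^bsub>D\<^esub> \<mu> v w) \<cdot>\<^bsub>D\<^esub> \<mu> u (v \<odot>\<^bsub>C\<^esub> w) =
        (\<mu> u v \<otimes>\<^bsub>D\<^esub> Ide D (FO F w)) \<cdot>\<^bsub>D\<^esub> \<mu> (u \<odot>\<^bsub>C\<^esub> v) w) \<and>
     (\<forall>v \<in> Obj C. \<mu> \<one>\<^bsub>C\<^esub> v = Ide D (FO F v) \<and> \<mu> v \<one>\<^bsub>C\<^esub> = Ide D (FO F v))"

definition strict_braided_oplax_monoidal_functor ::
  "('o, 'm, 'x) braided_moncat_scheme \<Rightarrow> ('p, 'n, 'y) braided_moncat_scheme \<Rightarrow>
   ('o, 'm, 'p, 'n) fctr \<Rightarrow> ('o \<Rightarrow> 'o \<Rightarrow> 'n) \<Rightarrow> bool"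
where
  "strict_braided_oplax_monoidal_functor C D F \<mu> \<longleftrightarrow> strict_oplax_monoidal_functor C D F \<mu> \<and>
     (\<forall>u \<in> Obj C. \<forall>v \<in> Obj C.
        \<mu> v u \<cdot>\<^bsub>D\<^esub> FA F (Braid C u v) = Braid D (FO F u) (FO F v) \<cdot>\<^bsub>D\<^esub> \<mu> u v)"

definition monoidal_nat_trans ::
  "('o, 'm, 'x) moncat_scheme \<Rightarrow> ('p, 'n, 'y) moncat_scheme \<Rightarrow>
   ('o, 'm, 'p, 'n) fctr \<Rightarrow> ('o \<Rightarrow> 'o \<Rightarrow> 'n) \<Rightarrow>
   ('o, 'm, 'p, 'n) fctr \<Rightarrow> ('o \<Rightarrow> 'o \<Rightarrow> 'n) \<Rightarrow> ('o \<Rightarrow> 'n) \<Rightarrow> bool"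
where
  "monoidal_nat_trans C D F \<rho> G \<sigma> \<theta> \<longleftrightarrow> nat_trans C D F G \<theta> \<and>
     (\<forall>a \<in> Obj C. \<forall>b \<in> Obj C. \<theta> (a \<odot>\<^bsub>C\<^esub> b) \<cdot>\<^bsub>D\<^esub> \<rho> a b = \<sigma> a b \<cdot>\<^bsub>D\<^esub> (\<theta> a \<otimes>\<^bsub>D\<^esub> \<theta> b)) \<and>
     \<theta> \<one>\<^bsub>C\<^esub> = Ide D \<one>\<^bsub>D\<^esub>"


section \<open>The Drinfeld center\<close>

text \<open>
  \<open>Tag x y f\<close> is the datum \<open>f\<close> equipped with a source and a target; it is used for arrows of the
  center and for 2-cells.
\<close>

datatype ('o, 'm) tagged = Tag (tsrc: 'o) (ttgt: 'o) (tval: 'm)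

text \<open>
  The condition \<open>e \<one> = Ide \<one>\<close> is not listed: it follows from multiplicativity and invertibility.
\<close>

definition half_braiding :: "('o, 'm, 'x) moncat_scheme \<Rightarrow> 'o \<Rightarrow> ('o \<Rightarrow> 'm) \<Rightarrow> bool" where
  "half_braiding A z e \<longleftrightarrow>
     e \<in> (\<Pi>\<^sub>E a \<in> Obj A. hom A (a \<odot>\<^bsub>A\<^esub> z) (z \<odot>\<^bsub>A\<^esub> a)) \<and>
     (\<forall>a \<in> Obj A. is_iso A (e a)) \<and>
     (\<forall>f \<in> Arr A. (Ide A z \<otimes>\<^bsub>A\<^esub> f) \<cdot>\<^bsub>A\<^esub> e (Dom A f) = e (Cod A f) \<cdot>\<^bsub>A\<^esub> (f \<otimes>\<^bsub>A\<^esub> Ide A z)) \<and>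
     (\<forall>a \<in> Obj A. \<forall>b \<in> Obj A.
        e (a \<odot>\<^bsub>A\<^esub> b) = (e a \<otimes>\<^bsub>A\<^esub> Ide A b) \<cdot>\<^bsub>A\<^esub> (Ide A a \<otimes>\<^bsub>A\<^esub> e b))"

definition center_tenO ::
  "('o, 'm, 'x) moncat_scheme \<Rightarrow> 'o \<times> ('o \<Rightarrow> 'm) \<Rightarrow> 'o \<times> ('o \<Rightarrow> 'm) \<Rightarrow> 'o \<times> ('o \<Rightarrow> 'm)"
where
  "center_tenO A x y =
     (fst x \<odot>\<^bsub>A\<^esub> fst y,
      \<lambda>a\<in>Obj A. (Ide A (fst x) \<otimes>\<^bsub>A\<^esub> snd y a) \<cdot>\<^bsub>A\<^esub> (snd x a \<otimes>\<^bsub>A\<^esub> Ide A (fst y)))"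

definition center ::
  "('o, 'm, 'x) moncat_scheme \<Rightarrow>
   ('o \<times> ('o \<Rightarrow> 'm), ('o \<times> ('o \<Rightarrow> 'm), 'm) tagged) braided_moncat"
where
  "center A =
    \<lparr>Obj = {(z, e). z \<in> Obj A \<and> half_braiding A z e},
     Arr = {Tag (z, e) (w, e') f | z e w e' f.
              z \<in> Obj A \<and> half_braiding A z e \<and> w \<in> Obj A \<and> half_braiding A w e' \<and> f \<in> hom A z w \<and>
              (\<forall>a \<in> Obj A. (f \<otimes>\<^bsub>A\<^esub> Ide A a) \<cdot>\<^bsub>A\<^esub> e a = e' a \<cdot>\<^bsub>A\<^esub> (Ide A a \<otimes>\<^bsub>A\<^esub> f))},
     Dom = tsrc,
     Cod = ttgt,
     Ide = (\<lambda>x. Tag x x (Ide A (fst x))),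
     Cmp = (\<lambda>t s. Tag (tsrc s) (ttgt t) (tval t \<cdot>\<^bsub>A\<^esub> tval s)),
     Unit = (\<one>\<^bsub>A\<^esub>, \<lambda>a\<in>Obj A. Ide A a),
     TenO = center_tenO A,
     TenM = (\<lambda>s t. Tag (center_tenO A (tsrc s) (tsrc t)) (center_tenO A (ttgt s) (ttgt t))
                       (tval s \<otimes>\<^bsub>A\<^esub> tval t)),
     Braid = (\<lambda>x z. Tag (center_tenO A x z) (center_tenO A z x) (snd z (fst x)))\<rparr>"


section \<open>2-categories\<close>

text \<open>
  Strict 2-categories.  1-cells need not determine their source and target, so all operations carry
  the 0-cells as arguments: \<open>Cmp1 A B C G F\<close> is the composite \<open>A \<rightarrow> B \<rightarrow> C\<close> of \<open>F\<close> and \<open>G\<close>, and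
  \<open>HCmp A B C y x\<close> the horizontal composite of the 2-cells \<open>x\<close> in \<open>Hom A B\<close> and \<open>y\<close> in \<open>Hom B C\<close>.
  Vertical composition is composition in \<open>Hom A B\<close>.
\<close>

record ('o, 'f, 't) twocat =
  Obj0 :: "'o set"
  Hom :: "'o \<Rightarrow> 'o \<Rightarrow> ('f, 't) cat"
  Id1 :: "'o \<Rightarrow> 'f"
  Cmp1 :: "'o \<Rightarrow> 'o \<Rightarrow> 'o \<Rightarrow> 'f \<Rightarrow> 'f \<Rightarrow> 'f"
  HCmp :: "'o \<Rightarrow> 'o \<Rightarrow> 'o \<Rightarrow> 't \<Rightarrow> 't \<Rightarrow> 't"

locale two_category =
  fixes K :: "('o, 'f, 't) twocat"
  assumes Hom_category: "A \<in> Obj0 K \<Longrightarrow> B \<in> Obj0 K \<Longrightarrow> category (Hom K A B)"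
    and Id1_in: "A \<in> Obj0 K \<Longrightarrow> Id1 K A \<in> Obj (Hom K A A)"
    and Cmp1_in: "A \<in> Obj0 K \<Longrightarrow> B \<in> Obj0 K \<Longrightarrow> C \<in> Obj0 K \<Longrightarrow>
        F \<in> Obj (Hom K A B) \<Longrightarrow> G \<in> Obj (Hom K B C) \<Longrightarrow> Cmp1 K A B C G F \<in> Obj (Hom K A C)"
    and HCmp_in: "A \<in> Obj0 K \<Longrightarrow> B \<in> Obj0 K \<Longrightarrow> C \<in> Obj0 K \<Longrightarrow>
        x \<in> hom (Hom K A B) F F' \<Longrightarrow> y \<in> hom (Hom K B C) G G' \<Longrightarrow>
        HCmp K A B C y x \<in> hom (Hom K A C) (Cmp1 K A B C G F) (Cmp1 K A B C G' F')"
    and HCmp_ide: "A \<in> Obj0 K \<Longrightarrow> B \<in> Obj0 K \<Longrightarrow> C \<in> Obj0 K \<Longrightarrow>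
        F \<in> Obj (Hom K A B) \<Longrightarrow> G \<in> Obj (Hom K B C) \<Longrightarrow>
        HCmp K A B C (Ide (Hom K B C) G) (Ide (Hom K A B) F) = Ide (Hom K A C) (Cmp1 K A B C G F)"
    and HCmp_interchange: "A \<in> Obj0 K \<Longrightarrow> B \<in> Obj0 K \<Longrightarrow> C \<in> Obj0 K \<Longrightarrow>
        x \<in> hom (Hom K A B) F F' \<Longrightarrow> x' \<in> hom (Hom K A B) F' F'' \<Longrightarrow>
        y \<in> hom (Hom K B C) G G' \<Longrightarrow> y' \<in> hom (Hom K B C) G' G'' \<Longrightarrow>
        HCmp K A B C (y' \<cdot>\<^bsub>Hom K B C\<^esub> y) (x' \<cdot>\<^bsub>Hom K A B\<^esub> x) =
        HCmp K A B C y' x' \<cdot>\<^bsub>Hom K A C\<^esub> HCmp K A B C y x"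
    and Cmp1_unit: "A \<in> Obj0 K \<Longrightarrow> B \<in> Obj0 K \<Longrightarrow> F \<in> Obj (Hom K A B) \<Longrightarrow>
        Cmp1 K A A B F (Id1 K A) = F \<and> Cmp1 K A B B (Id1 K B) F = F"
    and Cmp1_assoc: "A \<in> Obj0 K \<Longrightarrow> B \<in> Obj0 K \<Longrightarrow> C \<in> Obj0 K \<Longrightarrow> D \<in> Obj0 K \<Longrightarrow>
        F \<in> Obj (Hom K A B) \<Longrightarrow> G \<in> Obj (Hom K B C) \<Longrightarrow> H \<in> Obj (Hom K C D) \<Longrightarrow>
        Cmp1 K A B D (Cmp1 K B C D H G) F = Cmp1 K A C D H (Cmp1 K A B C G F)"
    and HCmp_unit: "A \<in> Obj0 K \<Longrightarrow> B \<in> Obj0 K \<Longrightarrow> x \<in> Arr (Hom K A B) \<Longrightarrow>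
        HCmp K A A B x (Ide (Hom K A A) (Id1 K A)) = x \<and>
        HCmp K A B B (Ide (Hom K B B) (Id1 K B)) x = x"
    and HCmp_assoc: "A \<in> Obj0 K \<Longrightarrow> B \<in> Obj0 K \<Longrightarrow> C \<in> Obj0 K \<Longrightarrow> D \<in> Obj0 K \<Longrightarrow>
        x \<in> Arr (Hom K A B) \<Longrightarrow> y \<in> Arr (Hom K B C) \<Longrightarrow> z \<in> Arr (Hom K C D) \<Longrightarrow>
        HCmp K A B D (HCmp K B C D z y) x = HCmp K A C D z (HCmp K A B C y x)"

text \<open>\<open>P1 P A B\<close> is the functor \<open>Hom A B \<rightarrow> Hom (P A) (P B)\<close> of a 2-functor \<open>P\<close>.\<close>

record ('o, 'f, 't, 'p, 'g, 'u) twofun =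
  P0 :: "'o \<Rightarrow> 'p"
  P1 :: "'o \<Rightarrow> 'o \<Rightarrow> ('f, 't, 'g, 'u) fctr"

locale two_functor = K: two_category K + L: two_category L
  for K :: "('o, 'f, 't) twocat" and L :: "('p, 'g, 'u) twocat" +
  fixes P :: "('o, 'f, 't, 'p, 'g, 'u) twofun"
  assumes P0_in: "A \<in> Obj0 K \<Longrightarrow> P0 P A \<in> Obj0 L"
    and P1_functor: "A \<in> Obj0 K \<Longrightarrow> B \<in> Obj0 K \<Longrightarrow>
        cfunctor (Hom K A B) (Hom L (P0 P A) (P0 P B)) (P1 P A B)"
    and P_Id1: "A \<in> Obj0 K \<Longrightarrow> FO (P1 P A A) (Id1 K A) = Id1 L (P0 P A)"
    and P_Cmp1: "A \<in> Obj0 K \<Longrightarrow> B \<in> Obj0 K \<Longrightarrow> C \<in> Obj0 K \<Longrightarrow>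
        F \<in> Obj (Hom K A B) \<Longrightarrow> G \<in> Obj (Hom K B C) \<Longrightarrow>
        FO (P1 P A C) (Cmp1 K A B C G F) =
        Cmp1 L (P0 P A) (P0 P B) (P0 P C) (FO (P1 P B C) G) (FO (P1 P A B) F)"
    and P_HCmp: "A \<in> Obj0 K \<Longrightarrow> B \<in> Obj0 K \<Longrightarrow> C \<in> Obj0 K \<Longrightarrow>
        x \<in> Arr (Hom K A B) \<Longrightarrow> y \<in> Arr (Hom K B C) \<Longrightarrow>
        FA (P1 P A C) (HCmp K A B C y x) =
        HCmp L (P0 P A) (P0 P B) (P0 P C) (FA (P1 P B C) y) (FA (P1 P A B) x)"

definition equivalent0 :: "('o, 'f, 't) twocat \<Rightarrow> 'o \<Rightarrow> 'o \<Rightarrow> bool" where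
  "equivalent0 K A B \<longleftrightarrow>
     (\<exists>F \<in> Obj (Hom K A B). \<exists>G \<in> Obj (Hom K B A).
        isomorphic (Hom K A A) (Cmp1 K A B A G F) (Id1 K A) \<and>
        isomorphic (Hom K B B) (Cmp1 K B A B F G) (Id1 K B))"

definition two_equivalence ::
  "('o, 'f, 't) twocat \<Rightarrow> ('p, 'g, 'u) twocat \<Rightarrow> ('o, 'f, 't, 'p, 'g, 'u) twofun \<Rightarrow> bool"
where
  "two_equivalence K L P \<longleftrightarrow> two_functor K L P \<and>
     (\<forall>B \<in> Obj0 L. \<exists>A \<in> Obj0 K. equivalent0 L B (P0 P A)) \<and>
     (\<forall>A \<in> Obj0 K. \<forall>B \<in> Obj0 K.
        equivalence_of_categories (Hom K A B) (Hom L (P0 P A) (P0 P B)) (P1 P A B))"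


section \<open>Enriched monoidal categories\<close>

text \<open>
  \<open>vCmp A a b c : A(a \<rightarrow> b) A(b \<rightarrow> c) \<rightarrow> A(a \<rightarrow> c)\<close> and
  \<open>vTenM A a c b d : A(a \<rightarrow> c) A(b \<rightarrow> d) \<rightarrow> A(ab \<rightarrow> cd)\<close>.
\<close>

record ('a, 'v, 'm) vcat =
  vObj :: "'a set"
  vHom :: "'a \<Rightarrow> 'a \<Rightarrow> 'v"
  vId :: "'a \<Rightarrow> 'm"
  vCmp :: "'a \<Rightarrow> 'a \<Rightarrow> 'a \<Rightarrow> 'm"

record ('a, 'v, 'm) vmoncat = "('a, 'v, 'm) vcat" +
  vUnit :: "'a"
  vTenO :: "'a \<Rightarrow> 'a \<Rightarrow> 'a"
  vTenM :: "'a \<Rightarrow> 'a \<Rightarrow> 'a \<Rightarrow> 'a \<Rightarrow> 'm"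

locale enriched_category =
  fixes V :: "('v, 'm) braided_moncat" (structure)
    and A :: "('a, 'v, 'm, 'x) vcat_scheme"
  assumes vHom_in: "a \<in> vObj A \<Longrightarrow> b \<in> vObj A \<Longrightarrow> vHom A a b \<in> Obj V"
    and vId_in: "a \<in> vObj A \<Longrightarrow> vId A a \<in> hom V \<one> (vHom A a a)"
    and vCmp_in: "a \<in> vObj A \<Longrightarrow> b \<in> vObj A \<Longrightarrow> c \<in> vObj A \<Longrightarrow>
        vCmp A a b c \<in> hom V (vHom A a b \<odot> vHom A b c) (vHom A a c)"
    and vId_vCmp: "a \<in> vObj A \<Longrightarrow> b \<in> vObj A \<Longrightarrow>
        vCmp A a a b \<cdot> (vId A a \<otimes> Ide V (vHom A a b)) = Ide V (vHom A a b)"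
    and vCmp_vId: "a \<in> vObj A \<Longrightarrow> b \<in> vObj A \<Longrightarrow>
        vCmp A a b b \<cdot> (Ide V (vHom A a b) \<otimes> vId A b) = Ide V (vHom A a b)"
    and vCmp_assoc: "a \<in> vObj A \<Longrightarrow> b \<in> vObj A \<Longrightarrow> c \<in> vObj A \<Longrightarrow> d \<in> vObj A \<Longrightarrow>
        vCmp A a c d \<cdot> (vCmp A a b c \<otimes> Ide V (vHom A c d)) =
        vCmp A a b d \<cdot> (Ide V (vHom A a b) \<otimes> vCmp A b c d)"

locale enriched_monoidal_category = enriched_category V A
  for V :: "('v, 'm) braided_moncat" (structure)
    and A :: "('a, 'v, 'm, 'x) vmoncat_scheme" +
  assumes vUnit_in: "vUnit A \<in> vObj A"
    and vTenO_in: "a \<in> vObj A \<Longrightarrow> b \<in> vObj A \<Longrightarrow> vTenO A a b \<in> vObj A"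
    and vTenO_assoc: "a \<in> vObj A \<Longrightarrow> b \<in> vObj A \<Longrightarrow> c \<in> vObj A \<Longrightarrow>
        vTenO A (vTenO A a b) c = vTenO A a (vTenO A b c)"
    and vTenO_unit: "a \<in> vObj A \<Longrightarrow> vTenO A (vUnit A) a = a"
        "a \<in> vObj A \<Longrightarrow> vTenO A a (vUnit A) = a"
    and vTenM_in: "a \<in> vObj A \<Longrightarrow> b \<in> vObj A \<Longrightarrow> c \<in> vObj A \<Longrightarrow> d \<in> vObj A \<Longrightarrow>
        vTenM A a c b d \<in> hom V (vHom A a c \<odot> vHom A b d) (vHom A (vTenO A a b) (vTenO A c d))"
    and vTenM_assoc: "a \<in> vObj A \<Longrightarrow> a' \<in> vObj A \<Longrightarrow> b \<in> vObj A \<Longrightarrow> b' \<in> vObj A \<Longrightarrow>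
        c \<in> vObj A \<Longrightarrow> c' \<in> vObj A \<Longrightarrow>
        vTenM A (vTenO A a b) (vTenO A a' b') c c' \<cdot> (vTenM A a a' b b' \<otimes> Ide V (vHom A c c')) =
        vTenM A a a' (vTenO A b c) (vTenO A b' c') \<cdot> (Ide V (vHom A a a') \<otimes> vTenM A b b' c c')"
    and vTenM_unit:
        "a \<in> vObj A \<Longrightarrow> b \<in> vObj A \<Longrightarrow>
         vTenM A (vUnit A) (vUnit A) a b \<cdot> (vId A (vUnit A) \<otimes> Ide V (vHom A a b)) = Ide V (vHom A a b)"
        "a \<in> vObj A \<Longrightarrow> b \<in> vObj A \<Longrightarrow>
         vTenM A a b (vUnit A) (vUnit A) \<cdot> (Ide V (vHom A a b) \<otimes> vId A (vUnit A)) = Ide V (vHom A a b)"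
    and vTenM_vId: "a \<in> vObj A \<Longrightarrow> b \<in> vObj A \<Longrightarrow>
        vTenM A a a b b \<cdot> (vId A a \<otimes> vId A b) = vId A (vTenO A a b)"
    and interchange: "a \<in> vObj A \<Longrightarrow> b \<in> vObj A \<Longrightarrow> c \<in> vObj A \<Longrightarrow>
        d \<in> vObj A \<Longrightarrow> e \<in> vObj A \<Longrightarrow> f \<in> vObj A \<Longrightarrow>
        vCmp A (vTenO A a d) (vTenO A b e) (vTenO A c f) \<cdot> (vTenM A a b d e \<otimes> vTenM A b c e f) =
        vTenM A a c d f \<cdot> (vCmp A a b c \<otimes> vCmp A d e f) \<cdot>
          (Ide V (vHom A a b) \<otimes> Braid V (vHom A d e) (vHom A b c) \<otimes> Ide V (vHom A e f))"

text \<open>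
  Composition \<open>a \<rightarrow> b \<rightarrow> c\<close> of \<open>f : 1 \<rightarrow> A(a \<rightarrow> b)\<close> and \<open>g : 1 \<rightarrow> A(b \<rightarrow> c)\<close>, and product of
  \<open>f : 1 \<rightarrow> A(a \<rightarrow> c)\<close> and \<open>g : 1 \<rightarrow> A(b \<rightarrow> d)\<close>, in the underlying category.
\<close>

definition ucmp ::
  "('v, 'm) braided_moncat \<Rightarrow> ('a, 'v, 'm, 'x) vmoncat_scheme \<Rightarrow> 'a \<Rightarrow> 'a \<Rightarrow> 'a \<Rightarrow> 'm \<Rightarrow> 'm \<Rightarrow> 'm"
where
  "ucmp V A a b c g f = vCmp A a b c \<cdot>\<^bsub>V\<^esub> (f \<otimes>\<^bsub>V\<^esub> g)"

definition uten ::
  "('v, 'm) braided_moncat \<Rightarrow> ('a, 'v, 'm, 'x) vmoncat_scheme \<Rightarrow>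
   'a \<Rightarrow> 'a \<Rightarrow> 'a \<Rightarrow> 'a \<Rightarrow> 'm \<Rightarrow> 'm \<Rightarrow> 'm"
where
  "uten V A a c b d f g = vTenM A a c b d \<cdot>\<^bsub>V\<^esub> (f \<otimes>\<^bsub>V\<^esub> g)"

text \<open>
  \<open>Elt a b f\<close> is \<open>f : 1 \<rightarrow> A(a \<rightarrow> b)\<close> viewed as an arrow \<open>a \<rightarrow> b\<close>.  The summand \<open>Other\<close> never occurs
  in an underlying category.  It makes the arrow type large enough to contain a copy of any given
  type \<open>'h\<close>, so that the monoidal categories below are not confined to those whose arrows are
  arrows of \<open>V\<close>.
\<close>

datatype ('a, 'm, 'h) uarr = Elt (usrc: 'a) (utgt: 'a) (uelt: 'm) | Other 'h

definition underlying ::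
  "('v, 'm) braided_moncat \<Rightarrow> ('a, 'v, 'm, 'x) vmoncat_scheme \<Rightarrow> ('a, ('a, 'm, 'h) uarr) moncat"
where
  "underlying V A =
    \<lparr>Obj = vObj A,
     Arr = {Elt a b f | a b f. a \<in> vObj A \<and> b \<in> vObj A \<and> f \<in> hom V \<one>\<^bsub>V\<^esub> (vHom A a b)},
     Dom = usrc,
     Cod = utgt,
     Ide = (\<lambda>a. Elt a a (vId A a)),
     Cmp = (\<lambda>g f. Elt (usrc f) (utgt g) (ucmp V A (usrc f) (utgt f) (utgt g) (uelt g) (uelt f))),
     Unit = vUnit A,
     TenO = vTenO A,
     TenM = (\<lambda>f g. Elt (vTenO A (usrc f) (usrc g)) (vTenO A (utgt f) (utgt g))
                       (uten V A (usrc f) (utgt f) (usrc g) (utgt g) (uelt f) (uelt g)))\<rparr>"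

text \<open>The functor \<open>x \<mapsto> A(1 \<rightarrow> x)\<close> from the underlying category to \<open>V\<close>.\<close>

definition from_unit ::
  "('v, 'm) braided_moncat \<Rightarrow> ('a, 'v, 'm, 'x) vmoncat_scheme \<Rightarrow> ('a, ('a, 'm, 'h) uarr, 'v, 'm) fctr"
where
  "from_unit V A =
    \<lparr>FO = (\<lambda>x. vHom A (vUnit A) x),
     FA = (\<lambda>f. vCmp A (vUnit A) (usrc f) (utgt f) \<cdot>\<^bsub>V\<^esub>
                 (Ide V (vHom A (vUnit A) (usrc f)) \<otimes>\<^bsub>V\<^esub> uelt f))\<rparr>"


section \<open>The 2-category VMonCat\<close>

text \<open>The argument \<open>TYPE('h)\<close> only fixes the arrow type in which underlying categories are formed.\<close>

definition vmoncat_0cell ::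
  "('v, 'm) braided_moncat \<Rightarrow> 'h itself \<Rightarrow> ('a, 'v, 'm) vmoncat \<Rightarrow> bool"
where
  "vmoncat_0cell V T A \<longleftrightarrow> enriched_monoidal_category V A \<and>
     rigid_monoidal_category (underlying V A :: ('a, ('a, 'm, 'h) uarr) moncat) \<and>
     has_left_adjoint V (underlying V A :: ('a, ('a, 'm, 'h) uarr) moncat) (from_unit V A)"

text \<open>
  1-cells and 2-cells are extensional in all their components, so that equality of cells, and hence
  the strict 2-category laws, have their mathematical meaning.
\<close>

record ('a, 'm) vfunctor =
  vfO :: "'a \<Rightarrow> 'a"
  vfM :: "'a \<Rightarrow> 'a \<Rightarrow> 'm"
  vfLax :: "'a \<Rightarrow> 'a \<Rightarrow> 'm"

definition lax_enriched_monoidal_functor ::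
  "('v, 'm) braided_moncat \<Rightarrow> ('a, 'v, 'm) vmoncat \<Rightarrow> ('a, 'v, 'm) vmoncat \<Rightarrow> ('a, 'm) vfunctor \<Rightarrow> bool"
where
  "lax_enriched_monoidal_functor V A B R \<longleftrightarrow>
     vfO R \<in> vObj A \<rightarrow>\<^sub>E vObj B \<and>
     vfM R \<in> (\<Pi>\<^sub>E a \<in> vObj A. \<Pi>\<^sub>E b \<in> vObj A. hom V (vHom A a b) (vHom B (vfO R a) (vfO R b))) \<and>
     (\<forall>a \<in> vObj A. vfM R a a \<cdot>\<^bsub>V\<^esub> vId A a = vId B (vfO R a)) \<and>
     (\<forall>a \<in> vObj A. \<forall>b \<in> vObj A. \<forall>c \<in> vObj A.
        vfM R a c \<cdot>\<^bsub>V\<^esub> vCmp A a b c =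
        vCmp B (vfO R a) (vfO R b) (vfO R c) \<cdot>\<^bsub>V\<^esub> (vfM R a b \<otimes>\<^bsub>V\<^esub> vfM R b c)) \<and>
     vfO R (vUnit A) = vUnit B \<and>
     vfLax R \<in> (\<Pi>\<^sub>E a \<in> vObj A. \<Pi>\<^sub>E b \<in> vObj A.
        hom V \<one>\<^bsub>V\<^esub> (vHom B (vTenO B (vfO R a) (vfO R b)) (vfO R (vTenO A a b)))) \<and>
     (\<forall>a \<in> vObj A. \<forall>b \<in> vObj A. \<forall>c \<in> vObj A. \<forall>d \<in> vObj A.
        vCmp B (vTenO B (vfO R a) (vfO R b)) (vfO R (vTenO A a b)) (vfO R (vTenO A c d)) \<cdot>\<^bsub>V\<^esub>
          (vfLax R a b \<otimes>\<^bsub>V\<^esub> (vfM R (vTenO A a b) (vTenO A c d) \<cdot>\<^bsub>V\<^esub> vTenM A a c b d)) =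
        vCmp B (vTenO B (vfO R a) (vfO R b)) (vTenO B (vfO R c) (vfO R d)) (vfO R (vTenO A c d)) \<cdot>\<^bsub>V\<^esub>
          ((vTenM B (vfO R a) (vfO R c) (vfO R b) (vfO R d) \<cdot>\<^bsub>V\<^esub> (vfM R a c \<otimes>\<^bsub>V\<^esub> vfM R b d))
             \<otimes>\<^bsub>V\<^esub> vfLax R c d)) \<and>
     (\<forall>a \<in> vObj A. \<forall>b \<in> vObj A. \<forall>c \<in> vObj A.
        ucmp V B (vTenO B (vfO R a) (vTenO B (vfO R b) (vfO R c)))
                 (vTenO B (vfO R a) (vfO R (vTenO A b c)))
                 (vfO R (vTenO A a (vTenO A b c)))
          (vfLax R a (vTenO A b c))
          (uten V B (vfO R a) (vfO R a) (vTenO B (vfO R b) (vfO R c)) (vfO R (vTenO A b c))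
             (vId B (vfO R a)) (vfLax R b c)) =
        ucmp V B (vTenO B (vTenO B (vfO R a) (vfO R b)) (vfO R c))
                 (vTenO B (vfO R (vTenO A a b)) (vfO R c))
                 (vfO R (vTenO A (vTenO A a b) c))
          (vfLax R (vTenO A a b) c)
          (uten V B (vTenO B (vfO R a) (vfO R b)) (vfO R (vTenO A a b)) (vfO R c) (vfO R c)
             (vfLax R a b) (vId B (vfO R c)))) \<and>
     (\<forall>a \<in> vObj A. vfLax R (vUnit A) a = vId B (vfO R a) \<and> vfLax R a (vUnit A) = vId B (vfO R a))"

definition graded_monoidal_nat_trans ::
  "('v, 'm) braided_moncat \<Rightarrow> ('a, 'v, 'm) vmoncat \<Rightarrow> ('a, 'v, 'm) vmoncat \<Rightarrow>
   ('a, 'm) vfunctor \<Rightarrow> ('a, 'm) vfunctor \<Rightarrow> ('a \<Rightarrow> 'm) \<Rightarrow> bool"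
where
  "graded_monoidal_nat_trans V A B R S \<theta> \<longleftrightarrow>
     \<theta> \<in> (\<Pi>\<^sub>E a \<in> vObj A. hom V \<one>\<^bsub>V\<^esub> (vHom B (vfO R a) (vfO S a))) \<and>
     (\<forall>a \<in> vObj A. \<forall>b \<in> vObj A.
        vCmp B (vfO R a) (vfO S a) (vfO S b) \<cdot>\<^bsub>V\<^esub> (\<theta> a \<otimes>\<^bsub>V\<^esub> vfM S a b) =
        vCmp B (vfO R a) (vfO R b) (vfO S b) \<cdot>\<^bsub>V\<^esub> (vfM R a b \<otimes>\<^bsub>V\<^esub> \<theta> b)) \<and>
     (\<forall>a \<in> vObj A. \<forall>b \<in> vObj A.
        ucmp V B (vTenO B (vfO R a) (vfO R b)) (vfO R (vTenO A a b)) (vfO S (vTenO A a b))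
          (\<theta> (vTenO A a b)) (vfLax R a b) =
        ucmp V B (vTenO B (vfO R a) (vfO R b)) (vTenO B (vfO S a) (vfO S b)) (vfO S (vTenO A a b))
          (vfLax S a b) (uten V B (vfO R a) (vfO S a) (vfO R b) (vfO S b) (\<theta> a) (\<theta> b))) \<and>
     \<theta> (vUnit A) = vId B (vUnit B)"

definition vmoncat_hom ::
  "('v, 'm) braided_moncat \<Rightarrow> ('a, 'v, 'm) vmoncat \<Rightarrow> ('a, 'v, 'm) vmoncat \<Rightarrow>
   (('a, 'm) vfunctor, (('a, 'm) vfunctor, 'a \<Rightarrow> 'm) tagged) cat"
where
  "vmoncat_hom V A B =
    \<lparr>Obj = {R. lax_enriched_monoidal_functor V A B R},
     Arr = {Tag R S \<theta> | R S \<theta>. lax_enriched_monoidal_functor V A B R \<and>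
              lax_enriched_monoidal_functor V A B S \<and> graded_monoidal_nat_trans V A B R S \<theta>},
     Dom = tsrc,
     Cod = ttgt,
     Ide = (\<lambda>R. Tag R R (\<lambda>a\<in>vObj A. vId B (vfO R a))),
     Cmp = (\<lambda>y x. Tag (tsrc x) (ttgt y)
              (\<lambda>a\<in>vObj A. ucmp V B (vfO (tsrc x) a) (vfO (ttgt x) a) (vfO (ttgt y) a)
                             (tval y a) (tval x a)))\<rparr>"

definition vmoncat_id1 :: "('v, 'm) braided_moncat \<Rightarrow> ('a, 'v, 'm) vmoncat \<Rightarrow> ('a, 'm) vfunctor" where
  "vmoncat_id1 V A =
    \<lparr>vfO = (\<lambda>a\<in>vObj A. a),
     vfM = (\<lambda>a\<in>vObj A. \<lambda>b\<in>vObj A. Ide V (vHom A a b)),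
     vfLax = (\<lambda>a\<in>vObj A. \<lambda>b\<in>vObj A. vId A (vTenO A a b))\<rparr>"

definition vmoncat_cmp1 ::
  "('v, 'm) braided_moncat \<Rightarrow> ('a, 'v, 'm) vmoncat \<Rightarrow> ('a, 'v, 'm) vmoncat \<Rightarrow> ('a, 'v, 'm) vmoncat \<Rightarrow>
   ('a, 'm) vfunctor \<Rightarrow> ('a, 'm) vfunctor \<Rightarrow> ('a, 'm) vfunctor"
where
  "vmoncat_cmp1 V A B C S R =
    \<lparr>vfO = (\<lambda>a\<in>vObj A. vfO S (vfO R a)),
     vfM = (\<lambda>a\<in>vObj A. \<lambda>b\<in>vObj A. vfM S (vfO R a) (vfO R b) \<cdot>\<^bsub>V\<^esub> vfM R a b),
     vfLax = (\<lambda>a\<in>vObj A. \<lambda>b\<in>vObj A.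
        ucmp V C (vTenO C (vfO S (vfO R a)) (vfO S (vfO R b)))
                 (vfO S (vTenO B (vfO R a) (vfO R b)))
                 (vfO S (vfO R (vTenO A a b)))
          (vfM S (vTenO B (vfO R a) (vfO R b)) (vfO R (vTenO A a b)) \<cdot>\<^bsub>V\<^esub> vfLax R a b)
          (vfLax S (vfO R a) (vfO R b)))\<rparr>"

text \<open>For \<open>x : R \<Rightarrow> S\<close> and \<open>y : R' \<Rightarrow> S'\<close> the component at \<open>a\<close> is \<open>y\<close> at \<open>S a\<close> after \<open>R'\<close> of \<open>x\<close> at \<open>a\<close>.\<close>

definition vmoncat_hcmp ::
  "('v, 'm) braided_moncat \<Rightarrow> ('a, 'v, 'm) vmoncat \<Rightarrow> ('a, 'v, 'm) vmoncat \<Rightarrow> ('a, 'v, 'm) vmoncat \<Rightarrow>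
   (('a, 'm) vfunctor, 'a \<Rightarrow> 'm) tagged \<Rightarrow> (('a, 'm) vfunctor, 'a \<Rightarrow> 'm) tagged \<Rightarrow>
   (('a, 'm) vfunctor, 'a \<Rightarrow> 'm) tagged"
where
  "vmoncat_hcmp V A B C y x =
    (let R = tsrc x; S = ttgt x; R' = tsrc y; S' = ttgt y in
     Tag (vmoncat_cmp1 V A B C R' R) (vmoncat_cmp1 V A B C S' S)
       (\<lambda>a\<in>vObj A. ucmp V C (vfO R' (vfO R a)) (vfO R' (vfO S a)) (vfO S' (vfO S a))
          (tval y (vfO S a)) (vfM R' (vfO R a) (vfO S a) \<cdot>\<^bsub>V\<^esub> tval x a)))"

definition VMonCat ::
  "('v, 'm) braided_moncat \<Rightarrow> 'h itself \<Rightarrow>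
   (('a, 'v, 'm) vmoncat, ('a, 'm) vfunctor, (('a, 'm) vfunctor, 'a \<Rightarrow> 'm) tagged) twocat"
where
  "VMonCat V T =
    \<lparr>Obj0 = {A. vmoncat_0cell V T A},
     Hom = vmoncat_hom V,
     Id1 = vmoncat_id1 V,
     Cmp1 = vmoncat_cmp1 V,
     HCmp = vmoncat_hcmp V\<rparr>"


section \<open>The 2-category VModTens\<close>

text \<open>
  \<open>mtFun\<close> is the functor from \<open>V\<close> to the center and \<open>mtMu\<close> its oplaxitor, whose components are
  arrows of the center.
\<close>

record ('v, 'm, 'a, 'h) modtens =
  mtCat :: "('a, 'h) moncat"
  mtFun :: "('v, 'm, 'a \<times> ('a \<Rightarrow> 'h), ('a \<times> ('a \<Rightarrow> 'h), 'h) tagged) fctr"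
  mtMu :: "'v \<Rightarrow> 'v \<Rightarrow> ('a \<times> ('a \<Rightarrow> 'h), 'h) tagged"

text \<open>The composite of \<open>mtFun\<close> with the forgetful functor, its oplaxitor, and the half-braidings.\<close>

definition mtF :: "('v, 'm, 'a, 'h) modtens \<Rightarrow> ('v, 'm, 'a, 'h) fctr" where
  "mtF X = \<lparr>FO = (\<lambda>v. fst (FO (mtFun X) v)), FA = (\<lambda>f. tval (FA (mtFun X) f))\<rparr>"

definition mt_mu :: "('v, 'm, 'a, 'h) modtens \<Rightarrow> 'v \<Rightarrow> 'v \<Rightarrow> 'h" where
  "mt_mu X u v = tval (mtMu X u v)"

definition mt_hb :: "('v, 'm, 'a, 'h) modtens \<Rightarrow> 'a \<Rightarrow> 'v \<Rightarrow> 'h" where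
  "mt_hb X a v = snd (FO (mtFun X) v) a"

definition modtens_0cell :: "('v, 'm) braided_moncat \<Rightarrow> ('v, 'm, 'a, 'h) modtens \<Rightarrow> bool" where
  "modtens_0cell V X \<longleftrightarrow> rigid_monoidal_category (mtCat X) \<and>
     strict_braided_oplax_monoidal_functor V (center (mtCat X)) (mtFun X) (mtMu X) \<and>
     has_right_adjoint V (mtCat X) (mtF X)"

record ('v, 'a, 'h) mt1cell =
  mtR :: "('a, 'h, 'a, 'h) fctr"
  mtLax :: "'a \<Rightarrow> 'a \<Rightarrow> 'h"
  mtCoh :: "'v \<Rightarrow> 'h"

definition modtens_1cell ::
  "('v, 'm) braided_moncat \<Rightarrow> ('v, 'm, 'a, 'h) modtens \<Rightarrow> ('v, 'm, 'a, 'h) modtens \<Rightarrow>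
   ('v, 'a, 'h) mt1cell \<Rightarrow> bool"
where
  "modtens_1cell V X Y R \<longleftrightarrow>
    (let A = mtCat X; B = mtCat Y; F = FO (mtF X);
         RO = FO (mtR R); RA = FA (mtR R); \<rho> = mtLax R; r = mtCoh R in
     RO \<in> extensional (Obj A) \<and> RA \<in> extensional (Arr A) \<and>
     \<rho> \<in> extensional (Obj A) \<and> (\<forall>a \<in> Obj A. \<rho> a \<in> extensional (Obj A)) \<and>
     r \<in> extensional (Obj V) \<and>
     strict_lax_monoidal_functor A B (mtR R) \<rho> \<and>
     nat_trans V B (mtF Y) (fcomp V (mtR R) (mtF X)) r \<and>
     r \<one>\<^bsub>V\<^esub> = Ide B \<one>\<^bsub>B\<^esub> \<and>
     (\<forall>a \<in> Obj A. \<forall>v \<in> Obj V.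
        \<rho> (F v) a \<cdot>\<^bsub>B\<^esub> (r v \<otimes>\<^bsub>B\<^esub> Ide B (RO a)) \<cdot>\<^bsub>B\<^esub> mt_hb Y (RO a) v =
        RA (mt_hb X a v) \<cdot>\<^bsub>B\<^esub> \<rho> a (F v) \<cdot>\<^bsub>B\<^esub> (Ide B (RO a) \<otimes>\<^bsub>B\<^esub> r v)) \<and>
     (\<forall>u \<in> Obj V. \<forall>v \<in> Obj V.
        RA (mt_mu X u v) \<cdot>\<^bsub>B\<^esub> r (u \<odot>\<^bsub>V\<^esub> v) =
        \<rho> (F u) (F v) \<cdot>\<^bsub>B\<^esub> (r u \<otimes>\<^bsub>B\<^esub> r v) \<cdot>\<^bsub>B\<^esub> mt_mu Y u v))"

definition modtens_2cell ::
  "('v, 'm) braided_moncat \<Rightarrow> ('v, 'm, 'a, 'h) modtens \<Rightarrow> ('v, 'm, 'a, 'h) modtens \<Rightarrow>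
   ('v, 'a, 'h) mt1cell \<Rightarrow> ('v, 'a, 'h) mt1cell \<Rightarrow> ('a \<Rightarrow> 'h) \<Rightarrow> bool"
where
  "modtens_2cell V X Y R S \<Theta> \<longleftrightarrow>
     \<Theta> \<in> extensional (Obj (mtCat X)) \<and>
     monoidal_nat_trans (mtCat X) (mtCat Y) (mtR R) (mtLax R) (mtR S) (mtLax S) \<Theta> \<and>
     (\<forall>v \<in> Obj V. \<Theta> (FO (mtF X) v) \<cdot>\<^bsub>mtCat Y\<^esub> mtCoh R v = mtCoh S v)"

definition modtens_hom ::
  "('v, 'm) braided_moncat \<Rightarrow> ('v, 'm, 'a, 'h) modtens \<Rightarrow> ('v, 'm, 'a, 'h) modtens \<Rightarrow>
   (('v, 'a, 'h) mt1cell, (('v, 'a, 'h) mt1cell, 'a \<Rightarrow> 'h) tagged) cat"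
where
  "modtens_hom V X Y =
    \<lparr>Obj = {R. modtens_1cell V X Y R},
     Arr = {Tag R S \<Theta> | R S \<Theta>. modtens_1cell V X Y R \<and> modtens_1cell V X Y S \<and>
              modtens_2cell V X Y R S \<Theta>},
     Dom = tsrc,
     Cod = ttgt,
     Ide = (\<lambda>R. Tag R R (\<lambda>a\<in>Obj (mtCat X). Ide (mtCat Y) (FO (mtR R) a))),
     Cmp = (\<lambda>y x. Tag (tsrc x) (ttgt y) (\<lambda>a\<in>Obj (mtCat X). tval y a \<cdot>\<^bsub>mtCat Y\<^esub> tval x a))\<rparr>"

definition modtens_id1 ::
  "('v, 'm) braided_moncat \<Rightarrow> ('v, 'm, 'a, 'h) modtens \<Rightarrow> ('v, 'a, 'h) mt1cell"
where
  "modtens_id1 V X =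
    \<lparr>mtR = fid (mtCat X),
     mtLax = (\<lambda>a\<in>Obj (mtCat X). \<lambda>b\<in>Obj (mtCat X). Ide (mtCat X) (a \<odot>\<^bsub>mtCat X\<^esub> b)),
     mtCoh = (\<lambda>v\<in>Obj V. Ide (mtCat X) (FO (mtF X) v))\<rparr>"

definition modtens_cmp1 ::
  "('v, 'm) braided_moncat \<Rightarrow>
   ('v, 'm, 'a, 'h) modtens \<Rightarrow> ('v, 'm, 'a, 'h) modtens \<Rightarrow> ('v, 'm, 'a, 'h) modtens \<Rightarrow>
   ('v, 'a, 'h) mt1cell \<Rightarrow> ('v, 'a, 'h) mt1cell \<Rightarrow> ('v, 'a, 'h) mt1cell"
where
  "modtens_cmp1 V X Y Z S R =
    \<lparr>mtR = fcomp (mtCat X) (mtR S) (mtR R),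
     mtLax = (\<lambda>a\<in>Obj (mtCat X). \<lambda>b\<in>Obj (mtCat X).
        FA (mtR S) (mtLax R a b) \<cdot>\<^bsub>mtCat Z\<^esub> mtLax S (FO (mtR R) a) (FO (mtR R) b)),
     mtCoh = (\<lambda>v\<in>Obj V. FA (mtR S) (mtCoh R v) \<cdot>\<^bsub>mtCat Z\<^esub> mtCoh S v)\<rparr>"

definition modtens_hcmp ::
  "('v, 'm) braided_moncat \<Rightarrow>
   ('v, 'm, 'a, 'h) modtens \<Rightarrow> ('v, 'm, 'a, 'h) modtens \<Rightarrow> ('v, 'm, 'a, 'h) modtens \<Rightarrow>
   (('v, 'a, 'h) mt1cell, 'a \<Rightarrow> 'h) tagged \<Rightarrow> (('v, 'a, 'h) mt1cell, 'a \<Rightarrow> 'h) tagged \<Rightarrow>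
   (('v, 'a, 'h) mt1cell, 'a \<Rightarrow> 'h) tagged"
where
  "modtens_hcmp V X Y Z y x =
    (let R = tsrc x; S = ttgt x; R' = tsrc y; S' = ttgt y in
     Tag (modtens_cmp1 V X Y Z R' R) (modtens_cmp1 V X Y Z S' S)
       (\<lambda>a\<in>Obj (mtCat X). tval y (FO (mtR S) a) \<cdot>\<^bsub>mtCat Z\<^esub> FA (mtR R') (tval x a)))"

definition VModTens ::
  "('v, 'm) braided_moncat \<Rightarrow>
   (('v, 'm, 'a, 'h) modtens, ('v, 'a, 'h) mt1cell, (('v, 'a, 'h) mt1cell, 'a \<Rightarrow> 'h) tagged) twocat"
where
  "VModTens V =
    \<lparr>Obj0 = {X. modtens_0cell V X},
     Hom = modtens_hom V,
     Id1 = modtens_id1 V,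
     Cmp1 = modtens_cmp1 V,
     HCmp = modtens_hcmp V\<rparr>"


section \<open>The 2-functor P\<close>

text \<open>
  A left adjoint of \<open>x \<mapsto> A(1 \<rightarrow> x)\<close> together with its unit.  A choice function \<open>L\<close> assigns one to
  every 0-cell.
\<close>

record ('v, 'm, 'a, 'h) ladj =
  laF :: "('v, 'm, 'a, ('a, 'm, 'h) uarr) fctr"
  laEta :: "'v \<Rightarrow> 'm"

definition chosen_left_adjoints ::
  "('v, 'm) braided_moncat \<Rightarrow> (('a, 'v, 'm) vmoncat \<Rightarrow> ('v, 'm, 'a, 'h) ladj) \<Rightarrow> bool"
where
  "chosen_left_adjoints V L \<longleftrightarrow>
     (\<forall>A \<in> Obj0 (VMonCat V TYPE('h)).
        (\<exists>\<epsilon>. adjunction V (underlying V A) (laF (L A)) (from_unit V A) (laEta (L A)) \<epsilon>) \<and>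
        FO (laF (L A)) \<one>\<^bsub>V\<^esub> = vUnit A \<and> laEta (L A) \<one>\<^bsub>V\<^esub> = vId A (vUnit A))"

text \<open>
  The mate of \<open>g : v \<rightarrow> A(a \<rightarrow> b)\<close>: the unique arrow \<open>f : a F(v) \<rightarrow> b\<close> of the underlying category
  whose image under \<open>A(a F(v) \<rightarrow> b) \<cong> V(v \<rightarrow> A(a \<rightarrow> b))\<close> is \<open>g\<close>.
\<close>

definition mate ::
  "('v, 'm) braided_moncat \<Rightarrow> ('a, 'v, 'm) vmoncat \<Rightarrow> ('v, 'm, 'a, 'h) ladj \<Rightarrow>
   'a \<Rightarrow> 'v \<Rightarrow> 'a \<Rightarrow> 'm \<Rightarrow> ('a, 'm, 'h) uarr"
where
  "mate V A l a v b g =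
    (let Fv = FO (laF l) v in
     THE f. f \<in> hom (underlying V A) (vTenO A a Fv) b \<and>
       vCmp A a (vTenO A a Fv) b \<cdot>\<^bsub>V\<^esub>
         ((vTenM A a a (vUnit A) Fv \<cdot>\<^bsub>V\<^esub> (vId A a \<otimes>\<^bsub>V\<^esub> laEta l v)) \<otimes>\<^bsub>V\<^esub> uelt f) = g)"

definition P_mu ::
  "('v, 'm) braided_moncat \<Rightarrow> ('a, 'v, 'm) vmoncat \<Rightarrow> ('v, 'm, 'a, 'h) ladj \<Rightarrow>
   'v \<Rightarrow> 'v \<Rightarrow> ('a, 'm, 'h) uarr"
where
  "P_mu V A l u v =
     mate V A l (vUnit A) (u \<odot>\<^bsub>V\<^esub> v) (vTenO A (FO (laF l) u) (FO (laF l) v))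
       (vTenM A (vUnit A) (FO (laF l) u) (vUnit A) (FO (laF l) v) \<cdot>\<^bsub>V\<^esub> (laEta l u \<otimes>\<^bsub>V\<^esub> laEta l v))"

definition P_hb ::
  "('v, 'm) braided_moncat \<Rightarrow> ('a, 'v, 'm) vmoncat \<Rightarrow> ('v, 'm, 'a, 'h) ladj \<Rightarrow>
   'a \<Rightarrow> 'v \<Rightarrow> ('a, 'm, 'h) uarr"
where
  "P_hb V A l a v =
     mate V A l a v (vTenO A (FO (laF l) v) a)
       (vTenM A (vUnit A) (FO (laF l) v) a a \<cdot>\<^bsub>V\<^esub> (laEta l v \<otimes>\<^bsub>V\<^esub> vId A a))"

definition P_FZ_obj ::
  "('v, 'm) braided_moncat \<Rightarrow> ('a, 'v, 'm) vmoncat \<Rightarrow> ('v, 'm, 'a, 'h) ladj \<Rightarrow>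
   'v \<Rightarrow> 'a \<times> ('a \<Rightarrow> ('a, 'm, 'h) uarr)"
where
  "P_FZ_obj V A l v = (FO (laF l) v, \<lambda>a\<in>vObj A. P_hb V A l a v)"

definition P_0cell ::
  "('v, 'm) braided_moncat \<Rightarrow> ('a, 'v, 'm) vmoncat \<Rightarrow> ('v, 'm, 'a, 'h) ladj \<Rightarrow>
   ('v, 'm, 'a, ('a, 'm, 'h) uarr) modtens"
where
  "P_0cell V A l =
    \<lparr>mtCat = underlying V A,
     mtFun = \<lparr>FO = P_FZ_obj V A l,
              FA = (\<lambda>f. Tag (P_FZ_obj V A l (Dom V f)) (P_FZ_obj V A l (Cod V f)) (FA (laF l) f))\<rparr>,
     mtMu = (\<lambda>u v. Tag (P_FZ_obj V A l (u \<odot>\<^bsub>V\<^esub> v))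
                       (center_tenO (underlying V A) (P_FZ_obj V A l u) (P_FZ_obj V A l v))
                       (P_mu V A l u v))\<rparr>"

definition P_1cell ::
  "('v, 'm) braided_moncat \<Rightarrow> ('a, 'v, 'm) vmoncat \<Rightarrow> ('v, 'm, 'a, 'h) ladj \<Rightarrow>
   ('a, 'v, 'm) vmoncat \<Rightarrow> ('v, 'm, 'a, 'h) ladj \<Rightarrow>
   ('a, 'm) vfunctor \<Rightarrow> ('v, 'a, ('a, 'm, 'h) uarr) mt1cell"
where
  "P_1cell V A l B k R =
    \<lparr>mtR = \<lparr>FO = (\<lambda>a\<in>vObj A. vfO R a),
            FA = (\<lambda>f\<in>Arr (underlying V A).
                    Elt (vfO R (usrc f)) (vfO R (utgt f)) (vfM R (usrc f) (utgt f) \<cdot>\<^bsub>V\<^esub> uelt f))\<rparr>,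
     mtLax = (\<lambda>a\<in>vObj A. \<lambda>b\<in>vObj A.
        Elt (vTenO B (vfO R a) (vfO R b)) (vfO R (vTenO A a b)) (vfLax R a b)),
     mtCoh = (\<lambda>v\<in>Obj V.
        mate V B k (vUnit B) v (vfO R (FO (laF l) v))
          (vfM R (vUnit A) (FO (laF l) v) \<cdot>\<^bsub>V\<^esub> laEta l v))\<rparr>"

definition P_2cell ::
  "('v, 'm) braided_moncat \<Rightarrow> ('a, 'v, 'm) vmoncat \<Rightarrow> ('v, 'm, 'a, 'h) ladj \<Rightarrow>
   ('a, 'v, 'm) vmoncat \<Rightarrow> ('v, 'm, 'a, 'h) ladj \<Rightarrow>
   (('a, 'm) vfunctor, 'a \<Rightarrow> 'm) tagged \<Rightarrow>
   (('v, 'a, ('a, 'm, 'h) uarr) mt1cell, 'a \<Rightarrow> ('a, 'm, 'h) uarr) tagged"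
where
  "P_2cell V A l B k x =
     Tag (P_1cell V A l B k (tsrc x)) (P_1cell V A l B k (ttgt x))
       (\<lambda>a\<in>vObj A. Elt (vfO (tsrc x) a) (vfO (ttgt x) a) (tval x a))"

definition P_functor ::
  "('v, 'm) braided_moncat \<Rightarrow> (('a, 'v, 'm) vmoncat \<Rightarrow> ('v, 'm, 'a, 'h) ladj) \<Rightarrow>
   (('a, 'v, 'm) vmoncat, ('a, 'm) vfunctor, (('a, 'm) vfunctor, 'a \<Rightarrow> 'm) tagged,
    ('v, 'm, 'a, ('a, 'm, 'h) uarr) modtens,
    ('v, 'a, ('a, 'm, 'h) uarr) mt1cell,
    (('v, 'a, ('a, 'm, 'h) uarr) mt1cell, 'a \<Rightarrow> ('a, 'm, 'h) uarr) tagged) twofun"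
where
  "P_functor V L =
    \<lparr>P0 = (\<lambda>A. P_0cell V A (L A)),
     P1 = (\<lambda>A B. \<lparr>FO = P_1cell V A (L A) B (L B), FA = P_2cell V A (L A) B (L B)\<rparr>)\<rparr>"

end

theory Submission
  imports Defs
begin

text \<open>
  Both kinds of 0-cell are the same thing seen from two sides: a monoidal category whose arrows carry a
  grade in \<open>V\<close>.  In an enriched category an arrow \<open>a \<rightarrow> b\<close> of grade \<open>v\<close> is a morphism
  \<open>v \<rightarrow> A(a \<rightarrow> b)\<close> of \<open>V\<close>; in a module tensor category it is an arrow \<open>a F(v) \<rightarrow> b\<close>.  Composition and
  product multiply the grades, morphisms of \<open>V\<close> act by restriction, and the interchange law holds up to
  the braiding of two grades (\<open>graded_monoidal\<close>).  The arrows of grade one form the underlying category.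
  The left adjoint \<open>F\<close> and rigidity give, for each \<open>v\<close>, an arrow \<open>\<eta> v : 1 \<rightarrow> F(v)\<close> of grade \<open>v\<close> such that
  every \<open>f : a \<rightarrow> b\<close> of grade \<open>v\<close> is \<open>hat f\<close> after \<open>a \<eta>(v)\<close> for a unique \<open>hat f : a F(v) \<rightarrow> b\<close> of grade one
  (\<open>hat\<close>, \<open>whisker_eta_unique\<close>).  The mates in the definition of \<open>P\<close> are these arrows, so that the
  half-braiding and the oplaxitor are characterised by what they do to the \<open>\<eta> v\<close>, and their axioms hold
  because both sides agree after universal arrows; compatibility with the braiding is the graded
  interchange law.

  The 2-functor is locally an isomorphism of categories (\<open>equivalence_P\<close>).  An enriched lax monoidal
  functor is a functor of graded categories, by the Yoneda lemma.  The factorisation through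
  \<open>\<eta>\<close> shows that such a functor is determined by its restriction to grade one and its values on the
  \<open>\<eta> v\<close>, and these data are exactly a 1-cell of module tensor categories: half-braiding coherence makes
  the extension \<open>lift\<close> compatible with products, action coherence makes it compatible with composition
  (\<open>graded_lift\<close>).  Likewise naturality in all grades is naturality in grade one together with naturality
  at the \<open>\<eta> v\<close>, which is the condition on 2-cells (\<open>natural_of_pure\<close>).  Since \<open>P\<close> is injective on cells and
  preserves all operations, the laws of a 2-category hold for enriched categories because they hold for
  module tensor categories (\<open>two_functor_reflect\<close>), where they are direct calculations.

  For essential surjectivity, let \<open>(A, F)\<close> be a module tensor category and \<open>M\<close> the category graded by
  \<open>a F(v) \<rightarrow> b\<close>; its composition splits \<open>F(u v)\<close> by the oplaxitor and its product moves \<open>F(u)\<close> past an object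
  by the half-braiding (\<open>graded_M\<close>).  For a dual \<open>d\<close> of \<open>a\<close> and the right adjoint \<open>R\<close> of \<open>F\<close>, the object
  \<open>R(d b)\<close> represents the arrows \<open>a \<rightarrow> b\<close> of all grades (\<open>hom_object_exists\<close>), and a graded category with such
  hom objects comes from an enriched one (\<open>enriched_EC\<close>).  Applying \<open>P\<close> to it gives back \<open>(A, F)\<close> up to the
  isomorphism between two left adjoints of the same functor (\<open>Q_Q'\<close>, \<open>Q'_Q\<close>).
\<close>

section \<open>Categories and monoidal categories by sources and targets\<close>

context category
begin

lemma dom_obj [simp]: "f \<in> Arr C \<Longrightarrow> Dom C f \<in> Obj C"
  by (rule dom_in)

lemma cod_obj [simp]: "f \<in> Arr C \<Longrightarrow> Cod C f \<in> Obj C"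
  by (rule cod_in)

lemma ide_arr [simp]:
  assumes "a \<in> Obj C"
  shows "Ide C a \<in> Arr C" "Dom C (Ide C a) = a" "Cod C (Ide C a) = a"
  using ide_in[OF assms] by (auto simp: hom_def)

lemma cmp_arr [simp]:
  assumes "f \<in> Arr C" "g \<in> Arr C" "Cod C f = Dom C g"
  shows "g \<cdot> f \<in> Arr C" "Dom C (g \<cdot> f) = Dom C f" "Cod C (g \<cdot> f) = Cod C g"
  using cmp_in[of f "Dom C f" "Cod C f" g "Cod C g"] assms by (auto simp: hom_def)

lemma cmp_ide_dom [simp]: "f \<in> Arr C \<Longrightarrow> Dom C f = a \<Longrightarrow> f \<cdot> Ide C a = f"
  using cmp_ide[of f a "Cod C f"] by (auto simp: hom_def)

lemma ide_cod_cmp [simp]: "f \<in> Arr C \<Longrightarrow> Cod C f = a \<Longrightarrow> Ide C a \<cdot> f = f"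
  using ide_cmp[of f "Dom C f" a] by (auto simp: hom_def)

lemma cmp_assoc_arr [simp]:
  "f \<in> Arr C \<Longrightarrow> g \<in> Arr C \<Longrightarrow> h \<in> Arr C \<Longrightarrow> Cod C f = Dom C g \<Longrightarrow> Cod C g = Dom C h \<Longrightarrow>
   (h \<cdot> g) \<cdot> f = h \<cdot> (g \<cdot> f)"
  using cmp_assoc[of f "Dom C f" "Cod C f" g "Cod C g" h "Cod C h"] by (auto simp: hom_def)

lemma cmp_eq_extend:
  assumes "g \<cdot> f = k \<cdot> h" "f \<in> Arr C" "g \<in> Arr C" "h \<in> Arr C" "k \<in> Arr C" "x \<in> Arr C"
    "Cod C f = Dom C g" "Cod C h = Dom C k" "Cod C x = Dom C f" "Cod C x = Dom C h"
  shows "g \<cdot> (f \<cdot> x) = k \<cdot> (h \<cdot> x)"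
  using assms cmp_assoc_arr[of x f g] cmp_assoc_arr[of x h k] by simp

lemma cmp_eq_extend1:
  assumes "g \<cdot> f = k" "f \<in> Arr C" "g \<in> Arr C" "x \<in> Arr C"
    "Cod C f = Dom C g" "Cod C x = Dom C f"
  shows "g \<cdot> (f \<cdot> x) = k \<cdot> x"
  using assms cmp_assoc_arr[of x f g] by simp

end

lemma homD:
  "f \<in> hom C a b \<Longrightarrow> f \<in> Arr C \<and> Dom C f = a \<and> Cod C f = b"
  by (simp add: hom_def)

text \<open>This is how the unit laws of half-braidings and of braidings follow from multiplicativity.\<close>

lemma (in category) iso_idem:
  assumes "is_iso C f" "Dom C f = a" "Cod C f = a" "f \<cdot> f = f"
  shows "f = Ide C a"
proof -
  obtain g where g: "g \<in> hom C a a" "g \<cdot> f = Ide C a" and [simp]: "f \<in> Arr C"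
    using assms unfolding is_iso_def by auto
  have "f = (g \<cdot> f) \<cdot> f" using assms by (simp add: g)
  also have "\<dots> = g \<cdot> (f \<cdot> f)" using homD[OF g(1)] assms by (intro cmp_assoc_arr) simp_all
  also have "\<dots> = Ide C a" by (simp only: assms g)
  finally show ?thesis .
qed

context cfunctor
begin

lemma FO_obj [simp]: "a \<in> Obj C \<Longrightarrow> FO F a \<in> Obj D"
  by (rule FO_in)

lemma FA_arr [simp]:
  assumes "f \<in> Arr C"
  shows "FA F f \<in> Arr D" "Dom D (FA F f) = FO F (Dom C f)" "Cod D (FA F f) = FO F (Cod C f)"
  using FA_in[of f "Dom C f" "Cod C f"] assms by (auto simp: hom_def)

lemma FA_ide_obj [simp]: "a \<in> Obj C \<Longrightarrow> FA F (Ide C a) = Ide D (FO F a)"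
  by (rule FA_ide)

lemma FA_cmp_arr:
  "f \<in> Arr C \<Longrightarrow> g \<in> Arr C \<Longrightarrow> Cod C f = Dom C g \<Longrightarrow> FA F (g \<cdot>\<^bsub>C\<^esub> f) = FA F g \<cdot>\<^bsub>D\<^esub> FA F f"
  using FA_cmp[of f "Dom C f" "Cod C f" g "Cod C g"] by (auto simp: hom_def)

end

lemma cfunctor_fid: "category C \<Longrightarrow> cfunctor C C (fid C)"
  by (intro cfunctor.intro cfunctor_axioms.intro)
     (auto simp: fid_def hom_def category.cmp_arr category.ide_arr
       category.dom_obj category.cod_obj)

lemma cfunctor_fcomp:
  assumes "cfunctor C D F" "cfunctor D E G"
  shows "cfunctor C E (fcomp C G F)"
proof -
  interpret F: cfunctor C D F by fact
  interpret G: cfunctor D E G by fact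
  show ?thesis
    by unfold_locales (auto simp: fcomp_def hom_def F.FA_cmp_arr G.FA_cmp_arr)
qed

context strict_monoidal_category
begin

lemma unit_obj [simp]: "\<one> \<in> Obj C"
  by (rule unit_in)

lemma tenO_obj [simp]: "a \<in> Obj C \<Longrightarrow> b \<in> Obj C \<Longrightarrow> a \<odot> b \<in> Obj C"
  by (rule tenO_in)

lemma ten_arr [simp]:
  assumes "f \<in> Arr C" "g \<in> Arr C"
  shows "f \<otimes> g \<in> Arr C" "Dom C (f \<otimes> g) = Dom C f \<odot> Dom C g" "Cod C (f \<otimes> g) = Cod C f \<odot> Cod C g"
  using tenM_in[of f "Dom C f" "Cod C f" g "Dom C g" "Cod C g"] assms by (auto simp: hom_def)

lemma ten_cmp:
  "f \<in> Arr C \<Longrightarrow> g \<in> Arr C \<Longrightarrow> f' \<in> Arr C \<Longrightarrow> g' \<in> Arr C \<Longrightarrow> Cod C f = Dom C f' \<Longrightarrow> Cod C g = Dom C g' \<Longrightarrow>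
   (f' \<otimes> g') \<cdot> (f \<otimes> g) = (f' \<cdot> f) \<otimes> (g' \<cdot> g)"
  using tenM_cmp[of f "Dom C f" "Cod C f" f' "Cod C f'" g "Dom C g" "Cod C g" g' "Cod C g'"]
  by (auto simp: hom_def)

lemma ten_cmp_extend:
  "f \<in> Arr C \<Longrightarrow> g \<in> Arr C \<Longrightarrow> f' \<in> Arr C \<Longrightarrow> g' \<in> Arr C \<Longrightarrow> Cod C f = Dom C f' \<Longrightarrow> Cod C g = Dom C g' \<Longrightarrow>
   x \<in> Arr C \<Longrightarrow> Cod C x = Dom C f \<odot> Dom C g \<Longrightarrow>
   (f' \<otimes> g') \<cdot> ((f \<otimes> g) \<cdot> x) = ((f' \<cdot> f) \<otimes> (g' \<cdot> g)) \<cdot> x"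
  by (subst cmp_assoc_arr[symmetric]) (auto simp: ten_cmp)

lemmas tenO_assoc_obj [simp] = tenO_assoc
lemmas tenO_unit_obj [simp] = tenO_unit
lemmas tenM_ide_obj [simp] = tenM_ide
lemmas tenM_assoc_arr [simp] = tenM_assoc
lemmas tenM_unit_arr [simp] = tenM_unit

end

text \<open>
  An inverse of the half-braiding at \<open>a\<close> is the half-braiding at a dual \<open>d\<close> of \<open>a\<close>, rotated by
  evaluation and coevaluation; naturality of the half-braiding along these two arrows makes it a
  one-sided inverse on each side.
\<close>

lemma (in strict_monoidal_category) half_braiding_invertible:
  assumes "z \<in> Obj C" "a \<in> Obj C" "d \<in> Obj C" "dual_pair C d a"
    and e_in: "\<And>a. a \<in> Obj C \<Longrightarrow> e a \<in> hom C (a \<odot> z) (z \<odot> a)"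
    and e_nat: "\<And>f. f \<in> Arr C \<Longrightarrow> (Ide C z \<otimes> f) \<cdot> e (Dom C f) = e (Cod C f) \<cdot> (f \<otimes> Ide C z)"
    and e_mult: "\<And>a b. a \<in> Obj C \<Longrightarrow> b \<in> Obj C \<Longrightarrow>
                   e (a \<odot> b) = (e a \<otimes> Ide C b) \<cdot> (Ide C a \<otimes> e b)"
    and e_unit: "e \<one> = Ide C z"
  shows "is_iso C (e a)"
proof -
  have e_arr [simp]: "e x \<in> Arr C" "Dom C (e x) = x \<odot> z" "Cod C (e x) = z \<odot> x" if "x \<in> Obj C" for x
    using e_in[OF that] by (auto simp: hom_def)
  from \<open>dual_pair C d a\<close> obtain ev coev where
    ev: "ev \<in> hom C (d \<odot> a) \<one>" and coev: "coev \<in> hom C \<one> (a \<odot> d)" and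
    z1: "(Ide C a \<otimes> ev) \<cdot> (coev \<otimes> Ide C a) = Ide C a"
    unfolding dual_pair_def by blast
  note [simp] = assms(1-3)
  have [simp]: "ev \<in> Arr C" "Dom C ev = d \<odot> a" "Cod C ev = \<one>"
    "coev \<in> Arr C" "Dom C coev = \<one>" "Cod C coev = a \<odot> d"
    using ev coev by (auto simp: hom_def)
  let ?I = "Ide C"
  define k where "k = (?I a \<otimes> (?I z \<otimes> ev)) \<cdot> ((?I a \<otimes> (e d \<otimes> ?I a)) \<cdot> (coev \<otimes> (?I z \<otimes> ?I a)))"
  have k_hom: "k \<in> hom C (z \<odot> a) (a \<odot> z)"
    by (simp add: k_def hom_def del: tenM_ide_obj)
  have n_ev: "(?I z \<otimes> ev) \<cdot> e (d \<odot> a) = ev \<otimes> ?I z"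
    using e_nat[of ev] by (simp add: e_unit)
  have n_coev: "e (a \<odot> d) \<cdot> (coev \<otimes> ?I z) = ?I z \<otimes> coev"
    using e_nat[of coev] by (simp add: e_unit)
  have "e a \<cdot> k = (e a \<cdot> (?I (a \<odot> z) \<otimes> ev)) \<cdot> (?I a \<otimes> (e d \<otimes> ?I a)) \<cdot> (coev \<otimes> (?I z \<otimes> ?I a))"
    unfolding k_def by (simp flip: tenM_assoc_arr add: tenM_assoc_arr[symmetric])
  also have "e a \<cdot> (?I (a \<odot> z) \<otimes> ev) = (?I (z \<odot> a) \<otimes> ev) \<cdot> (e a \<otimes> ?I (d \<odot> a))"
    using ten_cmp[of "e a" "?I (d \<odot> a)" "?I (z \<odot> a)" ev] ten_cmp[of "?I (a \<odot> z)" ev "e a" "?I \<one>"]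
    by simp
  also have "(?I (z \<odot> a) \<otimes> ev) \<cdot> (e a \<otimes> ?I (d \<odot> a)) \<cdot> (?I a \<otimes> (e d \<otimes> ?I a)) \<cdot> (coev \<otimes> (?I z \<otimes> ?I a)) =
    (?I (z \<odot> a) \<otimes> ev) \<cdot> ((((e a \<otimes> ?I d) \<cdot> (?I a \<otimes> e d)) \<cdot> (coev \<otimes> ?I z)) \<otimes> ?I a)"
    using ten_cmp[of "?I a \<otimes> e d" "?I a" "e a \<otimes> ?I d" "?I a"]
      ten_cmp[of "coev \<otimes> ?I z" "?I a" "((e a \<otimes> ?I d) \<cdot> (?I a \<otimes> e d))" "?I a"]
    by (simp flip: tenM_ide_obj)
  also have "((e a \<otimes> ?I d) \<cdot> (?I a \<otimes> e d)) \<cdot> (coev \<otimes> ?I z) = ?I z \<otimes> coev"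
    using n_coev by (simp add: e_mult)
  also have "(?I (z \<odot> a) \<otimes> ev) \<cdot> ((?I z \<otimes> coev) \<otimes> ?I a) = ?I (z \<odot> a)"
    using ten_cmp[of "?I z" "coev \<otimes> ?I a" "?I z" "?I a \<otimes> ev"] z1
    by (simp flip: tenM_ide_obj)
  finally have 1: "e a \<cdot> k = ?I (z \<odot> a)" .
  have "k \<cdot> e a = (?I a \<otimes> (?I z \<otimes> ev)) \<cdot> (?I a \<otimes> (e d \<otimes> ?I a)) \<cdot> ((coev \<otimes> ?I (z \<odot> a)) \<cdot> e a)"
    unfolding k_def by simp
  also have "(coev \<otimes> ?I (z \<odot> a)) \<cdot> e a = (?I (a \<odot> d) \<otimes> e a) \<cdot> (coev \<otimes> ?I (a \<odot> z))"
    using ten_cmp[of "?I \<one>" "e a" coev "?I (z \<odot> a)"] ten_cmp[of coev "?I (a \<odot> z)" "?I (a \<odot> d)" "e a"]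
    by simp
  also have "(?I a \<otimes> (?I z \<otimes> ev)) \<cdot> (?I a \<otimes> (e d \<otimes> ?I a)) \<cdot> \<dots> =
     (?I a \<otimes> ((?I z \<otimes> ev) \<cdot> ((e d \<otimes> ?I a) \<cdot> (?I d \<otimes> e a)))) \<cdot> (coev \<otimes> ?I (a \<odot> z))"
    using ten_cmp_extend[of "?I a" "?I d \<otimes> e a" "?I a" "e d \<otimes> ?I a" "coev \<otimes> ?I (a \<odot> z)"]
      ten_cmp_extend[of "?I a" "(e d \<otimes> ?I a) \<cdot> (?I d \<otimes> e a)" "?I a" "?I z \<otimes> ev"
        "coev \<otimes> ?I (a \<odot> z)"]
    by (simp add: tenM_ide_obj[symmetric] del: tenM_ide_obj)
  also have "(?I z \<otimes> ev) \<cdot> ((e d \<otimes> ?I a) \<cdot> (?I d \<otimes> e a)) = ev \<otimes> ?I z"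
    using n_ev by (simp add: e_mult)
  also have "(?I a \<otimes> (ev \<otimes> ?I z)) \<cdot> (coev \<otimes> ?I (a \<odot> z)) = ?I (a \<odot> z)"
    using ten_cmp[of "coev \<otimes> ?I a" "?I z" "?I a \<otimes> ev" "?I z"] z1
    by (simp flip: tenM_ide_obj)
  finally have 2: "k \<cdot> e a = ?I (a \<odot> z)" .
  show ?thesis
    unfolding is_iso_def using k_hom 1 2 by auto
qed

section \<open>Lax monoidal functors\<close>

text \<open>
  Laxitors compose as soon as whiskering with an identity respects composition.  This is less than
  functoriality of the product, and it also holds for the graded categories below, in which products
  satisfy the interchange law only up to the braiding.
\<close>

locale whisker_category = category C
  for C :: "('o, 'm, 'x) moncat_scheme" (structure) +
  assumes w_unit [simp]: "\<one> \<in> Obj C"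
    and w_tenO [simp]: "a \<in> Obj C \<Longrightarrow> b \<in> Obj C \<Longrightarrow> a \<odot> b \<in> Obj C"
    and w_ten [simp]: "f \<in> Arr C \<Longrightarrow> g \<in> Arr C \<Longrightarrow> f \<otimes> g \<in> Arr C"
      "f \<in> Arr C \<Longrightarrow> g \<in> Arr C \<Longrightarrow> Dom C (f \<otimes> g) = Dom C f \<odot> Dom C g"
      "f \<in> Arr C \<Longrightarrow> g \<in> Arr C \<Longrightarrow> Cod C (f \<otimes> g) = Cod C f \<odot> Cod C g"
    and w_left: "a \<in> Obj C \<Longrightarrow> f \<in> Arr C \<Longrightarrow> g \<in> Arr C \<Longrightarrow> Cod C f = Dom C g \<Longrightarrow>
      Ide C a \<otimes> (g \<cdot> f) = (Ide C a \<otimes> g) \<cdot> (Ide C a \<otimes> f)"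
    and w_right: "a \<in> Obj C \<Longrightarrow> f \<in> Arr C \<Longrightarrow> g \<in> Arr C \<Longrightarrow> Cod C f = Dom C g \<Longrightarrow>
      (g \<cdot> f) \<otimes> Ide C a = (g \<otimes> Ide C a) \<cdot> (f \<otimes> Ide C a)"
    and w_ide: "a \<in> Obj C \<Longrightarrow> b \<in> Obj C \<Longrightarrow> Ide C a \<otimes> Ide C b = Ide C (a \<odot> b)"

lemma (in strict_monoidal_category) whisker_category: "whisker_category C"
  by unfold_locales (auto simp: ten_cmp)

locale lax_functor = cfunctor C D F
  for C :: "('o, 'm, 'x) moncat_scheme" and D :: "('p, 'n, 'y) moncat_scheme" and F +
  fixes \<rho> :: "'o \<Rightarrow> 'o \<Rightarrow> 'n"
  assumes lax: "strict_lax_monoidal_functor C D F \<rho>"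
begin

lemma FO_one [simp]: "FO F \<one>\<^bsub>C\<^esub> = \<one>\<^bsub>D\<^esub>"
  using lax by (simp add: strict_lax_monoidal_functor_def)

lemma lax_arr [simp]:
  assumes "a \<in> Obj C" "b \<in> Obj C"
  shows "\<rho> a b \<in> Arr D" "Dom D (\<rho> a b) = FO F a \<odot>\<^bsub>D\<^esub> FO F b" "Cod D (\<rho> a b) = FO F (a \<odot>\<^bsub>C\<^esub> b)"
  using lax assms by (auto simp: strict_lax_monoidal_functor_def hom_def)

lemma lax_nat:
  assumes "f \<in> Arr C" "g \<in> Arr C" "Dom C f = a" "Dom C g = b" "Cod C f = c" "Cod C g = d"
  shows "FA F (f \<otimes>\<^bsub>C\<^esub> g) \<cdot>\<^bsub>D\<^esub> \<rho> a b = \<rho> c d \<cdot>\<^bsub>D\<^esub> (FA F f \<otimes>\<^bsub>D\<^esub> FA F g)"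
  using lax assms by (auto simp: strict_lax_monoidal_functor_def)

lemma lax_assoc:
  assumes "a \<in> Obj C" "b \<in> Obj C" "c \<in> Obj C"
  shows "\<rho> a (b \<odot>\<^bsub>C\<^esub> c) \<cdot>\<^bsub>D\<^esub> (Ide D (FO F a) \<otimes>\<^bsub>D\<^esub> \<rho> b c) =
         \<rho> (a \<odot>\<^bsub>C\<^esub> b) c \<cdot>\<^bsub>D\<^esub> (\<rho> a b \<otimes>\<^bsub>D\<^esub> Ide D (FO F c))"
  using lax assms unfolding strict_lax_monoidal_functor_def by blast

lemma lax_unit [simp]:
  assumes "a \<in> Obj C"
  shows "\<rho> \<one>\<^bsub>C\<^esub> a = Ide D (FO F a)" "\<rho> a \<one>\<^bsub>C\<^esub> = Ide D (FO F a)"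
  using lax assms unfolding strict_lax_monoidal_functor_def by auto

end

lemma lax_functorI: "strict_lax_monoidal_functor C D F \<rho> \<Longrightarrow> lax_functor C D F \<rho>"
  by (simp add: lax_functor_def lax_functor_axioms_def strict_lax_monoidal_functor_def)

lemma lax_functor_id:
  assumes "whisker_category C"
    and "\<And>a b c. a \<in> Obj C \<Longrightarrow> b \<in> Obj C \<Longrightarrow> c \<in> Obj C \<Longrightarrow> (a \<odot>\<^bsub>C\<^esub> b) \<odot>\<^bsub>C\<^esub> c = a \<odot>\<^bsub>C\<^esub> (b \<odot>\<^bsub>C\<^esub> c)"
    and "\<And>a. a \<in> Obj C \<Longrightarrow> \<one>\<^bsub>C\<^esub> \<odot>\<^bsub>C\<^esub> a = a \<and> a \<odot>\<^bsub>C\<^esub> \<one>\<^bsub>C\<^esub> = a"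
  shows "strict_lax_monoidal_functor C C (fid C) (\<lambda>a\<in>Obj C. \<lambda>b\<in>Obj C. Ide C (a \<odot>\<^bsub>C\<^esub> b))"
proof -
  interpret whisker_category C by fact
  show ?thesis
    unfolding strict_lax_monoidal_functor_def
    using cfunctor_fid[OF category_axioms] assms(2,3)
    by (auto simp: fid_def hom_def w_ide)
qed

lemma lax_functor_fcomp:
  assumes "strict_lax_monoidal_functor C D R \<rho>" "strict_lax_monoidal_functor D E S \<sigma>"
    and "whisker_category C" "whisker_category D" "whisker_category E"
  shows "strict_lax_monoidal_functor C E (fcomp C S R)
    (\<lambda>a\<in>Obj C. \<lambda>b\<in>Obj C. FA S (\<rho> a b) \<cdot>\<^bsub>E\<^esub> \<sigma> (FO R a) (FO R b))"
    (is "strict_lax_monoidal_functor C E ?SR ?l")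
proof -
  interpret R: lax_functor C D R \<rho> using assms(1) by (rule lax_functorI)
  interpret S: lax_functor D E S \<sigma> using assms(2) by (rule lax_functorI)
  interpret C: whisker_category C by fact
  interpret D: whisker_category D by fact
  interpret E: whisker_category E by fact
  have nat: "FA S (FA R (f \<otimes>\<^bsub>C\<^esub> g)) \<cdot>\<^bsub>E\<^esub> (FA S (\<rho> (Dom C f) (Dom C g)) \<cdot>\<^bsub>E\<^esub> \<sigma> (FO R (Dom C f)) (FO R (Dom C g))) =
    FA S (\<rho> (Cod C f) (Cod C g)) \<cdot>\<^bsub>E\<^esub> (\<sigma> (FO R (Cod C f)) (FO R (Cod C g)) \<cdot>\<^bsub>E\<^esub> (FA S (FA R f) \<otimes>\<^bsub>E\<^esub> FA S (FA R g)))"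
    (is "?a = ?b") if [simp]: "f \<in> Arr C" "g \<in> Arr C" for f g
  proof -
    have "?a = FA S (FA R (f \<otimes>\<^bsub>C\<^esub> g) \<cdot>\<^bsub>D\<^esub> \<rho> (Dom C f) (Dom C g)) \<cdot>\<^bsub>E\<^esub> \<sigma> (FO R (Dom C f)) (FO R (Dom C g))"
      by (simp add: S.FA_cmp_arr)
    also have "\<dots> = FA S (\<rho> (Cod C f) (Cod C g) \<cdot>\<^bsub>D\<^esub> (FA R f \<otimes>\<^bsub>D\<^esub> FA R g)) \<cdot>\<^bsub>E\<^esub> \<sigma> (FO R (Dom C f)) (FO R (Dom C g))"
      by (simp add: R.lax_nat)
    also have "\<dots> = ?b"
      by (simp add: S.FA_cmp_arr S.lax_nat)
    finally show ?thesis .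
  qed
  have assoc: "(FA S (\<rho> a (b \<odot>\<^bsub>C\<^esub> c)) \<cdot>\<^bsub>E\<^esub> \<sigma> (FO R a) (FO R (b \<odot>\<^bsub>C\<^esub> c))) \<cdot>\<^bsub>E\<^esub>
       (Ide E (FO S (FO R a)) \<otimes>\<^bsub>E\<^esub> (FA S (\<rho> b c) \<cdot>\<^bsub>E\<^esub> \<sigma> (FO R b) (FO R c))) =
     (FA S (\<rho> (a \<odot>\<^bsub>C\<^esub> b) c) \<cdot>\<^bsub>E\<^esub> \<sigma> (FO R (a \<odot>\<^bsub>C\<^esub> b)) (FO R c)) \<cdot>\<^bsub>E\<^esub>
       ((FA S (\<rho> a b) \<cdot>\<^bsub>E\<^esub> \<sigma> (FO R a) (FO R b)) \<otimes>\<^bsub>E\<^esub> Ide E (FO S (FO R c)))"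
    (is "?a = ?b") if [simp]: "a \<in> Obj C" "b \<in> Obj C" "c \<in> Obj C" for a b c
  proof -
    let ?a' = "FO R a" and ?b' = "FO R b" and ?c' = "FO R c"
    have "?a = FA S (\<rho> a (b \<odot>\<^bsub>C\<^esub> c)) \<cdot>\<^bsub>E\<^esub> ((\<sigma> ?a' (FO R (b \<odot>\<^bsub>C\<^esub> c)) \<cdot>\<^bsub>E\<^esub>
        (FA S (Ide D ?a') \<otimes>\<^bsub>E\<^esub> FA S (\<rho> b c))) \<cdot>\<^bsub>E\<^esub> (Ide E (FO S ?a') \<otimes>\<^bsub>E\<^esub> \<sigma> ?b' ?c'))"
      by (simp add: E.w_left)
    also have "\<sigma> ?a' (FO R (b \<odot>\<^bsub>C\<^esub> c)) \<cdot>\<^bsub>E\<^esub> (FA S (Ide D ?a') \<otimes>\<^bsub>E\<^esub> FA S (\<rho> b c)) =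
        FA S (Ide D ?a' \<otimes>\<^bsub>D\<^esub> \<rho> b c) \<cdot>\<^bsub>E\<^esub> \<sigma> ?a' (?b' \<odot>\<^bsub>D\<^esub> ?c')"
      by (rule S.lax_nat[symmetric]) auto
    also have "FA S (\<rho> a (b \<odot>\<^bsub>C\<^esub> c)) \<cdot>\<^bsub>E\<^esub> ((FA S (Ide D ?a' \<otimes>\<^bsub>D\<^esub> \<rho> b c) \<cdot>\<^bsub>E\<^esub> \<sigma> ?a' (?b' \<odot>\<^bsub>D\<^esub> ?c')) \<cdot>\<^bsub>E\<^esub>
          (Ide E (FO S ?a') \<otimes>\<^bsub>E\<^esub> \<sigma> ?b' ?c')) =
        FA S (\<rho> a (b \<odot>\<^bsub>C\<^esub> c) \<cdot>\<^bsub>D\<^esub> (Ide D ?a' \<otimes>\<^bsub>D\<^esub> \<rho> b c)) \<cdot>\<^bsub>E\<^esub> (\<sigma> ?a' (?b' \<odot>\<^bsub>D\<^esub> ?c') \<cdot>\<^bsub>E\<^esub>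
          (Ide E (FO S ?a') \<otimes>\<^bsub>E\<^esub> \<sigma> ?b' ?c'))"
      by (simp add: S.FA_cmp_arr)
    also have "\<dots> = FA S (\<rho> (a \<odot>\<^bsub>C\<^esub> b) c \<cdot>\<^bsub>D\<^esub> (\<rho> a b \<otimes>\<^bsub>D\<^esub> Ide D ?c')) \<cdot>\<^bsub>E\<^esub> (\<sigma> (?a' \<odot>\<^bsub>D\<^esub> ?b') ?c' \<cdot>\<^bsub>E\<^esub>
          (\<sigma> ?a' ?b' \<otimes>\<^bsub>E\<^esub> Ide E (FO S ?c')))"
      by (simp add: R.lax_assoc S.lax_assoc)
    also have "\<dots> = FA S (\<rho> (a \<odot>\<^bsub>C\<^esub> b) c) \<cdot>\<^bsub>E\<^esub> ((FA S (\<rho> a b \<otimes>\<^bsub>D\<^esub> Ide D ?c') \<cdot>\<^bsub>E\<^esub> \<sigma> (?a' \<odot>\<^bsub>D\<^esub> ?b') ?c') \<cdot>\<^bsub>E\<^esub>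
          (\<sigma> ?a' ?b' \<otimes>\<^bsub>E\<^esub> Ide E (FO S ?c')))"
    proof -
      have "Cod D (\<rho> a b \<otimes>\<^bsub>D\<^esub> Ide D ?c') = Dom D (\<rho> (a \<odot>\<^bsub>C\<^esub> b) c)" by simp
      moreover have "Dom E (FA S (\<rho> a b \<otimes>\<^bsub>D\<^esub> Ide D ?c')) = FO S ((?a' \<odot>\<^bsub>D\<^esub> ?b') \<odot>\<^bsub>D\<^esub> ?c')" by simp
      ultimately show ?thesis by (simp add: S.FA_cmp_arr)
    qed
    also have "FA S (\<rho> a b \<otimes>\<^bsub>D\<^esub> Ide D ?c') \<cdot>\<^bsub>E\<^esub> \<sigma> (?a' \<odot>\<^bsub>D\<^esub> ?b') ?c' =
        \<sigma> (FO R (a \<odot>\<^bsub>C\<^esub> b)) ?c' \<cdot>\<^bsub>E\<^esub> (FA S (\<rho> a b) \<otimes>\<^bsub>E\<^esub> FA S (Ide D ?c'))"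
      by (rule S.lax_nat) auto
    also have "FA S (\<rho> (a \<odot>\<^bsub>C\<^esub> b) c) \<cdot>\<^bsub>E\<^esub> (\<dots> \<cdot>\<^bsub>E\<^esub> (\<sigma> ?a' ?b' \<otimes>\<^bsub>E\<^esub> Ide E (FO S ?c'))) = ?b"
      by (simp add: E.w_right)
    finally show ?thesis .
  qed
  show ?thesis
    unfolding strict_lax_monoidal_functor_def
    using cfunctor_fcomp[OF R.cfunctor_axioms S.cfunctor_axioms] nat assoc
    by (auto simp: fcomp_def hom_def)
qed

section \<open>Module tensor categories\<close>

lemma Arr_centerD:
  assumes "t \<in> Arr (center A)"
  shows "fst (tsrc t) \<in> Obj A" "fst (ttgt t) \<in> Obj A"
    "half_braiding A (fst (tsrc t)) (snd (tsrc t))" "half_braiding A (fst (ttgt t)) (snd (ttgt t))"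
    "tval t \<in> hom A (fst (tsrc t)) (fst (ttgt t))"
    "\<And>a. a \<in> Obj A \<Longrightarrow> (tval t \<otimes>\<^bsub>A\<^esub> Ide A a) \<cdot>\<^bsub>A\<^esub> snd (tsrc t) a = snd (ttgt t) a \<cdot>\<^bsub>A\<^esub> (Ide A a \<otimes>\<^bsub>A\<^esub> tval t)"
  using assms by (auto simp: center_def)

locale modtens_object = V: braided_monoidal_category V + A: rigid_monoidal_category "mtCat X"
  for V :: "('v, 'm) braided_moncat" and X :: "('v, 'm, 'a, 'h) modtens" +
  assumes cell: "modtens_0cell V X"
begin

abbreviation "A \<equiv> mtCat X"
abbreviation "F \<equiv> FO (mtF X)"
abbreviation "e \<equiv> mt_hb X"
abbreviation "\<mu> \<equiv> mt_mu X"

lemma oplax: "strict_braided_oplax_monoidal_functor V (center A) (mtFun X) (mtMu X)"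
  using cell by (simp add: modtens_0cell_def)

lemma FZ: "cfunctor V (center A) (mtFun X)"
  using oplax by (simp add: strict_braided_oplax_monoidal_functor_def strict_oplax_monoidal_functor_def)

interpretation FZ: cfunctor V "center A" "mtFun X" by (rule FZ)

lemma F_half_braiding:
  assumes "v \<in> Obj V"
  shows "F v \<in> Obj A" "half_braiding A (F v) (\<lambda>a. e a v)"
  using FZ.FO_in[OF assms] by (auto simp: center_def mtF_def mt_hb_def split: prod.splits)

lemma F_obj [simp]: "v \<in> Obj V \<Longrightarrow> F v \<in> Obj A"
  by (rule F_half_braiding)

lemma FZ_arr:
  assumes "p \<in> Arr V"
  shows "FA (mtFun X) p \<in> Arr (center A)"
    "tsrc (FA (mtFun X) p) = FO (mtFun X) (Dom V p)" "ttgt (FA (mtFun X) p) = FO (mtFun X) (Cod V p)"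
  using FZ.FA_arr[OF assms] by (auto simp: center_def)

lemma F_functor: "cfunctor V A (mtF X)"
proof
  fix v assume "v \<in> Obj V" then show "F v \<in> Obj A" by simp
next
  fix f a b assume "f \<in> hom V a b"
  then show "FA (mtF X) f \<in> hom A (F a) (F b)"
    using Arr_centerD(5)[OF FZ_arr(1)[of f]] FZ_arr[of f] by (simp add: mtF_def hom_def)
next
  fix a assume "a \<in> Obj V"
  from FZ.FA_ide[OF this] show "FA (mtF X) (Ide V a) = Ide A (F a)"
    by (simp add: mtF_def center_def)
next
  fix f a b g c assume "f \<in> hom V a b" "g \<in> hom V b c"
  from FZ.FA_cmp[OF this] show "FA (mtF X) (g \<cdot>\<^bsub>V\<^esub> f) = FA (mtF X) g \<cdot>\<^bsub>A\<^esub> FA (mtF X) f"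
    by (simp add: mtF_def center_def)
qed

sublocale F: cfunctor V "mtCat X" "mtF X" by (rule F_functor)

lemma F_one [simp]: "F \<one>\<^bsub>V\<^esub> = \<one>\<^bsub>A\<^esub>" and hb_one [simp]: "a \<in> Obj A \<Longrightarrow> e a \<one>\<^bsub>V\<^esub> = Ide A a"
  using oplax
  by (auto simp: strict_braided_oplax_monoidal_functor_def strict_oplax_monoidal_functor_def
      center_def mtF_def mt_hb_def)

lemma hb_arr [simp]:
  assumes "a \<in> Obj A" "v \<in> Obj V"
  shows "e a v \<in> Arr A" "Dom A (e a v) = a \<odot>\<^bsub>A\<^esub> F v" "Cod A (e a v) = F v \<odot>\<^bsub>A\<^esub> a"
  using F_half_braiding(2)[OF assms(2)] assms(1)
  by (auto simp: half_braiding_def PiE_iff hom_def)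

lemma hb_iso: "a \<in> Obj A \<Longrightarrow> v \<in> Obj V \<Longrightarrow> is_iso A (e a v)"
  using F_half_braiding(2)[of v] by (auto simp: half_braiding_def)

lemma hb_nat:
  assumes "v \<in> Obj V" "f \<in> Arr A" "Dom A f = a" "Cod A f = b"
  shows "(Ide A (F v) \<otimes>\<^bsub>A\<^esub> f) \<cdot>\<^bsub>A\<^esub> e a v = e b v \<cdot>\<^bsub>A\<^esub> (f \<otimes>\<^bsub>A\<^esub> Ide A (F v))"
  using F_half_braiding(2)[OF assms(1)] assms by (auto simp: half_braiding_def)

lemma hb_mult:
  assumes "v \<in> Obj V" "a \<in> Obj A" "b \<in> Obj A"
  shows "e (a \<odot>\<^bsub>A\<^esub> b) v = (e a v \<otimes>\<^bsub>A\<^esub> Ide A b) \<cdot>\<^bsub>A\<^esub> (Ide A a \<otimes>\<^bsub>A\<^esub> e b v)"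
  using F_half_braiding(2)[OF assms(1)] assms by (auto simp: half_braiding_def)

lemma hb_at_one [simp]:
  assumes [simp]: "v \<in> Obj V"
  shows "e \<one>\<^bsub>A\<^esub> v = Ide A (F v)"
  by (rule A.iso_idem[OF hb_iso]) (use hb_mult[of v "\<one>\<^bsub>A\<^esub>" "\<one>\<^bsub>A\<^esub>"] in simp_all)

lemma F_central:
  assumes "p \<in> Arr V" "Dom V p = u" "Cod V p = v" "a \<in> Obj A"
  shows "(FA (mtF X) p \<otimes>\<^bsub>A\<^esub> Ide A a) \<cdot>\<^bsub>A\<^esub> e a u = e a v \<cdot>\<^bsub>A\<^esub> (Ide A a \<otimes>\<^bsub>A\<^esub> FA (mtF X) p)"
  using Arr_centerD(6)[OF FZ_arr(1)[OF assms(1)] assms(4)] FZ_arr[OF assms(1)] assms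
  by (simp add: mtF_def mt_hb_def)

lemma mtMu_in:
  assumes "u \<in> Obj V" "v \<in> Obj V"
  shows "mtMu X u v \<in> Arr (center A)" "tsrc (mtMu X u v) = FO (mtFun X) (u \<odot>\<^bsub>V\<^esub> v)"
    "ttgt (mtMu X u v) = center_tenO A (FO (mtFun X) u) (FO (mtFun X) v)"
  using oplax assms
  by (auto simp: strict_braided_oplax_monoidal_functor_def strict_oplax_monoidal_functor_def
      center_def hom_def)

lemma mu_arr [simp]:
  assumes "u \<in> Obj V" "v \<in> Obj V"
  shows "\<mu> u v \<in> Arr A" "Dom A (\<mu> u v) = F (u \<odot>\<^bsub>V\<^esub> v)" "Cod A (\<mu> u v) = F u \<odot>\<^bsub>A\<^esub> F v"
  using Arr_centerD(5)[OF mtMu_in(1)[OF assms]] mtMu_in[OF assms]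
  by (auto simp: hom_def mt_mu_def mtF_def center_tenO_def)

lemma mu_central:
  assumes "u \<in> Obj V" "v \<in> Obj V" "a \<in> Obj A"
  shows "(\<mu> u v \<otimes>\<^bsub>A\<^esub> Ide A a) \<cdot>\<^bsub>A\<^esub> e a (u \<odot>\<^bsub>V\<^esub> v) =
    ((Ide A (F u) \<otimes>\<^bsub>A\<^esub> e a v) \<cdot>\<^bsub>A\<^esub> (e a u \<otimes>\<^bsub>A\<^esub> Ide A (F v))) \<cdot>\<^bsub>A\<^esub> (Ide A a \<otimes>\<^bsub>A\<^esub> \<mu> u v)"
  using Arr_centerD(6)[OF mtMu_in(1)[OF assms(1,2)] assms(3)] mtMu_in[OF assms(1,2)] assms
  by (simp add: mt_mu_def mt_hb_def mtF_def center_tenO_def)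

lemma mu_nat:
  assumes "f \<in> Arr V" "g \<in> Arr V" "Dom V f = u" "Dom V g = v" "Cod V f = u'" "Cod V g = v'"
  shows "(FA (mtF X) f \<otimes>\<^bsub>A\<^esub> FA (mtF X) g) \<cdot>\<^bsub>A\<^esub> \<mu> u v = \<mu> u' v' \<cdot>\<^bsub>A\<^esub> FA (mtF X) (f \<otimes>\<^bsub>V\<^esub> g)"
proof -
  have "TenM (center A) (FA (mtFun X) f) (FA (mtFun X) g) \<cdot>\<^bsub>center A\<^esub> mtMu X u v =
      mtMu X u' v' \<cdot>\<^bsub>center A\<^esub> FA (mtFun X) (f \<otimes>\<^bsub>V\<^esub> g)"
    using oplax assms unfolding strict_braided_oplax_monoidal_functor_def strict_oplax_monoidal_functor_def
    by blast
  then show ?thesis by (auto simp: mt_mu_def mtF_def center_def)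
qed

lemma mu_assoc:
  assumes "u \<in> Obj V" "v \<in> Obj V" "w \<in> Obj V"
  shows "(Ide A (F u) \<otimes>\<^bsub>A\<^esub> \<mu> v w) \<cdot>\<^bsub>A\<^esub> \<mu> u (v \<odot>\<^bsub>V\<^esub> w) =
    (\<mu> u v \<otimes>\<^bsub>A\<^esub> Ide A (F w)) \<cdot>\<^bsub>A\<^esub> \<mu> (u \<odot>\<^bsub>V\<^esub> v) w"
proof -
  have "TenM (center A) (Ide (center A) (FO (mtFun X) u)) (mtMu X v w) \<cdot>\<^bsub>center A\<^esub> mtMu X u (v \<odot>\<^bsub>V\<^esub> w) =
      TenM (center A) (mtMu X u v) (Ide (center A) (FO (mtFun X) w)) \<cdot>\<^bsub>center A\<^esub> mtMu X (u \<odot>\<^bsub>V\<^esub> v) w"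
    using oplax assms unfolding strict_braided_oplax_monoidal_functor_def strict_oplax_monoidal_functor_def
    by blast
  then show ?thesis by (auto simp: mt_mu_def mtF_def center_def)
qed

lemma mu_unit [simp]:
  assumes "v \<in> Obj V"
  shows "\<mu> \<one>\<^bsub>V\<^esub> v = Ide A (F v)" "\<mu> v \<one>\<^bsub>V\<^esub> = Ide A (F v)"
proof -
  have "mtMu X \<one>\<^bsub>V\<^esub> v = Ide (center A) (FO (mtFun X) v)" "mtMu X v \<one>\<^bsub>V\<^esub> = Ide (center A) (FO (mtFun X) v)"
    using oplax assms unfolding strict_braided_oplax_monoidal_functor_def strict_oplax_monoidal_functor_def
    by blast+
  then show "\<mu> \<one>\<^bsub>V\<^esub> v = Ide A (F v)" "\<mu> v \<one>\<^bsub>V\<^esub> = Ide A (F v)"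
    by (auto simp: mt_mu_def mtF_def center_def)
qed

lemma mu_braid:
  assumes "u \<in> Obj V" "v \<in> Obj V"
  shows "\<mu> v u \<cdot>\<^bsub>A\<^esub> FA (mtF X) (Braid V u v) = e (F u) v \<cdot>\<^bsub>A\<^esub> \<mu> u v"
proof -
  have "mtMu X v u \<cdot>\<^bsub>center A\<^esub> FA (mtFun X) (Braid V u v) =
      Braid (center A) (FO (mtFun X) u) (FO (mtFun X) v) \<cdot>\<^bsub>center A\<^esub> mtMu X u v"
    using oplax assms unfolding strict_braided_oplax_monoidal_functor_def by blast
  then show ?thesis by (auto simp: mt_mu_def mt_hb_def mtF_def center_def)
qed

end

lemma modtens_objectI:
  assumes "braided_monoidal_category V" "modtens_0cell V X"
  shows "modtens_object V X"
  using assms by (auto simp: modtens_object_def modtens_object_axioms_def modtens_0cell_def)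

locale modtens_arrow = X: modtens_object V X + Y: modtens_object V Y +
    lax_functor "mtCat X" "mtCat Y" "mtR R" "mtLax R"
  for V :: "('v, 'm) braided_moncat" and X Y :: "('v, 'm, 'a, 'h) modtens"
    and R :: "('v, 'a, 'h) mt1cell" +
  assumes cell1: "modtens_1cell V X Y R"
begin

abbreviation "R0 \<equiv> FO (mtR R)"
abbreviation "RA \<equiv> FA (mtR R)"
abbreviation "\<rho> \<equiv> mtLax R"
abbreviation "r \<equiv> mtCoh R"

lemma ext: "R0 \<in> extensional (Obj X.A)" "RA \<in> extensional (Arr X.A)" "\<rho> \<in> extensional (Obj X.A)"
    "a \<in> Obj X.A \<Longrightarrow> \<rho> a \<in> extensional (Obj X.A)" "r \<in> extensional (Obj V)"
  using cell1 by (auto simp: modtens_1cell_def Let_def)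

lemma r_arr [simp]:
  assumes "v \<in> Obj V"
  shows "r v \<in> Arr Y.A" "Dom Y.A (r v) = Y.F v" "Cod Y.A (r v) = R0 (X.F v)"
  using cell1 assms by (auto simp: modtens_1cell_def Let_def nat_trans_def fcomp_def hom_def)

lemma r_nat:
  assumes "p \<in> Arr V" "Dom V p = u" "Cod V p = v"
  shows "RA (FA (mtF X) p) \<cdot>\<^bsub>Y.A\<^esub> r u = r v \<cdot>\<^bsub>Y.A\<^esub> FA (mtF Y) p"
  using cell1 assms by (auto simp: modtens_1cell_def Let_def nat_trans_def fcomp_def)

lemma r_one [simp]: "r \<one>\<^bsub>V\<^esub> = Ide Y.A \<one>\<^bsub>Y.A\<^esub>"
  using cell1 by (auto simp: modtens_1cell_def Let_def)

lemma r_hb: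
  assumes "a \<in> Obj X.A" "v \<in> Obj V"
  shows "\<rho> (X.F v) a \<cdot>\<^bsub>Y.A\<^esub> ((r v \<otimes>\<^bsub>Y.A\<^esub> Ide Y.A (R0 a)) \<cdot>\<^bsub>Y.A\<^esub> Y.e (R0 a) v) =
    RA (X.e a v) \<cdot>\<^bsub>Y.A\<^esub> (\<rho> a (X.F v) \<cdot>\<^bsub>Y.A\<^esub> (Ide Y.A (R0 a) \<otimes>\<^bsub>Y.A\<^esub> r v))"
proof -
  have "(\<rho> (X.F v) a \<cdot>\<^bsub>Y.A\<^esub> (r v \<otimes>\<^bsub>Y.A\<^esub> Ide Y.A (R0 a))) \<cdot>\<^bsub>Y.A\<^esub> Y.e (R0 a) v =
    (RA (X.e a v) \<cdot>\<^bsub>Y.A\<^esub> \<rho> a (X.F v)) \<cdot>\<^bsub>Y.A\<^esub> (Ide Y.A (R0 a) \<otimes>\<^bsub>Y.A\<^esub> r v)"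
    using cell1 assms unfolding modtens_1cell_def Let_def by blast
  with assms show ?thesis by simp
qed

lemma r_mu:
  assumes "u \<in> Obj V" "v \<in> Obj V"
  shows "RA (X.\<mu> u v) \<cdot>\<^bsub>Y.A\<^esub> r (u \<odot>\<^bsub>V\<^esub> v) = \<rho> (X.F u) (X.F v) \<cdot>\<^bsub>Y.A\<^esub> ((r u \<otimes>\<^bsub>Y.A\<^esub> r v) \<cdot>\<^bsub>Y.A\<^esub> Y.\<mu> u v)"
proof -
  have "RA (X.\<mu> u v) \<cdot>\<^bsub>Y.A\<^esub> r (u \<odot>\<^bsub>V\<^esub> v) = \<rho> (X.F u) (X.F v) \<cdot>\<^bsub>Y.A\<^esub> (r u \<otimes>\<^bsub>Y.A\<^esub> r v) \<cdot>\<^bsub>Y.A\<^esub> Y.\<mu> u v"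
    using cell1 assms unfolding modtens_1cell_def Let_def by blast
  with assms show ?thesis by simp
qed

end

lemma modtens_arrowI:
  assumes "modtens_object V X" "modtens_object V Y" "modtens_1cell V X Y R"
  shows "modtens_arrow V X Y R"
  using assms
  by (auto simp: modtens_arrow_def modtens_arrow_axioms_def modtens_1cell_def Let_def intro: lax_functorI)

lemma modtens_1cellI:
  fixes X Y :: "('v, 'm, 'a, 'h) modtens"
  assumes "modtens_object V X" "modtens_object V Y"
    "FO (mtR R) \<in> extensional (Obj (mtCat X))" "FA (mtR R) \<in> extensional (Arr (mtCat X))"
    "mtLax R \<in> extensional (Obj (mtCat X))"
    "\<And>a. a \<in> Obj (mtCat X) \<Longrightarrow> mtLax R a \<in> extensional (Obj (mtCat X))"
    "mtCoh R \<in> extensional (Obj V)"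
    and lax: "strict_lax_monoidal_functor (mtCat X) (mtCat Y) (mtR R) (mtLax R)"
    and r_in: "\<And>v. v \<in> Obj V \<Longrightarrow> mtCoh R v \<in> hom (mtCat Y) (FO (mtF Y) v) (FO (mtR R) (FO (mtF X) v))"
    and r_nat: "\<And>p. p \<in> Arr V \<Longrightarrow> FA (mtR R) (FA (mtF X) p) \<cdot>\<^bsub>mtCat Y\<^esub> mtCoh R (Dom V p) =
                  mtCoh R (Cod V p) \<cdot>\<^bsub>mtCat Y\<^esub> FA (mtF Y) p"
    and r_one: "mtCoh R \<one>\<^bsub>V\<^esub> = Ide (mtCat Y) \<one>\<^bsub>mtCat Y\<^esub>"
    and r_hb: "\<And>a v. a \<in> Obj (mtCat X) \<Longrightarrow> v \<in> Obj V \<Longrightarrow>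
      mtLax R (FO (mtF X) v) a \<cdot>\<^bsub>mtCat Y\<^esub> ((mtCoh R v \<otimes>\<^bsub>mtCat Y\<^esub> Ide (mtCat Y) (FO (mtR R) a)) \<cdot>\<^bsub>mtCat Y\<^esub>
         mt_hb Y (FO (mtR R) a) v) =
      FA (mtR R) (mt_hb X a v) \<cdot>\<^bsub>mtCat Y\<^esub> (mtLax R a (FO (mtF X) v) \<cdot>\<^bsub>mtCat Y\<^esub>
         (Ide (mtCat Y) (FO (mtR R) a) \<otimes>\<^bsub>mtCat Y\<^esub> mtCoh R v))"
    and r_mu: "\<And>u v. u \<in> Obj V \<Longrightarrow> v \<in> Obj V \<Longrightarrow>
      FA (mtR R) (mt_mu X u v) \<cdot>\<^bsub>mtCat Y\<^esub> mtCoh R (u \<odot>\<^bsub>V\<^esub> v) =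
      mtLax R (FO (mtF X) u) (FO (mtF X) v) \<cdot>\<^bsub>mtCat Y\<^esub> ((mtCoh R u \<otimes>\<^bsub>mtCat Y\<^esub> mtCoh R v) \<cdot>\<^bsub>mtCat Y\<^esub> mt_mu Y u v)"
  shows "modtens_1cell V X Y R"
proof -
  interpret X: modtens_object V X by fact
  interpret Y: modtens_object V Y by fact
  interpret lax_functor X.A Y.A "mtR R" "mtLax R" using lax by (rule lax_functorI)
  have r_arr [simp]: "mtCoh R v \<in> Arr Y.A" "Dom Y.A (mtCoh R v) = Y.F v"
    "Cod Y.A (mtCoh R v) = FO (mtR R) (X.F v)" if "v \<in> Obj V" for v
    using r_in[OF that] by (auto simp: hom_def)
  have "nat_trans V Y.A (mtF Y) (fcomp V (mtR R) (mtF X)) (mtCoh R)"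
    using r_in r_nat by (auto simp: nat_trans_def fcomp_def)
  then show ?thesis
    using assms(3-7) lax r_one r_hb r_mu by (simp add: modtens_1cell_def Let_def)
qed

section \<open>Module tensor categories form a 2-category\<close>

lemma modtens_2cellD:
  assumes "modtens_2cell V X Y R S \<Theta>"
  shows "\<Theta> \<in> extensional (Obj (mtCat X))"
    and "a \<in> Obj (mtCat X) \<Longrightarrow> \<Theta> a \<in> Arr (mtCat Y)"
    and "a \<in> Obj (mtCat X) \<Longrightarrow> Dom (mtCat Y) (\<Theta> a) = FO (mtR R) a"
    and "a \<in> Obj (mtCat X) \<Longrightarrow> Cod (mtCat Y) (\<Theta> a) = FO (mtR S) a"
    and "f \<in> Arr (mtCat X) \<Longrightarrow> Dom (mtCat X) f = a \<Longrightarrow> Cod (mtCat X) f = b \<Longrightarrow>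
       FA (mtR S) f \<cdot>\<^bsub>mtCat Y\<^esub> \<Theta> a = \<Theta> b \<cdot>\<^bsub>mtCat Y\<^esub> FA (mtR R) f"
    and "a \<in> Obj (mtCat X) \<Longrightarrow> b \<in> Obj (mtCat X) \<Longrightarrow>
       \<Theta> (a \<odot>\<^bsub>mtCat X\<^esub> b) \<cdot>\<^bsub>mtCat Y\<^esub> mtLax R a b = mtLax S a b \<cdot>\<^bsub>mtCat Y\<^esub> (\<Theta> a \<otimes>\<^bsub>mtCat Y\<^esub> \<Theta> b)"
    and "\<Theta> \<one>\<^bsub>mtCat X\<^esub> = Ide (mtCat Y) \<one>\<^bsub>mtCat Y\<^esub>"
    and "v \<in> Obj V \<Longrightarrow> \<Theta> (FO (mtF X) v) \<cdot>\<^bsub>mtCat Y\<^esub> mtCoh R v = mtCoh S v"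
  using assms by (auto simp: modtens_2cell_def monoidal_nat_trans_def nat_trans_def hom_def)

lemma modtens_2cellI:
  assumes "\<Theta> \<in> extensional (Obj (mtCat X))"
    and "\<And>a. a \<in> Obj (mtCat X) \<Longrightarrow> \<Theta> a \<in> hom (mtCat Y) (FO (mtR R) a) (FO (mtR S) a)"
    and "\<And>f. f \<in> Arr (mtCat X) \<Longrightarrow>
       FA (mtR S) f \<cdot>\<^bsub>mtCat Y\<^esub> \<Theta> (Dom (mtCat X) f) = \<Theta> (Cod (mtCat X) f) \<cdot>\<^bsub>mtCat Y\<^esub> FA (mtR R) f"
    and "\<And>a b. a \<in> Obj (mtCat X) \<Longrightarrow> b \<in> Obj (mtCat X) \<Longrightarrow>
       \<Theta> (a \<odot>\<^bsub>mtCat X\<^esub> b) \<cdot>\<^bsub>mtCat Y\<^esub> mtLax R a b = mtLax S a b \<cdot>\<^bsub>mtCat Y\<^esub> (\<Theta> a \<otimes>\<^bsub>mtCat Y\<^esub> \<Theta> b)"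
    and "\<Theta> \<one>\<^bsub>mtCat X\<^esub> = Ide (mtCat Y) \<one>\<^bsub>mtCat Y\<^esub>"
    and "\<And>v. v \<in> Obj V \<Longrightarrow> \<Theta> (FO (mtF X) v) \<cdot>\<^bsub>mtCat Y\<^esub> mtCoh R v = mtCoh S v"
  shows "modtens_2cell V X Y R S \<Theta>"
  using assms by (auto simp: modtens_2cell_def monoidal_nat_trans_def nat_trans_def)

lemma hom_modtens_hom:
  "x \<in> hom (modtens_hom V X Y) R S \<longleftrightarrow> (\<exists>\<Theta>. x = Tag R S \<Theta> \<and>
     modtens_1cell V X Y R \<and> modtens_1cell V X Y S \<and> modtens_2cell V X Y R S \<Theta>)"
  by (auto simp: hom_def modtens_hom_def)

lemma modtens_2cell_ide:
  assumes "modtens_arrow V X Y R"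
  shows "modtens_2cell V X Y R R (\<lambda>a\<in>Obj (mtCat X). Ide (mtCat Y) (FO (mtR R) a))"
proof -
  interpret R: modtens_arrow V X Y R by fact
  show ?thesis
    by (rule modtens_2cellI) (auto simp: hom_def)
qed

lemma modtens_2cell_vcmp:
  assumes "modtens_arrow V X Y R" "modtens_arrow V X Y S" "modtens_arrow V X Y Q"
    "modtens_2cell V X Y R S \<Theta>" "modtens_2cell V X Y S Q \<Psi>"
  shows "modtens_2cell V X Y R Q (\<lambda>a\<in>Obj (mtCat X). \<Psi> a \<cdot>\<^bsub>mtCat Y\<^esub> \<Theta> a)"
proof -
  interpret R: modtens_arrow V X Y R by fact
  interpret S: modtens_arrow V X Y S by fact
  interpret Q: modtens_arrow V X Y Q by fact
  note T = modtens_2cellD[OF assms(4)] and P = modtens_2cellD[OF assms(5)]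
  note [simp] = T(2-4) P(2-4)
  let ?Y = "mtCat Y" and ?X = "mtCat X"
  show ?thesis
  proof (rule modtens_2cellI)
    fix f assume f [simp]: "f \<in> Arr ?X"
    have "Q.RA f \<cdot>\<^bsub>?Y\<^esub> (\<Psi> (Dom ?X f) \<cdot>\<^bsub>?Y\<^esub> \<Theta> (Dom ?X f)) = \<Psi> (Cod ?X f) \<cdot>\<^bsub>?Y\<^esub> (S.RA f \<cdot>\<^bsub>?Y\<^esub> \<Theta> (Dom ?X f))"
      using P(5)[OF f refl refl] by (intro R.Y.A.cmp_eq_extend) auto
    then show "FA (mtR Q) f \<cdot>\<^bsub>?Y\<^esub> (\<lambda>a\<in>Obj ?X. \<Psi> a \<cdot>\<^bsub>?Y\<^esub> \<Theta> a) (Dom ?X f) =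
        (\<lambda>a\<in>Obj ?X. \<Psi> a \<cdot>\<^bsub>?Y\<^esub> \<Theta> a) (Cod ?X f) \<cdot>\<^bsub>?Y\<^esub> FA (mtR R) f"
      using T(5)[OF f refl refl] by simp
  next
    fix a b assume ab [simp]: "a \<in> Obj ?X" "b \<in> Obj ?X"
    have "\<Psi> (a \<odot>\<^bsub>?X\<^esub> b) \<cdot>\<^bsub>?Y\<^esub> (S.\<rho> a b \<cdot>\<^bsub>?Y\<^esub> (\<Theta> a \<otimes>\<^bsub>?Y\<^esub> \<Theta> b)) =
      Q.\<rho> a b \<cdot>\<^bsub>?Y\<^esub> ((\<Psi> a \<otimes>\<^bsub>?Y\<^esub> \<Psi> b) \<cdot>\<^bsub>?Y\<^esub> (\<Theta> a \<otimes>\<^bsub>?Y\<^esub> \<Theta> b))"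
      using P(6)[OF ab] by (intro R.Y.A.cmp_eq_extend) auto
    then show "(\<lambda>a\<in>Obj ?X. \<Psi> a \<cdot>\<^bsub>?Y\<^esub> \<Theta> a) (a \<odot>\<^bsub>?X\<^esub> b) \<cdot>\<^bsub>?Y\<^esub> mtLax R a b =
        mtLax Q a b \<cdot>\<^bsub>?Y\<^esub> ((\<lambda>a\<in>Obj ?X. \<Psi> a \<cdot>\<^bsub>?Y\<^esub> \<Theta> a) a \<otimes>\<^bsub>?Y\<^esub> (\<lambda>a\<in>Obj ?X. \<Psi> a \<cdot>\<^bsub>?Y\<^esub> \<Theta> a) b)"
      using T(6)[OF ab] by (simp add: R.Y.A.ten_cmp)
  qed (auto simp: hom_def T(7,8) P(7,8))
qed

lemma modtens_arrow_id1:
  assumes "modtens_object V X"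
  shows "modtens_1cell V X X (modtens_id1 V X)"
proof -
  interpret X: modtens_object V X by fact
  have lax: "strict_lax_monoidal_functor X.A X.A (fid X.A) (\<lambda>a\<in>Obj X.A. \<lambda>b\<in>Obj X.A. Ide X.A (a \<odot>\<^bsub>X.A\<^esub> b))"
    by (rule lax_functor_id[OF X.A.whisker_category]) auto
  show ?thesis
    by (rule modtens_1cellI[OF assms assms])
       (use lax in \<open>auto simp: modtens_id1_def fid_def hom_def X.A.ten_cmp\<close>)
qed

lemma modtens_arrow_cmp1:
  assumes "modtens_arrow V X Y R" "modtens_arrow V Y Z S"
  shows "modtens_1cell V X Z (modtens_cmp1 V X Y Z S R)"
proof -
  interpret R: modtens_arrow V X Y R by fact
  interpret S: modtens_arrow V Y Z S by fact
  let ?X = "mtCat X" and ?Y = "mtCat Y" and ?Z = "mtCat Z"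
  note lax = lax_functor_fcomp[OF R.lax S.lax R.X.A.whisker_category R.Y.A.whisker_category S.Y.A.whisker_category]
  interpret SR: lax_functor ?X ?Z "fcomp ?X (mtR S) (mtR R)"
      "\<lambda>a\<in>Obj ?X. \<lambda>b\<in>Obj ?X. S.RA (R.\<rho> a b) \<cdot>\<^bsub>?Z\<^esub> S.\<rho> (R.R0 a) (R.R0 b)"
    using lax by (rule lax_functorI)
  show ?thesis
  proof (rule modtens_1cellI[OF R.X.modtens_object_axioms S.Y.modtens_object_axioms], goal_cases)
    case (7 v) then show ?case by (auto simp: modtens_cmp1_def fcomp_def hom_def)
  next
    case (8 p)
    then have [simp]: "p \<in> Arr V" .
    have "S.RA (R.RA (FA (mtF X) p)) \<cdot>\<^bsub>?Z\<^esub> (S.RA (R.r (Dom V p)) \<cdot>\<^bsub>?Z\<^esub> S.r (Dom V p)) =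
      S.RA (R.RA (FA (mtF X) p) \<cdot>\<^bsub>?Y\<^esub> R.r (Dom V p)) \<cdot>\<^bsub>?Z\<^esub> S.r (Dom V p)"
      by (simp add: S.FA_cmp_arr)
    also have "\<dots> = S.RA (R.r (Cod V p) \<cdot>\<^bsub>?Y\<^esub> FA (mtF Y) p) \<cdot>\<^bsub>?Z\<^esub> S.r (Dom V p)"
      by (simp add: R.r_nat)
    also have "\<dots> = S.RA (R.r (Cod V p)) \<cdot>\<^bsub>?Z\<^esub> (S.r (Cod V p) \<cdot>\<^bsub>?Z\<^esub> FA (mtF Z) p)"
      by (simp add: S.FA_cmp_arr S.r_nat)
    finally show ?case by (simp add: modtens_cmp1_def fcomp_def)
  next
    case (10 a v)
    then have [simp]: "a \<in> Obj ?X" "v \<in> Obj V" .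
    let ?b = "R.R0 a" and ?c = "S.R0 (R.R0 a)"
    let ?q = "S.RA (R.r v) \<cdot>\<^bsub>?Z\<^esub> S.r v"
    have "(S.RA (R.\<rho> (R.X.F v) a) \<cdot>\<^bsub>?Z\<^esub> S.\<rho> (R.R0 (R.X.F v)) ?b) \<cdot>\<^bsub>?Z\<^esub> ((?q \<otimes>\<^bsub>?Z\<^esub> Ide ?Z ?c) \<cdot>\<^bsub>?Z\<^esub> S.Y.e ?c v)
      = S.RA (R.\<rho> (R.X.F v) a) \<cdot>\<^bsub>?Z\<^esub> ((S.\<rho> (R.R0 (R.X.F v)) ?b \<cdot>\<^bsub>?Z\<^esub> (S.RA (R.r v) \<otimes>\<^bsub>?Z\<^esub> S.RA (Ide ?Y ?b))) \<cdot>\<^bsub>?Z\<^esub>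
          ((S.r v \<otimes>\<^bsub>?Z\<^esub> Ide ?Z ?c) \<cdot>\<^bsub>?Z\<^esub> S.Y.e ?c v))"
      by (simp add: S.Y.A.ten_cmp_extend)
    also have "S.\<rho> (R.R0 (R.X.F v)) ?b \<cdot>\<^bsub>?Z\<^esub> (S.RA (R.r v) \<otimes>\<^bsub>?Z\<^esub> S.RA (Ide ?Y ?b)) =
        S.RA (R.r v \<otimes>\<^bsub>?Y\<^esub> Ide ?Y ?b) \<cdot>\<^bsub>?Z\<^esub> S.\<rho> (R.Y.F v) ?b"
      by (rule S.lax_nat[symmetric]) auto
    also have "S.RA (R.\<rho> (R.X.F v) a) \<cdot>\<^bsub>?Z\<^esub> ((S.RA (R.r v \<otimes>\<^bsub>?Y\<^esub> Ide ?Y ?b) \<cdot>\<^bsub>?Z\<^esub> S.\<rho> (R.Y.F v) ?b) \<cdot>\<^bsub>?Z\<^esub>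
          ((S.r v \<otimes>\<^bsub>?Z\<^esub> Ide ?Z ?c) \<cdot>\<^bsub>?Z\<^esub> S.Y.e ?c v)) =
       S.RA (R.\<rho> (R.X.F v) a) \<cdot>\<^bsub>?Z\<^esub> (S.RA (R.r v \<otimes>\<^bsub>?Y\<^esub> Ide ?Y ?b) \<cdot>\<^bsub>?Z\<^esub> (S.RA (R.Y.e ?b v) \<cdot>\<^bsub>?Z\<^esub>
          (S.\<rho> ?b (R.Y.F v) \<cdot>\<^bsub>?Z\<^esub> (Ide ?Z ?c \<otimes>\<^bsub>?Z\<^esub> S.r v))))"
      by (simp add: S.r_hb)
    also have "\<dots> = S.RA (R.\<rho> (R.X.F v) a \<cdot>\<^bsub>?Y\<^esub> ((R.r v \<otimes>\<^bsub>?Y\<^esub> Ide ?Y ?b) \<cdot>\<^bsub>?Y\<^esub> R.Y.e ?b v)) \<cdot>\<^bsub>?Z\<^esub>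
          (S.\<rho> ?b (R.Y.F v) \<cdot>\<^bsub>?Z\<^esub> (Ide ?Z ?c \<otimes>\<^bsub>?Z\<^esub> S.r v))"
      by (simp add: S.FA_cmp_arr)
    also have "\<dots> = S.RA (R.RA (R.X.e a v)) \<cdot>\<^bsub>?Z\<^esub> (S.RA (R.\<rho> a (R.X.F v)) \<cdot>\<^bsub>?Z\<^esub>
       ((S.RA (Ide ?Y ?b \<otimes>\<^bsub>?Y\<^esub> R.r v) \<cdot>\<^bsub>?Z\<^esub> S.\<rho> ?b (R.Y.F v)) \<cdot>\<^bsub>?Z\<^esub> (Ide ?Z ?c \<otimes>\<^bsub>?Z\<^esub> S.r v)))"
      by (simp add: R.r_hb S.FA_cmp_arr)
    also have "S.RA (Ide ?Y ?b \<otimes>\<^bsub>?Y\<^esub> R.r v) \<cdot>\<^bsub>?Z\<^esub> S.\<rho> ?b (R.Y.F v) =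
       S.\<rho> ?b (R.R0 (R.X.F v)) \<cdot>\<^bsub>?Z\<^esub> (S.RA (Ide ?Y ?b) \<otimes>\<^bsub>?Z\<^esub> S.RA (R.r v))"
      by (rule S.lax_nat) auto
    also have "S.RA (R.RA (R.X.e a v)) \<cdot>\<^bsub>?Z\<^esub> (S.RA (R.\<rho> a (R.X.F v)) \<cdot>\<^bsub>?Z\<^esub>
       (\<dots> \<cdot>\<^bsub>?Z\<^esub> (Ide ?Z ?c \<otimes>\<^bsub>?Z\<^esub> S.r v))) =
       S.RA (R.RA (R.X.e a v)) \<cdot>\<^bsub>?Z\<^esub> ((S.RA (R.\<rho> a (R.X.F v)) \<cdot>\<^bsub>?Z\<^esub> S.\<rho> ?b (R.R0 (R.X.F v))) \<cdot>\<^bsub>?Z\<^esub> (Ide ?Z ?c \<otimes>\<^bsub>?Z\<^esub> ?q))"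
      by (simp add: S.Y.A.ten_cmp)
    finally show ?case by (simp add: modtens_cmp1_def fcomp_def)
  next
    case (11 u v)
    then have [simp]: "u \<in> Obj V" "v \<in> Obj V" .
    have "S.RA (R.RA (R.X.\<mu> u v)) \<cdot>\<^bsub>?Z\<^esub> (S.RA (R.r (u \<odot>\<^bsub>V\<^esub> v)) \<cdot>\<^bsub>?Z\<^esub> S.r (u \<odot>\<^bsub>V\<^esub> v)) =
      S.RA (R.RA (R.X.\<mu> u v) \<cdot>\<^bsub>?Y\<^esub> R.r (u \<odot>\<^bsub>V\<^esub> v)) \<cdot>\<^bsub>?Z\<^esub> S.r (u \<odot>\<^bsub>V\<^esub> v)"
      by (simp add: S.FA_cmp_arr)
    also have "\<dots> = S.RA (R.\<rho> (R.X.F u) (R.X.F v)) \<cdot>\<^bsub>?Z\<^esub> (S.RA (R.r u \<otimes>\<^bsub>?Y\<^esub> R.r v) \<cdot>\<^bsub>?Z\<^esub>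
       (S.\<rho> (R.Y.F u) (R.Y.F v) \<cdot>\<^bsub>?Z\<^esub> ((S.r u \<otimes>\<^bsub>?Z\<^esub> S.r v) \<cdot>\<^bsub>?Z\<^esub> S.Y.\<mu> u v)))"
      by (simp add: R.r_mu S.FA_cmp_arr S.r_mu)
    also have "S.RA (R.r u \<otimes>\<^bsub>?Y\<^esub> R.r v) \<cdot>\<^bsub>?Z\<^esub> (S.\<rho> (R.Y.F u) (R.Y.F v) \<cdot>\<^bsub>?Z\<^esub> ((S.r u \<otimes>\<^bsub>?Z\<^esub> S.r v) \<cdot>\<^bsub>?Z\<^esub> S.Y.\<mu> u v)) =
      S.\<rho> (R.R0 (R.X.F u)) (R.R0 (R.X.F v)) \<cdot>\<^bsub>?Z\<^esub> ((S.RA (R.r u) \<otimes>\<^bsub>?Z\<^esub> S.RA (R.r v)) \<cdot>\<^bsub>?Z\<^esub> ((S.r u \<otimes>\<^bsub>?Z\<^esub> S.r v) \<cdot>\<^bsub>?Z\<^esub> S.Y.\<mu> u v))"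
      by (rule S.Y.A.cmp_eq_extend[OF S.lax_nat]) auto
    finally show ?case
      by (simp add: modtens_cmp1_def fcomp_def S.Y.A.ten_cmp_extend)
  qed (use lax in \<open>auto simp: modtens_cmp1_def fcomp_def\<close>)
qed

lemma modtens_2cell_hcmp:
  assumes "modtens_arrow V X Y R" "modtens_arrow V X Y R'" "modtens_arrow V Y Z S" "modtens_arrow V Y Z S'"
    and "modtens_2cell V X Y R R' \<Theta>" "modtens_2cell V Y Z S S' \<Psi>"
  shows "modtens_2cell V X Z (modtens_cmp1 V X Y Z S R) (modtens_cmp1 V X Y Z S' R')
    (\<lambda>a\<in>Obj (mtCat X). \<Psi> (FO (mtR R') a) \<cdot>\<^bsub>mtCat Z\<^esub> FA (mtR S) (\<Theta> a))"
proof -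
  interpret R: modtens_arrow V X Y R by fact
  interpret R': modtens_arrow V X Y R' by fact
  interpret S: modtens_arrow V Y Z S by fact
  interpret S': modtens_arrow V Y Z S' by fact
  let ?X = "mtCat X" and ?Y = "mtCat Y" and ?Z = "mtCat Z"
  note T = modtens_2cellD[OF assms(5)] and P = modtens_2cellD[OF assms(6)]
  note [simp] = T(2-4) P(2-4)
  show ?thesis
  proof (rule modtens_2cellI, goal_cases)
    case (2 a) then show ?case by (simp add: modtens_cmp1_def fcomp_def hom_def)
  next
    case (3 f)
    then have f [simp]: "f \<in> Arr ?X" .
    let ?a = "Dom ?X f" and ?b = "Cod ?X f"
    have "S'.RA (R'.RA f) \<cdot>\<^bsub>?Z\<^esub> (\<Psi> (R'.R0 ?a) \<cdot>\<^bsub>?Z\<^esub> S.RA (\<Theta> ?a)) =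
       \<Psi> (R'.R0 ?b) \<cdot>\<^bsub>?Z\<^esub> (S.RA (R'.RA f) \<cdot>\<^bsub>?Z\<^esub> S.RA (\<Theta> ?a))"
      by (rule S.Y.A.cmp_eq_extend[OF P(5)]) auto
    also have "S.RA (R'.RA f) \<cdot>\<^bsub>?Z\<^esub> S.RA (\<Theta> ?a) = S.RA (\<Theta> ?b) \<cdot>\<^bsub>?Z\<^esub> S.RA (R.RA f)"
      using T(5)[OF f refl refl] by (simp flip: S.FA_cmp_arr)
    finally show ?case by (simp add: modtens_cmp1_def fcomp_def)
  next
    case (4 a b)
    then have ab [simp]: "a \<in> Obj ?X" "b \<in> Obj ?X" .
    have "\<Psi> (R'.R0 (a \<odot>\<^bsub>?X\<^esub> b)) \<cdot>\<^bsub>?Z\<^esub> (S.RA (\<Theta> (a \<odot>\<^bsub>?X\<^esub> b)) \<cdot>\<^bsub>?Z\<^esub> (S.RA (R.\<rho> a b) \<cdot>\<^bsub>?Z\<^esub> S.\<rho> (R.R0 a) (R.R0 b))) =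
      \<Psi> (R'.R0 (a \<odot>\<^bsub>?X\<^esub> b)) \<cdot>\<^bsub>?Z\<^esub> (S.RA (\<Theta> (a \<odot>\<^bsub>?X\<^esub> b) \<cdot>\<^bsub>?Y\<^esub> R.\<rho> a b) \<cdot>\<^bsub>?Z\<^esub> S.\<rho> (R.R0 a) (R.R0 b))"
      by (simp add: S.FA_cmp_arr)
    also have "\<dots> = \<Psi> (R'.R0 (a \<odot>\<^bsub>?X\<^esub> b)) \<cdot>\<^bsub>?Z\<^esub> (S.RA (R'.\<rho> a b) \<cdot>\<^bsub>?Z\<^esub> (S.RA (\<Theta> a \<otimes>\<^bsub>?Y\<^esub> \<Theta> b) \<cdot>\<^bsub>?Z\<^esub> S.\<rho> (R.R0 a) (R.R0 b)))"
      by (simp add: T(6) S.FA_cmp_arr)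
    also have "S.RA (\<Theta> a \<otimes>\<^bsub>?Y\<^esub> \<Theta> b) \<cdot>\<^bsub>?Z\<^esub> S.\<rho> (R.R0 a) (R.R0 b) =
       S.\<rho> (R'.R0 a) (R'.R0 b) \<cdot>\<^bsub>?Z\<^esub> (S.RA (\<Theta> a) \<otimes>\<^bsub>?Z\<^esub> S.RA (\<Theta> b))"
      by (rule S.lax_nat) auto
    also have "\<Psi> (R'.R0 (a \<odot>\<^bsub>?X\<^esub> b)) \<cdot>\<^bsub>?Z\<^esub> (S.RA (R'.\<rho> a b) \<cdot>\<^bsub>?Z\<^esub> (S.\<rho> (R'.R0 a) (R'.R0 b) \<cdot>\<^bsub>?Z\<^esub> (S.RA (\<Theta> a) \<otimes>\<^bsub>?Z\<^esub> S.RA (\<Theta> b)))) =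
      S'.RA (R'.\<rho> a b) \<cdot>\<^bsub>?Z\<^esub> (\<Psi> (R'.R0 a \<odot>\<^bsub>?Y\<^esub> R'.R0 b) \<cdot>\<^bsub>?Z\<^esub> (S.\<rho> (R'.R0 a) (R'.R0 b) \<cdot>\<^bsub>?Z\<^esub> (S.RA (\<Theta> a) \<otimes>\<^bsub>?Z\<^esub> S.RA (\<Theta> b))))"
      by (rule S.Y.A.cmp_eq_extend[OF P(5)[symmetric]]) auto
    also have "\<Psi> (R'.R0 a \<odot>\<^bsub>?Y\<^esub> R'.R0 b) \<cdot>\<^bsub>?Z\<^esub> (S.\<rho> (R'.R0 a) (R'.R0 b) \<cdot>\<^bsub>?Z\<^esub> (S.RA (\<Theta> a) \<otimes>\<^bsub>?Z\<^esub> S.RA (\<Theta> b))) =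
       S'.\<rho> (R'.R0 a) (R'.R0 b) \<cdot>\<^bsub>?Z\<^esub> ((\<Psi> (R'.R0 a) \<otimes>\<^bsub>?Z\<^esub> \<Psi> (R'.R0 b)) \<cdot>\<^bsub>?Z\<^esub> (S.RA (\<Theta> a) \<otimes>\<^bsub>?Z\<^esub> S.RA (\<Theta> b)))"
      by (rule S.Y.A.cmp_eq_extend[OF P(6)]) auto
    finally show ?case by (simp add: modtens_cmp1_def fcomp_def S.Y.A.ten_cmp)
  next
    case (6 v)
    then have v [simp]: "v \<in> Obj V" .
    have "\<Psi> (R'.R0 (R.X.F v)) \<cdot>\<^bsub>?Z\<^esub> (S.RA (\<Theta> (R.X.F v)) \<cdot>\<^bsub>?Z\<^esub> (S.RA (R.r v) \<cdot>\<^bsub>?Z\<^esub> S.r v)) =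
      \<Psi> (R'.R0 (R.X.F v)) \<cdot>\<^bsub>?Z\<^esub> (S.RA (\<Theta> (R.X.F v) \<cdot>\<^bsub>?Y\<^esub> R.r v) \<cdot>\<^bsub>?Z\<^esub> S.r v)"
      by (simp add: S.FA_cmp_arr)
    also have "\<dots> = \<Psi> (R'.R0 (R.X.F v)) \<cdot>\<^bsub>?Z\<^esub> (S.RA (R'.r v) \<cdot>\<^bsub>?Z\<^esub> S.r v)"
      by (simp add: T(8))
    also have "\<dots> = S'.RA (R'.r v) \<cdot>\<^bsub>?Z\<^esub> (\<Psi> (R.Y.F v) \<cdot>\<^bsub>?Z\<^esub> S.r v)"
      by (rule S.Y.A.cmp_eq_extend[OF P(5)[symmetric]]) auto
    also have "\<dots> = S'.RA (R'.r v) \<cdot>\<^bsub>?Z\<^esub> S'.r v"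
      by (simp add: P(8))
    finally show ?case by (simp add: modtens_cmp1_def fcomp_def)
  qed (auto simp: T(7) P(7))
qed

lemma category_modtens_hom:
  assumes "modtens_object V X" "modtens_object V Y"
  shows "category (modtens_hom V X Y)"
proof -
  have arrow: "modtens_arrow V X Y R" if "modtens_1cell V X Y R" for R
    by (rule modtens_arrowI[OF assms that])
  interpret Y: modtens_object V Y by fact
  show ?thesis
  proof (unfold_locales, goal_cases)
    case (3 a)
    then show ?case
      using modtens_2cell_ide[OF arrow] by (simp add: hom_modtens_hom) (simp add: modtens_hom_def)
  next
    case (4 f a b g c)
    then show ?case
      using modtens_2cell_vcmp[OF arrow arrow arrow]
      by (auto simp: hom_modtens_hom) (auto simp: modtens_hom_def)
  next
    case (5 f a b)
    then obtain \<Theta> where "f = Tag a b \<Theta>" "modtens_2cell V X Y a b \<Theta>" by (auto simp: hom_modtens_hom)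
    with modtens_2cellD[OF this(2)] show ?case
      by (auto simp: modtens_hom_def fun_eq_iff extensional_def)
  next
    case (6 f a b)
    then obtain \<Theta> where "f = Tag a b \<Theta>" "modtens_2cell V X Y a b \<Theta>" by (auto simp: hom_modtens_hom)
    with modtens_2cellD[OF this(2)] show ?case
      by (auto simp: modtens_hom_def fun_eq_iff extensional_def)
  next
    case (7 f a b g c h d)
    then obtain \<Theta> \<Psi> \<Phi> where "f = Tag a b \<Theta>" "modtens_2cell V X Y a b \<Theta>"
      "g = Tag b c \<Psi>" "modtens_2cell V X Y b c \<Psi>" "h = Tag c d \<Phi>" "modtens_2cell V X Y c d \<Phi>"
      by (auto simp: hom_modtens_hom)
    with modtens_2cellD[OF this(2)] modtens_2cellD[OF this(4)] modtens_2cellD[OF this(6)] show ?case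
      by (auto simp: modtens_hom_def fun_eq_iff)
  qed (auto simp: modtens_hom_def)
qed

lemma two_category_VModTens:
  fixes V :: "('v, 'm) braided_moncat"
  assumes "braided_monoidal_category V"
  shows "two_category (VModTens V :: (('v, 'm, 'a, 'h) modtens, _, _) twocat)"
proof -
  let ?K = "VModTens V :: (('v, 'm, 'a, 'h) modtens, _, _) twocat"
  have obj: "modtens_object V X" if "X \<in> Obj0 ?K" for X
    using modtens_objectI[OF assms] that by (simp add: VModTens_def)
  have arr: "modtens_arrow V X Y R" if "X \<in> Obj0 ?K" "Y \<in> Obj0 ?K" "R \<in> Obj (Hom ?K X Y)" for X Y R
    using modtens_arrowI[OF obj[OF that(1)] obj[OF that(2)]] that(3)
    by (simp add: VModTens_def modtens_hom_def)
  have cell: "\<exists>R S \<Theta>. x = Tag R S \<Theta> \<and> modtens_arrow V X Y R \<and> modtens_arrow V X Y S \<and>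
      modtens_2cell V X Y R S \<Theta>" if "X \<in> Obj0 ?K" "Y \<in> Obj0 ?K" "x \<in> Arr (Hom ?K X Y)" for X Y x
    using that modtens_arrowI[OF obj[OF that(1)] obj[OF that(2)]]
    by (force simp: VModTens_def modtens_hom_def)
  note defs = VModTens_def modtens_hom_def
  have unit: "Cmp1 ?K A A B F (Id1 ?K A) = F \<and> Cmp1 ?K A B B (Id1 ?K B) F = F"
    if "A \<in> Obj0 ?K" "B \<in> Obj0 ?K" "F \<in> Obj (Hom ?K A B)" for A B F
  proof -
    interpret F: modtens_arrow V A B F by (rule arr[OF that])
    have 1: "F.\<rho> a b = undefined" if "a \<in> Obj F.X.A" "b \<notin> Obj F.X.A" for a b
      using F.ext(4)[OF that(1)] that(2) by (auto simp: extensional_def)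
    have "mtR (modtens_cmp1 V A A B F (modtens_id1 V A)) = mtR F"
         "mtR (modtens_cmp1 V A B B (modtens_id1 V B) F) = mtR F"
      using F.ext(1,2)
      by (auto simp: modtens_cmp1_def modtens_id1_def fcomp_def fid_def extensional_def fun_eq_iff
          intro!: fctr.equality)
    moreover have "mtLax (modtens_cmp1 V A A B F (modtens_id1 V A)) = F.\<rho>"
      "mtLax (modtens_cmp1 V A B B (modtens_id1 V B) F) = F.\<rho>"
      using F.ext(3) 1
      by (auto simp: modtens_cmp1_def modtens_id1_def fcomp_def fid_def extensional_def fun_eq_iff)
    moreover have "mtCoh (modtens_cmp1 V A A B F (modtens_id1 V A)) = F.r"
      "mtCoh (modtens_cmp1 V A B B (modtens_id1 V B) F) = F.r"
      using F.ext(5)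
      by (auto simp: modtens_cmp1_def modtens_id1_def fcomp_def fid_def extensional_def fun_eq_iff)
    ultimately show ?thesis
      by (auto simp: VModTens_def intro!: mt1cell.equality)
  qed
  have assoc: "Cmp1 ?K A B D (Cmp1 ?K B C D H G) F = Cmp1 ?K A C D H (Cmp1 ?K A B C G F)"
    if "A \<in> Obj0 ?K" "B \<in> Obj0 ?K" "C \<in> Obj0 ?K" "D \<in> Obj0 ?K"
      "F \<in> Obj (Hom ?K A B)" "G \<in> Obj (Hom ?K B C)" "H \<in> Obj (Hom ?K C D)" for A B C D F G H
  proof -
    interpret F: modtens_arrow V A B F by (rule arr[OF that(1,2,5)])
    interpret G: modtens_arrow V B C G by (rule arr[OF that(2,3,6)])
    interpret H: modtens_arrow V C D H by (rule arr[OF that(3,4,7)])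
    show ?thesis
      by (auto simp: VModTens_def modtens_cmp1_def fcomp_def fun_eq_iff H.FA_cmp_arr)
  qed
  show ?thesis
  proof (rule two_category.intro, goal_cases)
    case (1 A B) then show ?case
      using category_modtens_hom[OF obj obj] by (simp add: VModTens_def)
  next
    case (2 A) then show ?case using modtens_arrow_id1[OF obj] by (simp add: defs)
  next
    case (3 A B C F G)
    from modtens_arrow_cmp1[OF arr[OF 3(1,2,4)] arr[OF 3(2,3,5)]] show ?case by (simp add: defs)
  next
    case (4 A B C x F F' y G G')
    obtain \<Theta> where x: "x = Tag F F' \<Theta>" "modtens_arrow V A B F" "modtens_arrow V A B F'"
      "modtens_2cell V A B F F' \<Theta>"
      using cell[OF 4(1,2), of x] 4(4) by (auto simp: hom_def defs)
    obtain \<Psi> where y: "y = Tag G G' \<Psi>" "modtens_arrow V B C G" "modtens_arrow V B C G'"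
      "modtens_2cell V B C G G' \<Psi>"
      using cell[OF 4(2,3), of y] 4(5) by (auto simp: hom_def defs)
    show ?case
      using x y modtens_2cell_hcmp[OF x(2,3) y(2,3) x(4) y(4)] modtens_arrow_cmp1
      by (auto simp: VModTens_def hom_modtens_hom modtens_hcmp_def Let_def)
  next
    case (5 A B C F G)
    interpret F: modtens_arrow V A B F by (rule arr[OF 5(1,2,4)])
    interpret G: modtens_arrow V B C G by (rule arr[OF 5(2,3,5)])
    show ?case
      by (auto simp: defs modtens_hcmp_def modtens_cmp1_def fcomp_def fun_eq_iff)
  next
    case (6 A B C x F F' x' F'' y G G' y' G'')
    obtain \<Theta> where x: "x = Tag F F' \<Theta>" "modtens_arrow V A B F" "modtens_arrow V A B F'"
      "modtens_2cell V A B F F' \<Theta>"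
      using cell[OF 6(1,2), of x] 6(4) by (auto simp: hom_def defs)
    obtain \<Theta>' where x': "x' = Tag F' F'' \<Theta>'" "modtens_arrow V A B F''"
      "modtens_2cell V A B F' F'' \<Theta>'"
      using cell[OF 6(1,2), of x'] 6(5) by (auto simp: hom_def defs)
    obtain \<Psi> where y: "y = Tag G G' \<Psi>" "modtens_arrow V B C G" "modtens_arrow V B C G'"
      "modtens_2cell V B C G G' \<Psi>"
      using cell[OF 6(2,3), of y] 6(6) by (auto simp: hom_def defs)
    obtain \<Psi>' where y': "y' = Tag G' G'' \<Psi>'" "modtens_arrow V B C G''"
      "modtens_2cell V B C G' G'' \<Psi>'"
      using cell[OF 6(2,3), of y'] 6(7) by (auto simp: hom_def defs)
    interpret F: modtens_arrow V A B F by fact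
    interpret F': modtens_arrow V A B F' by fact
    interpret F'': modtens_arrow V A B F'' by fact
    interpret G: modtens_arrow V B C G by fact
    interpret G': modtens_arrow V B C G' by fact
    interpret G'': modtens_arrow V B C G'' by fact
    note [simp] = modtens_2cellD(2-4)[OF x(4)] modtens_2cellD(2-4)[OF x'(3)]
      modtens_2cellD(2-4)[OF y(4)] modtens_2cellD(2-4)[OF y'(3)]
    have "(\<Psi>' (F''.R0 a) \<cdot>\<^bsub>mtCat C\<^esub> \<Psi> (F''.R0 a)) \<cdot>\<^bsub>mtCat C\<^esub> G.RA (\<Theta>' a \<cdot>\<^bsub>mtCat B\<^esub> \<Theta> a) =
      (\<Psi>' (F''.R0 a) \<cdot>\<^bsub>mtCat C\<^esub> G'.RA (\<Theta>' a)) \<cdot>\<^bsub>mtCat C\<^esub> (\<Psi> (F'.R0 a) \<cdot>\<^bsub>mtCat C\<^esub> G.RA (\<Theta> a))"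
      if [simp]: "a \<in> Obj (mtCat A)" for a
    proof -
      have "\<Psi> (F''.R0 a) \<cdot>\<^bsub>mtCat C\<^esub> (G.RA (\<Theta>' a) \<cdot>\<^bsub>mtCat C\<^esub> G.RA (\<Theta> a)) =
         G'.RA (\<Theta>' a) \<cdot>\<^bsub>mtCat C\<^esub> (\<Psi> (F'.R0 a) \<cdot>\<^bsub>mtCat C\<^esub> G.RA (\<Theta> a))"
        by (rule G.Y.A.cmp_eq_extend[OF modtens_2cellD(5)[OF y(4), symmetric]]) auto
      then show ?thesis by (simp add: G.FA_cmp_arr)
    qed
    then show ?case
      using x x' y y' by (auto simp: defs modtens_hcmp_def fun_eq_iff)
  next
    case (7 A B F) then show ?case by (rule unit)
  next
    case (8 A B C D F G H) then show ?case by (rule assoc)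
  next
    case (9 A B x)
    obtain R S \<Theta> where x: "x = Tag R S \<Theta>" "modtens_arrow V A B R" "modtens_arrow V A B S"
      "modtens_2cell V A B R S \<Theta>"
      using cell[OF 9] by blast
    interpret R: modtens_arrow V A B R by fact
    interpret S: modtens_arrow V A B S by fact
    note T = modtens_2cellD[OF x(4)]
    note [simp] = T(2-4)
    have "\<Theta> a = undefined" if "a \<notin> Obj (mtCat A)" for a
      using T(1) that by (auto simp: extensional_def)
    then show ?case
      using unit[OF 9(1,2), of R] unit[OF 9(1,2), of S] x R.cell1 S.cell1
      by (auto simp: defs modtens_hcmp_def modtens_id1_def fid_def fun_eq_iff)
  next
    case (10 A B C D x y z)
    obtain R S \<Theta> where x: "x = Tag R S \<Theta>" "modtens_arrow V A B R" "modtens_arrow V A B S"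
      "modtens_2cell V A B R S \<Theta>"
      using cell[OF 10(1,2,5)] by blast
    obtain R' S' \<Psi> where y: "y = Tag R' S' \<Psi>" "modtens_arrow V B C R'" "modtens_arrow V B C S'"
      "modtens_2cell V B C R' S' \<Psi>"
      using cell[OF 10(2,3,6)] by blast
    obtain R'' S'' \<Phi> where z: "z = Tag R'' S'' \<Phi>" "modtens_arrow V C D R''" "modtens_arrow V C D S''"
      "modtens_2cell V C D R'' S'' \<Phi>"
      using cell[OF 10(3,4,7)] by blast
    interpret R: modtens_arrow V A B R by fact
    interpret S: modtens_arrow V A B S by fact
    interpret R': modtens_arrow V B C R' by fact
    interpret S': modtens_arrow V B C S' by fact
    interpret R'': modtens_arrow V C D R'' by fact
    interpret S'': modtens_arrow V C D S'' by fact
    note [simp] = modtens_2cellD(2-4)[OF x(4)] modtens_2cellD(2-4)[OF y(4)] modtens_2cellD(2-4)[OF z(4)]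
    show ?case
      using assoc[OF 10(1-4), of R R' R''] assoc[OF 10(1-4), of S S' S'']
        R.cell1 R'.cell1 R''.cell1 S.cell1 S'.cell1 S''.cell1
      by (auto simp: x y z defs modtens_hcmp_def fun_eq_iff R''.FA_cmp_arr)
         (auto simp: modtens_cmp1_def fcomp_def R''.FA_cmp_arr)
  qed
qed

section \<open>Graded monoidal categories\<close>

lemma (in braided_monoidal_category) braid_arr [simp]:
  assumes "a \<in> Obj C" "b \<in> Obj C"
  shows "Braid C a b \<in> Arr C" "Dom C (Braid C a b) = a \<odot> b" "Cod C (Braid C a b) = b \<odot> a"
  using braid_in[OF assms] by (auto simp: hom_def)

lemma (in braided_monoidal_category) braid_unit [simp]:
  assumes [simp]: "a \<in> Obj C"
  shows "Braid C \<one> a = Ide C a" "Braid C a \<one> = Ide C a"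
proof -
  show "Braid C \<one> a = Ide C a"
    by (rule iso_idem[OF braid_iso]) (use hexagon_left[of \<one> \<one> a] in simp_all)
  show "Braid C a \<one> = Ide C a"
    by (rule iso_idem[OF braid_iso]) (use hexagon_right[of a \<one> \<one>] in simp_all)
qed

text \<open>
  The grades of composites and products are written in the order of the arguments in the enriched
  composition: first the grade of the arrow that is applied first.  Restriction of \<open>f\<close> along a morphism
  \<open>p\<close> into its grade is \<open>f \<lhd> p\<close>.
\<close>

locale graded_monoidal = V: braided_monoidal_category V + category G
  for V :: "('v, 'm) braided_moncat" and G :: "('a, 'g) moncat" (structure) +
  fixes gr :: "'g \<Rightarrow> 'v" and act :: "'g \<Rightarrow> 'm \<Rightarrow> 'g"  (infixl "\<lhd>" 80)
  assumes unit_obj [simp]: "\<one> \<in> Obj G"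
    and tenO_obj [simp]: "a \<in> Obj G \<Longrightarrow> b \<in> Obj G \<Longrightarrow> a \<odot> b \<in> Obj G"
    and tenO_assoc [simp]: "a \<in> Obj G \<Longrightarrow> b \<in> Obj G \<Longrightarrow> c \<in> Obj G \<Longrightarrow> (a \<odot> b) \<odot> c = a \<odot> (b \<odot> c)"
    and tenO_unit [simp]: "a \<in> Obj G \<Longrightarrow> \<one> \<odot> a = a" "a \<in> Obj G \<Longrightarrow> a \<odot> \<one> = a"
    and gr_obj [simp]: "f \<in> Arr G \<Longrightarrow> gr f \<in> Obj V"
    and gr_ide [simp]: "a \<in> Obj G \<Longrightarrow> gr (Ide G a) = \<one>\<^bsub>V\<^esub>"
    and gr_cmp [simp]: "f \<in> Arr G \<Longrightarrow> g \<in> Arr G \<Longrightarrow> Cod G f = Dom G g \<Longrightarrow> gr (g \<cdot> f) = gr f \<odot>\<^bsub>V\<^esub> gr g"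
    and act_arr [simp]:
      "f \<in> Arr G \<Longrightarrow> p \<in> Arr V \<Longrightarrow> Cod V p = gr f \<Longrightarrow> f \<lhd> p \<in> Arr G"
      "f \<in> Arr G \<Longrightarrow> p \<in> Arr V \<Longrightarrow> Cod V p = gr f \<Longrightarrow> Dom G (f \<lhd> p) = Dom G f"
      "f \<in> Arr G \<Longrightarrow> p \<in> Arr V \<Longrightarrow> Cod V p = gr f \<Longrightarrow> Cod G (f \<lhd> p) = Cod G f"
      "f \<in> Arr G \<Longrightarrow> p \<in> Arr V \<Longrightarrow> Cod V p = gr f \<Longrightarrow> gr (f \<lhd> p) = Dom V p"
    and act_ide [simp]: "f \<in> Arr G \<Longrightarrow> gr f = v \<Longrightarrow> f \<lhd> Ide V v = f"
    and act_act: "f \<in> Arr G \<Longrightarrow> p \<in> Arr V \<Longrightarrow> q \<in> Arr V \<Longrightarrow> Cod V p = gr f \<Longrightarrow> Cod V q = Dom V p \<Longrightarrow>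
      f \<lhd> p \<lhd> q = f \<lhd> (p \<cdot>\<^bsub>V\<^esub> q)"
    and cmp_act: "f \<in> Arr G \<Longrightarrow> g \<in> Arr G \<Longrightarrow> Cod G f = Dom G g \<Longrightarrow> p \<in> Arr V \<Longrightarrow> q \<in> Arr V \<Longrightarrow>
      Cod V p = gr f \<Longrightarrow> Cod V q = gr g \<Longrightarrow> (g \<lhd> q) \<cdot> (f \<lhd> p) = (g \<cdot> f) \<lhd> (p \<otimes>\<^bsub>V\<^esub> q)"
    and ten_arr [simp]:
      "f \<in> Arr G \<Longrightarrow> g \<in> Arr G \<Longrightarrow> f \<otimes> g \<in> Arr G"
      "f \<in> Arr G \<Longrightarrow> g \<in> Arr G \<Longrightarrow> Dom G (f \<otimes> g) = Dom G f \<odot> Dom G g"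
      "f \<in> Arr G \<Longrightarrow> g \<in> Arr G \<Longrightarrow> Cod G (f \<otimes> g) = Cod G f \<odot> Cod G g"
      "f \<in> Arr G \<Longrightarrow> g \<in> Arr G \<Longrightarrow> gr (f \<otimes> g) = gr f \<odot>\<^bsub>V\<^esub> gr g"
    and ten_act: "f \<in> Arr G \<Longrightarrow> g \<in> Arr G \<Longrightarrow> p \<in> Arr V \<Longrightarrow> q \<in> Arr V \<Longrightarrow>
      Cod V p = gr f \<Longrightarrow> Cod V q = gr g \<Longrightarrow> (f \<lhd> p) \<otimes> (g \<lhd> q) = (f \<otimes> g) \<lhd> (p \<otimes>\<^bsub>V\<^esub> q)"
    and ten_ide [simp]: "a \<in> Obj G \<Longrightarrow> b \<in> Obj G \<Longrightarrow> Ide G a \<otimes> Ide G b = Ide G (a \<odot> b)"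
    and ten_assoc [simp]: "f \<in> Arr G \<Longrightarrow> g \<in> Arr G \<Longrightarrow> h \<in> Arr G \<Longrightarrow> (f \<otimes> g) \<otimes> h = f \<otimes> (g \<otimes> h)"
    and ten_unit [simp]: "f \<in> Arr G \<Longrightarrow> Ide G \<one> \<otimes> f = f" "f \<in> Arr G \<Longrightarrow> f \<otimes> Ide G \<one> = f"
    and gr_interchange: "f \<in> Arr G \<Longrightarrow> f' \<in> Arr G \<Longrightarrow> g \<in> Arr G \<Longrightarrow> g' \<in> Arr G \<Longrightarrow>
      Cod G f = Dom G f' \<Longrightarrow> Cod G g = Dom G g' \<Longrightarrow>
      (f' \<otimes> g') \<cdot> (f \<otimes> g) = ((f' \<cdot> f) \<otimes> (g' \<cdot> g)) \<lhd>
        (Ide V (gr f) \<otimes>\<^bsub>V\<^esub> Braid V (gr g) (gr f') \<otimes>\<^bsub>V\<^esub> Ide V (gr g'))"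
begin

abbreviation pure :: "('a, 'g) moncat" where
  "pure \<equiv> G\<lparr>Arr := {f \<in> Arr G. gr f = \<one>\<^bsub>V\<^esub>}\<rparr>"

text \<open>
  The braiding in the interchange law exchanges the grades of \<open>g\<close> and \<open>f'\<close>, and is trivial as soon as one
  of them is the unit.
\<close>

lemma ten_cmp_post:
  assumes "f \<in> Arr G" "f' \<in> Arr G" "g \<in> Arr G" "g' \<in> Arr G" "gr f' = \<one>\<^bsub>V\<^esub>"
    "Cod G f = Dom G f'" "Cod G g = Dom G g'"
  shows "(f' \<otimes> g') \<cdot> (f \<otimes> g) = (f' \<cdot> f) \<otimes> (g' \<cdot> g)"
  using assms gr_interchange[OF assms(1-4) assms(6,7)] by simp

lemma ten_cmp_pre:
  assumes "f \<in> Arr G" "f' \<in> Arr G" "g \<in> Arr G" "g' \<in> Arr G" "gr g = \<one>\<^bsub>V\<^esub>"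
    "Cod G f = Dom G f'" "Cod G g = Dom G g'"
  shows "(f' \<otimes> g') \<cdot> (f \<otimes> g) = (f' \<cdot> f) \<otimes> (g' \<cdot> g)"
  using assms gr_interchange[OF assms(1-4) assms(6,7)] by simp

lemma ten_cmp_post_extend:
  assumes "f \<in> Arr G" "f' \<in> Arr G" "g \<in> Arr G" "g' \<in> Arr G" "gr f' = \<one>\<^bsub>V\<^esub>"
    "Cod G f = Dom G f'" "Cod G g = Dom G g'" "x \<in> Arr G" "Cod G x = Dom G f \<odot> Dom G g"
  shows "(f' \<otimes> g') \<cdot> ((f \<otimes> g) \<cdot> x) = ((f' \<cdot> f) \<otimes> (g' \<cdot> g)) \<cdot> x"
  using assms by (subst cmp_assoc_arr[symmetric]) (auto simp: ten_cmp_post)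

lemma pure_cmp_act:
  assumes "f \<in> Arr G" "g \<in> Arr G" "Cod G f = Dom G g" "p \<in> Arr V" "Cod V p = gr f" "gr g = \<one>\<^bsub>V\<^esub>"
  shows "g \<cdot> (f \<lhd> p) = (g \<cdot> f) \<lhd> p"
  using assms cmp_act[of f g p "Ide V \<one>\<^bsub>V\<^esub>"] by simp

lemma pure_ten_act:
  assumes "f \<in> Arr G" "g \<in> Arr G" "p \<in> Arr V" "Cod V p = gr f" "gr g = \<one>\<^bsub>V\<^esub>"
  shows "g \<otimes> (f \<lhd> p) = (g \<otimes> f) \<lhd> p" "(f \<lhd> p) \<otimes> g = (f \<otimes> g) \<lhd> p"
  using assms ten_act[of g f "Ide V \<one>\<^bsub>V\<^esub>" p] ten_act[of f g p "Ide V \<one>\<^bsub>V\<^esub>"] by simp_all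

lemma strict_monoidal_pure: "strict_monoidal_category pure"
  by unfold_locales (auto simp: hom_def ten_cmp_post)

lemma whisker_category_graded: "whisker_category G"
  by unfold_locales (auto simp: ten_cmp_post ten_cmp_pre)

end

text \<open>
  \<open>F v\<close> represents the arrows of grade \<open>v\<close> out of the unit, with universal arrow \<open>\<eta> v\<close>.
\<close>

locale represented_graded = graded_monoidal V G gr act + U: rigid_monoidal_category pure
  for V :: "('v, 'm) braided_moncat" and G :: "('a, 'g) moncat" (structure)
    and gr and act (infixl "\<lhd>" 80) +
  fixes F :: "('v, 'm, 'a, 'g) fctr" and \<eta> :: "'v \<Rightarrow> 'g"
  assumes F_functor: "cfunctor V pure F"
    and F_one [simp]: "FO F \<one>\<^bsub>V\<^esub> = \<one>"
    and eta_arr [simp]: "v \<in> Obj V \<Longrightarrow> \<eta> v \<in> Arr G" "v \<in> Obj V \<Longrightarrow> Dom G (\<eta> v) = \<one>"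
      "v \<in> Obj V \<Longrightarrow> Cod G (\<eta> v) = FO F v" "v \<in> Obj V \<Longrightarrow> gr (\<eta> v) = v"
    and eta_one [simp]: "\<eta> \<one>\<^bsub>V\<^esub> = Ide G \<one>"
    and eta_nat: "p \<in> Arr V \<Longrightarrow> FA F p \<cdot> \<eta> (Dom V p) = \<eta> (Cod V p) \<lhd> p"
    and eta_exists: "f \<in> Arr G \<Longrightarrow> Dom G f = \<one> \<Longrightarrow>
      \<exists>g \<in> Arr G. gr g = \<one>\<^bsub>V\<^esub> \<and> Dom G g = FO F (gr f) \<and> Cod G g = Cod G f \<and> g \<cdot> \<eta> (gr f) = f"
    and eta_unique: "v \<in> Obj V \<Longrightarrow> g \<in> Arr G \<Longrightarrow> g' \<in> Arr G \<Longrightarrow> gr g = \<one>\<^bsub>V\<^esub> \<Longrightarrow> gr g' = \<one>\<^bsub>V\<^esub> \<Longrightarrow>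
      Dom G g = FO F v \<Longrightarrow> Dom G g' = FO F v \<Longrightarrow> g \<cdot> \<eta> v = g' \<cdot> \<eta> v \<Longrightarrow> g = g'"
begin

lemma F_obj [simp]: "v \<in> Obj V \<Longrightarrow> FO F v \<in> Obj G"
  using cfunctor.FO_obj[OF F_functor] by simp

lemma F_arr [simp]:
  assumes "p \<in> Arr V"
  shows "FA F p \<in> Arr G" "gr (FA F p) = \<one>\<^bsub>V\<^esub>" "Dom G (FA F p) = FO F (Dom V p)"
    "Cod G (FA F p) = FO F (Cod V p)"
  using cfunctor.FA_arr[OF F_functor assms] by simp_all

lemma F_ide [simp]: "v \<in> Obj V \<Longrightarrow> FA F (Ide V v) = Ide G (FO F v)"
  using cfunctor.FA_ide[OF F_functor] by simp

lemma right_dual_obtain: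
  assumes "a \<in> Obj G"
  obtains d ev coev where "d \<in> Obj G"
    "ev \<in> Arr G" "gr ev = \<one>\<^bsub>V\<^esub>" "Dom G ev = a \<odot> d" "Cod G ev = \<one>"
    "coev \<in> Arr G" "gr coev = \<one>\<^bsub>V\<^esub>" "Dom G coev = \<one>" "Cod G coev = d \<odot> a"
    "(ev \<otimes> Ide G a) \<cdot> (Ide G a \<otimes> coev) = Ide G a"
  using U.right_dual[of a] assms unfolding dual_pair_def hom_def by auto

text \<open>
  A dual \<open>d\<close> of \<open>a\<close> turns an arrow \<open>a F(v) \<rightarrow> b\<close> into an arrow \<open>F(v) \<rightarrow> d b\<close> and back, which moves the
  universal property of \<open>\<eta> v\<close> from the unit to \<open>a\<close>.
\<close>

lemma whisker_eta_unique:
  assumes [simp]: "a \<in> Obj G" "v \<in> Obj V" "g \<in> Arr G" "g' \<in> Arr G" "gr g = \<one>\<^bsub>V\<^esub>" "gr g' = \<one>\<^bsub>V\<^esub>"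
    "Dom G g = a \<odot> FO F v" "Dom G g' = a \<odot> FO F v" and cod: "Cod G g = Cod G g'"
    and eq: "g \<cdot> (Ide G a \<otimes> \<eta> v) = g' \<cdot> (Ide G a \<otimes> \<eta> v)"
  shows "g = g'"
proof -
  obtain d ev coev where [simp]: "d \<in> Obj G"
    "ev \<in> Arr G" "gr ev = \<one>\<^bsub>V\<^esub>" "Dom G ev = a \<odot> d" "Cod G ev = \<one>"
    "coev \<in> Arr G" "gr coev = \<one>\<^bsub>V\<^esub>" "Dom G coev = \<one>" "Cod G coev = d \<odot> a" and
    zig: "(ev \<otimes> Ide G a) \<cdot> (Ide G a \<otimes> coev) = Ide G a"
    by (rule right_dual_obtain[OF assms(1)])
  let ?I = "Ide G" and ?F = "FO F v"
  define k where "k h = (?I d \<otimes> h) \<cdot> (coev \<otimes> ?I ?F)" for h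
  have recov: "h = (ev \<otimes> ?I (Cod G h)) \<cdot> (?I a \<otimes> k h)" and
    eta: "k h \<cdot> \<eta> v = (?I d \<otimes> (h \<cdot> (?I a \<otimes> \<eta> v))) \<cdot> coev"
    if [simp]: "h \<in> Arr G" "gr h = \<one>\<^bsub>V\<^esub>" "Dom G h = a \<odot> ?F" for h
  proof -
    have "(ev \<otimes> ?I (Cod G h)) \<cdot> (?I a \<otimes> k h) =
      (ev \<otimes> ?I (Cod G h)) \<cdot> ((?I (a \<odot> d) \<otimes> h) \<cdot> (?I a \<otimes> (coev \<otimes> ?I ?F)))"
      using ten_cmp_post[of "?I a" "?I a" "coev \<otimes> ?I ?F" "?I d \<otimes> h"]
      by (simp add: k_def ten_ide[symmetric] del: ten_ide)
    also have "\<dots> = (ev \<otimes> h) \<cdot> (?I a \<otimes> (coev \<otimes> ?I ?F))"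
      by (subst ten_cmp_post_extend) auto
    also have "ev \<otimes> h = (?I \<one> \<otimes> h) \<cdot> (ev \<otimes> ?I (a \<odot> ?F))"
      by (subst ten_cmp_post) auto
    also have "\<dots> \<cdot> (?I a \<otimes> (coev \<otimes> ?I ?F)) = h \<cdot> (((ev \<otimes> ?I a) \<cdot> (?I a \<otimes> coev)) \<otimes> ?I ?F)"
      using ten_cmp_post[of "?I a \<otimes> coev" "ev \<otimes> ?I a" "?I ?F" "?I ?F"]
      by (simp add: ten_ide[symmetric] del: ten_ide)
    finally show "h = (ev \<otimes> ?I (Cod G h)) \<cdot> (?I a \<otimes> k h)" by (simp add: zig)
    have "k h \<cdot> \<eta> v = (?I d \<otimes> h) \<cdot> ((coev \<otimes> ?I ?F) \<cdot> (?I \<one> \<otimes> \<eta> v))"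
      by (simp add: k_def)
    also have "(coev \<otimes> ?I ?F) \<cdot> (?I \<one> \<otimes> \<eta> v) = (?I (d \<odot> a) \<otimes> \<eta> v) \<cdot> (coev \<otimes> ?I \<one>)"
      using ten_cmp_post[of "?I \<one>" coev "\<eta> v" "?I ?F"] ten_cmp_post[of coev "?I (d \<odot> a)" "?I \<one>" "\<eta> v"]
      by simp
    also have "(?I d \<otimes> h) \<cdot> \<dots> = (?I d \<otimes> (h \<cdot> (?I a \<otimes> \<eta> v))) \<cdot> coev"
      using ten_cmp_post_extend[of "?I d" "?I d" "?I a \<otimes> \<eta> v" h coev]
      by (simp add: ten_ide[symmetric] del: ten_ide)
    finally show "k h \<cdot> \<eta> v = (?I d \<otimes> (h \<cdot> (?I a \<otimes> \<eta> v))) \<cdot> coev" .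
  qed
  have "k g = k g'"
    by (rule eta_unique[of v]) (simp_all add: eta eq, simp_all add: k_def)
  then show ?thesis
    using recov[of g] recov[of g'] cod by simp
qed

lemma whisker_eta_exists:
  assumes f [simp]: "f \<in> Arr G"
  shows "\<exists>g \<in> Arr G. gr g = \<one>\<^bsub>V\<^esub> \<and> Dom G g = Dom G f \<odot> FO F (gr f) \<and> Cod G g = Cod G f \<and>
    g \<cdot> (Ide G (Dom G f) \<otimes> \<eta> (gr f)) = f"
proof -
  let ?a = "Dom G f" and ?v = "gr f" and ?I = "Ide G"
  have a: "?a \<in> Obj G" by simp
  obtain d ev coev where [simp]: "d \<in> Obj G"
    "ev \<in> Arr G" "gr ev = \<one>\<^bsub>V\<^esub>" "Dom G ev = ?a \<odot> d" "Cod G ev = \<one>"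
    "coev \<in> Arr G" "gr coev = \<one>\<^bsub>V\<^esub>" "Dom G coev = \<one>" "Cod G coev = d \<odot> ?a" and
    zig: "(ev \<otimes> Ide G ?a) \<cdot> (Ide G ?a \<otimes> coev) = Ide G ?a"
    by (rule right_dual_obtain[OF a])
  obtain k where [simp]: "k \<in> Arr G" "gr k = \<one>\<^bsub>V\<^esub>" "Dom G k = FO F ?v" "Cod G k = d \<odot> Cod G f" and
    k: "k \<cdot> \<eta> ?v = (?I d \<otimes> f) \<cdot> coev"
    using eta_exists[of "(?I d \<otimes> f) \<cdot> coev"] by auto
  let ?g = "(ev \<otimes> ?I (Cod G f)) \<cdot> (?I ?a \<otimes> k)"
  have "?g \<cdot> (?I ?a \<otimes> \<eta> ?v) = (ev \<otimes> ?I (Cod G f)) \<cdot> (?I ?a \<otimes> ((?I d \<otimes> f) \<cdot> coev))"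
    by (simp add: ten_cmp_post flip: k)
  also have "\<dots> = (ev \<otimes> ?I (Cod G f)) \<cdot> ((?I (?a \<odot> d) \<otimes> f) \<cdot> (?I ?a \<otimes> coev))"
    using ten_cmp_post[of "?I ?a" "?I ?a" coev "?I d \<otimes> f"]
    by (simp add: ten_ide[symmetric] del: ten_ide)
  also have "\<dots> = (ev \<otimes> f) \<cdot> (?I ?a \<otimes> coev)"
    by (subst ten_cmp_post_extend) auto
  also have "ev \<otimes> f = (?I \<one> \<otimes> f) \<cdot> (ev \<otimes> ?I ?a)"
    by (subst ten_cmp_post) auto
  also have "\<dots> \<cdot> (?I ?a \<otimes> coev) = f \<cdot> ((ev \<otimes> ?I ?a) \<cdot> (?I ?a \<otimes> coev))"
    by simp
  also have "\<dots> = f" by (simp add: zig)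
  finally show ?thesis by (intro bexI[of _ ?g]) auto
qed

text \<open>\<open>hat f\<close> is the arrow \<open>a F(v) \<rightarrow> b\<close> that classifies an arrow \<open>f : a \<rightarrow> b\<close> of grade \<open>v\<close>.\<close>

definition hat :: "'g \<Rightarrow> 'g" where
  "hat f = (THE g. g \<in> hom pure (Dom G f \<odot> FO F (gr f)) (Cod G f) \<and>
     g \<cdot> (Ide G (Dom G f) \<otimes> \<eta> (gr f)) = f)"

lemma hat:
  assumes "f \<in> Arr G"
  shows hat_arr [simp]: "hat f \<in> Arr G" "gr (hat f) = \<one>\<^bsub>V\<^esub>" "Dom G (hat f) = Dom G f \<odot> FO F (gr f)"
      "Cod G (hat f) = Cod G f"
    and hat_eta: "hat f \<cdot> (Ide G (Dom G f) \<otimes> \<eta> (gr f)) = f"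
proof -
  have "\<exists>!g. g \<in> hom pure (Dom G f \<odot> FO F (gr f)) (Cod G f) \<and> g \<cdot> (Ide G (Dom G f) \<otimes> \<eta> (gr f)) = f"
  proof (rule ex_ex1I)
    show "\<exists>g. g \<in> hom pure (Dom G f \<odot> FO F (gr f)) (Cod G f) \<and> g \<cdot> (Ide G (Dom G f) \<otimes> \<eta> (gr f)) = f"
      using whisker_eta_exists[OF assms] by (simp add: hom_def) blast
    show "g = g'" if "g \<in> hom pure (Dom G f \<odot> FO F (gr f)) (Cod G f) \<and> g \<cdot> (Ide G (Dom G f) \<otimes> \<eta> (gr f)) = f"
      "g' \<in> hom pure (Dom G f \<odot> FO F (gr f)) (Cod G f) \<and> g' \<cdot> (Ide G (Dom G f) \<otimes> \<eta> (gr f)) = f" for g g'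
      by (rule whisker_eta_unique[of "Dom G f" "gr f"]) (use that assms in \<open>simp_all add: hom_def\<close>)
  qed
  from theI'[OF this, folded hat_def] show "hat f \<in> Arr G" "gr (hat f) = \<one>\<^bsub>V\<^esub>"
    "Dom G (hat f) = Dom G f \<odot> FO F (gr f)" "Cod G (hat f) = Cod G f"
    "hat f \<cdot> (Ide G (Dom G f) \<otimes> \<eta> (gr f)) = f"
    by (simp_all add: hom_def)
qed

lemma hat_eqI:
  assumes "f \<in> Arr G" "g \<in> Arr G" "gr g = \<one>\<^bsub>V\<^esub>" "Dom G g = Dom G f \<odot> FO F (gr f)" "Cod G g = Cod G f"
    "g \<cdot> (Ide G (Dom G f) \<otimes> \<eta> (gr f)) = f"
  shows "hat f = g"
  by (rule whisker_eta_unique[of "Dom G f" "gr f"]) (use assms in \<open>simp_all add: hat_eta\<close>)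

lemma hat_pure [simp]: "f \<in> Arr G \<Longrightarrow> gr f = \<one>\<^bsub>V\<^esub> \<Longrightarrow> hat f = f"
  by (rule hat_eqI) auto

text \<open>
  The half-braiding and the oplaxitor of the central functor that belongs to \<open>F\<close>.
\<close>

definition hb :: "'a \<Rightarrow> 'v \<Rightarrow> 'g" where
  "hb a v = hat (\<eta> v \<otimes> Ide G a)"

definition oplaxitor :: "'v \<Rightarrow> 'v \<Rightarrow> 'g" where
  "oplaxitor u v = hat (\<eta> u \<otimes> \<eta> v)"

lemma hb_arr [simp]:
  assumes "a \<in> Obj G" "v \<in> Obj V"
  shows "hb a v \<in> Arr G" "gr (hb a v) = \<one>\<^bsub>V\<^esub>" "Dom G (hb a v) = a \<odot> FO F v" "Cod G (hb a v) = FO F v \<odot> a"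
  using assms by (simp_all add: hb_def)

lemma hb_eta [simp]:
  assumes "a \<in> Obj G" "v \<in> Obj V"
  shows "hb a v \<cdot> (Ide G a \<otimes> \<eta> v) = \<eta> v \<otimes> Ide G a"
  using hat_eta[of "\<eta> v \<otimes> Ide G a"] assms by (simp add: hb_def)

lemma oplaxitor_arr [simp]:
  assumes "u \<in> Obj V" "v \<in> Obj V"
  shows "oplaxitor u v \<in> Arr G" "gr (oplaxitor u v) = \<one>\<^bsub>V\<^esub>" "Dom G (oplaxitor u v) = FO F (u \<odot>\<^bsub>V\<^esub> v)"
    "Cod G (oplaxitor u v) = FO F u \<odot> FO F v"
  using assms by (simp_all add: oplaxitor_def)

lemma oplaxitor_eta [simp]:
  assumes "u \<in> Obj V" "v \<in> Obj V"
  shows "oplaxitor u v \<cdot> \<eta> (u \<odot>\<^bsub>V\<^esub> v) = \<eta> u \<otimes> \<eta> v"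
  using hat_eta[of "\<eta> u \<otimes> \<eta> v"] assms by (simp add: oplaxitor_def)

end

section \<open>The central functor of a represented graded category\<close>

context strict_monoidal_category
begin

lemma is_iso_cmp:
  assumes "is_iso C f" "is_iso C g" "Cod C f = Dom C g"
  shows "is_iso C (g \<cdot> f)"
proof -
  obtain f' where f': "f \<in> Arr C" "f' \<in> Arr C" "Dom C f' = Cod C f" "Cod C f' = Dom C f"
    "f' \<cdot> f = Ide C (Dom C f)" "f \<cdot> f' = Ide C (Cod C f)"
    using assms(1) by (auto simp: is_iso_def hom_def)
  obtain g' where g': "g \<in> Arr C" "g' \<in> Arr C" "Dom C g' = Cod C g" "Cod C g' = Dom C g"
    "g' \<cdot> g = Ide C (Dom C g)" "g \<cdot> g' = Ide C (Cod C g)"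
    using assms(2) by (auto simp: is_iso_def hom_def)
  note [simp] = f' g' assms(3) cmp_eq_extend1[OF g'(5)] cmp_eq_extend1[OF f'(6)]
  show ?thesis
    unfolding is_iso_def by (intro conjI bexI[of _ "f' \<cdot> g'"]) (simp_all add: hom_def)
qed

lemma is_iso_ten:
  assumes "is_iso C f" "is_iso C g"
  shows "is_iso C (f \<otimes> g)"
proof -
  obtain f' where f': "f \<in> Arr C" "f' \<in> Arr C" "Dom C f' = Cod C f" "Cod C f' = Dom C f"
    "f' \<cdot> f = Ide C (Dom C f)" "f \<cdot> f' = Ide C (Cod C f)"
    using assms(1) by (auto simp: is_iso_def hom_def)
  obtain g' where g': "g \<in> Arr C" "g' \<in> Arr C" "Dom C g' = Cod C g" "Cod C g' = Dom C g"
    "g' \<cdot> g = Ide C (Dom C g)" "g \<cdot> g' = Ide C (Cod C g)"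
    using assms(2) by (auto simp: is_iso_def hom_def)
  note [simp] = f' g'
  show ?thesis
    unfolding is_iso_def by (intro conjI bexI[of _ "f' \<otimes> g'"]) (simp_all add: hom_def ten_cmp)
qed

lemma is_iso_ide: "a \<in> Obj C \<Longrightarrow> is_iso C (Ide C a)"
  unfolding is_iso_def by (auto intro!: bexI[of _ "Ide C a"] simp: hom_def)

lemma half_braiding_ten:
  assumes "half_braiding C z e" "half_braiding C w e'" "z \<in> Obj C" "w \<in> Obj C"
  shows "half_braiding C (z \<odot> w) (\<lambda>a\<in>Obj C. (Ide C z \<otimes> e' a) \<cdot> (e a \<otimes> Ide C w))"
proof -
  note [simp] = assms(3,4)
  have e [simp]: "e a \<in> Arr C" "Dom C (e a) = a \<odot> z" "Cod C (e a) = z \<odot> a"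
    and e' [simp]: "e' a \<in> Arr C" "Dom C (e' a) = a \<odot> w" "Cod C (e' a) = w \<odot> a" if "a \<in> Obj C" for a
    using assms(1,2) that by (auto simp: half_braiding_def PiE_iff hom_def)
  have iso: "is_iso C (e a)" "is_iso C (e' a)" if "a \<in> Obj C" for a
    using assms(1,2) that by (auto simp: half_braiding_def)
  have nat: "(Ide C z \<otimes> f) \<cdot> e (Dom C f) = e (Cod C f) \<cdot> (f \<otimes> Ide C z)"
    "(Ide C w \<otimes> f) \<cdot> e' (Dom C f) = e' (Cod C f) \<cdot> (f \<otimes> Ide C w)" if "f \<in> Arr C" for f
    using assms(1,2) that by (auto simp: half_braiding_def)
  have mult: "e (a \<odot> b) = (e a \<otimes> Ide C b) \<cdot> (Ide C a \<otimes> e b)"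
    "e' (a \<odot> b) = (e' a \<otimes> Ide C b) \<cdot> (Ide C a \<otimes> e' b)" if "a \<in> Obj C" "b \<in> Obj C" for a b
    using assms(1,2) that by (auto simp: half_braiding_def)
  show ?thesis
    unfolding half_braiding_def
  proof (intro conjI ballI, goal_cases)
    case 1 show ?case by (auto simp: hom_def)
  next
    case (2 a) then show ?case by (simp add: is_iso_cmp is_iso_ten is_iso_ide iso)
  next
    case (3 f)
    then have f [simp]: "f \<in> Arr C" .
    let ?a = "Dom C f" and ?b = "Cod C f"
    have "(Ide C (z \<odot> w) \<otimes> f) \<cdot> ((Ide C z \<otimes> e' ?a) \<cdot> (e ?a \<otimes> Ide C w)) =
      (Ide C z \<otimes> ((Ide C w \<otimes> f) \<cdot> e' ?a)) \<cdot> (e ?a \<otimes> Ide C w)"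
      using ten_cmp_extend[of "Ide C z" "e' ?a" "Ide C z" "Ide C w \<otimes> f" "e ?a \<otimes> Ide C w"]
      by (simp add: tenM_ide_obj[symmetric] del: tenM_ide_obj)
    also have "\<dots> = (Ide C z \<otimes> e' ?b) \<cdot> ((Ide C z \<otimes> (f \<otimes> Ide C w)) \<cdot> (e ?a \<otimes> Ide C w))"
      by (subst nat) (simp_all add: ten_cmp_extend)
    also have "(Ide C z \<otimes> (f \<otimes> Ide C w)) \<cdot> (e ?a \<otimes> Ide C w) = ((Ide C z \<otimes> f) \<cdot> e ?a) \<otimes> Ide C w"
      using ten_cmp[of "e ?a" "Ide C w" "Ide C z \<otimes> f" "Ide C w"] by simp
    also have "\<dots> = (e ?b \<otimes> Ide C w) \<cdot> (f \<otimes> Ide C (z \<odot> w))"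
      using ten_cmp[of "f \<otimes> Ide C z" "Ide C w" "e ?b" "Ide C w"] by (simp add: nat)
    finally show ?case by simp
  next
    case (4 a b)
    then have [simp]: "a \<in> Obj C" "b \<in> Obj C" .
    let ?I = "Ide C"
    have ex: "(?I (z \<odot> a) \<otimes> e' b) \<cdot> (e a \<otimes> ?I (b \<odot> w)) = (e a \<otimes> ?I (w \<odot> b)) \<cdot> (?I (a \<odot> z) \<otimes> e' b)"
      by (simp only: ten_cmp ide_arr cmp_arr e e' tenO_obj \<open>a \<in> Obj C\<close> \<open>b \<in> Obj C\<close> assms(3,4))
         simp
    have s1: "?I z \<otimes> ((e' a \<otimes> ?I b) \<cdot> (?I a \<otimes> e' b)) = (?I z \<otimes> (e' a \<otimes> ?I b)) \<cdot> (?I z \<otimes> (?I a \<otimes> e' b))"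
      using ten_cmp[of "?I z" "?I a \<otimes> e' b" "?I z" "e' a \<otimes> ?I b"] by simp
    have s2: "((e a \<otimes> ?I b) \<cdot> (?I a \<otimes> e b)) \<otimes> ?I w = (e a \<otimes> (?I b \<otimes> ?I w)) \<cdot> (?I a \<otimes> (e b \<otimes> ?I w))"
      using ten_cmp[of "?I a \<otimes> e b" "?I w" "e a \<otimes> ?I b" "?I w"] by (simp del: tenM_ide_obj)
    have s3: "((?I z \<otimes> e' a) \<cdot> (e a \<otimes> ?I w)) \<otimes> ?I b = (?I z \<otimes> (e' a \<otimes> ?I b)) \<cdot> (e a \<otimes> (?I w \<otimes> ?I b))"
      using ten_cmp[of "e a \<otimes> ?I w" "?I b" "?I z \<otimes> e' a" "?I b"] by (simp del: tenM_ide_obj)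
    have s4: "?I a \<otimes> ((?I z \<otimes> e' b) \<cdot> (e b \<otimes> ?I w)) = (?I a \<otimes> (?I z \<otimes> e' b)) \<cdot> (?I a \<otimes> (e b \<otimes> ?I w))"
      using ten_cmp[of "?I a" "e b \<otimes> ?I w" "?I a" "?I z \<otimes> e' b"] by (simp del: tenM_ide_obj)
    have "(?I z \<otimes> e' (a \<odot> b)) \<cdot> (e (a \<odot> b) \<otimes> ?I w) =
      (?I z \<otimes> (e' a \<otimes> ?I b)) \<cdot> (((?I z \<otimes> (?I a \<otimes> e' b)) \<cdot> (e a \<otimes> (?I b \<otimes> ?I w))) \<cdot> (?I a \<otimes> (e b \<otimes> ?I w)))"
      by (simp add: mult s1 s2 del: tenM_ide_obj)
    also have "(?I z \<otimes> (?I a \<otimes> e' b)) \<cdot> (e a \<otimes> (?I b \<otimes> ?I w)) = (e a \<otimes> (?I w \<otimes> ?I b)) \<cdot> (?I a \<otimes> (?I z \<otimes> e' b))"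
      using ex by (simp add: tenM_ide_obj[symmetric] del: tenM_ide_obj)
    also have "(?I z \<otimes> (e' a \<otimes> ?I b)) \<cdot> (\<dots> \<cdot> (?I a \<otimes> (e b \<otimes> ?I w))) =
      (((?I z \<otimes> e' a) \<cdot> (e a \<otimes> ?I w)) \<otimes> ?I b) \<cdot> (?I a \<otimes> ((?I z \<otimes> e' b) \<cdot> (e b \<otimes> ?I w)))"
      by (simp add: s3 s4 del: tenM_ide_obj)
    finally show ?case by simp
  qed
qed

lemma center_tenO_assoc:
  assumes "half_braiding C z e" "half_braiding C w e'" "half_braiding C y e''"
    and [simp]: "z \<in> Obj C" "w \<in> Obj C" "y \<in> Obj C"
  shows "center_tenO C (center_tenO C (z, e) (w, e')) (y, e'') =
    center_tenO C (z, e) (center_tenO C (w, e') (y, e''))"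
proof -
  let ?I = "Ide C"
  have [simp]: "e x \<in> Arr C" "Dom C (e x) = x \<odot> z" "Cod C (e x) = z \<odot> x"
    "e' x \<in> Arr C" "Dom C (e' x) = x \<odot> w" "Cod C (e' x) = w \<odot> x"
    "e'' x \<in> Arr C" "Dom C (e'' x) = x \<odot> y" "Cod C (e'' x) = y \<odot> x" if "x \<in> Obj C" for x
    using assms(1-3) that by (auto simp: half_braiding_def PiE_iff hom_def)
  have "(?I (z \<odot> w) \<otimes> e'' a) \<cdot> (((?I z \<otimes> e' a) \<cdot> (e a \<otimes> ?I w)) \<otimes> ?I y) =
    (?I z \<otimes> ((?I w \<otimes> e'' a) \<cdot> (e' a \<otimes> ?I y))) \<cdot> (e a \<otimes> ?I (w \<odot> y))" if [simp]: "a \<in> Obj C" for a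
  proof -
    have 1: "((?I z \<otimes> e' a) \<cdot> (e a \<otimes> ?I w)) \<otimes> ?I y = (?I z \<otimes> (e' a \<otimes> ?I y)) \<cdot> (e a \<otimes> (?I w \<otimes> ?I y))"
      using ten_cmp[of "e a \<otimes> ?I w" "?I y" "?I z \<otimes> e' a" "?I y"] by (simp del: tenM_ide_obj)
    have 2: "?I z \<otimes> ((?I w \<otimes> e'' a) \<cdot> (e' a \<otimes> ?I y)) = (?I z \<otimes> (?I w \<otimes> e'' a)) \<cdot> (?I z \<otimes> (e' a \<otimes> ?I y))"
      using ten_cmp[of "?I z" "e' a \<otimes> ?I y" "?I z" "?I w \<otimes> e'' a"] by simp
    show ?thesis by (simp add: 1 2 tenM_ide_obj[symmetric] del: tenM_ide_obj)
  qed
  then show ?thesis by (auto simp: center_tenO_def fun_eq_iff)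
qed

lemma category_center: "category (center C)"
proof (unfold_locales, goal_cases)
  case (3 a)
  obtain z e where a [simp]: "a = (z, e)" by (cases a)
  have "z \<in> Obj C" "half_braiding C z e" using 3 by (auto simp: center_def)
  moreover have "e x \<in> Arr C" "Dom C (e x) = x \<odot> z" "Cod C (e x) = z \<odot> x" if "x \<in> Obj C" for x
    using calculation that by (auto simp: half_braiding_def PiE_iff hom_def)
  ultimately show ?case by (auto simp: center_def hom_def)
next
  case (4 f a b g c)
  obtain z1 e1 z2 e2 z3 e3 f0 g0 where [simp]: "a = (z1, e1)" "b = (z2, e2)" "c = (z3, e3)"
    "f = Tag (z1, e1) (z2, e2) f0" "g = Tag (z2, e2) (z3, e3) g0"
    using 4 by (cases a; cases b; cases c; cases f; cases g) (auto simp: center_def hom_def)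
  have [simp]: "z1 \<in> Obj C" "z2 \<in> Obj C" "z3 \<in> Obj C" and
    hb: "half_braiding C z1 e1" "half_braiding C z2 e2" "half_braiding C z3 e3"
    and [simp]: "f0 \<in> Arr C" "Dom C f0 = z1" "Cod C f0 = z2" "g0 \<in> Arr C" "Dom C g0 = z2" "Cod C g0 = z3"
    and nat: "\<And>a. a \<in> Obj C \<Longrightarrow> (f0 \<otimes> Ide C a) \<cdot> e1 a = e2 a \<cdot> (Ide C a \<otimes> f0)"
      "\<And>a. a \<in> Obj C \<Longrightarrow> (g0 \<otimes> Ide C a) \<cdot> e2 a = e3 a \<cdot> (Ide C a \<otimes> g0)"
    using 4 by (auto simp: center_def hom_def)
  have [simp]: "e1 x \<in> Arr C" "Dom C (e1 x) = x \<odot> z1" "Cod C (e1 x) = z1 \<odot> x"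
    "e2 x \<in> Arr C" "Dom C (e2 x) = x \<odot> z2" "Cod C (e2 x) = z2 \<odot> x"
    "e3 x \<in> Arr C" "Dom C (e3 x) = x \<odot> z3" "Cod C (e3 x) = z3 \<odot> x" if "x \<in> Obj C" for x
    using hb that by (auto simp: half_braiding_def PiE_iff hom_def)
  have "((g0 \<cdot> f0) \<otimes> Ide C x) \<cdot> e1 x = e3 x \<cdot> (Ide C x \<otimes> (g0 \<cdot> f0))" if [simp]: "x \<in> Obj C" for x
  proof -
    have "((g0 \<cdot> f0) \<otimes> Ide C x) \<cdot> e1 x = (g0 \<otimes> Ide C x) \<cdot> ((f0 \<otimes> Ide C x) \<cdot> e1 x)"
      by (simp add: ten_cmp_extend)
    also have "\<dots> = (g0 \<otimes> Ide C x) \<cdot> (e2 x \<cdot> (Ide C x \<otimes> f0))"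
      by (simp add: nat)
    also have "\<dots> = e3 x \<cdot> ((Ide C x \<otimes> g0) \<cdot> (Ide C x \<otimes> f0))"
      by (rule cmp_eq_extend[OF nat(2)]) auto
    finally show ?thesis by (simp add: ten_cmp)
  qed
  then show ?case using hb by (auto simp: center_def hom_def)
qed (auto simp: center_def hom_def)

end

context represented_graded
begin

definition central_obj :: "'v \<Rightarrow> 'a \<times> ('a \<Rightarrow> 'g)" where
  "central_obj v = (FO F v, \<lambda>a\<in>Obj G. hb a v)"

text \<open>
  A module tensor category is given by total functions, and only their values on the carriers are
  determined by the graded category.
\<close>

definition models :: "('v, 'm, 'a, 'g) modtens \<Rightarrow> bool" where
  "models X \<longleftrightarrow> mtCat X = pure \<and> mtF X = F \<and>
     (\<forall>v \<in> Obj V. FO (mtFun X) v = central_obj v) \<and>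
     (\<forall>p \<in> Arr V. FA (mtFun X) p = Tag (central_obj (Dom V p)) (central_obj (Cod V p)) (FA F p)) \<and>
     (\<forall>u \<in> Obj V. \<forall>v \<in> Obj V. mtMu X u v =
        Tag (central_obj (u \<odot>\<^bsub>V\<^esub> v)) (center_tenO pure (central_obj u) (central_obj v)) (oplaxitor u v))"

text \<open>
  Each law of a central functor is an equality of two arrows of grade one out of some \<open>a F(v)\<close>.  It
  suffices to compare them after \<open>a \<eta>(v)\<close>, where both sides turn into products of universal arrows.
\<close>

lemma hb_nat:
  assumes [simp]: "v \<in> Obj V" "f \<in> Arr G" "gr f = \<one>\<^bsub>V\<^esub>"
  shows "(Ide G (FO F v) \<otimes> f) \<cdot> hb (Dom G f) v = hb (Cod G f) v \<cdot> (f \<otimes> Ide G (FO F v))"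
proof (rule whisker_eta_unique[of "Dom G f" v])
  have "(hb (Cod G f) v \<cdot> (f \<otimes> Ide G (FO F v))) \<cdot> (Ide G (Dom G f) \<otimes> \<eta> v) =
      hb (Cod G f) v \<cdot> ((Ide G (Cod G f) \<otimes> \<eta> v) \<cdot> (f \<otimes> Ide G \<one>))"
    using ten_cmp_post[of "Ide G (Dom G f)" f "\<eta> v" "Ide G (FO F v)"]
      ten_cmp_post[of f "Ide G (Cod G f)" "Ide G \<one>" "\<eta> v"] by simp
  also have "\<dots> = (\<eta> v \<otimes> Ide G (Cod G f)) \<cdot> (Ide G \<one> \<otimes> f)"
    by (subst cmp_eq_extend1[OF hb_eta]) auto
  also have "\<dots> = \<eta> v \<otimes> f"
    by (subst ten_cmp_pre) auto
  finally show "((Ide G (FO F v) \<otimes> f) \<cdot> hb (Dom G f) v) \<cdot> (Ide G (Dom G f) \<otimes> \<eta> v) =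
      (hb (Cod G f) v \<cdot> (f \<otimes> Ide G (FO F v))) \<cdot> (Ide G (Dom G f) \<otimes> \<eta> v)"
    by (simp add: ten_cmp_post)
qed simp_all

lemma hb_mult:
  assumes [simp]: "v \<in> Obj V" "a \<in> Obj G" "b \<in> Obj G"
  shows "hb (a \<odot> b) v = (hb a v \<otimes> Ide G b) \<cdot> (Ide G a \<otimes> hb b v)"
proof (rule whisker_eta_unique[of "a \<odot> b" v])
  have "((hb a v \<otimes> Ide G b) \<cdot> (Ide G a \<otimes> hb b v)) \<cdot> (Ide G (a \<odot> b) \<otimes> \<eta> v) =
    (hb a v \<otimes> Ide G b) \<cdot> (Ide G a \<otimes> (hb b v \<cdot> (Ide G b \<otimes> \<eta> v)))"
    using ten_cmp_post[of "Ide G a" "Ide G a" "Ide G b \<otimes> \<eta> v" "hb b v"]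
    by (simp add: ten_ide[symmetric] del: ten_ide hb_eta)
  also have "\<dots> = \<eta> v \<otimes> Ide G (a \<odot> b)"
    using ten_cmp_post[of "Ide G a \<otimes> \<eta> v" "hb a v" "Ide G b" "Ide G b"] by simp
  finally show "hb (a \<odot> b) v \<cdot> (Ide G (a \<odot> b) \<otimes> \<eta> v) =
    ((hb a v \<otimes> Ide G b) \<cdot> (Ide G a \<otimes> hb b v)) \<cdot> (Ide G (a \<odot> b) \<otimes> \<eta> v)"
    by simp
qed simp_all

lemma hb_one [simp]: "v \<in> Obj V \<Longrightarrow> hb \<one> v = Ide G (FO F v)"
  by (rule whisker_eta_unique[of \<one> v]) (use hb_eta[of \<one> v] in simp_all)

lemma hb_grade_one [simp]: "a \<in> Obj G \<Longrightarrow> hb a \<one>\<^bsub>V\<^esub> = Ide G a"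
  by (rule whisker_eta_unique[of a "\<one>\<^bsub>V\<^esub>"]) (use hb_eta[of a "\<one>\<^bsub>V\<^esub>"] in simp_all)

lemma central_half_braiding:
  assumes [simp]: "v \<in> Obj V"
  shows "half_braiding pure (FO F v) (\<lambda>a\<in>Obj G. hb a v)"
proof -
  have "is_iso pure (hb a v)" if a [simp]: "a \<in> Obj G" for a
  proof -
    obtain d where "d \<in> Obj G" "dual_pair pure d a"
      using U.left_dual[of a] by auto
    then show ?thesis
      by (intro U.half_braiding_invertible[of "FO F v" a d "\<lambda>a. hb a v"])
         (auto simp: hom_def hb_nat hb_mult)
  qed
  then show ?thesis
    unfolding half_braiding_def by (auto simp: hom_def hb_nat hb_mult)
qed

lemma F_central:
  assumes [simp]: "p \<in> Arr V" "a \<in> Obj G"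
  shows "(FA F p \<otimes> Ide G a) \<cdot> hb a (Dom V p) = hb a (Cod V p) \<cdot> (Ide G a \<otimes> FA F p)"
proof (rule whisker_eta_unique[of a "Dom V p"])
  have "((FA F p \<otimes> Ide G a) \<cdot> hb a (Dom V p)) \<cdot> (Ide G a \<otimes> \<eta> (Dom V p)) = (\<eta> (Cod V p) \<lhd> p) \<otimes> Ide G a"
    by (simp add: ten_cmp_post eta_nat)
  also have "\<dots> = hb a (Cod V p) \<cdot> (Ide G a \<otimes> (\<eta> (Cod V p) \<lhd> p))"
    by (simp add: pure_ten_act pure_cmp_act)
  also have "\<dots> = (hb a (Cod V p) \<cdot> (Ide G a \<otimes> FA F p)) \<cdot> (Ide G a \<otimes> \<eta> (Dom V p))"
    by (simp add: ten_cmp_post eta_nat)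
  finally show "((FA F p \<otimes> Ide G a) \<cdot> hb a (Dom V p)) \<cdot> (Ide G a \<otimes> \<eta> (Dom V p)) =
    (hb a (Cod V p) \<cdot> (Ide G a \<otimes> FA F p)) \<cdot> (Ide G a \<otimes> \<eta> (Dom V p))" .
qed simp_all

lemma oplaxitor_central:
  assumes [simp]: "u \<in> Obj V" "v \<in> Obj V" "a \<in> Obj G"
  shows "(oplaxitor u v \<otimes> Ide G a) \<cdot> hb a (u \<odot>\<^bsub>V\<^esub> v) =
    ((Ide G (FO F u) \<otimes> hb a v) \<cdot> (hb a u \<otimes> Ide G (FO F v))) \<cdot> (Ide G a \<otimes> oplaxitor u v)"
proof (rule whisker_eta_unique[of a "u \<odot>\<^bsub>V\<^esub> v"])
  have "(((Ide G (FO F u) \<otimes> hb a v) \<cdot> (hb a u \<otimes> Ide G (FO F v))) \<cdot> (Ide G a \<otimes> oplaxitor u v)) \<cdot>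
      (Ide G a \<otimes> \<eta> (u \<odot>\<^bsub>V\<^esub> v)) =
    (Ide G (FO F u) \<otimes> hb a v) \<cdot> ((hb a u \<otimes> Ide G (FO F v)) \<cdot> ((Ide G a \<otimes> \<eta> u) \<otimes> \<eta> v))"
    by (simp add: ten_cmp_post)
  also have "(hb a u \<otimes> Ide G (FO F v)) \<cdot> ((Ide G a \<otimes> \<eta> u) \<otimes> \<eta> v) = \<eta> u \<otimes> (Ide G a \<otimes> \<eta> v)"
    by (subst ten_cmp_post) simp_all
  also have "(Ide G (FO F u) \<otimes> hb a v) \<cdot> \<dots> = (\<eta> u \<otimes> \<eta> v) \<otimes> Ide G a"
    by (subst ten_cmp_post) simp_all
  finally show "((oplaxitor u v \<otimes> Ide G a) \<cdot> hb a (u \<odot>\<^bsub>V\<^esub> v)) \<cdot> (Ide G a \<otimes> \<eta> (u \<odot>\<^bsub>V\<^esub> v)) =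
      (((Ide G (FO F u) \<otimes> hb a v) \<cdot> (hb a u \<otimes> Ide G (FO F v))) \<cdot> (Ide G a \<otimes> oplaxitor u v)) \<cdot>
      (Ide G a \<otimes> \<eta> (u \<odot>\<^bsub>V\<^esub> v))"
    by (simp add: ten_cmp_post)
qed simp_all

lemma oplaxitor_nat:
  assumes [simp]: "p \<in> Arr V" "q \<in> Arr V"
  shows "(FA F p \<otimes> FA F q) \<cdot> oplaxitor (Dom V p) (Dom V q) =
    oplaxitor (Cod V p) (Cod V q) \<cdot> FA F (p \<otimes>\<^bsub>V\<^esub> q)"
proof (rule eta_unique[of "Dom V p \<odot>\<^bsub>V\<^esub> Dom V q"])
  have "(oplaxitor (Cod V p) (Cod V q) \<cdot> FA F (p \<otimes>\<^bsub>V\<^esub> q)) \<cdot> \<eta> (Dom V p \<odot>\<^bsub>V\<^esub> Dom V q) =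
     oplaxitor (Cod V p) (Cod V q) \<cdot> (\<eta> (Cod V p \<odot>\<^bsub>V\<^esub> Cod V q) \<lhd> (p \<otimes>\<^bsub>V\<^esub> q))"
    using eta_nat[of "p \<otimes>\<^bsub>V\<^esub> q"] by simp
  also have "\<dots> = (\<eta> (Cod V p) \<lhd> p) \<otimes> (\<eta> (Cod V q) \<lhd> q)"
    by (simp add: pure_cmp_act ten_act)
  finally show "((FA F p \<otimes> FA F q) \<cdot> oplaxitor (Dom V p) (Dom V q)) \<cdot> \<eta> (Dom V p \<odot>\<^bsub>V\<^esub> Dom V q) =
    (oplaxitor (Cod V p) (Cod V q) \<cdot> FA F (p \<otimes>\<^bsub>V\<^esub> q)) \<cdot> \<eta> (Dom V p \<odot>\<^bsub>V\<^esub> Dom V q)"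
    by (simp add: ten_cmp_post eta_nat)
qed simp_all

lemma oplaxitor_assoc:
  assumes [simp]: "u \<in> Obj V" "v \<in> Obj V" "w \<in> Obj V"
  shows "(Ide G (FO F u) \<otimes> oplaxitor v w) \<cdot> oplaxitor u (v \<odot>\<^bsub>V\<^esub> w) =
    (oplaxitor u v \<otimes> Ide G (FO F w)) \<cdot> oplaxitor (u \<odot>\<^bsub>V\<^esub> v) w"
proof (rule eta_unique[of "u \<odot>\<^bsub>V\<^esub> (v \<odot>\<^bsub>V\<^esub> w)"])
  show "((Ide G (FO F u) \<otimes> oplaxitor v w) \<cdot> oplaxitor u (v \<odot>\<^bsub>V\<^esub> w)) \<cdot> \<eta> (u \<odot>\<^bsub>V\<^esub> (v \<odot>\<^bsub>V\<^esub> w)) =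
    ((oplaxitor u v \<otimes> Ide G (FO F w)) \<cdot> oplaxitor (u \<odot>\<^bsub>V\<^esub> v) w) \<cdot> \<eta> (u \<odot>\<^bsub>V\<^esub> (v \<odot>\<^bsub>V\<^esub> w))"
    using oplaxitor_eta[of "u \<odot>\<^bsub>V\<^esub> v" w] by (simp add: ten_cmp_post)
qed simp_all

lemma oplaxitor_unit [simp]:
  assumes [simp]: "v \<in> Obj V"
  shows "oplaxitor \<one>\<^bsub>V\<^esub> v = Ide G (FO F v)" "oplaxitor v \<one>\<^bsub>V\<^esub> = Ide G (FO F v)"
  by (rule eta_unique[of v]; use oplaxitor_eta[of "\<one>\<^bsub>V\<^esub>" v] oplaxitor_eta[of v "\<one>\<^bsub>V\<^esub>"] in simp)+

text \<open>
  The arrow \<open>\<eta> u\<close> followed by \<open>\<eta> v\<close> on its left has grade \<open>u v\<close>, while the product \<open>\<eta> v \<otimes> \<eta> u\<close> has grade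
  \<open>v u\<close>; the graded interchange law compares them by the braiding.
\<close>

lemma oplaxitor_braid:
  assumes [simp]: "u \<in> Obj V" "v \<in> Obj V"
  shows "oplaxitor v u \<cdot> FA F (Braid V u v) = hb (FO F u) v \<cdot> oplaxitor u v"
proof (rule eta_unique[of "u \<odot>\<^bsub>V\<^esub> v"])
  have "(oplaxitor v u \<cdot> FA F (Braid V u v)) \<cdot> \<eta> (u \<odot>\<^bsub>V\<^esub> v) = (\<eta> v \<otimes> \<eta> u) \<lhd> Braid V u v"
    using eta_nat[of "Braid V u v"] by (simp add: pure_cmp_act)
  also have "\<dots> = (\<eta> v \<otimes> Ide G (FO F u)) \<cdot> (Ide G \<one> \<otimes> \<eta> u)"
    by (subst gr_interchange) simp_all
  also have "\<dots> = hb (FO F u) v \<cdot> ((Ide G (FO F u) \<otimes> \<eta> v) \<cdot> (\<eta> u \<otimes> Ide G \<one>))"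
    by (subst cmp_eq_extend1[OF hb_eta]) auto
  also have "(Ide G (FO F u) \<otimes> \<eta> v) \<cdot> (\<eta> u \<otimes> Ide G \<one>) = \<eta> u \<otimes> \<eta> v"
    by (subst ten_cmp_post) simp_all
  finally show "(oplaxitor v u \<cdot> FA F (Braid V u v)) \<cdot> \<eta> (u \<odot>\<^bsub>V\<^esub> v) =
     (hb (FO F u) v \<cdot> oplaxitor u v) \<cdot> \<eta> (u \<odot>\<^bsub>V\<^esub> v)"
    by simp
qed simp_all

lemma models_object:
  assumes X: "models X" and adj: "has_right_adjoint V pure F"
  shows "modtens_0cell V X"
proof -
  have cat: "mtCat X = pure" "mtF X = F" and
    FO: "v \<in> Obj V \<Longrightarrow> FO (mtFun X) v = central_obj v" and
    FA: "p \<in> Arr V \<Longrightarrow> FA (mtFun X) p = Tag (central_obj (Dom V p)) (central_obj (Cod V p)) (FA F p)" and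
    mu: "u \<in> Obj V \<Longrightarrow> v \<in> Obj V \<Longrightarrow> mtMu X u v =
        Tag (central_obj (u \<odot>\<^bsub>V\<^esub> v)) (center_tenO pure (central_obj u) (central_obj v)) (oplaxitor u v)"
    for u v p using X unfolding models_def by blast+
  have obj: "central_obj v \<in> Obj (center pure)" if "v \<in> Obj V" for v
    using central_half_braiding[OF that] that by (simp add: central_obj_def center_def)
  have F_cmp: "FA F (q \<cdot>\<^bsub>V\<^esub> p) = FA F q \<cdot> FA F p" if "p \<in> Arr V" "q \<in> Arr V" "Cod V p = Dom V q" for p q
    using cfunctor.FA_cmp_arr[OF F_functor that] by simp
  have F_arr': "Tag (central_obj (Dom V p)) (central_obj (Cod V p)) (FA F p) \<in> Arr (center pure)"
    if [simp]: "p \<in> Arr V" for p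
    using central_half_braiding[of "Dom V p"] central_half_braiding[of "Cod V p"] F_central[of p]
    by (simp add: central_obj_def center_def hom_def)
  have mu_arr: "Tag (central_obj (u \<odot>\<^bsub>V\<^esub> v)) (center_tenO pure (central_obj u) (central_obj v)) (oplaxitor u v)
     \<in> Arr (center pure)" if [simp]: "u \<in> Obj V" "v \<in> Obj V" for u v
    using central_half_braiding[of "u \<odot>\<^bsub>V\<^esub> v"] oplaxitor_central[of u v]
      U.half_braiding_ten[OF central_half_braiding[of u] central_half_braiding[of v]]
    by (auto simp: central_obj_def center_def center_tenO_def hom_def cong: restrict_cong)
  have fctr: "cfunctor V (center pure) (mtFun X)"
    by (rule cfunctor.intro[OF V.category_axioms U.category_center], unfold_locales)
       (use F_arr' obj in \<open>auto simp: FO FA hom_def F_cmp\<close>, auto simp: center_def central_obj_def)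
  have "strict_oplax_monoidal_functor V (center pure) (mtFun X) (mtMu X)"
    unfolding strict_oplax_monoidal_functor_def
  proof (intro conjI ballI fctr, goal_cases)
    case 1 show ?case by (auto simp: FO center_def central_obj_def)
  next
    case (2 u v) then show ?case using mu_arr[of u v] by (auto simp: FO mu hom_def) (auto simp: center_def)
  next
    case (3 p q) then show ?case using oplaxitor_nat[of p q] by (simp add: FA mu) (simp add: center_def)
  next
    case (4 u v w)
    then show ?case
      using oplaxitor_assoc[of u v w]
        U.center_tenO_assoc[OF central_half_braiding[of u] central_half_braiding[of v]
          central_half_braiding[of w], folded central_obj_def]
      by (simp add: FO mu) (simp add: center_def central_obj_def)
  next
    case (5 v) then show ?case by (simp add: FO mu) (auto simp: center_def center_tenO_def central_obj_def)
  next
    case (6 v) then show ?case by (simp add: FO mu) (auto simp: center_def center_tenO_def central_obj_def)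
  qed
  moreover have "mtMu X v u \<cdot>\<^bsub>center pure\<^esub> FA (mtFun X) (Braid V u v) =
      Braid (center pure) (FO (mtFun X) u) (FO (mtFun X) v) \<cdot>\<^bsub>center pure\<^esub> mtMu X u v"
    if [simp]: "u \<in> Obj V" "v \<in> Obj V" for u v
    using oplaxitor_braid[of u v] by (simp add: FO FA mu) (simp add: center_def central_obj_def)
  ultimately have "strict_braided_oplax_monoidal_functor V (center pure) (mtFun X) (mtMu X)"
    by (simp add: strict_braided_oplax_monoidal_functor_def)
  with adj show ?thesis
    by (simp add: modtens_0cell_def cat U.rigid_monoidal_category_axioms)
qed

end

section \<open>Graded functors from module functors\<close>

definition graded_lax_functor ::
  "('v, 'm) braided_moncat \<Rightarrow> ('a, 'g) moncat \<Rightarrow> ('g \<Rightarrow> 'v) \<Rightarrow> ('g \<Rightarrow> 'm \<Rightarrow> 'g) \<Rightarrow>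
   ('a, 'g) moncat \<Rightarrow> ('g \<Rightarrow> 'v) \<Rightarrow> ('g \<Rightarrow> 'm \<Rightarrow> 'g) \<Rightarrow>
   ('a, 'g, 'a, 'g) fctr \<Rightarrow> ('a \<Rightarrow> 'a \<Rightarrow> 'g) \<Rightarrow> bool"
where
  "graded_lax_functor V G gr act H gr' act' T \<rho> \<longleftrightarrow> strict_lax_monoidal_functor G H T \<rho> \<and>
     (\<forall>f \<in> Arr G. gr' (FA T f) = gr f) \<and>
     (\<forall>f \<in> Arr G. \<forall>p \<in> Arr V. Cod V p = gr f \<longrightarrow> FA T (act f p) = act' (FA T f) p) \<and>
     (\<forall>a \<in> Obj G. \<forall>b \<in> Obj G. gr' (\<rho> a b) = \<one>\<^bsub>V\<^esub>)"

locale represented_pair =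
  A: represented_graded V GA grA actA F \<eta> + B: represented_graded V GB grB actB K \<kappa>
  for V :: "('v, 'm) braided_moncat"
    and GA :: "('a, 'g) moncat" and grA actA F \<eta>
    and GB :: "('a, 'g) moncat" (structure) and grB actB K \<kappa>

text \<open>
  The data of a module functor with coherence \<open>r\<close>, where \<open>s v\<close> stands for \<open>r v\<close> after the universal arrow
  \<open>\<kappa> v\<close> of the target.  In this form the coherence laws mention the half-braiding and the oplaxitor of
  the source only: those of the target are absorbed by \<open>\<kappa>\<close>.
\<close>

locale pure_cell = represented_pair V GA grA actA F \<eta> GB grB actB K \<kappa>
  for V :: "('v, 'm) braided_moncat"
    and GA :: "('a, 'g) moncat" and grA actA F \<eta>
    and GB :: "('a, 'g) moncat" (structure) and grB actB K \<kappa> +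
  fixes R :: "('a, 'g, 'a, 'g) fctr" and \<rho> :: "'a \<Rightarrow> 'a \<Rightarrow> 'g" and s :: "'v \<Rightarrow> 'g"
  assumes R_lax: "strict_lax_monoidal_functor A.pure B.pure R \<rho>"
    and s_arr [simp]: "v \<in> Obj V \<Longrightarrow> s v \<in> Arr GB" "v \<in> Obj V \<Longrightarrow> grB (s v) = v"
      "v \<in> Obj V \<Longrightarrow> Dom GB (s v) = \<one>" "v \<in> Obj V \<Longrightarrow> Cod GB (s v) = FO R (FO F v)"
    and s_nat: "p \<in> Arr V \<Longrightarrow> FA R (FA F p) \<cdot> s (Dom V p) = actB (s (Cod V p)) p"
    and s_one [simp]: "s \<one>\<^bsub>V\<^esub> = Ide GB \<one>"
    and s_hb: "a \<in> Obj GA \<Longrightarrow> v \<in> Obj V \<Longrightarrow>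
      FA R (A.hb a v) \<cdot> (\<rho> a (FO F v) \<cdot> (Ide GB (FO R a) \<otimes> s v)) = \<rho> (FO F v) a \<cdot> (s v \<otimes> Ide GB (FO R a))"
    and s_mu: "u \<in> Obj V \<Longrightarrow> v \<in> Obj V \<Longrightarrow>
      FA R (A.oplaxitor u v) \<cdot> s (u \<odot>\<^bsub>V\<^esub> v) = \<rho> (FO F u) (FO F v) \<cdot> (s u \<otimes> s v)"
begin

lemma R_loc: "lax_functor A.pure B.pure R \<rho>"
  by (rule lax_functorI[OF R_lax])

lemma R_obj [simp]: "a \<in> Obj GA \<Longrightarrow> FO R a \<in> Obj GB"
  using cfunctor.FO_obj[OF lax_functor.axioms(1)[OF R_loc]] by simp

lemma R_one [simp]: "FO R \<one>\<^bsub>GA\<^esub> = \<one>"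
  using lax_functor.FO_one[OF R_loc] by simp

lemma R_arr [simp]:
  assumes "f \<in> Arr GA" "grA f = \<one>\<^bsub>V\<^esub>"
  shows "FA R f \<in> Arr GB" "grB (FA R f) = \<one>\<^bsub>V\<^esub>"
    "Dom GB (FA R f) = FO R (Dom GA f)" "Cod GB (FA R f) = FO R (Cod GA f)"
  using cfunctor.FA_arr[OF lax_functor.axioms(1)[OF R_loc], of f] assms by simp_all

lemma R_ide [simp]: "a \<in> Obj GA \<Longrightarrow> FA R (Ide GA a) = Ide GB (FO R a)"
  using cfunctor.FA_ide_obj[OF lax_functor.axioms(1)[OF R_loc], of a] by simp

lemma R_cmp:
  assumes "f \<in> Arr GA" "grA f = \<one>\<^bsub>V\<^esub>" "g \<in> Arr GA" "grA g = \<one>\<^bsub>V\<^esub>" "Cod GA f = Dom GA g"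
  shows "FA R (g \<cdot>\<^bsub>GA\<^esub> f) = FA R g \<cdot> FA R f"
  using cfunctor.FA_cmp_arr[OF lax_functor.axioms(1)[OF R_loc], of f g] assms by simp

lemma rho_arr [simp]:
  assumes "a \<in> Obj GA" "b \<in> Obj GA"
  shows "\<rho> a b \<in> Arr GB" "grB (\<rho> a b) = \<one>\<^bsub>V\<^esub>"
    "Dom GB (\<rho> a b) = FO R a \<odot> FO R b" "Cod GB (\<rho> a b) = FO R (a \<odot>\<^bsub>GA\<^esub> b)"
  using lax_functor.lax_arr[OF R_loc, of a b] assms by simp_all

lemma rho_nat:
  assumes "f \<in> Arr GA" "grA f = \<one>\<^bsub>V\<^esub>" "g \<in> Arr GA" "grA g = \<one>\<^bsub>V\<^esub>"
    "Dom GA f = a" "Dom GA g = b" "Cod GA f = c" "Cod GA g = d"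
  shows "FA R (f \<otimes>\<^bsub>GA\<^esub> g) \<cdot> \<rho> a b = \<rho> c d \<cdot> (FA R f \<otimes> FA R g)"
  using lax_functor.lax_nat[OF R_loc, of f g, OF _ _ refl refl refl refl] assms by simp

lemma rho_assoc:
  assumes "a \<in> Obj GA" "b \<in> Obj GA" "c \<in> Obj GA"
  shows "\<rho> a (b \<odot>\<^bsub>GA\<^esub> c) \<cdot> (Ide GB (FO R a) \<otimes> \<rho> b c) = \<rho> (a \<odot>\<^bsub>GA\<^esub> b) c \<cdot> (\<rho> a b \<otimes> Ide GB (FO R c))"
  using lax_functor.lax_assoc[OF R_loc, of a b c] assms by simp

lemma rho_unit [simp]:
  assumes "a \<in> Obj GA"
  shows "\<rho> \<one>\<^bsub>GA\<^esub> a = Ide GB (FO R a)" "\<rho> a \<one>\<^bsub>GA\<^esub> = Ide GB (FO R a)"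
  using lax_functor.lax_unit[OF R_loc, of a] assms by simp_all

text \<open>\<open>gen a v\<close> is the value of the graded functor at \<open>Ide a \<otimes> \<eta> v\<close>.\<close>

definition gen :: "'a \<Rightarrow> 'v \<Rightarrow> 'g" where
  "gen a v = \<rho> a (FO F v) \<cdot> (Ide GB (FO R a) \<otimes> s v)"

text \<open>
  Since \<open>f\<close> is \<open>hat f\<close> after \<open>a \<eta>(v)\<close>, this is the only possible value at \<open>f\<close> of a graded functor that extends
  \<open>R\<close> and sends \<open>\<eta> v\<close> to \<open>s v\<close>.
\<close>

definition lift :: "'g \<Rightarrow> 'g" where
  "lift f = FA R (A.hat f) \<cdot> gen (Dom GA f) (grA f)"

lemma gen_arr [simp]:
  assumes "a \<in> Obj GA" "v \<in> Obj V"
  shows "gen a v \<in> Arr GB" "grB (gen a v) = v" "Dom GB (gen a v) = FO R a"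
    "Cod GB (gen a v) = FO R (a \<odot>\<^bsub>GA\<^esub> FO F v)"
  using assms by (simp_all add: gen_def)

lemma lift_arr [simp]:
  assumes "f \<in> Arr GA"
  shows "lift f \<in> Arr GB" "grB (lift f) = grA f" "Dom GB (lift f) = FO R (Dom GA f)"
    "Cod GB (lift f) = FO R (Cod GA f)"
  using assms by (simp_all add: lift_def)

lemma lift_gen [simp]:
  assumes "a \<in> Obj GA" "v \<in> Obj V"
  shows "lift (Ide GA a \<otimes>\<^bsub>GA\<^esub> \<eta> v) = gen a v"
  using assms A.hat_eqI[of "Ide GA a \<otimes>\<^bsub>GA\<^esub> \<eta> v" "Ide GA (a \<odot>\<^bsub>GA\<^esub> FO F v)"] by (simp add: lift_def)

lemma lift_pure [simp]:
  assumes "f \<in> Arr GA" "grA f = \<one>\<^bsub>V\<^esub>"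
  shows "lift f = FA R f"
  using assms by (simp add: lift_def gen_def)

lemma lift_post:
  assumes [simp]: "f \<in> Arr GA" "g \<in> Arr GA" "grA g = \<one>\<^bsub>V\<^esub>" "Cod GA f = Dom GA g"
  shows "lift (g \<cdot>\<^bsub>GA\<^esub> f) = FA R g \<cdot> lift f"
proof -
  have "A.hat (g \<cdot>\<^bsub>GA\<^esub> f) = g \<cdot>\<^bsub>GA\<^esub> A.hat f"
    by (rule A.hat_eqI) (simp_all add: A.hat_eta)
  then show ?thesis by (simp add: lift_def R_cmp)
qed

lemma gen_nat:
  assumes [simp]: "f \<in> Arr GA" "grA f = \<one>\<^bsub>V\<^esub>" "v \<in> Obj V"
  shows "FA R (f \<otimes>\<^bsub>GA\<^esub> Ide GA (FO F v)) \<cdot> gen (Dom GA f) v = gen (Cod GA f) v \<cdot> FA R f"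
proof -
  have "FA R (f \<otimes>\<^bsub>GA\<^esub> Ide GA (FO F v)) \<cdot> gen (Dom GA f) v =
     \<rho> (Cod GA f) (FO F v) \<cdot> ((FA R f \<otimes> FA R (Ide GA (FO F v))) \<cdot> (Ide GB (FO R (Dom GA f)) \<otimes> s v))"
    unfolding gen_def by (rule B.cmp_eq_extend[OF rho_nat]) simp_all
  also have "(FA R f \<otimes> FA R (Ide GA (FO F v))) \<cdot> (Ide GB (FO R (Dom GA f)) \<otimes> s v) = FA R f \<otimes> s v"
    by (subst B.ten_cmp_post) simp_all
  also have "\<dots> = (Ide GB (FO R (Cod GA f)) \<otimes> s v) \<cdot> (FA R f \<otimes> Ide GB \<one>)"
    by (subst B.ten_cmp_post) simp_all
  finally show ?thesis by (simp add: gen_def)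
qed

text \<open>
  The composite of two universal arrows factors through the universal arrow of the product of their
  grades by the oplaxitor; action coherence says that the assigned values do the same.
\<close>

lemma gen_gen:
  assumes [simp]: "a \<in> Obj GA" "u \<in> Obj V" "v \<in> Obj V"
  shows "FA R (Ide GA a \<otimes>\<^bsub>GA\<^esub> A.oplaxitor u v) \<cdot> gen a (u \<odot>\<^bsub>V\<^esub> v) = gen (a \<odot>\<^bsub>GA\<^esub> FO F u) v \<cdot> gen a u"
proof -
  let ?Fu = "FO F u" and ?Fv = "FO F v" and ?I = "Ide GB" and ?Ra = "FO R a"
  have "FA R (Ide GA a \<otimes>\<^bsub>GA\<^esub> A.oplaxitor u v) \<cdot> gen a (u \<odot>\<^bsub>V\<^esub> v) =
     \<rho> a (?Fu \<odot>\<^bsub>GA\<^esub> ?Fv) \<cdot> ((FA R (Ide GA a) \<otimes> FA R (A.oplaxitor u v)) \<cdot> (?I ?Ra \<otimes> s (u \<odot>\<^bsub>V\<^esub> v)))"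
    unfolding gen_def by (rule B.cmp_eq_extend[OF rho_nat]) simp_all
  also have "\<dots> = \<rho> a (?Fu \<odot>\<^bsub>GA\<^esub> ?Fv) \<cdot> (?I ?Ra \<otimes> (\<rho> ?Fu ?Fv \<cdot> (s u \<otimes> s v)))"
    by (simp add: B.ten_cmp_post s_mu)
  also have "?I ?Ra \<otimes> (\<rho> ?Fu ?Fv \<cdot> (s u \<otimes> s v)) = (?I ?Ra \<otimes> \<rho> ?Fu ?Fv) \<cdot> (?I ?Ra \<otimes> (s u \<otimes> s v))"
    by (simp add: B.ten_cmp_post)
  also have "\<rho> a (?Fu \<odot>\<^bsub>GA\<^esub> ?Fv) \<cdot> \<dots> = \<rho> (a \<odot>\<^bsub>GA\<^esub> ?Fu) ?Fv \<cdot> ((\<rho> a ?Fu \<otimes> ?I (FO R ?Fv)) \<cdot> (?I ?Ra \<otimes> (s u \<otimes> s v)))"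
    by (rule B.cmp_eq_extend[OF rho_assoc]) simp_all
  also have "(\<rho> a ?Fu \<otimes> ?I (FO R ?Fv)) \<cdot> (?I ?Ra \<otimes> (s u \<otimes> s v)) = gen a u \<otimes> s v"
    using B.ten_cmp_post[of "?I ?Ra \<otimes> s u" "\<rho> a ?Fu" "s v" "?I (FO R ?Fv)"] by (simp add: gen_def)
  also have "\<dots> = (?I (FO R (a \<odot>\<^bsub>GA\<^esub> ?Fu)) \<otimes> s v) \<cdot> (gen a u \<otimes> ?I \<one>)"
    by (subst B.ten_cmp_post) simp_all
  finally show ?thesis by (simp add: gen_def[of "a \<odot>\<^bsub>GA\<^esub> ?Fu"])
qed

text \<open>
  Sliding the universal arrow of \<open>g\<close> past \<open>hat f\<close> collects the two universal arrows, and \<open>gen_gen\<close> applies.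
\<close>

lemma lift_cmp:
  assumes [simp]: "f \<in> Arr GA" "g \<in> Arr GA" "Cod GA f = Dom GA g"
  shows "lift (g \<cdot>\<^bsub>GA\<^esub> f) = lift g \<cdot> lift f"
proof -
  let ?a = "Dom GA f" and ?b = "Cod GA f" and ?u = "grA f" and ?v = "grA g"
  let ?I = "Ide GA" and ?Fu = "FO F (grA f)" and ?Fv = "FO F (grA g)"
  let ?h = "?I ?a \<otimes>\<^bsub>GA\<^esub> \<eta> ?u" and ?k = "?I ?b \<otimes>\<^bsub>GA\<^esub> \<eta> ?v"
  have kh: "?k \<cdot>\<^bsub>GA\<^esub> A.hat f = (A.hat f \<otimes>\<^bsub>GA\<^esub> ?I ?Fv) \<cdot>\<^bsub>GA\<^esub> (?I (?a \<odot>\<^bsub>GA\<^esub> ?Fu) \<otimes>\<^bsub>GA\<^esub> \<eta> ?v)"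
    using A.ten_cmp_post[of "?I (?a \<odot>\<^bsub>GA\<^esub> ?Fu)" "A.hat f" "\<eta> ?v" "?I ?Fv"]
      A.ten_cmp_post[of "A.hat f" "?I ?b" "?I \<one>\<^bsub>GA\<^esub>" "\<eta> ?v"] by simp
  have hh: "(?I (?a \<odot>\<^bsub>GA\<^esub> ?Fu) \<otimes>\<^bsub>GA\<^esub> \<eta> ?v) \<cdot>\<^bsub>GA\<^esub> ?h = (?I ?a \<otimes>\<^bsub>GA\<^esub> A.oplaxitor ?u ?v) \<cdot>\<^bsub>GA\<^esub> (?I ?a \<otimes>\<^bsub>GA\<^esub> \<eta> (?u \<odot>\<^bsub>V\<^esub> ?v))"
    using A.ten_cmp_post[of ?h "?I (?a \<odot>\<^bsub>GA\<^esub> ?Fu)" "?I \<one>\<^bsub>GA\<^esub>" "\<eta> ?v"]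
      A.ten_cmp_post[of "?I ?a" "?I ?a" "\<eta> (?u \<odot>\<^bsub>V\<^esub> ?v)" "A.oplaxitor ?u ?v"] by simp
  have "g \<cdot>\<^bsub>GA\<^esub> f = (A.hat g \<cdot>\<^bsub>GA\<^esub> ?k) \<cdot>\<^bsub>GA\<^esub> (A.hat f \<cdot>\<^bsub>GA\<^esub> ?h)"
    using A.hat_eta[of f] A.hat_eta[of g] by simp
  also have "\<dots> = A.hat g \<cdot>\<^bsub>GA\<^esub> ((?k \<cdot>\<^bsub>GA\<^esub> A.hat f) \<cdot>\<^bsub>GA\<^esub> ?h)" by simp
  also have "\<dots> = A.hat g \<cdot>\<^bsub>GA\<^esub> ((A.hat f \<otimes>\<^bsub>GA\<^esub> ?I ?Fv) \<cdot>\<^bsub>GA\<^esub> ((?I ?a \<otimes>\<^bsub>GA\<^esub> A.oplaxitor ?u ?v) \<cdot>\<^bsub>GA\<^esub> (?I ?a \<otimes>\<^bsub>GA\<^esub> \<eta> (?u \<odot>\<^bsub>V\<^esub> ?v))))"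
    unfolding kh by (simp add: hh del: A.ten_ide)
  finally have "lift (g \<cdot>\<^bsub>GA\<^esub> f) = FA R (A.hat g) \<cdot> (FA R (A.hat f \<otimes>\<^bsub>GA\<^esub> ?I ?Fv) \<cdot>
      (FA R (?I ?a \<otimes>\<^bsub>GA\<^esub> A.oplaxitor ?u ?v) \<cdot> gen ?a (?u \<odot>\<^bsub>V\<^esub> ?v)))"
    by (simp add: lift_post)
  also have "\<dots> = FA R (A.hat g) \<cdot> (FA R (A.hat f \<otimes>\<^bsub>GA\<^esub> ?I ?Fv) \<cdot> (gen (?a \<odot>\<^bsub>GA\<^esub> ?Fu) ?v \<cdot> gen ?a ?u))"
    by (simp add: gen_gen)
  also have "FA R (A.hat f \<otimes>\<^bsub>GA\<^esub> ?I ?Fv) \<cdot> (gen (?a \<odot>\<^bsub>GA\<^esub> ?Fu) ?v \<cdot> gen ?a ?u) =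
      gen ?b ?v \<cdot> (FA R (A.hat f) \<cdot> gen ?a ?u)"
    using gen_nat[of "A.hat f" ?v] by (intro B.cmp_eq_extend) simp_all
  finally show ?thesis by (simp add: lift_def)
qed

lemma lift_act:
  assumes [simp]: "f \<in> Arr GA" "p \<in> Arr V" "Cod V p = grA f"
  shows "lift (actA f p) = actB (lift f) p"
proof -
  let ?a = "Dom GA f"
  have "A.hat (actA f p) = A.hat f \<cdot>\<^bsub>GA\<^esub> (Ide GA ?a \<otimes>\<^bsub>GA\<^esub> FA F p)"
  proof (rule A.hat_eqI)
    show "(A.hat f \<cdot>\<^bsub>GA\<^esub> (Ide GA ?a \<otimes>\<^bsub>GA\<^esub> FA F p)) \<cdot>\<^bsub>GA\<^esub> (Ide GA (Dom GA (actA f p)) \<otimes>\<^bsub>GA\<^esub> \<eta> (grA (actA f p))) = actA f p"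
      by (simp add: A.ten_cmp_post A.eta_nat A.pure_ten_act A.pure_cmp_act A.hat_eta)
  qed simp_all
  then have "lift (actA f p) = FA R (A.hat f) \<cdot> (FA R (Ide GA ?a \<otimes>\<^bsub>GA\<^esub> FA F p) \<cdot> gen ?a (Dom V p))"
    by (simp add: lift_def R_cmp)
  also have "FA R (Ide GA ?a \<otimes>\<^bsub>GA\<^esub> FA F p) \<cdot> gen ?a (Dom V p) =
    \<rho> ?a (FO F (Cod V p)) \<cdot> ((FA R (Ide GA ?a) \<otimes> FA R (FA F p)) \<cdot> (Ide GB (FO R ?a) \<otimes> s (Dom V p)))"
    unfolding gen_def by (rule B.cmp_eq_extend[OF rho_nat]) simp_all
  also have "\<dots> = actB (gen ?a (Cod V p)) p"
    using s_nat[of p] by (simp add: B.ten_cmp_post B.pure_ten_act B.pure_cmp_act gen_def)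
  finally show ?thesis by (simp add: lift_def B.pure_cmp_act)
qed

lemma gen_left:
  assumes [simp]: "a \<in> Obj GA" "b \<in> Obj GA" "v \<in> Obj V"
  shows "gen (a \<odot>\<^bsub>GA\<^esub> b) v \<cdot> \<rho> a b = \<rho> a (b \<odot>\<^bsub>GA\<^esub> FO F v) \<cdot> (Ide GB (FO R a) \<otimes> gen b v)"
proof -
  let ?I = "Ide GB" and ?Ra = "FO R a" and ?Rb = "FO R b" and ?Fv = "FO F v"
  have "(?I (FO R (a \<odot>\<^bsub>GA\<^esub> b)) \<otimes> s v) \<cdot> (\<rho> a b \<otimes> ?I \<one>) = \<rho> a b \<otimes> s v"
    by (subst B.ten_cmp_post) simp_all
  also have "\<dots> = (\<rho> a b \<otimes> ?I (FO R ?Fv)) \<cdot> (?I (?Ra \<odot> ?Rb) \<otimes> s v)"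
    by (subst B.ten_cmp_post) simp_all
  finally have "gen (a \<odot>\<^bsub>GA\<^esub> b) v \<cdot> \<rho> a b =
     \<rho> (a \<odot>\<^bsub>GA\<^esub> b) ?Fv \<cdot> ((\<rho> a b \<otimes> ?I (FO R ?Fv)) \<cdot> (?I (?Ra \<odot> ?Rb) \<otimes> s v))"
    by (simp add: gen_def)
  also have "\<dots> = \<rho> a (b \<odot>\<^bsub>GA\<^esub> ?Fv) \<cdot> ((?I ?Ra \<otimes> \<rho> b ?Fv) \<cdot> (?I (?Ra \<odot> ?Rb) \<otimes> s v))"
    by (rule B.cmp_eq_extend[OF rho_assoc[symmetric]]) simp_all
  also have "(?I ?Ra \<otimes> \<rho> b ?Fv) \<cdot> (?I (?Ra \<odot> ?Rb) \<otimes> s v) = ?I ?Ra \<otimes> gen b v"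
    using B.ten_cmp_post[of "?I ?Ra" "?I ?Ra" "?I ?Rb \<otimes> s v" "\<rho> b ?Fv"]
    by (simp add: gen_def B.ten_ide[symmetric] del: B.ten_ide)
  finally show ?thesis .
qed

lemma lift_left:
  assumes [simp]: "a \<in> Obj GA" "g \<in> Arr GA"
  shows "lift (Ide GA a \<otimes>\<^bsub>GA\<^esub> g) \<cdot> \<rho> a (Dom GA g) = \<rho> a (Cod GA g) \<cdot> (Ide GB (FO R a) \<otimes> lift g)"
proof -
  let ?b = "Dom GA g" and ?v = "grA g" and ?Fv = "FO F (grA g)"
  have "Ide GA a \<otimes>\<^bsub>GA\<^esub> g = (Ide GA a \<otimes>\<^bsub>GA\<^esub> A.hat g) \<cdot>\<^bsub>GA\<^esub> (Ide GA (a \<odot>\<^bsub>GA\<^esub> ?b) \<otimes>\<^bsub>GA\<^esub> \<eta> ?v)"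
    using A.ten_cmp_post[of "Ide GA a" "Ide GA a" "Ide GA ?b \<otimes>\<^bsub>GA\<^esub> \<eta> ?v" "A.hat g"]
    by (simp add: A.hat_eta A.ten_ide[symmetric] del: A.ten_ide)
  then have "lift (Ide GA a \<otimes>\<^bsub>GA\<^esub> g) \<cdot> \<rho> a ?b =
     FA R (Ide GA a \<otimes>\<^bsub>GA\<^esub> A.hat g) \<cdot> (gen (a \<odot>\<^bsub>GA\<^esub> ?b) ?v \<cdot> \<rho> a ?b)"
    by (simp add: lift_post)
  also have "\<dots> = FA R (Ide GA a \<otimes>\<^bsub>GA\<^esub> A.hat g) \<cdot> (\<rho> a (?b \<odot>\<^bsub>GA\<^esub> ?Fv) \<cdot> (Ide GB (FO R a) \<otimes> gen ?b ?v))"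
    by (simp add: gen_left)
  also have "\<dots> = \<rho> a (Cod GA g) \<cdot> ((FA R (Ide GA a) \<otimes> FA R (A.hat g)) \<cdot> (Ide GB (FO R a) \<otimes> gen ?b ?v))"
    by (rule B.cmp_eq_extend[OF rho_nat]) simp_all
  finally show ?thesis by (simp add: B.ten_cmp_post lift_def)
qed

text \<open>
  On the right of an object \<open>b\<close> the universal arrow is brought into standard position by the half-braiding
  at \<open>b\<close>, so this case needs half-braiding coherence.
\<close>

lemma gen_right:
  assumes [simp]: "a \<in> Obj GA" "b \<in> Obj GA" "u \<in> Obj V"
  shows "FA R (Ide GA a \<otimes>\<^bsub>GA\<^esub> A.hb b u) \<cdot> (gen (a \<odot>\<^bsub>GA\<^esub> b) u \<cdot> \<rho> a b) =
    \<rho> (a \<odot>\<^bsub>GA\<^esub> FO F u) b \<cdot> (gen a u \<otimes> Ide GB (FO R b))"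
proof -
  let ?I = "Ide GB" and ?Ra = "FO R a" and ?Rb = "FO R b" and ?Fu = "FO F u"
  have "FA R (Ide GA a \<otimes>\<^bsub>GA\<^esub> A.hb b u) \<cdot> (\<rho> a (b \<odot>\<^bsub>GA\<^esub> ?Fu) \<cdot> (?I ?Ra \<otimes> gen b u)) =
    \<rho> a (?Fu \<odot>\<^bsub>GA\<^esub> b) \<cdot> ((FA R (Ide GA a) \<otimes> FA R (A.hb b u)) \<cdot> (?I ?Ra \<otimes> gen b u))"
    by (rule B.cmp_eq_extend[OF rho_nat]) simp_all
  also have "\<dots> = \<rho> a (?Fu \<odot>\<^bsub>GA\<^esub> b) \<cdot> (?I ?Ra \<otimes> (\<rho> ?Fu b \<cdot> (s u \<otimes> ?I ?Rb)))"
    using s_hb[of b u] by (simp add: B.ten_cmp_post gen_def)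
  also have "?I ?Ra \<otimes> (\<rho> ?Fu b \<cdot> (s u \<otimes> ?I ?Rb)) = (?I ?Ra \<otimes> \<rho> ?Fu b) \<cdot> (?I ?Ra \<otimes> (s u \<otimes> ?I ?Rb))"
    by (simp add: B.ten_cmp_post)
  also have "\<rho> a (?Fu \<odot>\<^bsub>GA\<^esub> b) \<cdot> \<dots> = \<rho> (a \<odot>\<^bsub>GA\<^esub> ?Fu) b \<cdot> ((\<rho> a ?Fu \<otimes> ?I ?Rb) \<cdot> (?I ?Ra \<otimes> (s u \<otimes> ?I ?Rb)))"
    by (rule B.cmp_eq_extend[OF rho_assoc]) simp_all
  also have "(\<rho> a ?Fu \<otimes> ?I ?Rb) \<cdot> (?I ?Ra \<otimes> (s u \<otimes> ?I ?Rb)) = gen a u \<otimes> ?I ?Rb"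
    using B.ten_cmp_post[of "?I ?Ra \<otimes> s u" "\<rho> a ?Fu" "?I ?Rb" "?I ?Rb"] by (simp add: gen_def)
  finally show ?thesis by (simp add: gen_left)
qed

lemma lift_right:
  assumes [simp]: "f \<in> Arr GA" "b \<in> Obj GA"
  shows "lift (f \<otimes>\<^bsub>GA\<^esub> Ide GA b) \<cdot> \<rho> (Dom GA f) b = \<rho> (Cod GA f) b \<cdot> (lift f \<otimes> Ide GB (FO R b))"
proof -
  let ?a = "Dom GA f" and ?u = "grA f" and ?Fu = "FO F (grA f)"
  have "f \<otimes>\<^bsub>GA\<^esub> Ide GA b = (A.hat f \<cdot>\<^bsub>GA\<^esub> (Ide GA ?a \<otimes>\<^bsub>GA\<^esub> \<eta> ?u)) \<otimes>\<^bsub>GA\<^esub> Ide GA b"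
    by (simp add: A.hat_eta)
  also have "\<dots> = (A.hat f \<otimes>\<^bsub>GA\<^esub> Ide GA b) \<cdot>\<^bsub>GA\<^esub> (Ide GA ?a \<otimes>\<^bsub>GA\<^esub> (\<eta> ?u \<otimes>\<^bsub>GA\<^esub> Ide GA b))"
    using A.ten_cmp_post[of "Ide GA ?a \<otimes>\<^bsub>GA\<^esub> \<eta> ?u" "A.hat f" "Ide GA b" "Ide GA b"] by simp
  also have "Ide GA ?a \<otimes>\<^bsub>GA\<^esub> (\<eta> ?u \<otimes>\<^bsub>GA\<^esub> Ide GA b) =
      (Ide GA ?a \<otimes>\<^bsub>GA\<^esub> A.hb b ?u) \<cdot>\<^bsub>GA\<^esub> (Ide GA (?a \<odot>\<^bsub>GA\<^esub> b) \<otimes>\<^bsub>GA\<^esub> \<eta> ?u)"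
    using A.ten_cmp_post[of "Ide GA ?a" "Ide GA ?a" "Ide GA b \<otimes>\<^bsub>GA\<^esub> \<eta> ?u" "A.hb b ?u"]
    by (simp add: A.ten_ide[symmetric] del: A.ten_ide)
  finally have "lift (f \<otimes>\<^bsub>GA\<^esub> Ide GA b) \<cdot> \<rho> ?a b =
    FA R (A.hat f \<otimes>\<^bsub>GA\<^esub> Ide GA b) \<cdot> (FA R (Ide GA ?a \<otimes>\<^bsub>GA\<^esub> A.hb b ?u) \<cdot> (gen (?a \<odot>\<^bsub>GA\<^esub> b) ?u \<cdot> \<rho> ?a b))"
    by (simp add: lift_post)
  also have "\<dots> = FA R (A.hat f \<otimes>\<^bsub>GA\<^esub> Ide GA b) \<cdot> (\<rho> (?a \<odot>\<^bsub>GA\<^esub> ?Fu) b \<cdot> (gen ?a ?u \<otimes> Ide GB (FO R b)))"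
    by (simp add: gen_right)
  also have "\<dots> = \<rho> (Cod GA f) b \<cdot> ((FA R (A.hat f) \<otimes> FA R (Ide GA b)) \<cdot> (gen ?a ?u \<otimes> Ide GB (FO R b)))"
    by (rule B.cmp_eq_extend[OF rho_nat]) simp_all
  finally show ?thesis by (simp add: B.ten_cmp_post lift_def)
qed

text \<open>
  A product is \<open>f\<close> on the left followed by \<open>g\<close> on the right, without braiding, so the one-sided products
  with an object suffice.
\<close>

lemma lift_ten:
  assumes [simp]: "f \<in> Arr GA" "g \<in> Arr GA"
  shows "lift (f \<otimes>\<^bsub>GA\<^esub> g) \<cdot> \<rho> (Dom GA f) (Dom GA g) = \<rho> (Cod GA f) (Cod GA g) \<cdot> (lift f \<otimes> lift g)"
proof -
  let ?a = "Dom GA f" and ?b = "Dom GA g" and ?c = "Cod GA f" and ?d = "Cod GA g"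
  have "f \<otimes>\<^bsub>GA\<^esub> g = (Ide GA ?c \<otimes>\<^bsub>GA\<^esub> g) \<cdot>\<^bsub>GA\<^esub> (f \<otimes>\<^bsub>GA\<^esub> Ide GA ?b)"
    by (subst A.ten_cmp_post) simp_all
  then have "lift (f \<otimes>\<^bsub>GA\<^esub> g) \<cdot> \<rho> ?a ?b = lift (Ide GA ?c \<otimes>\<^bsub>GA\<^esub> g) \<cdot> (lift (f \<otimes>\<^bsub>GA\<^esub> Ide GA ?b) \<cdot> \<rho> ?a ?b)"
    by (simp add: lift_cmp)
  also have "\<dots> = lift (Ide GA ?c \<otimes>\<^bsub>GA\<^esub> g) \<cdot> (\<rho> ?c ?b \<cdot> (lift f \<otimes> Ide GB (FO R ?b)))"
    by (simp add: lift_right)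
  also have "\<dots> = \<rho> ?c ?d \<cdot> ((Ide GB (FO R ?c) \<otimes> lift g) \<cdot> (lift f \<otimes> Ide GB (FO R ?b)))"
    by (rule B.cmp_eq_extend[OF lift_left]) simp_all
  also have "(Ide GB (FO R ?c) \<otimes> lift g) \<cdot> (lift f \<otimes> Ide GB (FO R ?b)) = lift f \<otimes> lift g"
    by (subst B.ten_cmp_post) simp_all
  finally show ?thesis .
qed

lemma graded_lift:
  "graded_lax_functor V GA grA actA GB grB actB \<lparr>FO = FO R, FA = lift\<rparr> \<rho>"
proof -
  have "cfunctor GA GB \<lparr>FO = FO R, FA = lift\<rparr>"
    by unfold_locales (auto simp: hom_def lift_cmp)
  then show ?thesis
    by (auto simp: graded_lax_functor_def strict_lax_monoidal_functor_def hom_def lift_act lift_ten rho_assoc)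
qed

lemma lift_eta [simp]: "v \<in> Obj V \<Longrightarrow> lift (\<eta> v) = s v"
  using lift_gen[of "\<one>\<^bsub>GA\<^esub>" v] by (simp add: gen_def)

end

text \<open>
  An arrow of grade \<open>v\<close> is \<open>hat f\<close> after \<open>Ide a \<otimes> \<eta> v\<close>, so a graded functor is determined by its
  restriction to the arrows of grade one together with its values on the \<open>\<eta> v\<close>, and naturality
  need only be checked on these.
\<close>

context represented_pair
begin

lemma graded_pure_cell:
  assumes T: "graded_lax_functor V GA grA actA GB grB actB T \<rho>"
    and "\<And>a. a \<in> Obj GA \<Longrightarrow> FO R a = FO T a"
    and "\<And>f. f \<in> Arr GA \<Longrightarrow> grA f = \<one>\<^bsub>V\<^esub> \<Longrightarrow> FA R f = FA T f"
    and "\<And>a b. a \<in> Obj GA \<Longrightarrow> b \<in> Obj GA \<Longrightarrow> \<rho>' a b = \<rho> a b"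
  shows "pure_cell V GA grA actA F \<eta> GB grB actB K \<kappa> R \<rho>' (\<lambda>v. FA T (\<eta> v))"
    and "f \<in> Arr GA \<Longrightarrow> pure_cell.lift V GA grA F \<eta> GB R \<rho>' (\<lambda>v. FA T (\<eta> v)) f = FA T f"
proof -
  note [simp] = assms(2-4)
  have lax: "strict_lax_monoidal_functor GA GB T \<rho>"
    and gr [simp]: "f \<in> Arr GA \<Longrightarrow> grB (FA T f) = grA f"
    and act: "f \<in> Arr GA \<Longrightarrow> p \<in> Arr V \<Longrightarrow> Cod V p = grA f \<Longrightarrow> FA T (actA f p) = actB (FA T f) p"
    and gr' [simp]: "a \<in> Obj GA \<Longrightarrow> b \<in> Obj GA \<Longrightarrow> grB (\<rho> a b) = \<one>\<^bsub>V\<^esub>" for f p a b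
    using T by (auto simp: graded_lax_functor_def)
  interpret T: lax_functor GA GB T \<rho> using lax by (rule lax_functorI)
  have "strict_lax_monoidal_functor A.pure B.pure R \<rho>'"
    unfolding strict_lax_monoidal_functor_def
  proof (intro conjI ballI)
    show "cfunctor A.pure B.pure R"
      by (rule cfunctor.intro[OF A.U.category_axioms B.U.category_axioms], unfold_locales)
         (auto simp: hom_def T.FA_cmp_arr)
  qed (auto simp: hom_def T.lax_nat T.lax_assoc)
  then show cell: "pure_cell V GA grA actA F \<eta> GB grB actB K \<kappa> R \<rho>' (\<lambda>v. FA T (\<eta> v))"
  proof (unfold_locales, goal_cases)
    case (6 p)
    then show ?case by (simp add: A.eta_nat act flip: T.FA_cmp_arr)
  next
    case (8 a v)
    then have [simp]: "a \<in> Obj GA" "v \<in> Obj V" by simp_all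
    have "\<rho> a (FO F v) \<cdot> (Ide GB (FO T a) \<otimes> FA T (\<eta> v)) = FA T (Ide GA a \<otimes>\<^bsub>GA\<^esub> \<eta> v)"
      using T.lax_nat[of "Ide GA a" "\<eta> v", OF _ _ refl refl refl refl] by simp
    moreover have "\<rho> (FO F v) a \<cdot> (FA T (\<eta> v) \<otimes> Ide GB (FO T a)) = FA T (\<eta> v \<otimes>\<^bsub>GA\<^esub> Ide GA a)"
      using T.lax_nat[of "\<eta> v" "Ide GA a", OF _ _ refl refl refl refl] by simp
    ultimately show ?case by (simp flip: T.FA_cmp_arr)
  next
    case (9 u v)
    then show ?case
      using T.lax_nat[of "\<eta> u" "\<eta> v", OF _ _ refl refl refl refl] by (simp flip: T.FA_cmp_arr)
  qed auto
  interpret C: pure_cell V GA grA actA F \<eta> GB grB actB K \<kappa> R \<rho>' "\<lambda>v. FA T (\<eta> v)" by (fact cell)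
  show "C.lift f = FA T f" if [simp]: "f \<in> Arr GA"
  proof -
    have "C.gen (Dom GA f) (grA f) = FA T (Ide GA (Dom GA f) \<otimes>\<^bsub>GA\<^esub> \<eta> (grA f))"
      using T.lax_nat[of "Ide GA (Dom GA f)" "\<eta> (grA f)", OF _ _ refl refl refl refl] by (simp add: C.gen_def)
    then show ?thesis by (simp add: C.lift_def A.hat_eta flip: T.FA_cmp_arr)
  qed
qed

lemma natural_of_pure:
  assumes "pure_cell V GA grA actA F \<eta> GB grB actB K \<kappa> R \<rho> s"
    and "pure_cell V GA grA actA F \<eta> GB grB actB K \<kappa> S \<sigma> t"
    and th: "\<And>a. a \<in> Obj GA \<Longrightarrow> \<theta> a \<in> hom B.pure (FO R a) (FO S a)"
    and nat: "\<And>f. f \<in> Arr GA \<Longrightarrow> grA f = \<one>\<^bsub>V\<^esub> \<Longrightarrow> FA S f \<cdot> \<theta> (Dom GA f) = \<theta> (Cod GA f) \<cdot> FA R f"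
    and mon: "\<And>a b. a \<in> Obj GA \<Longrightarrow> b \<in> Obj GA \<Longrightarrow> \<theta> (a \<odot>\<^bsub>GA\<^esub> b) \<cdot> \<rho> a b = \<sigma> a b \<cdot> (\<theta> a \<otimes> \<theta> b)"
    and st: "\<And>v. v \<in> Obj V \<Longrightarrow> \<theta> (FO F v) \<cdot> s v = t v"
    and f: "f \<in> Arr GA"
  shows "pure_cell.lift V GA grA F \<eta> GB S \<sigma> t f \<cdot> \<theta> (Dom GA f) =
    \<theta> (Cod GA f) \<cdot> pure_cell.lift V GA grA F \<eta> GB R \<rho> s f"
proof -
  interpret R: pure_cell V GA grA actA F \<eta> GB grB actB K \<kappa> R \<rho> s by fact
  interpret S: pure_cell V GA grA actA F \<eta> GB grB actB K \<kappa> S \<sigma> t by fact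
  note [simp] = f
  have [simp]: "\<theta> a \<in> Arr GB" "grB (\<theta> a) = \<one>\<^bsub>V\<^esub>" "Dom GB (\<theta> a) = FO R a" "Cod GB (\<theta> a) = FO S a"
    if "a \<in> Obj GA" for a
    using th[OF that] by (auto simp: hom_def)
  let ?a = "Dom GA f" and ?v = "grA f" and ?I = "Ide GB" and ?Fv = "FO F (grA f)"
  have "(?I (FO S ?a) \<otimes> t ?v) \<cdot> (\<theta> ?a \<otimes> ?I \<one>) = \<theta> ?a \<otimes> (\<theta> ?Fv \<cdot> s ?v)"
    by (subst B.ten_cmp_post) (simp_all add: st)
  also have "\<dots> = (\<theta> ?a \<otimes> \<theta> ?Fv) \<cdot> (?I (FO R ?a) \<otimes> s ?v)"
    by (subst B.ten_cmp_post) simp_all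
  finally have "S.gen ?a ?v \<cdot> \<theta> ?a = \<sigma> ?a ?Fv \<cdot> ((\<theta> ?a \<otimes> \<theta> ?Fv) \<cdot> (?I (FO R ?a) \<otimes> s ?v))"
    by (simp add: S.gen_def)
  also have "\<dots> = \<theta> (?a \<odot>\<^bsub>GA\<^esub> ?Fv) \<cdot> R.gen ?a ?v"
    unfolding R.gen_def by (rule B.cmp_eq_extend[OF mon[symmetric]]) simp_all
  finally have "S.lift f \<cdot> \<theta> ?a = FA S (A.hat f) \<cdot> (\<theta> (?a \<odot>\<^bsub>GA\<^esub> ?Fv) \<cdot> R.gen ?a ?v)"
    by (simp add: S.lift_def)
  also have "\<dots> = \<theta> (Cod GA f) \<cdot> (FA R (A.hat f) \<cdot> R.gen ?a ?v)"
    using nat[of "A.hat f"] by (intro B.cmp_eq_extend) simp_all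
  finally show ?thesis by (simp add: R.lift_def)
qed

end

lemma (in represented_graded) models_data:
  assumes "models X"
  shows "mtCat X = pure" "mtF X = F"
    "a \<in> Obj G \<Longrightarrow> v \<in> Obj V \<Longrightarrow> mt_hb X a v = hb a v"
    "u \<in> Obj V \<Longrightarrow> v \<in> Obj V \<Longrightarrow> mt_mu X u v = oplaxitor u v"
  using assms by (simp_all add: models_def mt_hb_def mt_mu_def central_obj_def)

context represented_pair
begin

text \<open>
  By universality of \<open>\<kappa> v\<close>, the coherence \<open>r v\<close> and its composite with \<open>\<kappa> v\<close> determine each other, and so do
  the corresponding forms of the coherence laws.
\<close>

lemma pure_cell_of_1cell:
  assumes "A.models X" "B.models Y" "modtens_object V X" "modtens_object V Y" "modtens_1cell V X Y R"
  shows "pure_cell V GA grA actA F \<eta> GB grB actB K \<kappa> (mtR R) (mtLax R) (\<lambda>v. mtCoh R v \<cdot> \<kappa> v)"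
proof -
  interpret R: modtens_arrow V X Y R by (rule modtens_arrowI[OF assms(3-5)])
  note X = A.models_data[OF assms(1)] and Y = B.models_data[OF assms(2)]
  have r [simp]: "R.r v \<in> Arr GB" "grB (R.r v) = \<one>\<^bsub>V\<^esub>" "Dom GB (R.r v) = FO K v" "Cod GB (R.r v) = FO (mtR R) (FO F v)"
    if "v \<in> Obj V" for v
    using R.r_arr[OF that] by (simp_all add: X(1,2) Y(1,2))
  have R0 [simp]: "R.R0 a \<in> Obj GB" if "a \<in> Obj GA" for a
    using R.FO_obj[of a] that by (simp add: X(1) Y(1))
  have RA [simp]: "R.RA f \<in> Arr GB" "grB (R.RA f) = \<one>\<^bsub>V\<^esub>" "Dom GB (R.RA f) = R.R0 (Dom GA f)"
    "Cod GB (R.RA f) = R.R0 (Cod GA f)" if "f \<in> Arr GA" "grA f = \<one>\<^bsub>V\<^esub>" for f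
    using R.FA_arr[of f] that by (simp_all add: X(1) Y(1))
  have rho [simp]: "R.\<rho> a b \<in> Arr GB" "grB (R.\<rho> a b) = \<one>\<^bsub>V\<^esub>" "Dom GB (R.\<rho> a b) = R.R0 a \<odot> R.R0 b"
    "Cod GB (R.\<rho> a b) = R.R0 (a \<odot>\<^bsub>GA\<^esub> b)" if "a \<in> Obj GA" "b \<in> Obj GA" for a b
    using R.lax_arr[of a b] that by (simp_all add: X(1) Y(1))
  show ?thesis
  proof (unfold_locales, goal_cases)
    case 1 show ?case using R.lax by (simp add: X Y)
  next
    case (6 p)
    then have [simp]: "p \<in> Arr V" .
    have "R.RA (FA F p) \<cdot> (R.r (Dom V p) \<cdot> \<kappa> (Dom V p)) = R.r (Cod V p) \<cdot> (FA K p \<cdot> \<kappa> (Dom V p))"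
      by (rule B.cmp_eq_extend) (use R.r_nat[of p, OF _ refl refl] in \<open>simp_all add: X Y\<close>)
    then show ?case by (simp add: B.eta_nat B.pure_cmp_act)
  next
    case 7 show ?case using R.r_one by (simp add: Y)
  next
    case (8 a v)
    then have [simp]: "a \<in> Obj GA" "v \<in> Obj V" .
    let ?b = "R.R0 a" and ?I = "Ide GB"
    have hb: "R.\<rho> (FO F v) a \<cdot> ((R.r v \<otimes> ?I ?b) \<cdot> B.hb ?b v) = R.RA (A.hb a v) \<cdot> (R.\<rho> a (FO F v) \<cdot> (?I ?b \<otimes> R.r v))"
      using R.r_hb[of a v] by (simp add: X Y)
    have "R.RA (A.hb a v) \<cdot> (R.\<rho> a (FO F v) \<cdot> (?I ?b \<otimes> (R.r v \<cdot> \<kappa> v))) =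
      (R.RA (A.hb a v) \<cdot> (R.\<rho> a (FO F v) \<cdot> (?I ?b \<otimes> R.r v))) \<cdot> (?I ?b \<otimes> \<kappa> v)"
      by (simp add: B.ten_cmp_post)
    also have "\<dots> = R.\<rho> (FO F v) a \<cdot> ((R.r v \<otimes> ?I ?b) \<cdot> (\<kappa> v \<otimes> ?I ?b))"
      by (simp flip: hb)
    finally show ?case by (simp add: B.ten_cmp_post)
  next
    case (9 u v)
    then have [simp]: "u \<in> Obj V" "v \<in> Obj V" .
    have mu: "R.RA (A.oplaxitor u v) \<cdot> R.r (u \<odot>\<^bsub>V\<^esub> v) = R.\<rho> (FO F u) (FO F v) \<cdot> ((R.r u \<otimes> R.r v) \<cdot> B.oplaxitor u v)"
      using R.r_mu[of u v] by (simp add: X Y)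
    have "R.RA (A.oplaxitor u v) \<cdot> (R.r (u \<odot>\<^bsub>V\<^esub> v) \<cdot> \<kappa> (u \<odot>\<^bsub>V\<^esub> v)) =
       (R.\<rho> (FO F u) (FO F v) \<cdot> ((R.r u \<otimes> R.r v) \<cdot> B.oplaxitor u v)) \<cdot> \<kappa> (u \<odot>\<^bsub>V\<^esub> v)"
      by (rule B.cmp_eq_extend1[OF mu]) simp_all
    then show ?case by (simp add: B.ten_cmp_post)
  qed simp_all
qed

lemma modtens_1cell_of_pure_cell:
  assumes "A.models X" "B.models Y" "modtens_object V X" "modtens_object V Y"
    and cell: "pure_cell V GA grA actA F \<eta> GB grB actB K \<kappa> (mtR R) (mtLax R) s"
    and ext: "FO (mtR R) \<in> extensional (Obj GA)" "FA (mtR R) \<in> extensional (Arr A.pure)"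
      "mtLax R \<in> extensional (Obj GA)" "\<And>a. a \<in> Obj GA \<Longrightarrow> mtLax R a \<in> extensional (Obj GA)"
      "mtCoh R \<in> extensional (Obj V)"
    and r: "\<And>v. v \<in> Obj V \<Longrightarrow> mtCoh R v = B.hat (s v)"
  shows "modtens_1cell V X Y R"
proof -
  interpret C: pure_cell V GA grA actA F \<eta> GB grB actB K \<kappa> "mtR R" "mtLax R" s by fact
  note X = A.models_data[OF assms(1)] and Y = B.models_data[OF assms(2)]
  have s [simp]: "B.hat (s v) \<cdot> \<kappa> v = s v" if "v \<in> Obj V" for v
    using B.hat_eta[of "s v"] that by simp
  show ?thesis
  proof (rule modtens_1cellI[OF assms(3,4)], goal_cases)
    case (8 p)
    then have [simp]: "p \<in> Arr V" .
    have "FA (mtR R) (FA F p) \<cdot> B.hat (s (Dom V p)) = B.hat (s (Cod V p)) \<cdot> FA K p"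
    proof (rule B.eta_unique[of "Dom V p"])
      show "(FA (mtR R) (FA F p) \<cdot> B.hat (s (Dom V p))) \<cdot> \<kappa> (Dom V p) = (B.hat (s (Cod V p)) \<cdot> FA K p) \<cdot> \<kappa> (Dom V p)"
        by (simp add: C.s_nat B.eta_nat B.pure_cmp_act)
    qed simp_all
    then show ?case by (simp add: X Y r)
  next
    case (10 a v)
    then have [simp]: "a \<in> Obj GA" "v \<in> Obj V" by (simp_all add: X)
    let ?b = "FO (mtR R) a" and ?I = "Ide GB" and ?\<rho> = "mtLax R"
    have "?\<rho> (FO F v) a \<cdot> ((B.hat (s v) \<otimes> ?I ?b) \<cdot> B.hb ?b v) = FA (mtR R) (A.hb a v) \<cdot> (?\<rho> a (FO F v) \<cdot> (?I ?b \<otimes> B.hat (s v)))"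
      by (rule B.whisker_eta_unique[of ?b v]) (simp_all add: B.ten_cmp_post C.s_hb)
    then show ?case by (simp add: X Y r)
  next
    case (11 u v)
    then have [simp]: "u \<in> Obj V" "v \<in> Obj V" .
    have "FA (mtR R) (A.oplaxitor u v) \<cdot> B.hat (s (u \<odot>\<^bsub>V\<^esub> v)) =
      mtLax R (FO F u) (FO F v) \<cdot> ((B.hat (s u) \<otimes> B.hat (s v)) \<cdot> B.oplaxitor u v)"
      by (rule B.eta_unique[of "u \<odot>\<^bsub>V\<^esub> v"]) (simp_all add: B.ten_cmp_post C.s_mu)
    then show ?case by (simp add: X Y r)
  qed (use ext C.R_lax in \<open>simp_all add: X Y r hom_def\<close>)
qed

end

section \<open>Enriched monoidal categories as graded monoidal categories\<close>

text \<open>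
  A morphism \<open>v \<rightarrow> A(a \<rightarrow> b)\<close> of \<open>V\<close> is an arrow \<open>a \<rightarrow> b\<close> of grade \<open>v\<close>.  Composition and product are
  those of the underlying category, whose formulas make sense in all grades.
\<close>

definition graded_cat ::
  "('v, 'm) braided_moncat \<Rightarrow> ('a, 'v, 'm) vmoncat \<Rightarrow> ('a, ('a, 'm, 'h) uarr) moncat"
where
  "graded_cat V A = (underlying V A)
     \<lparr>Arr := {Elt a b f | a b f. a \<in> vObj A \<and> b \<in> vObj A \<and> f \<in> Arr V \<and> Cod V f = vHom A a b}\<rparr>"

definition grade :: "('v, 'm) braided_moncat \<Rightarrow> ('a, 'm, 'h) uarr \<Rightarrow> 'v" where
  "grade V f = Dom V (uelt f)"

definition regrade :: "('v, 'm) braided_moncat \<Rightarrow> ('a, 'm, 'h) uarr \<Rightarrow> 'm \<Rightarrow> ('a, 'm, 'h) uarr" where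
  "regrade V f p = Elt (usrc f) (utgt f) (uelt f \<cdot>\<^bsub>V\<^esub> p)"

lemma graded_cat_simps [simp]:
  "Obj (graded_cat V A) = vObj A"
  "Dom (graded_cat V A) = usrc" "Cod (graded_cat V A) = utgt"
  "Ide (graded_cat V A) a = Elt a a (vId A a)"
  "g \<cdot>\<^bsub>graded_cat V A\<^esub> f = Elt (usrc f) (utgt g) (vCmp A (usrc f) (utgt f) (utgt g) \<cdot>\<^bsub>V\<^esub> (uelt f \<otimes>\<^bsub>V\<^esub> uelt g))"
  "\<one>\<^bsub>graded_cat V A\<^esub> = vUnit A"
  "a \<odot>\<^bsub>graded_cat V A\<^esub> b = vTenO A a b"
  "f \<otimes>\<^bsub>graded_cat V A\<^esub> g = Elt (vTenO A (usrc f) (usrc g)) (vTenO A (utgt f) (utgt g))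
     (vTenM A (usrc f) (utgt f) (usrc g) (utgt g) \<cdot>\<^bsub>V\<^esub> (uelt f \<otimes>\<^bsub>V\<^esub> uelt g))"
  "Elt a b k \<in> Arr (graded_cat V A) \<longleftrightarrow> a \<in> vObj A \<and> b \<in> vObj A \<and> k \<in> Arr V \<and> Cod V k = vHom A a b"
  by (auto simp: graded_cat_def underlying_def ucmp_def uten_def)

lemma Arr_graded_catE:
  assumes "f \<in> Arr (graded_cat V A)"
  obtains a b k where "f = Elt a b k" "a \<in> vObj A" "b \<in> vObj A" "k \<in> Arr V" "Cod V k = vHom A a b"
  using assms by (auto simp: graded_cat_def)

lemma grade_simps [simp]:
  "grade V (Elt a b k) = Dom V k" "regrade V (Elt a b k) p = Elt a b (k \<cdot>\<^bsub>V\<^esub> p)"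
  by (simp_all add: grade_def regrade_def)

lemma pure_graded_cat:
  "(graded_cat V A)\<lparr>Arr := {f \<in> Arr (graded_cat V A). grade V f = \<one>\<^bsub>V\<^esub>}\<rparr> = underlying V A"
  by (auto simp: graded_cat_def underlying_def grade_def hom_def)

locale enriched = V: braided_monoidal_category V + enriched_monoidal_category V A
  for V :: "('v, 'm) braided_moncat" and A :: "('a, 'v, 'm) vmoncat"
begin

lemmas vObj_simps [simp] = vHom_in vUnit_in vTenO_in vTenO_assoc vTenO_unit

lemma vId_arr [simp]:
  assumes "a \<in> vObj A"
  shows "vId A a \<in> Arr V" "Dom V (vId A a) = \<one>\<^bsub>V\<^esub>" "Cod V (vId A a) = vHom A a a"
  using vId_in[OF assms] by (auto simp: hom_def)

lemma vCmp_arr [simp]: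
  assumes "a \<in> vObj A" "b \<in> vObj A" "c \<in> vObj A"
  shows "vCmp A a b c \<in> Arr V" "Dom V (vCmp A a b c) = vHom A a b \<odot>\<^bsub>V\<^esub> vHom A b c"
    "Cod V (vCmp A a b c) = vHom A a c"
  using vCmp_in[OF assms] by (auto simp: hom_def)

lemma vTenM_arr [simp]:
  assumes "a \<in> vObj A" "b \<in> vObj A" "c \<in> vObj A" "d \<in> vObj A"
  shows "vTenM A a c b d \<in> Arr V" "Dom V (vTenM A a c b d) = vHom A a c \<odot>\<^bsub>V\<^esub> vHom A b d"
    "Cod V (vTenM A a c b d) = vHom A (vTenO A a b) (vTenO A c d)"
  using vTenM_in[OF assms] by (auto simp: hom_def)

lemma vCmp_ten_left:
  assumes "k \<in> Arr V" "l \<in> Arr V" "h \<in> Arr V" "Cod V k = Dom V l"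
  shows "(l \<cdot>\<^bsub>V\<^esub> k) \<otimes>\<^bsub>V\<^esub> h = (l \<otimes>\<^bsub>V\<^esub> Ide V (Cod V h)) \<cdot>\<^bsub>V\<^esub> (k \<otimes>\<^bsub>V\<^esub> h)"
    "h \<otimes>\<^bsub>V\<^esub> (l \<cdot>\<^bsub>V\<^esub> k) = (Ide V (Cod V h) \<otimes>\<^bsub>V\<^esub> l) \<cdot>\<^bsub>V\<^esub> (h \<otimes>\<^bsub>V\<^esub> k)"
  using assms by (simp_all add: V.ten_cmp)

lemma category_graded: "category (graded_cat V A :: ('a, ('a, 'm, 'h) uarr) moncat)"
proof (unfold_locales, goal_cases)
  case (4 f a b g c)
  then show ?case by (auto simp: hom_def elim!: Arr_graded_catE)
next
  case (5 f a b)
  then obtain k where [simp]: "f = Elt a b k" "a \<in> vObj A" "b \<in> vObj A" "k \<in> Arr V" "Cod V k = vHom A a b"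
    by (auto simp: hom_def elim!: Arr_graded_catE)
  have "vCmp A a a b \<cdot>\<^bsub>V\<^esub> (vId A a \<otimes>\<^bsub>V\<^esub> k) = (vCmp A a a b \<cdot>\<^bsub>V\<^esub> (vId A a \<otimes>\<^bsub>V\<^esub> Ide V (vHom A a b))) \<cdot>\<^bsub>V\<^esub> k"
    using V.ten_cmp[of "Ide V \<one>\<^bsub>V\<^esub>" k "vId A a" "Ide V (vHom A a b)"] by simp
  then show ?case by (simp add: vId_vCmp)
next
  case (6 f a b)
  then obtain k where [simp]: "f = Elt a b k" "a \<in> vObj A" "b \<in> vObj A" "k \<in> Arr V" "Cod V k = vHom A a b"
    by (auto simp: hom_def elim!: Arr_graded_catE)
  have "vCmp A a b b \<cdot>\<^bsub>V\<^esub> (k \<otimes>\<^bsub>V\<^esub> vId A b) = (vCmp A a b b \<cdot>\<^bsub>V\<^esub> (Ide V (vHom A a b) \<otimes>\<^bsub>V\<^esub> vId A b)) \<cdot>\<^bsub>V\<^esub> k"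
    using V.ten_cmp[of k "Ide V \<one>\<^bsub>V\<^esub>" "Ide V (vHom A a b)" "vId A b"] by simp
  then show ?case by (simp add: vCmp_vId)
next
  case (7 f a b g c h d)
  then obtain k l m where [simp]: "f = Elt a b k" "g = Elt b c l" "h = Elt c d m" "a \<in> vObj A" "b \<in> vObj A"
    "c \<in> vObj A" "d \<in> vObj A" "k \<in> Arr V" "Cod V k = vHom A a b" "l \<in> Arr V" "Cod V l = vHom A b c"
    "m \<in> Arr V" "Cod V m = vHom A c d"
    by (auto simp: hom_def elim!: Arr_graded_catE)
  have "vCmp A a b d \<cdot>\<^bsub>V\<^esub> (k \<otimes>\<^bsub>V\<^esub> (vCmp A b c d \<cdot>\<^bsub>V\<^esub> (l \<otimes>\<^bsub>V\<^esub> m))) =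
    vCmp A a b d \<cdot>\<^bsub>V\<^esub> ((Ide V (vHom A a b) \<otimes>\<^bsub>V\<^esub> vCmp A b c d) \<cdot>\<^bsub>V\<^esub> (k \<otimes>\<^bsub>V\<^esub> (l \<otimes>\<^bsub>V\<^esub> m)))"
    by (simp add: vCmp_ten_left)
  also have "\<dots> = vCmp A a c d \<cdot>\<^bsub>V\<^esub> ((vCmp A a b c \<otimes>\<^bsub>V\<^esub> Ide V (vHom A c d)) \<cdot>\<^bsub>V\<^esub> (k \<otimes>\<^bsub>V\<^esub> (l \<otimes>\<^bsub>V\<^esub> m)))"
    by (rule V.cmp_eq_extend[OF vCmp_assoc[symmetric]]) simp_all
  also have "\<dots> = vCmp A a c d \<cdot>\<^bsub>V\<^esub> ((vCmp A a b c \<cdot>\<^bsub>V\<^esub> (k \<otimes>\<^bsub>V\<^esub> l)) \<otimes>\<^bsub>V\<^esub> m)"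
    using vCmp_ten_left(1)[of "k \<otimes>\<^bsub>V\<^esub> l" "vCmp A a b c" m] by simp
  finally show ?case by simp
qed (auto simp: hom_def elim!: Arr_graded_catE)

text \<open>
  Each law is the law of the enriched category precomposed with a product of the given morphisms of \<open>V\<close>.
  In the interchange law these morphisms must in addition be moved past the braiding.
\<close>

lemma graded_monoidal: "graded_monoidal V (graded_cat V A :: ('a, ('a, 'm, 'h) uarr) moncat) (grade V) (regrade V)"
proof (rule graded_monoidal.intro[OF V.braided_monoidal_category_axioms category_graded], unfold_locales, goal_cases)
  case (14 f p q)
  then show ?case by (auto elim!: Arr_graded_catE)
next
  case (15 f g p q)
  then show ?case by (auto elim!: Arr_graded_catE simp: V.ten_cmp)
next
  case (20 f g p q)
  then show ?case by (auto elim!: Arr_graded_catE simp: V.ten_cmp)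
next
  case (21 a b)
  then show ?case by (simp add: vTenM_vId)
next
  case (22 f g h)
  then obtain a a' k b b' l c c' m where [simp]: "f = Elt a a' k" "g = Elt b b' l" "h = Elt c c' m"
    "a \<in> vObj A" "b \<in> vObj A" "c \<in> vObj A" "a' \<in> vObj A" "b' \<in> vObj A" "c' \<in> vObj A"
    "k \<in> Arr V" "Cod V k = vHom A a a'" "l \<in> Arr V" "Cod V l = vHom A b b'" "m \<in> Arr V" "Cod V m = vHom A c c'"
    by (auto elim!: Arr_graded_catE)
  have "vTenM A a a' (vTenO A b c) (vTenO A b' c') \<cdot>\<^bsub>V\<^esub> (k \<otimes>\<^bsub>V\<^esub> (vTenM A b b' c c' \<cdot>\<^bsub>V\<^esub> (l \<otimes>\<^bsub>V\<^esub> m))) =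
    vTenM A a a' (vTenO A b c) (vTenO A b' c') \<cdot>\<^bsub>V\<^esub> ((Ide V (vHom A a a') \<otimes>\<^bsub>V\<^esub> vTenM A b b' c c') \<cdot>\<^bsub>V\<^esub> (k \<otimes>\<^bsub>V\<^esub> (l \<otimes>\<^bsub>V\<^esub> m)))"
    by (simp add: vCmp_ten_left)
  also have "\<dots> = vTenM A (vTenO A a b) (vTenO A a' b') c c' \<cdot>\<^bsub>V\<^esub> ((vTenM A a a' b b' \<otimes>\<^bsub>V\<^esub> Ide V (vHom A c c')) \<cdot>\<^bsub>V\<^esub> (k \<otimes>\<^bsub>V\<^esub> (l \<otimes>\<^bsub>V\<^esub> m)))"
    by (rule V.cmp_eq_extend[OF vTenM_assoc[symmetric]]) simp_all
  also have "\<dots> = vTenM A (vTenO A a b) (vTenO A a' b') c c' \<cdot>\<^bsub>V\<^esub> ((vTenM A a a' b b' \<cdot>\<^bsub>V\<^esub> (k \<otimes>\<^bsub>V\<^esub> l)) \<otimes>\<^bsub>V\<^esub> m)"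
    using vCmp_ten_left(1)[of "k \<otimes>\<^bsub>V\<^esub> l" "vTenM A a a' b b'" m] by simp
  finally show ?case by simp
next
  case (23 f)
  then obtain a b k where [simp]: "f = Elt a b k" "a \<in> vObj A" "b \<in> vObj A" "k \<in> Arr V" "Cod V k = vHom A a b"
    by (auto elim!: Arr_graded_catE)
  let ?t = "vTenM A (vUnit A) (vUnit A) a b"
  have "?t \<cdot>\<^bsub>V\<^esub> (vId A (vUnit A) \<otimes>\<^bsub>V\<^esub> k) = (?t \<cdot>\<^bsub>V\<^esub> (vId A (vUnit A) \<otimes>\<^bsub>V\<^esub> Ide V (vHom A a b))) \<cdot>\<^bsub>V\<^esub> k"
    using V.ten_cmp[of "Ide V \<one>\<^bsub>V\<^esub>" k "vId A (vUnit A)" "Ide V (vHom A a b)"] by simp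
  then show ?case by (simp add: vTenM_unit)
next
  case (24 f)
  then obtain a b k where [simp]: "f = Elt a b k" "a \<in> vObj A" "b \<in> vObj A" "k \<in> Arr V" "Cod V k = vHom A a b"
    by (auto elim!: Arr_graded_catE)
  let ?t = "vTenM A a b (vUnit A) (vUnit A)"
  have "?t \<cdot>\<^bsub>V\<^esub> (k \<otimes>\<^bsub>V\<^esub> vId A (vUnit A)) = (?t \<cdot>\<^bsub>V\<^esub> (Ide V (vHom A a b) \<otimes>\<^bsub>V\<^esub> vId A (vUnit A))) \<cdot>\<^bsub>V\<^esub> k"
    using V.ten_cmp[of k "Ide V \<one>\<^bsub>V\<^esub>" "Ide V (vHom A a b)" "vId A (vUnit A)"] by simp
  then show ?case by (simp add: vTenM_unit)
next
  case (25 f f' g g')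
  then obtain a b k c k' d e l x l' where [simp]: "f = Elt a b k" "f' = Elt b c k'" "g = Elt d e l" "g' = Elt e x l'"
    "a \<in> vObj A" "b \<in> vObj A" "c \<in> vObj A" "d \<in> vObj A" "e \<in> vObj A" "x \<in> vObj A"
    "k \<in> Arr V" "Cod V k = vHom A a b" "k' \<in> Arr V" "Cod V k' = vHom A b c"
    "l \<in> Arr V" "Cod V l = vHom A d e" "l' \<in> Arr V" "Cod V l' = vHom A e x"
    by (auto elim!: Arr_graded_catE)
  let ?I = "Ide V" and ?C = "vCmp A (vTenO A a d) (vTenO A b e) (vTenO A c x)" and ?T = "vTenM A a c d x"
  let ?\<beta> = "?I (vHom A a b) \<otimes>\<^bsub>V\<^esub> (Braid V (vHom A d e) (vHom A b c) \<otimes>\<^bsub>V\<^esub> ?I (vHom A e x))"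
  let ?\<beta>' = "?I (Dom V k) \<otimes>\<^bsub>V\<^esub> (Braid V (Dom V l) (Dom V k') \<otimes>\<^bsub>V\<^esub> ?I (Dom V l'))"
  have nat: "Braid V (vHom A d e) (vHom A b c) \<cdot>\<^bsub>V\<^esub> (l \<otimes>\<^bsub>V\<^esub> k') = (k' \<otimes>\<^bsub>V\<^esub> l) \<cdot>\<^bsub>V\<^esub> Braid V (Dom V l) (Dom V k')"
    by (rule V.braid_nat) (auto simp: hom_def)
  have "?\<beta> \<cdot>\<^bsub>V\<^esub> (k \<otimes>\<^bsub>V\<^esub> ((l \<otimes>\<^bsub>V\<^esub> k') \<otimes>\<^bsub>V\<^esub> l')) = k \<otimes>\<^bsub>V\<^esub> (((k' \<otimes>\<^bsub>V\<^esub> l) \<cdot>\<^bsub>V\<^esub> Braid V (Dom V l) (Dom V k')) \<otimes>\<^bsub>V\<^esub> l')"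
    by (simp add: V.ten_cmp nat del: V.tenM_assoc_arr)
  also have "\<dots> = (k \<otimes>\<^bsub>V\<^esub> ((k' \<otimes>\<^bsub>V\<^esub> l) \<otimes>\<^bsub>V\<^esub> l')) \<cdot>\<^bsub>V\<^esub> ?\<beta>'"
    by (simp add: V.ten_cmp del: V.tenM_assoc_arr)
  finally have \<beta>: "?\<beta> \<cdot>\<^bsub>V\<^esub> (k \<otimes>\<^bsub>V\<^esub> (l \<otimes>\<^bsub>V\<^esub> (k' \<otimes>\<^bsub>V\<^esub> l'))) = (k \<otimes>\<^bsub>V\<^esub> (k' \<otimes>\<^bsub>V\<^esub> (l \<otimes>\<^bsub>V\<^esub> l'))) \<cdot>\<^bsub>V\<^esub> ?\<beta>'"
    by simp
  have ic: "?C \<cdot>\<^bsub>V\<^esub> (vTenM A a b d e \<otimes>\<^bsub>V\<^esub> vTenM A b c e x) = ?T \<cdot>\<^bsub>V\<^esub> ((vCmp A a b c \<otimes>\<^bsub>V\<^esub> vCmp A d e x) \<cdot>\<^bsub>V\<^esub> ?\<beta>)"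
    using interchange[of a b c d e x] by simp
  have "?C \<cdot>\<^bsub>V\<^esub> ((vTenM A a b d e \<cdot>\<^bsub>V\<^esub> (k \<otimes>\<^bsub>V\<^esub> l)) \<otimes>\<^bsub>V\<^esub> (vTenM A b c e x \<cdot>\<^bsub>V\<^esub> (k' \<otimes>\<^bsub>V\<^esub> l'))) =
     ?C \<cdot>\<^bsub>V\<^esub> ((vTenM A a b d e \<otimes>\<^bsub>V\<^esub> vTenM A b c e x) \<cdot>\<^bsub>V\<^esub> (k \<otimes>\<^bsub>V\<^esub> (l \<otimes>\<^bsub>V\<^esub> (k' \<otimes>\<^bsub>V\<^esub> l'))))"
    using V.ten_cmp[of "k \<otimes>\<^bsub>V\<^esub> l" "k' \<otimes>\<^bsub>V\<^esub> l'" "vTenM A a b d e" "vTenM A b c e x"] by simp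
  also have "\<dots> = ?T \<cdot>\<^bsub>V\<^esub> (((vCmp A a b c \<otimes>\<^bsub>V\<^esub> vCmp A d e x) \<cdot>\<^bsub>V\<^esub> ?\<beta>) \<cdot>\<^bsub>V\<^esub> (k \<otimes>\<^bsub>V\<^esub> (l \<otimes>\<^bsub>V\<^esub> (k' \<otimes>\<^bsub>V\<^esub> l'))))"
    by (rule V.cmp_eq_extend[OF ic]) simp_all
  also have "\<dots> = ?T \<cdot>\<^bsub>V\<^esub> ((vCmp A a b c \<otimes>\<^bsub>V\<^esub> vCmp A d e x) \<cdot>\<^bsub>V\<^esub> ((k \<otimes>\<^bsub>V\<^esub> (k' \<otimes>\<^bsub>V\<^esub> (l \<otimes>\<^bsub>V\<^esub> l'))) \<cdot>\<^bsub>V\<^esub> ?\<beta>'))"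
    by (simp add: \<beta>)
  also have "\<dots> = ?T \<cdot>\<^bsub>V\<^esub> (((vCmp A a b c \<cdot>\<^bsub>V\<^esub> (k \<otimes>\<^bsub>V\<^esub> k')) \<otimes>\<^bsub>V\<^esub> (vCmp A d e x \<cdot>\<^bsub>V\<^esub> (l \<otimes>\<^bsub>V\<^esub> l'))) \<cdot>\<^bsub>V\<^esub> ?\<beta>')"
    using V.ten_cmp_extend[of "k \<otimes>\<^bsub>V\<^esub> k'" "l \<otimes>\<^bsub>V\<^esub> l'" "vCmp A a b c" "vCmp A d e x" ?\<beta>'] by simp
  finally show ?case by simp
qed (auto elim!: Arr_graded_catE)

end

lemma adjunction_universal:
  assumes "adjunction C D F G \<eta> \<epsilon>" "c \<in> Obj C" "d \<in> Obj D" "f \<in> hom C c (FO G d)"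
  shows "\<exists>!g. g \<in> hom D (FO F c) d \<and> FA G g \<cdot>\<^bsub>C\<^esub> \<eta> c = f"
proof -
  interpret adjunction C D F G \<eta> \<epsilon> by fact
  note [simp] = assms(2,3)
  have [simp]: "f \<in> Arr C" "Dom C f = c" "Cod C f = FO G d" using assms(4) by (auto simp: hom_def)
  have eta [simp]: "\<eta> x \<in> Arr C" "Dom C (\<eta> x) = x" "Cod C (\<eta> x) = FO G (FO F x)" if "x \<in> Obj C" for x
    using unit_nat that by (auto simp: nat_trans_def fid_def fcomp_def hom_def)
  have eps [simp]: "\<epsilon> x \<in> Arr D" "Dom D (\<epsilon> x) = FO F (FO G x)" "Cod D (\<epsilon> x) = x" if "x \<in> Obj D" for x
    using counit_nat that by (auto simp: nat_trans_def fid_def fcomp_def hom_def)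
  have eta_nat: "FA G (FA F k) \<cdot>\<^bsub>C\<^esub> \<eta> (Dom C k) = \<eta> (Cod C k) \<cdot>\<^bsub>C\<^esub> k" if "k \<in> Arr C" for k
    using unit_nat that by (auto simp: nat_trans_def fid_def fcomp_def)
  have eps_nat: "k \<cdot>\<^bsub>D\<^esub> \<epsilon> (Dom D k) = \<epsilon> (Cod D k) \<cdot>\<^bsub>D\<^esub> FA F (FA G k)" if "k \<in> Arr D" for k
    using counit_nat that by (auto simp: nat_trans_def fid_def fcomp_def)
  show ?thesis
  proof (rule ex1I[of _ "\<epsilon> d \<cdot>\<^bsub>D\<^esub> FA F f"])
    have "FA G (\<epsilon> d) \<cdot>\<^bsub>C\<^esub> (FA G (FA F f) \<cdot>\<^bsub>C\<^esub> \<eta> c) = FA G (\<epsilon> d) \<cdot>\<^bsub>C\<^esub> (\<eta> (FO G d) \<cdot>\<^bsub>C\<^esub> f)"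
      using eta_nat[of f] by simp
    also have "\<dots> = f"
      by (subst F.C.cmp_eq_extend1[OF triangle_right]) simp_all
    finally show "\<epsilon> d \<cdot>\<^bsub>D\<^esub> FA F f \<in> hom D (FO F c) d \<and> FA G (\<epsilon> d \<cdot>\<^bsub>D\<^esub> FA F f) \<cdot>\<^bsub>C\<^esub> \<eta> c = f"
      by (simp add: G.FA_cmp_arr hom_def)
  next
    fix g assume g: "g \<in> hom D (FO F c) d \<and> FA G g \<cdot>\<^bsub>C\<^esub> \<eta> c = f"
    then have [simp]: "g \<in> Arr D" "Dom D g = FO F c" "Cod D g = d" by (auto simp: hom_def)
    have "\<epsilon> d \<cdot>\<^bsub>D\<^esub> FA F f = \<epsilon> d \<cdot>\<^bsub>D\<^esub> (FA F (FA G g) \<cdot>\<^bsub>D\<^esub> FA F (\<eta> c))"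
      using g by (simp flip: F.FA_cmp_arr)
    also have "\<dots> = g \<cdot>\<^bsub>D\<^esub> (\<epsilon> (FO F c) \<cdot>\<^bsub>D\<^esub> FA F (\<eta> c))"
      using eps_nat[of g] by (intro F.D.cmp_eq_extend) simp_all
    finally show "g = \<epsilon> d \<cdot>\<^bsub>D\<^esub> FA F f" by (simp add: triangle_left)
  qed
qed

text \<open>An object of \<open>VMonCat\<close> together with a chosen left adjoint.\<close>

locale moncat_object = enriched V A
  for V :: "('v, 'm) braided_moncat" and A :: "('a, 'v, 'm) vmoncat" +
  fixes l :: "('v, 'm, 'a, 'h) ladj"
  assumes rigid: "rigid_monoidal_category (underlying V A :: ('a, ('a, 'm, 'h) uarr) moncat)"
    and adj: "\<exists>\<epsilon>. adjunction V (underlying V A) (laF l) (from_unit V A) (laEta l) \<epsilon>"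
    and laF_one: "FO (laF l) \<one>\<^bsub>V\<^esub> = vUnit A" and laEta_one: "laEta l \<one>\<^bsub>V\<^esub> = vId A (vUnit A)"
begin

abbreviation G :: "('a, ('a, 'm, 'h) uarr) moncat" where "G \<equiv> graded_cat V A"

definition univ :: "'v \<Rightarrow> ('a, 'm, 'h) uarr" where
  "univ v = Elt (vUnit A) (FO (laF l) v) (laEta l v)"

lemma laEta_arr [simp]:
  assumes "v \<in> Obj V"
  shows "FO (laF l) v \<in> vObj A" "laEta l v \<in> Arr V" "Dom V (laEta l v) = v" "Cod V (laEta l v) = vHom A (vUnit A) (FO (laF l) v)"
proof -
  obtain \<epsilon> where "adjunction V (underlying V A) (laF l) (from_unit V A) (laEta l) \<epsilon>" using adj by blast
  then interpret adjunction V "underlying V A" "laF l" "from_unit V A" "laEta l" \<epsilon> .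
  show "FO (laF l) v \<in> vObj A" using F.FO_obj[OF assms] by (simp add: underlying_def)
  show "laEta l v \<in> Arr V" "Dom V (laEta l v) = v" "Cod V (laEta l v) = vHom A (vUnit A) (FO (laF l) v)"
    using unit_nat assms by (auto simp: nat_trans_def hom_def fid_def fcomp_def from_unit_def)
qed

lemma from_unit_eta:
  assumes "v \<in> Obj V" "b \<in> vObj A" "k \<in> Arr V" "Dom V k = \<one>\<^bsub>V\<^esub>" "Cod V k = vHom A (FO (laF l) v) b"
    and "g = Elt (FO (laF l) v) b k"
  shows "FA (from_unit V A) g \<cdot>\<^bsub>V\<^esub> laEta l v =
    vCmp A (vUnit A) (FO (laF l) v) b \<cdot>\<^bsub>V\<^esub> (laEta l v \<otimes>\<^bsub>V\<^esub> k)"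
  using assms V.ten_cmp[of "laEta l v" "Ide V \<one>\<^bsub>V\<^esub>" "Ide V (vHom A (vUnit A) (FO (laF l) v))" k]
  by (simp add: from_unit_def)

lemma represented_graded:
  "represented_graded V G (grade V) (regrade V) (laF l) univ"
proof -
  obtain \<epsilon> where adj': "adjunction V (underlying V A) (laF l) (from_unit V A) (laEta l) \<epsilon>" using adj by blast
  then interpret adjunction V "underlying V A" "laF l" "from_unit V A" "laEta l" \<epsilon> .
  interpret G: graded_monoidal V G "grade V" "regrade V" by (rule graded_monoidal)
  have pure: "G.pure = underlying V A" by (rule pure_graded_cat)
  have U: "f \<in> Arr (underlying V A) \<longleftrightarrow> f \<in> Arr G \<and> grade V f = \<one>\<^bsub>V\<^esub>" for f
    unfolding pure[symmetric] by simp
  have hom_U: "f \<in> hom (underlying V A) a b \<longleftrightarrow> f \<in> Arr G \<and> grade V f = \<one>\<^bsub>V\<^esub> \<and> usrc f = a \<and> utgt f = b" for f a b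
    unfolding pure[symmetric] by (auto simp: hom_def)
  have ex1: "\<exists>!g :: ('a, 'm, 'h) uarr. g \<in> hom (underlying V A) (FO (laF l) v) b \<and> vCmp A (vUnit A) (FO (laF l) v) b \<cdot>\<^bsub>V\<^esub> (laEta l v \<otimes>\<^bsub>V\<^esub> uelt g) = k"
    if [simp]: "v \<in> Obj V" "b \<in> vObj A" "k \<in> Arr V" "Dom V k = v" "Cod V k = vHom A (vUnit A) b" for v b k
  proof -
    have eq: "FA (from_unit V A) g \<cdot>\<^bsub>V\<^esub> laEta l v = vCmp A (vUnit A) (FO (laF l) v) b \<cdot>\<^bsub>V\<^esub> (laEta l v \<otimes>\<^bsub>V\<^esub> uelt g)"
      if "g \<in> hom (underlying V A) (FO (laF l) v) b" for g :: "('a, 'm, 'h) uarr"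
      using that by (intro from_unit_eta[of v b "uelt g" g]) (auto simp: hom_U elim!: Arr_graded_catE)
    have "\<exists>!g :: ('a, 'm, 'h) uarr. g \<in> hom (underlying V A) (FO (laF l) v) b \<and> FA (from_unit V A) g \<cdot>\<^bsub>V\<^esub> laEta l v = k"
      by (rule adjunction_universal[OF adj']) (simp_all add: underlying_def hom_def from_unit_def)
    then show ?thesis by (simp add: eq cong: conj_cong)
  qed
  show ?thesis
  proof (rule represented_graded.intro[OF graded_monoidal], unfold pure, rule rigid,
      rule represented_graded_axioms.intro, unfold pure, rule F.cfunctor_axioms, goal_cases)
    case 1 show ?case by (simp add: laF_one)
  next
    case 6 show ?case by (simp add: univ_def laEta_one laF_one)
  next
    case (7 p)
    then have [simp]: "p \<in> Arr V" .
    let ?u = "Dom V p" and ?v = "Cod V p"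
    have Fp: "FA (laF l) p \<in> hom (underlying V A) (FO (laF l) ?u) (FO (laF l) ?v)"
      by (simp add: hom_def)
    have "FA (from_unit V A) (FA (laF l) p) \<cdot>\<^bsub>V\<^esub> laEta l ?u = laEta l ?v \<cdot>\<^bsub>V\<^esub> p"
      using unit_nat by (auto simp: nat_trans_def fid_def fcomp_def)
    moreover have "FA (from_unit V A) (FA (laF l) p) \<cdot>\<^bsub>V\<^esub> laEta l ?u =
       vCmp A (vUnit A) (FO (laF l) ?u) (FO (laF l) ?v) \<cdot>\<^bsub>V\<^esub> (laEta l ?u \<otimes>\<^bsub>V\<^esub> uelt (FA (laF l) p))"
      using Fp by (intro from_unit_eta) (auto simp: hom_U elim!: Arr_graded_catE)
    ultimately show ?case using Fp by (auto simp: hom_U univ_def)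
  next
    case (8 f)
    then obtain b k where [simp]: "f = Elt (vUnit A) b k" "b \<in> vObj A" "k \<in> Arr V" "Cod V k = vHom A (vUnit A) b"
      by (auto elim!: Arr_graded_catE)
    from ex1[of "Dom V k" b k] obtain g :: "('a, 'm, 'h) uarr"
      where "g \<in> hom (underlying V A) (FO (laF l) (Dom V k)) b"
      "vCmp A (vUnit A) (FO (laF l) (Dom V k)) b \<cdot>\<^bsub>V\<^esub> (laEta l (Dom V k) \<otimes>\<^bsub>V\<^esub> uelt g) = k"
      by auto
    then show ?case by (intro bexI[of _ g]) (auto simp: hom_U univ_def)
  next
    case (9 v g g')
    let ?k = "vCmp A (vUnit A) (FO (laF l) v) (utgt g) \<cdot>\<^bsub>V\<^esub> (laEta l v \<otimes>\<^bsub>V\<^esub> uelt g)"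
    have "utgt g' = utgt g" "vCmp A (vUnit A) (FO (laF l) v) (utgt g) \<cdot>\<^bsub>V\<^esub> (laEta l v \<otimes>\<^bsub>V\<^esub> uelt g') = ?k"
      using 9 by (auto simp: univ_def)
    moreover have "utgt g \<in> vObj A" "?k \<in> Arr V" "Dom V ?k = v" "Cod V ?k = vHom A (vUnit A) (utgt g)"
      using 9 by (auto simp: grade_def elim!: Arr_graded_catE)
    ultimately show ?case
      using ex1[of v "utgt g" ?k] 9 by (auto simp: hom_U)
  qed (auto simp: univ_def)
qed

end

section \<open>Enriched functors as graded functors\<close>

definition graded_fun :: "('v, 'm) braided_moncat \<Rightarrow> ('a, 'm) vfunctor \<Rightarrow>
  ('a, ('a, 'm, 'h) uarr, 'a, ('a, 'm, 'h) uarr) fctr" where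
  "graded_fun V R = \<lparr>FO = vfO R,
     FA = (\<lambda>f. Elt (vfO R (usrc f)) (vfO R (utgt f)) (vfM R (usrc f) (utgt f) \<cdot>\<^bsub>V\<^esub> uelt f))\<rparr>"

definition graded_laxitor :: "('a, 'v, 'm) vmoncat \<Rightarrow> ('a, 'v, 'm) vmoncat \<Rightarrow> ('a, 'm) vfunctor \<Rightarrow>
  'a \<Rightarrow> 'a \<Rightarrow> ('a, 'm, 'h) uarr" where
  "graded_laxitor A B R a b = Elt (vTenO B (vfO R a) (vfO R b)) (vfO R (vTenO A a b)) (vfLax R a b)"

lemma graded_fun_simps [simp]:
  "FO (graded_fun V R) a = vfO R a"
  "FA (graded_fun V R) (Elt a b k) = Elt (vfO R a) (vfO R b) (vfM R a b \<cdot>\<^bsub>V\<^esub> k)"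
  by (simp_all add: graded_fun_def)

lemma lax_enrichedD:
  assumes "lax_enriched_monoidal_functor V A B R"
  shows "vfO R \<in> extensional (vObj A)" "vfM R \<in> extensional (vObj A)" "vfLax R \<in> extensional (vObj A)"
    and "a \<in> vObj A \<Longrightarrow> vfM R a \<in> extensional (vObj A)" "a \<in> vObj A \<Longrightarrow> vfLax R a \<in> extensional (vObj A)"
    and "a \<in> vObj A \<Longrightarrow> vfO R a \<in> vObj B"
    and "a \<in> vObj A \<Longrightarrow> b \<in> vObj A \<Longrightarrow> vfM R a b \<in> Arr V"
    and "a \<in> vObj A \<Longrightarrow> b \<in> vObj A \<Longrightarrow> Dom V (vfM R a b) = vHom A a b"
    and "a \<in> vObj A \<Longrightarrow> b \<in> vObj A \<Longrightarrow> Cod V (vfM R a b) = vHom B (vfO R a) (vfO R b)"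
    and "a \<in> vObj A \<Longrightarrow> b \<in> vObj A \<Longrightarrow> vfLax R a b \<in> Arr V"
    and "a \<in> vObj A \<Longrightarrow> b \<in> vObj A \<Longrightarrow> Dom V (vfLax R a b) = \<one>\<^bsub>V\<^esub>"
    and "a \<in> vObj A \<Longrightarrow> b \<in> vObj A \<Longrightarrow>
       Cod V (vfLax R a b) = vHom B (vTenO B (vfO R a) (vfO R b)) (vfO R (vTenO A a b))"
    and "a \<in> vObj A \<Longrightarrow> vfM R a a \<cdot>\<^bsub>V\<^esub> vId A a = vId B (vfO R a)"
    and "vfO R (vUnit A) = vUnit B"
    and "a \<in> vObj A \<Longrightarrow> vfLax R (vUnit A) a = vId B (vfO R a)"
    and "a \<in> vObj A \<Longrightarrow> vfLax R a (vUnit A) = vId B (vfO R a)"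
proof -
  have 1: "vfO R \<in> vObj A \<rightarrow>\<^sub>E vObj B"
    "vfM R \<in> (\<Pi>\<^sub>E a \<in> vObj A. \<Pi>\<^sub>E b \<in> vObj A. hom V (vHom A a b) (vHom B (vfO R a) (vfO R b)))"
    "vfLax R \<in> (\<Pi>\<^sub>E a \<in> vObj A. \<Pi>\<^sub>E b \<in> vObj A.
        hom V \<one>\<^bsub>V\<^esub> (vHom B (vTenO B (vfO R a) (vfO R b)) (vfO R (vTenO A a b))))"
    "\<forall>a \<in> vObj A. vfM R a a \<cdot>\<^bsub>V\<^esub> vId A a = vId B (vfO R a)" "vfO R (vUnit A) = vUnit B"
    "\<forall>a \<in> vObj A. vfLax R (vUnit A) a = vId B (vfO R a) \<and> vfLax R a (vUnit A) = vId B (vfO R a)"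
    using assms unfolding lax_enriched_monoidal_functor_def by blast+
  from 1(1) show "vfO R \<in> extensional (vObj A)" "a \<in> vObj A \<Longrightarrow> vfO R a \<in> vObj B"
    by (auto simp: PiE_iff)
  from 1(2) show "vfM R \<in> extensional (vObj A)" "a \<in> vObj A \<Longrightarrow> vfM R a \<in> extensional (vObj A)"
    "a \<in> vObj A \<Longrightarrow> b \<in> vObj A \<Longrightarrow> vfM R a b \<in> Arr V"
    "a \<in> vObj A \<Longrightarrow> b \<in> vObj A \<Longrightarrow> Dom V (vfM R a b) = vHom A a b"
    "a \<in> vObj A \<Longrightarrow> b \<in> vObj A \<Longrightarrow> Cod V (vfM R a b) = vHom B (vfO R a) (vfO R b)"
    by (auto simp: PiE_iff hom_def)
  from 1(3) show "vfLax R \<in> extensional (vObj A)" "a \<in> vObj A \<Longrightarrow> vfLax R a \<in> extensional (vObj A)"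
    "a \<in> vObj A \<Longrightarrow> b \<in> vObj A \<Longrightarrow> vfLax R a b \<in> Arr V"
    "a \<in> vObj A \<Longrightarrow> b \<in> vObj A \<Longrightarrow> Dom V (vfLax R a b) = \<one>\<^bsub>V\<^esub>"
    "a \<in> vObj A \<Longrightarrow> b \<in> vObj A \<Longrightarrow>
       Cod V (vfLax R a b) = vHom B (vTenO B (vfO R a) (vfO R b)) (vfO R (vTenO A a b))"
    by (auto simp: PiE_iff hom_def)
  from 1(4-6) show "a \<in> vObj A \<Longrightarrow> vfM R a a \<cdot>\<^bsub>V\<^esub> vId A a = vId B (vfO R a)" "vfO R (vUnit A) = vUnit B"
    "a \<in> vObj A \<Longrightarrow> vfLax R (vUnit A) a = vId B (vfO R a)"
    "a \<in> vObj A \<Longrightarrow> vfLax R a (vUnit A) = vId B (vfO R a)" by auto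
qed

lemma vfunctor_eqI:
  assumes "lax_enriched_monoidal_functor V A B R"
    "vfO S \<in> extensional (vObj A)" "vfM S \<in> extensional (vObj A)" "vfLax S \<in> extensional (vObj A)"
    "\<And>a. a \<in> vObj A \<Longrightarrow> vfM S a \<in> extensional (vObj A)" "\<And>a. a \<in> vObj A \<Longrightarrow> vfLax S a \<in> extensional (vObj A)"
    and "\<And>a. a \<in> vObj A \<Longrightarrow> vfO R a = vfO S a"
    "\<And>a b. a \<in> vObj A \<Longrightarrow> b \<in> vObj A \<Longrightarrow> vfM R a b = vfM S a b"
    "\<And>a b. a \<in> vObj A \<Longrightarrow> b \<in> vObj A \<Longrightarrow> vfLax R a b = vfLax S a b"
  shows "R = S"
proof (rule vfunctor.equality)
  note R = lax_enrichedD[OF assms(1)]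
  show "vfO R = vfO S" by (rule extensionalityI[OF R(1) assms(2)]) (rule assms)
  show "vfM R = vfM S"
    by (rule extensionalityI[OF R(2) assms(3)], rule extensionalityI[OF R(4) assms(5)]) (auto intro: assms)
  show "vfLax R = vfLax S"
    by (rule extensionalityI[OF R(3) assms(4)], rule extensionalityI[OF R(5) assms(6)]) (auto intro: assms)
qed simp

locale enriched_pair = A: enriched V A + B: enriched V B
  for V :: "('v, 'm) braided_moncat" and A B :: "('a, 'v, 'm) vmoncat"
begin

abbreviation "graded_lax \<equiv> graded_lax_functor V (graded_cat V A) (grade V) (regrade V) (graded_cat V B) (grade V) (regrade V)"

lemma graded_of_enriched:
  assumes R: "lax_enriched_monoidal_functor V A B R"
  shows "graded_lax (graded_fun V R) (graded_laxitor A B R :: 'a \<Rightarrow> 'a \<Rightarrow> ('a, 'm, 'h) uarr)"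
proof -
  note D = lax_enrichedD[OF R]
  note [simp] = D(6-16)
  let ?GA = "graded_cat V A :: ('a, ('a, 'm, 'h) uarr) moncat"
  let ?GB = "graded_cat V B :: ('a, ('a, 'm, 'h) uarr) moncat"
  have cmp: "vfM R a c \<cdot>\<^bsub>V\<^esub> vCmp A a b c = vCmp B (vfO R a) (vfO R b) (vfO R c) \<cdot>\<^bsub>V\<^esub> (vfM R a b \<otimes>\<^bsub>V\<^esub> vfM R b c)"
    if "a \<in> vObj A" "b \<in> vObj A" "c \<in> vObj A" for a b c
    using R that unfolding lax_enriched_monoidal_functor_def by blast
  have nat: "vCmp B (vTenO B (vfO R a) (vfO R b)) (vfO R (vTenO A a b)) (vfO R (vTenO A c d)) \<cdot>\<^bsub>V\<^esub>
          (vfLax R a b \<otimes>\<^bsub>V\<^esub> (vfM R (vTenO A a b) (vTenO A c d) \<cdot>\<^bsub>V\<^esub> vTenM A a c b d)) =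
        vCmp B (vTenO B (vfO R a) (vfO R b)) (vTenO B (vfO R c) (vfO R d)) (vfO R (vTenO A c d)) \<cdot>\<^bsub>V\<^esub>
          ((vTenM B (vfO R a) (vfO R c) (vfO R b) (vfO R d) \<cdot>\<^bsub>V\<^esub> (vfM R a c \<otimes>\<^bsub>V\<^esub> vfM R b d))
             \<otimes>\<^bsub>V\<^esub> vfLax R c d)"
    if "a \<in> vObj A" "b \<in> vObj A" "c \<in> vObj A" "d \<in> vObj A" for a b c d
    using R that unfolding lax_enriched_monoidal_functor_def by blast
  have assoc: "ucmp V B (vTenO B (vfO R a) (vTenO B (vfO R b) (vfO R c)))
                 (vTenO B (vfO R a) (vfO R (vTenO A b c)))
                 (vfO R (vTenO A a (vTenO A b c)))
          (vfLax R a (vTenO A b c))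
          (uten V B (vfO R a) (vfO R a) (vTenO B (vfO R b) (vfO R c)) (vfO R (vTenO A b c))
             (vId B (vfO R a)) (vfLax R b c)) =
        ucmp V B (vTenO B (vTenO B (vfO R a) (vfO R b)) (vfO R c))
                 (vTenO B (vfO R (vTenO A a b)) (vfO R c))
                 (vfO R (vTenO A (vTenO A a b) c))
          (vfLax R (vTenO A a b) c)
          (uten V B (vTenO B (vfO R a) (vfO R b)) (vfO R (vTenO A a b)) (vfO R c) (vfO R c)
             (vfLax R a b) (vId B (vfO R c)))"
    if "a \<in> vObj A" "b \<in> vObj A" "c \<in> vObj A" for a b c
    using R that unfolding lax_enriched_monoidal_functor_def by blast
  have "cfunctor ?GA ?GB (graded_fun V R)"
  proof (rule cfunctor.intro[OF A.category_graded B.category_graded], unfold_locales, goal_cases)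
    case (2 f a b)
    then show ?case by (auto simp: hom_def elim!: Arr_graded_catE)
  next
    case (4 f a b g c)
    then obtain k l where [simp]: "f = Elt a b k" "g = Elt b c l" "a \<in> vObj A" "b \<in> vObj A" "c \<in> vObj A"
      "k \<in> Arr V" "Cod V k = vHom A a b" "l \<in> Arr V" "Cod V l = vHom A b c"
      by (auto simp: hom_def elim!: Arr_graded_catE)
    have "vfM R a c \<cdot>\<^bsub>V\<^esub> (vCmp A a b c \<cdot>\<^bsub>V\<^esub> (k \<otimes>\<^bsub>V\<^esub> l)) =
      vCmp B (vfO R a) (vfO R b) (vfO R c) \<cdot>\<^bsub>V\<^esub> ((vfM R a b \<otimes>\<^bsub>V\<^esub> vfM R b c) \<cdot>\<^bsub>V\<^esub> (k \<otimes>\<^bsub>V\<^esub> l))"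
      by (rule A.V.cmp_eq_extend[OF cmp]) simp_all
    then show ?case by (simp add: A.V.ten_cmp)
  qed simp_all
  then have "strict_lax_monoidal_functor ?GA ?GB (graded_fun V R) (graded_laxitor A B R)"
    unfolding strict_lax_monoidal_functor_def
  proof (intro conjI ballI, goal_cases)
    case (4 f g)
    then obtain a c k b d l where [simp]: "f = Elt a c k" "g = Elt b d l" "a \<in> vObj A" "b \<in> vObj A" "c \<in> vObj A" "d \<in> vObj A"
      "k \<in> Arr V" "Cod V k = vHom A a c" "l \<in> Arr V" "Cod V l = vHom A b d"
      by (auto elim!: Arr_graded_catE)
    let ?C = "vCmp B (vTenO B (vfO R a) (vfO R b)) (vfO R (vTenO A a b)) (vfO R (vTenO A c d))"
    let ?C' = "vCmp B (vTenO B (vfO R a) (vfO R b)) (vTenO B (vfO R c) (vfO R d)) (vfO R (vTenO A c d))"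
    have "?C \<cdot>\<^bsub>V\<^esub> (vfLax R a b \<otimes>\<^bsub>V\<^esub> ((vfM R (vTenO A a b) (vTenO A c d) \<cdot>\<^bsub>V\<^esub> vTenM A a c b d) \<cdot>\<^bsub>V\<^esub> (k \<otimes>\<^bsub>V\<^esub> l))) =
      ?C \<cdot>\<^bsub>V\<^esub> ((vfLax R a b \<otimes>\<^bsub>V\<^esub> (vfM R (vTenO A a b) (vTenO A c d) \<cdot>\<^bsub>V\<^esub> vTenM A a c b d)) \<cdot>\<^bsub>V\<^esub> (k \<otimes>\<^bsub>V\<^esub> l))"
      using A.V.ten_cmp[of "Ide V \<one>\<^bsub>V\<^esub>" "k \<otimes>\<^bsub>V\<^esub> l" "vfLax R a b" "vfM R (vTenO A a b) (vTenO A c d) \<cdot>\<^bsub>V\<^esub> vTenM A a c b d"]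
      by simp
    also have "\<dots> = ?C' \<cdot>\<^bsub>V\<^esub> (((vTenM B (vfO R a) (vfO R c) (vfO R b) (vfO R d) \<cdot>\<^bsub>V\<^esub> (vfM R a c \<otimes>\<^bsub>V\<^esub> vfM R b d))
             \<otimes>\<^bsub>V\<^esub> vfLax R c d) \<cdot>\<^bsub>V\<^esub> (k \<otimes>\<^bsub>V\<^esub> l))"
      by (rule A.V.cmp_eq_extend[OF nat]) simp_all
    also have "\<dots> = ?C' \<cdot>\<^bsub>V\<^esub> ((vTenM B (vfO R a) (vfO R c) (vfO R b) (vfO R d) \<cdot>\<^bsub>V\<^esub> ((vfM R a c \<cdot>\<^bsub>V\<^esub> k) \<otimes>\<^bsub>V\<^esub> (vfM R b d \<cdot>\<^bsub>V\<^esub> l))) \<otimes>\<^bsub>V\<^esub> vfLax R c d)"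
      using A.V.ten_cmp[of "k \<otimes>\<^bsub>V\<^esub> l" "Ide V \<one>\<^bsub>V\<^esub>" "vTenM B (vfO R a) (vfO R c) (vfO R b) (vfO R d) \<cdot>\<^bsub>V\<^esub> (vfM R a c \<otimes>\<^bsub>V\<^esub> vfM R b d)" "vfLax R c d"]
      by (simp add: A.V.ten_cmp)
    finally show ?case by (simp add: graded_laxitor_def)
  next
    case (5 a b c)
    then show ?case using assoc[of a b c] by (simp add: graded_laxitor_def ucmp_def uten_def)
  qed (auto simp: hom_def graded_laxitor_def)
  then show ?thesis
    unfolding graded_lax_functor_def
    by (auto simp: graded_laxitor_def elim!: Arr_graded_catE)
qed

text \<open>
  Conversely, \<open>vfM R a b\<close> is recovered as the value on the arrow \<open>a \<rightarrow> b\<close> of grade \<open>A(a \<rightarrow> b)\<close> given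
  by the identity of \<open>A(a \<rightarrow> b)\<close>, from which all others arise by regrading.
\<close>

lemma enriched_of_graded:
  assumes T: "graded_lax T (\<rho> :: 'a \<Rightarrow> 'a \<Rightarrow> ('a, 'm, 'h) uarr)"
    and ext: "vfO R \<in> extensional (vObj A)" "vfM R \<in> extensional (vObj A)" "vfLax R \<in> extensional (vObj A)"
      "\<And>a. a \<in> vObj A \<Longrightarrow> vfM R a \<in> extensional (vObj A)" "\<And>a. a \<in> vObj A \<Longrightarrow> vfLax R a \<in> extensional (vObj A)"
    and R: "\<And>a. a \<in> vObj A \<Longrightarrow> vfO R a = FO T a"
      "\<And>a b. a \<in> vObj A \<Longrightarrow> b \<in> vObj A \<Longrightarrow> vfM R a b = uelt (FA T (Elt a b (Ide V (vHom A a b))))"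
      "\<And>a b. a \<in> vObj A \<Longrightarrow> b \<in> vObj A \<Longrightarrow> vfLax R a b = uelt (\<rho> a b)"
  shows "lax_enriched_monoidal_functor V A B R"
    and "f \<in> Arr (graded_cat V A) \<Longrightarrow> FA (graded_fun V R) f = FA T f"
    and "a \<in> vObj A \<Longrightarrow> b \<in> vObj A \<Longrightarrow> graded_laxitor A B R a b = \<rho> a b"
proof -
  let ?GA = "graded_cat V A :: ('a, ('a, 'm, 'h) uarr) moncat"
  let ?GB = "graded_cat V B :: ('a, ('a, 'm, 'h) uarr) moncat"
  have lax: "strict_lax_monoidal_functor ?GA ?GB T \<rho>"
    and gr: "f \<in> Arr ?GA \<Longrightarrow> grade V (FA T f) = grade V f"
    and act: "f \<in> Arr ?GA \<Longrightarrow> p \<in> Arr V \<Longrightarrow> Cod V p = grade V f \<Longrightarrow> FA T (regrade V f p) = regrade V (FA T f) p"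
    and gr': "a \<in> vObj A \<Longrightarrow> b \<in> vObj A \<Longrightarrow> grade V (\<rho> a b) = \<one>\<^bsub>V\<^esub>" for f p a b
    using T by (auto simp: graded_lax_functor_def)
  interpret T: lax_functor ?GA ?GB T \<rho> using lax by (rule lax_functorI)
  have T_obj [simp]: "FO T a \<in> vObj B" if "a \<in> vObj A" for a
    using T.FO_obj[of a] that by simp
  have T_one [simp]: "FO T (vUnit A) = vUnit B" using T.FO_one by simp
  let ?i = "\<lambda>a b. Elt a b (Ide V (vHom A a b))"
  have TM: "FA T (?i a b) = Elt (FO T a) (FO T b) (vfM R a b)" "vfM R a b \<in> Arr V"
    "Dom V (vfM R a b) = vHom A a b" "Cod V (vfM R a b) = vHom B (FO T a) (FO T b)"
    if ab: "a \<in> vObj A" "b \<in> vObj A" for a b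
  proof -
    have i: "?i a b \<in> Arr ?GA" using ab by simp
    from T.FA_arr[OF i] obtain k where k: "FA T (?i a b) = Elt (FO T a) (FO T b) k" "k \<in> Arr V"
      "Cod V k = vHom B (FO T a) (FO T b)" by (auto elim!: Arr_graded_catE)
    with R(2)[OF ab] gr[OF i] ab show "FA T (?i a b) = Elt (FO T a) (FO T b) (vfM R a b)" "vfM R a b \<in> Arr V"
    "Dom V (vfM R a b) = vHom A a b" "Cod V (vfM R a b) = vHom B (FO T a) (FO T b)"
      by simp_all
  qed
  note [simp] = TM(2-4) R(1)
  have FA_T: "FA T (Elt a b k) = Elt (FO T a) (FO T b) (vfM R a b \<cdot>\<^bsub>V\<^esub> k)"
    if "a \<in> vObj A" "b \<in> vObj A" "k \<in> Arr V" "Cod V k = vHom A a b" for a b k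
    using act[of "?i a b" k] that by (simp add: TM)
  then show "FA (graded_fun V R) f = FA T f" if "f \<in> Arr (graded_cat V A)" for f
    using that by (auto elim!: Arr_graded_catE)
  have rho: "\<rho> a b = Elt (vTenO B (FO T a) (FO T b)) (FO T (vTenO A a b)) (vfLax R a b)"
    and rho_arr [simp]: "vfLax R a b \<in> Arr V" "Dom V (vfLax R a b) = \<one>\<^bsub>V\<^esub>"
      "Cod V (vfLax R a b) = vHom B (vTenO B (FO T a) (FO T b)) (FO T (vTenO A a b))"
    if ab: "a \<in> vObj A" "b \<in> vObj A" for a b
  proof -
    have "\<rho> a b \<in> Arr ?GB" using ab by simp
    with T.lax_arr(2,3)[of a b] ab obtain k where k: "\<rho> a b = Elt (vTenO B (FO T a) (FO T b)) (FO T (vTenO A a b)) k"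
      "k \<in> Arr V" "Cod V k = vHom B (vTenO B (FO T a) (FO T b)) (FO T (vTenO A a b))"
      by (elim Arr_graded_catE) auto
    with R(3)[OF ab] gr'[OF ab] show "\<rho> a b = Elt (vTenO B (FO T a) (FO T b)) (FO T (vTenO A a b)) (vfLax R a b)"
     "vfLax R a b \<in> Arr V" "Dom V (vfLax R a b) = \<one>\<^bsub>V\<^esub>"
      "Cod V (vfLax R a b) = vHom B (vTenO B (FO T a) (FO T b)) (FO T (vTenO A a b))" by simp_all
  qed
  show "graded_laxitor A B R a b = \<rho> a b" if "a \<in> vObj A" "b \<in> vObj A" for a b
    using that by (simp add: graded_laxitor_def rho)
  show "lax_enriched_monoidal_functor V A B R"
    unfolding lax_enriched_monoidal_functor_def
  proof (intro conjI ballI, goal_cases)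
    case 1 show ?case using ext(1) by (simp add: PiE_iff)
  next
    case 2 show ?case using ext(2,4) by (simp add: PiE_iff hom_def)
  next
    case (3 a) then show ?case using T.FA_ide[of a] FA_T[of a a "vId A a"] by simp
  next
    case (4 a b c)
    then have [simp]: "a \<in> vObj A" "b \<in> vObj A" "c \<in> vObj A" .
    have "FA T (?i b c \<cdot>\<^bsub>?GA\<^esub> ?i a b) = FA T (?i b c) \<cdot>\<^bsub>?GB\<^esub> FA T (?i a b)"
      by (rule T.FA_cmp_arr) simp_all
    then show ?case by (simp add: FA_T)
  next
    case 5 show ?case by simp
  next
    case 6 show ?case using ext(3,5) by (simp add: PiE_iff hom_def)
  next
    case (7 a b c d)
    then have [simp]: "a \<in> vObj A" "b \<in> vObj A" "c \<in> vObj A" "d \<in> vObj A" .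
    have "FA T (?i a c \<otimes>\<^bsub>?GA\<^esub> ?i b d) \<cdot>\<^bsub>?GB\<^esub> \<rho> a b = \<rho> c d \<cdot>\<^bsub>?GB\<^esub> (FA T (?i a c) \<otimes>\<^bsub>?GB\<^esub> FA T (?i b d))"
      by (rule T.lax_nat) simp_all
    then show ?case by (simp add: FA_T rho)
  next
    case (8 a b c)
    then show ?case using T.lax_assoc[of a b c] by (simp add: rho ucmp_def uten_def)
  next
    case (9 a) then show ?case using T.lax_unit[of a] rho[of "vUnit A" a] by simp
  next
    case (10 a) then show ?case using T.lax_unit[of a] rho[of a "vUnit A"] by simp
  qed
qed

lemma graded_natE:
  assumes th: "graded_monoidal_nat_trans V A B R S \<theta>"
    and R: "lax_enriched_monoidal_functor V A B R" and S: "lax_enriched_monoidal_functor V A B S"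
    and f: "f \<in> Arr (graded_cat V A)"
  shows "FA (graded_fun V S) f \<cdot>\<^bsub>graded_cat V B\<^esub> Elt (vfO R (usrc f)) (vfO S (usrc f)) (\<theta> (usrc f)) =
    Elt (vfO R (utgt f)) (vfO S (utgt f)) (\<theta> (utgt f)) \<cdot>\<^bsub>graded_cat V B\<^esub> FA (graded_fun V R) f"
proof -
  note [simp] = lax_enrichedD(6-16)[OF R] lax_enrichedD(6-16)[OF S]
  have [simp]: "\<theta> a \<in> Arr V" "Dom V (\<theta> a) = \<one>\<^bsub>V\<^esub>" "Cod V (\<theta> a) = vHom B (vfO R a) (vfO S a)" if "a \<in> vObj A" for a
    using th that by (auto simp: graded_monoidal_nat_trans_def PiE_iff hom_def)
  obtain a b k where [simp]: "f = Elt a b k" "a \<in> vObj A" "b \<in> vObj A" "k \<in> Arr V" "Cod V k = vHom A a b"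
    using f by (auto elim!: Arr_graded_catE)
  have nat: "vCmp B (vfO R a) (vfO S a) (vfO S b) \<cdot>\<^bsub>V\<^esub> (\<theta> a \<otimes>\<^bsub>V\<^esub> vfM S a b) =
        vCmp B (vfO R a) (vfO R b) (vfO S b) \<cdot>\<^bsub>V\<^esub> (vfM R a b \<otimes>\<^bsub>V\<^esub> \<theta> b)"
    using th by (simp add: graded_monoidal_nat_trans_def)
  have "vCmp B (vfO R a) (vfO S a) (vfO S b) \<cdot>\<^bsub>V\<^esub> (\<theta> a \<otimes>\<^bsub>V\<^esub> (vfM S a b \<cdot>\<^bsub>V\<^esub> k)) =
    vCmp B (vfO R a) (vfO S a) (vfO S b) \<cdot>\<^bsub>V\<^esub> ((\<theta> a \<otimes>\<^bsub>V\<^esub> vfM S a b) \<cdot>\<^bsub>V\<^esub> k)"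
    using A.V.ten_cmp[of "Ide V \<one>\<^bsub>V\<^esub>" k "\<theta> a" "vfM S a b"] by simp
  also have "\<dots> = vCmp B (vfO R a) (vfO R b) (vfO S b) \<cdot>\<^bsub>V\<^esub> ((vfM R a b \<otimes>\<^bsub>V\<^esub> \<theta> b) \<cdot>\<^bsub>V\<^esub> k)"
    by (rule A.V.cmp_eq_extend[OF nat]) simp_all
  also have "\<dots> = vCmp B (vfO R a) (vfO R b) (vfO S b) \<cdot>\<^bsub>V\<^esub> ((vfM R a b \<cdot>\<^bsub>V\<^esub> k) \<otimes>\<^bsub>V\<^esub> \<theta> b)"
    using A.V.ten_cmp[of k "Ide V \<one>\<^bsub>V\<^esub>" "vfM R a b" "\<theta> b"] by simp
  finally show ?thesis by simp
qed

end

section \<open>The 2-functor on cells\<close>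

(* Unfolding the operations of the graded category would keep its laws from applying. *)
declare graded_cat_simps [simp del]

context moncat_object
begin

sublocale G: represented_graded V G "grade V" "regrade V" "laF l" univ
  by (rule represented_graded)

lemma pure_eq: "G.pure = underlying V A"
  by (rule pure_graded_cat)

text \<open>
  This turns the cells that \<open>P\<close> defines by mates into cells determined by universal arrows.
\<close>

lemma mate_hat:
  assumes "v \<in> Obj V" "a \<in> vObj A" "b \<in> vObj A" "g \<in> Arr V" "Dom V g = v" "Cod V g = vHom A a b"
  shows "mate V A l a v b g = G.hat (Elt a b g)"
proof -
  have "f \<in> hom (underlying V A) (vTenO A a (FO (laF l) v)) b \<and>
       vCmp A a (vTenO A a (FO (laF l) v)) b \<cdot>\<^bsub>V\<^esub>
         ((vTenM A a a (vUnit A) (FO (laF l) v) \<cdot>\<^bsub>V\<^esub> (vId A a \<otimes>\<^bsub>V\<^esub> laEta l v)) \<otimes>\<^bsub>V\<^esub> uelt f) = g \<longleftrightarrow>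
    f \<in> hom G.pure (Dom G (Elt a b g) \<odot>\<^bsub>G\<^esub> FO (laF l) (grade V (Elt a b g :: ('a, 'm, 'h) uarr))) (Cod G (Elt a b g)) \<and>
     f \<cdot>\<^bsub>G\<^esub> (Ide G (Dom G (Elt a b g)) \<otimes>\<^bsub>G\<^esub> univ (grade V (Elt a b g :: ('a, 'm, 'h) uarr))) = Elt a b g"
    for f :: "('a, 'm, 'h) uarr"
    unfolding pure_eq using assms
    by (auto simp: graded_cat_simps univ_def hom_def underlying_def)
  then show ?thesis
    unfolding mate_def G.hat_def Let_def by (simp only:)
qed

lemma P_hb_eq: "a \<in> vObj A \<Longrightarrow> v \<in> Obj V \<Longrightarrow> P_hb V A l a v = G.hb a v"
  unfolding P_hb_def G.hb_def
  by (subst mate_hat) (simp_all add: graded_cat_simps univ_def)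

lemma P_mu_eq: "u \<in> Obj V \<Longrightarrow> v \<in> Obj V \<Longrightarrow> P_mu V A l u v = G.oplaxitor u v"
  unfolding P_mu_def G.oplaxitor_def
  by (subst mate_hat) (simp_all add: graded_cat_simps univ_def)

lemma models_P: "G.models (P_0cell V A l)"
proof -
  have obj: "P_FZ_obj V A l v = G.central_obj v" if "v \<in> Obj V" for v
    using that by (auto simp: P_FZ_obj_def G.central_obj_def P_hb_eq graded_cat_simps(1))
  have "mtF (P_0cell V A l) = laF l"
    by (simp add: mtF_def P_0cell_def P_FZ_obj_def)
  then show ?thesis
    unfolding G.models_def pure_eq
    by (auto simp: P_0cell_def obj P_mu_eq)
qed

lemma P_object: "modtens_object V (P_0cell V A l)"
proof -
  have "has_right_adjoint V G.pure (laF l)"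
    using adj unfolding has_right_adjoint_def pure_eq by blast
  then show ?thesis
    by (intro modtens_objectI[OF V.braided_monoidal_category_axioms] G.models_object[OF models_P])
qed

end

locale moncat_pair = A: moncat_object V A l + B: moncat_object V B k
  for V :: "('v, 'm) braided_moncat"
    and A :: "('a, 'v, 'm) vmoncat" and l :: "('v, 'm, 'a, 'h) ladj"
    and B :: "('a, 'v, 'm) vmoncat" and k :: "('v, 'm, 'a, 'h) ladj"
begin

sublocale enriched_pair V A B ..

sublocale represented_pair V A.G "grade V" "regrade V" "laF l" A.univ
  B.G "grade V" "regrade V" "laF k" B.univ ..

abbreviation "PR \<equiv> P_1cell V A l B k"
abbreviation "X \<equiv> P_0cell V A l"
abbreviation "Y \<equiv> P_0cell V B k"
abbreviation "cell \<equiv> pure_cell V A.G (grade V) (regrade V) (laF l) A.univ B.G (grade V) (regrade V) (laF k) B.univ"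
abbreviation "lifting \<equiv> pure_cell.lift V A.G (grade V) (laF l) A.univ B.G"
abbreviation "on_eta R \<equiv> (\<lambda>v. FA (graded_fun V R) (A.univ v) :: ('a, 'm, 'h) uarr)"

lemma P_1cell_simps:
  "a \<in> vObj A \<Longrightarrow> FO (mtR (PR R)) a = vfO R a"
  "f \<in> Arr (underlying V A) \<Longrightarrow> FA (mtR (PR R)) f = FA (graded_fun V R) f"
  "a \<in> vObj A \<Longrightarrow> b \<in> vObj A \<Longrightarrow> mtLax (PR R) a b = graded_laxitor A B R a b"
  by (simp_all add: P_1cell_def graded_fun_def graded_laxitor_def)

lemma P_1cell_ext:
  "FO (mtR (PR R)) \<in> extensional (vObj A)" "FA (mtR (PR R)) \<in> extensional (Arr (underlying V A))"
  "mtLax (PR R) \<in> extensional (vObj A)" "a \<in> vObj A \<Longrightarrow> mtLax (PR R) a \<in> extensional (vObj A)"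
  "mtCoh (PR R) \<in> extensional (Obj V)"
  by (simp_all add: P_1cell_def)

lemma Arr_underlying: "f \<in> Arr (underlying V A) \<longleftrightarrow> f \<in> Arr A.G \<and> grade V f = \<one>\<^bsub>V\<^esub>"
  for f :: "('a, 'm, 'h) uarr"
  unfolding A.pure_eq[symmetric] by simp

lemma P_1cell_coh:
  assumes R: "lax_enriched_monoidal_functor V A B R" and [simp]: "v \<in> Obj V"
  shows "mtCoh (PR R) v = B.G.hat (FA (graded_fun V R) (A.univ v))"
proof -
  note [simp] = lax_enrichedD(6-16)[OF R]
  show ?thesis
    by (simp add: P_1cell_def B.mate_hat A.univ_def)
qed

lemma P_1cell_pure_cell:
  assumes R: "lax_enriched_monoidal_functor V A B R"
  shows "cell (mtR (PR R)) (mtLax (PR R)) (on_eta R)"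
    and "f \<in> Arr A.G \<Longrightarrow> lifting (mtR (PR R)) (mtLax (PR R)) (on_eta R) f = FA (graded_fun V R) f"
  by (rule graded_pure_cell[OF graded_of_enriched[OF R]];
      simp add: P_1cell_simps graded_cat_simps(1) Arr_underlying)+

lemma P_1cell_in:
  assumes R: "lax_enriched_monoidal_functor V A B R"
  shows "modtens_1cell V X Y (PR R)"
proof (rule modtens_1cell_of_pure_cell[OF A.models_P B.models_P A.P_object B.P_object P_1cell_pure_cell(1)[OF R]])
qed (simp_all add: P_1cell_ext P_1cell_coh[OF R] A.pure_eq graded_cat_simps(1))

text \<open>
  The value of \<open>R\<close> at the identity of a hom object, read as an arrow of that grade, is the morphism
  \<open>vfM R a b\<close>, and it is a \<open>lift\<close> of data that \<open>P\<close> retains.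
\<close>

lemma P_1cell_inj:
  assumes R: "lax_enriched_monoidal_functor V A B R" and S: "lax_enriched_monoidal_functor V A B S"
    and eq: "PR R = PR S"
  shows "R = S"
proof -
  note RD = lax_enrichedD[OF R] and SD = lax_enrichedD[OF S]
  have O: "vfO R a = vfO S a" if "a \<in> vObj A" for a
    using P_1cell_simps(1)[OF that, of R] P_1cell_simps(1)[OF that, of S] eq by simp
  have lax: "vfLax R a b = vfLax S a b" if "a \<in> vObj A" "b \<in> vObj A" for a b
    using P_1cell_simps(3)[OF that, of R] P_1cell_simps(3)[OF that, of S] eq by (simp add: graded_laxitor_def)
  interpret R: pure_cell V A.G "grade V" "regrade V" "laF l" A.univ B.G "grade V" "regrade V" "laF k" B.univ
    "mtR (PR R)" "mtLax (PR R)" "on_eta R" by (rule P_1cell_pure_cell(1)[OF R])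
  interpret S: pure_cell V A.G "grade V" "regrade V" "laF l" A.univ B.G "grade V" "regrade V" "laF k" B.univ
    "mtR (PR S)" "mtLax (PR S)" "on_eta S" by (rule P_1cell_pure_cell(1)[OF S])
  have img: "on_eta R v = on_eta S v" if v: "v \<in> Obj V" for v
  proof -
    have "B.G.hat (on_eta R v) = B.G.hat (on_eta S v)"
      using P_1cell_coh[OF R v] P_1cell_coh[OF S v] eq by simp
    then show ?thesis
      using B.G.hat_eta[OF R.s_arr(1)[OF v]] B.G.hat_eta[OF S.s_arr(1)[OF v]] v by (simp add: R.s_arr S.s_arr)
  qed
  have M: "vfM R a b = vfM S a b" if ab: "a \<in> vObj A" "b \<in> vObj A" for a b
  proof -
    let ?f = "Elt a b (Ide V (vHom A a b)) :: ('a, 'm, 'h) uarr"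
    have f: "?f \<in> Arr A.G" using ab by (simp add: graded_cat_simps)
    have "R.lift ?f = S.lift ?f"
      unfolding R.lift_def S.lift_def R.gen_def S.gen_def using img[OF A.G.gr_obj[OF f]] eq by simp
    then have "FA (graded_fun V R) ?f = FA (graded_fun V S) ?f"
      using P_1cell_pure_cell(2)[OF R f] P_1cell_pure_cell(2)[OF S f] by simp
    then show ?thesis using RD(7,8) SD(7,8) ab by simp
  qed
  show ?thesis
    by (rule vfunctor_eqI[OF R SD(1-5)]) (auto simp: O lax M)
qed

text \<open>
  The enriched functor is the one whose graded functor is the \<open>lift\<close> of the given module functor.
\<close>

lemma P_1cell_surj:
  assumes Q: "modtens_1cell V X Y Q"
  shows "\<exists>R. lax_enriched_monoidal_functor V A B R \<and> PR R = Q"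
proof -
  interpret Q: modtens_arrow V X Y Q by (rule modtens_arrowI[OF A.P_object B.P_object Q])
  have X: "mtCat X = underlying V A" by (simp add: P_0cell_def)
  interpret C: pure_cell V A.G "grade V" "regrade V" "laF l" A.univ B.G "grade V" "regrade V" "laF k" B.univ
    "mtR Q" "mtLax Q" "\<lambda>v. mtCoh Q v \<cdot>\<^bsub>B.G\<^esub> B.univ v"
    by (rule pure_cell_of_1cell[OF A.models_P B.models_P A.P_object B.P_object Q])
  define R where "R = \<lparr>vfO = (\<lambda>a\<in>vObj A. FO (mtR Q) a),
    vfM = (\<lambda>a\<in>vObj A. \<lambda>b\<in>vObj A. uelt (C.lift (Elt a b (Ide V (vHom A a b))))),
    vfLax = (\<lambda>a\<in>vObj A. \<lambda>b\<in>vObj A. uelt (mtLax Q a b))\<rparr>"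
  have R: "lax_enriched_monoidal_functor V A B R"
    "\<And>f. f \<in> Arr A.G \<Longrightarrow> FA (graded_fun V R) f = C.lift f"
    "\<And>a b. a \<in> vObj A \<Longrightarrow> b \<in> vObj A \<Longrightarrow> graded_laxitor A B R a b = mtLax Q a b"
    using enriched_of_graded[OF C.graded_lift, of R] by (simp_all add: R_def)
  have O: "a \<in> vObj A \<Longrightarrow> vfO R a = FO (mtR Q) a" for a by (simp add: R_def)
  have coh: "mtCoh (PR R) v = mtCoh Q v" if v: "v \<in> Obj V" for v
  proof -
    have r: "mtCoh Q v \<in> Arr B.G" "grade V (mtCoh Q v) = \<one>\<^bsub>V\<^esub>" "Dom B.G (mtCoh Q v) = FO (laF k) v"
      "Cod B.G (mtCoh Q v) = FO (mtR Q) (FO (laF l) v)"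
      using Q.r_arr[OF v] A.G.models_data(1,2)[OF A.models_P] B.G.models_data(1,2)[OF B.models_P] by auto
    have "mtCoh (PR R) v = B.G.hat (mtCoh Q v \<cdot>\<^bsub>B.G\<^esub> B.univ v)"
      using v by (simp add: P_1cell_coh[OF R(1)] R(2))
    also have "\<dots> = mtCoh Q v"
      by (rule B.G.hat_eqI) (use v in \<open>simp_all add: r\<close>)
    finally show ?thesis .
  qed
  have "PR R = Q"
  proof (rule mt1cell.equality)
    show "mtR (PR R) = mtR Q"
    proof (rule fctr.equality)
      show "FO (mtR (PR R)) = FO (mtR Q)"
        by (rule extensionalityI[of _ "vObj A"]) (use Q.ext P_1cell_ext in \<open>auto simp: X underlying_def P_1cell_simps O\<close>)
      show "FA (mtR (PR R)) = FA (mtR Q)"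
        by (rule extensionalityI[of _ "Arr (underlying V A)"])
          (use Q.ext P_1cell_ext in \<open>auto simp: X P_1cell_simps R(2) Arr_underlying\<close>)
    qed simp
    show "mtLax (PR R) = mtLax Q"
    proof (rule extensionalityI[of _ "vObj A"])
      fix a assume a: "a \<in> vObj A"
      show "mtLax (PR R) a = mtLax Q a"
        by (rule extensionalityI[of _ "vObj A"])
          (use Q.ext(4)[of a] P_1cell_ext(4)[OF a] a in \<open>auto simp: X underlying_def P_1cell_simps R(3)\<close>)
    qed (use Q.ext P_1cell_ext in \<open>auto simp: X underlying_def\<close>)
    show "mtCoh (PR R) = mtCoh Q"
      by (rule extensionalityI[of _ "Obj V"]) (use Q.ext P_1cell_ext coh in auto)
  qed simp
  with R show ?thesis by blast
qed

text \<open>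
  On 2-cells the two notions of naturality agree: one tests all arrows of grade one and the \<open>\<eta> v\<close>,
  the other arrows of all grades.
\<close>

lemma P_2cell_iff:
  assumes R: "lax_enriched_monoidal_functor V A B R" and S: "lax_enriched_monoidal_functor V A B S"
    and th: "\<theta> \<in> (\<Pi>\<^sub>E a \<in> vObj A. hom V \<one>\<^bsub>V\<^esub> (vHom B (vfO R a) (vfO S a)))"
  shows "graded_monoidal_nat_trans V A B R S \<theta> \<longleftrightarrow>
    modtens_2cell V X Y (PR R) (PR S) (\<lambda>a\<in>vObj A. Elt (vfO R a) (vfO S a) (\<theta> a))"
proof -
  interpret R: pure_cell V A.G "grade V" "regrade V" "laF l" A.univ B.G "grade V" "regrade V" "laF k" B.univ
    "mtR (PR R)" "mtLax (PR R)" "on_eta R" by (rule P_1cell_pure_cell(1)[OF R])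
  interpret S: pure_cell V A.G "grade V" "regrade V" "laF l" A.univ B.G "grade V" "regrade V" "laF k" B.univ
    "mtR (PR S)" "mtLax (PR S)" "on_eta S" by (rule P_1cell_pure_cell(1)[OF S])
  note X = A.G.models_data[OF A.models_P] and Y = B.G.models_data[OF B.models_P]
  note RD = lax_enrichedD[OF R] and SD = lax_enrichedD[OF S]
  note [simp] = RD(6-16) SD(6-16)
  define \<Theta> where "\<Theta> = (\<lambda>a\<in>vObj A. Elt (vfO R a) (vfO S a) (\<theta> a) :: ('a, 'm, 'h) uarr)"
  have \<Theta>: "\<Theta> a = Elt (vfO R a) (vfO S a) (\<theta> a)" if "a \<in> vObj A" for a
    using that by (simp add: \<Theta>_def)
  have tharr: "\<theta> a \<in> Arr V" "Dom V (\<theta> a) = \<one>\<^bsub>V\<^esub>" "Cod V (\<theta> a) = vHom B (vfO R a) (vfO S a)" if "a \<in> vObj A" for a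
    using th that by (auto simp: PiE_iff hom_def)
  have \<Theta>_arr [simp]: "\<Theta> a \<in> Arr B.G" "grade V (\<Theta> a) = \<one>\<^bsub>V\<^esub>" "Dom B.G (\<Theta> a) = vfO R a" "Cod B.G (\<Theta> a) = vfO S a"
    if "a \<in> vObj A" for a
    using that tharr[OF that] by (simp_all add: \<Theta> graded_cat_simps)
  have mon: "\<Theta> (vTenO A a b) \<cdot>\<^bsub>B.G\<^esub> graded_laxitor A B R a b = graded_laxitor A B S a b \<cdot>\<^bsub>B.G\<^esub> (\<Theta> a \<otimes>\<^bsub>B.G\<^esub> \<Theta> b) \<longleftrightarrow>
     ucmp V B (vTenO B (vfO R a) (vfO R b)) (vfO R (vTenO A a b)) (vfO S (vTenO A a b))
          (\<theta> (vTenO A a b)) (vfLax R a b) =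
        ucmp V B (vTenO B (vfO R a) (vfO R b)) (vTenO B (vfO S a) (vfO S b)) (vfO S (vTenO A a b))
          (vfLax S a b) (uten V B (vfO R a) (vfO S a) (vfO R b) (vfO S b) (\<theta> a) (\<theta> b))"
    if "a \<in> vObj A" "b \<in> vObj A" for a b
    using that by (simp add: \<Theta> graded_laxitor_def graded_cat_simps ucmp_def uten_def)
  have one: "\<Theta> (vUnit A) = Ide B.G (vUnit B) \<longleftrightarrow> \<theta> (vUnit A) = vId B (vUnit B)"
    by (simp add: \<Theta> graded_cat_simps)
  show ?thesis unfolding \<Theta>_def[symmetric]
  proof
    assume n: "graded_monoidal_nat_trans V A B R S \<theta>"
    have nat: "FA (graded_fun V S) f \<cdot>\<^bsub>B.G\<^esub> \<Theta> (usrc f) = \<Theta> (utgt f) \<cdot>\<^bsub>B.G\<^esub> FA (graded_fun V R) f" if "f \<in> Arr A.G" for f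
      using graded_natE[OF n R S that] that by (auto simp: \<Theta> elim!: Arr_graded_catE)
    show "modtens_2cell V X Y (PR R) (PR S) \<Theta>"
    proof (rule modtens_2cellI)
      show "\<Theta> \<in> extensional (Obj (mtCat X))" by (simp add: \<Theta>_def X graded_cat_simps)
    next
      fix a assume "a \<in> Obj (mtCat X)"
      then show "\<Theta> a \<in> hom (mtCat Y) (FO (mtR (PR R)) a) (FO (mtR (PR S)) a)"
        by (simp add: X Y graded_cat_simps(1) P_1cell_simps hom_def)
    next
      fix f assume "f \<in> Arr (mtCat X)"
      then show "FA (mtR (PR S)) f \<cdot>\<^bsub>mtCat Y\<^esub> \<Theta> (Dom (mtCat X) f) = \<Theta> (Cod (mtCat X) f) \<cdot>\<^bsub>mtCat Y\<^esub> FA (mtR (PR R)) f"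
        using nat[of f] by (simp add: X Y P_1cell_simps(2) Arr_underlying graded_cat_simps(2,3))
    next
      fix a b assume "a \<in> Obj (mtCat X)" "b \<in> Obj (mtCat X)"
      then show "\<Theta> (a \<odot>\<^bsub>mtCat X\<^esub> b) \<cdot>\<^bsub>mtCat Y\<^esub> mtLax (PR R) a b = mtLax (PR S) a b \<cdot>\<^bsub>mtCat Y\<^esub> (\<Theta> a \<otimes>\<^bsub>mtCat Y\<^esub> \<Theta> b)"
        using mon[of a b] n by (simp add: X Y graded_cat_simps(1,7) P_1cell_simps graded_monoidal_nat_trans_def)
    next
      show "\<Theta> \<one>\<^bsub>mtCat X\<^esub> = Ide (mtCat Y) \<one>\<^bsub>mtCat Y\<^esub>"
        using one n by (simp add: X Y graded_cat_simps(6) graded_monoidal_nat_trans_def)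
    next
      fix v assume v [simp]: "v \<in> Obj V"
      have [simp]: "FO (laF l) v \<in> vObj A" using A.G.F_obj[OF v] by (simp add: graded_cat_simps(1))
      have unit: "\<Theta> (vUnit A) = Ide B.G (vUnit B)"
        using one n by (simp add: graded_monoidal_nat_trans_def)
      have "on_eta S v \<cdot>\<^bsub>B.G\<^esub> \<Theta> (vUnit A) = \<Theta> (FO (laF l) v) \<cdot>\<^bsub>B.G\<^esub> on_eta R v"
        using nat[OF A.G.eta_arr(1)[OF v]] by (simp add: A.univ_def)
      moreover have "on_eta S v \<cdot>\<^bsub>B.G\<^esub> Ide B.G (vUnit B) = on_eta S v"
        using S.s_arr[OF v] by (simp add: graded_cat_simps(6))
      ultimately have "\<Theta> (FO (laF l) v) \<cdot>\<^bsub>B.G\<^esub> on_eta R v = on_eta S v" by (simp add: unit)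
      moreover have "B.G.hat (on_eta R v) \<cdot>\<^bsub>B.G\<^esub> B.univ v = on_eta R v" "B.G.hat (on_eta S v) \<cdot>\<^bsub>B.G\<^esub> B.univ v = on_eta S v"
        using B.G.hat_eta[OF R.s_arr(1)[OF v]] B.G.hat_eta[OF S.s_arr(1)[OF v]] v by (simp_all add: R.s_arr S.s_arr)
      ultimately have "\<Theta> (FO (laF l) v) \<cdot>\<^bsub>B.G\<^esub> B.G.hat (on_eta R v) = B.G.hat (on_eta S v)"
        by - (rule B.G.eta_unique[of v]; simp add: R.s_arr S.s_arr P_1cell_simps)
      then show "\<Theta> (FO (mtF X) v) \<cdot>\<^bsub>mtCat Y\<^esub> mtCoh (PR R) v = mtCoh (PR S) v"
        by (simp add: X Y P_1cell_coh[OF R] P_1cell_coh[OF S])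
    qed
  next
    assume t: "modtens_2cell V X Y (PR R) (PR S) \<Theta>"
    note T = modtens_2cellD[OF t]
    have lift_nat: "lifting (mtR (PR S)) (mtLax (PR S)) (on_eta S) f \<cdot>\<^bsub>B.G\<^esub> \<Theta> (Dom A.G f) =
      \<Theta> (Cod A.G f) \<cdot>\<^bsub>B.G\<^esub> lifting (mtR (PR R)) (mtLax (PR R)) (on_eta R) f" if f: "f \<in> Arr A.G" for f
    proof (rule natural_of_pure[OF R.pure_cell_axioms S.pure_cell_axioms _ _ _ _ f])
      fix a assume "a \<in> Obj A.G"
      then show "\<Theta> a \<in> hom B.G.pure (FO (mtR (PR R)) a) (FO (mtR (PR S)) a)"
        by (simp add: graded_cat_simps(1) P_1cell_simps hom_def)
    next
      fix f assume "f \<in> Arr A.G" "grade V f = \<one>\<^bsub>V\<^esub>"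
      then show "FA (mtR (PR S)) f \<cdot>\<^bsub>B.G\<^esub> \<Theta> (Dom A.G f) = \<Theta> (Cod A.G f) \<cdot>\<^bsub>B.G\<^esub> FA (mtR (PR R)) f"
        using T(5)[of f] by (simp add: X Y)
    next
      fix a b assume "a \<in> Obj A.G" "b \<in> Obj A.G"
      then show "\<Theta> (a \<odot>\<^bsub>A.G\<^esub> b) \<cdot>\<^bsub>B.G\<^esub> mtLax (PR R) a b = mtLax (PR S) a b \<cdot>\<^bsub>B.G\<^esub> (\<Theta> a \<otimes>\<^bsub>B.G\<^esub> \<Theta> b)"
        using T(6)[of a b] by (simp add: X Y)
    next
      fix v assume v [simp]: "v \<in> Obj V"
      have [simp]: "FO (laF l) v \<in> vObj A" using A.G.F_obj[OF v] by (simp add: graded_cat_simps(1))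
      have hat: "B.G.hat (on_eta R v) \<cdot>\<^bsub>B.G\<^esub> B.univ v = on_eta R v" "B.G.hat (on_eta S v) \<cdot>\<^bsub>B.G\<^esub> B.univ v = on_eta S v"
        using B.G.hat_eta[OF R.s_arr(1)[OF v]] B.G.hat_eta[OF S.s_arr(1)[OF v]] v by (simp_all add: R.s_arr S.s_arr)
      have "\<Theta> (FO (laF l) v) \<cdot>\<^bsub>B.G\<^esub> B.G.hat (on_eta R v) = B.G.hat (on_eta S v)"
        using T(8)[OF v] by (simp add: X Y P_1cell_coh[OF R] P_1cell_coh[OF S])
      then have "\<Theta> (FO (laF l) v) \<cdot>\<^bsub>B.G\<^esub> (B.G.hat (on_eta R v) \<cdot>\<^bsub>B.G\<^esub> B.univ v) = B.G.hat (on_eta S v) \<cdot>\<^bsub>B.G\<^esub> B.univ v"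
        by (rule B.G.cmp_eq_extend1) (simp_all add: R.s_arr P_1cell_simps)
      then show "\<Theta> (FO (laF l) v) \<cdot>\<^bsub>B.G\<^esub> on_eta R v = on_eta S v"
        by (simp only: hat)
    qed
    have nat: "FA (graded_fun V S) f \<cdot>\<^bsub>B.G\<^esub> \<Theta> (usrc f) = \<Theta> (utgt f) \<cdot>\<^bsub>B.G\<^esub> FA (graded_fun V R) f"
      if "f \<in> Arr A.G" for f
      using lift_nat[OF that] P_1cell_pure_cell(2)[OF R that] P_1cell_pure_cell(2)[OF S that] by (simp add: graded_cat_simps(2,3))
    have nat': "vCmp B (vfO R a) (vfO S a) (vfO S b) \<cdot>\<^bsub>V\<^esub> (\<theta> a \<otimes>\<^bsub>V\<^esub> vfM S a b) =
        vCmp B (vfO R a) (vfO R b) (vfO S b) \<cdot>\<^bsub>V\<^esub> (vfM R a b \<otimes>\<^bsub>V\<^esub> \<theta> b)" if [simp]: "a \<in> vObj A" "b \<in> vObj A" for a b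
      using nat[of "Elt a b (Ide V (vHom A a b))"] by (simp add: graded_cat_simps \<Theta>)
    show "graded_monoidal_nat_trans V A B R S \<theta>"
      unfolding graded_monoidal_nat_trans_def
    proof (intro conjI ballI th)
      fix a b assume ab: "a \<in> vObj A" "b \<in> vObj A"
      show "vCmp B (vfO R a) (vfO S a) (vfO S b) \<cdot>\<^bsub>V\<^esub> (\<theta> a \<otimes>\<^bsub>V\<^esub> vfM S a b) =
        vCmp B (vfO R a) (vfO R b) (vfO S b) \<cdot>\<^bsub>V\<^esub> (vfM R a b \<otimes>\<^bsub>V\<^esub> \<theta> b)" using nat'[OF ab] .
      show "ucmp V B (vTenO B (vfO R a) (vfO R b)) (vfO R (vTenO A a b)) (vfO S (vTenO A a b))
          (\<theta> (vTenO A a b)) (vfLax R a b) =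
        ucmp V B (vTenO B (vfO R a) (vfO R b)) (vTenO B (vfO S a) (vfO S b)) (vfO S (vTenO A a b))
          (vfLax S a b) (uten V B (vfO R a) (vfO S a) (vfO R b) (vfO S b) (\<theta> a) (\<theta> b))"
        using T(6)[of a b] mon[OF ab] ab by (simp add: X Y P_1cell_simps graded_cat_simps(1,7))
    next
      show "\<theta> (vUnit A) = vId B (vUnit B)"
        using T(7) one by (simp add: X Y graded_cat_simps(6))
    qed
  qed
qed

end

section \<open>Reflecting 2-category laws\<close>

text \<open>
  Operations that are preserved by an injective map into a 2-category satisfy the laws of a
  2-category.
\<close>

lemma category_reflect:
  fixes C :: "('o, 'm, 'x) cat_scheme" and D :: "('p, 'n, 'y) cat_scheme"
  assumes "category D"
    and arr: "\<And>f. f \<in> Arr C \<Longrightarrow> Dom C f \<in> Obj C \<and> Cod C f \<in> Obj C"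
    and ide: "\<And>a. a \<in> Obj C \<Longrightarrow> Ide C a \<in> hom C a a"
    and cmp: "\<And>f g a b c. f \<in> hom C a b \<Longrightarrow> g \<in> hom C b c \<Longrightarrow> g \<cdot>\<^bsub>C\<^esub> f \<in> hom C a c"
    and F_in: "\<And>f a b. f \<in> hom C a b \<Longrightarrow> F f \<in> hom D (obj a) (obj b)"
    and F_ide: "\<And>a. a \<in> Obj C \<Longrightarrow> F (Ide C a) = Ide D (obj a)"
    and F_cmp: "\<And>f g a b c. f \<in> hom C a b \<Longrightarrow> g \<in> hom C b c \<Longrightarrow> F (g \<cdot>\<^bsub>C\<^esub> f) = F g \<cdot>\<^bsub>D\<^esub> F f"
    and inj: "inj_on F (Arr C)"
  shows "category C"
proof -
  interpret D: category D by fact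
  have ob: "a \<in> Obj C" "b \<in> Obj C" "f \<in> Arr C" if "f \<in> hom C a b" for f a b
    using arr[of f] that by (auto simp: hom_def)
  show ?thesis
  proof (unfold_locales, goal_cases)
    case (5 f a b)
    have i: "Ide C a \<in> hom C a a" using ide ob[OF 5] by blast
    show ?case
      by (rule inj_onD[OF inj _ ob(3)[OF cmp[OF i 5]] ob(3)[OF 5]])
         (simp add: F_cmp[OF i 5] F_ide ob[OF 5] D.cmp_ide[OF F_in[OF 5]])
  next
    case (6 f a b)
    have i: "Ide C b \<in> hom C b b" using ide ob[OF 6] by blast
    show ?case
      by (rule inj_onD[OF inj _ ob(3)[OF cmp[OF 6 i]] ob(3)[OF 6]])
         (simp add: F_cmp[OF 6 i] F_ide ob[OF 6] D.ide_cmp[OF F_in[OF 6]])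
  next
    case (7 f a b g c h d)
    show ?case
      by (rule inj_onD[OF inj _ ob(3)[OF cmp[OF 7(1) cmp[OF 7(2,3)]]] ob(3)[OF cmp[OF cmp[OF 7(1,2)] 7(3)]]])
         (simp only: F_cmp[OF 7(1) cmp[OF 7(2,3)]] F_cmp[OF 7(2,3)] F_cmp[OF cmp[OF 7(1,2)] 7(3)]
           F_cmp[OF 7(1,2)] D.cmp_assoc[OF F_in[OF 7(1)] F_in[OF 7(2)] F_in[OF 7(3)]])
  qed (use arr ide cmp in blast)+
qed

lemma two_functor_reflect:
  fixes K :: "('o, 'f, 't) twocat" and L :: "('p, 'g, 'u) twocat"
    and P :: "('o, 'f, 't, 'p, 'g, 'u) twofun"
  assumes L: "two_category L"
    and P0: "\<And>A. A \<in> Obj0 K \<Longrightarrow> P0 P A \<in> Obj0 L"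
    and P1: "\<And>A B. A \<in> Obj0 K \<Longrightarrow> B \<in> Obj0 K \<Longrightarrow> cfunctor (Hom K A B) (Hom L (P0 P A) (P0 P B)) (P1 P A B)"
    and inj0: "\<And>A B. A \<in> Obj0 K \<Longrightarrow> B \<in> Obj0 K \<Longrightarrow> inj_on (FO (P1 P A B)) (Obj (Hom K A B))"
    and inj: "\<And>A B. A \<in> Obj0 K \<Longrightarrow> B \<in> Obj0 K \<Longrightarrow> inj_on (FA (P1 P A B)) (Arr (Hom K A B))"
    and Id1_in: "\<And>A. A \<in> Obj0 K \<Longrightarrow> Id1 K A \<in> Obj (Hom K A A)"
    and Cmp1_in: "\<And>A B C F G. A \<in> Obj0 K \<Longrightarrow> B \<in> Obj0 K \<Longrightarrow> C \<in> Obj0 K \<Longrightarrow>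
        F \<in> Obj (Hom K A B) \<Longrightarrow> G \<in> Obj (Hom K B C) \<Longrightarrow> Cmp1 K A B C G F \<in> Obj (Hom K A C)"
    and HCmp_in: "\<And>A B C x y F F' G G'. A \<in> Obj0 K \<Longrightarrow> B \<in> Obj0 K \<Longrightarrow> C \<in> Obj0 K \<Longrightarrow>
        x \<in> hom (Hom K A B) F F' \<Longrightarrow> y \<in> hom (Hom K B C) G G' \<Longrightarrow>
        HCmp K A B C y x \<in> hom (Hom K A C) (Cmp1 K A B C G F) (Cmp1 K A B C G' F')"
    and P_Id1: "\<And>A. A \<in> Obj0 K \<Longrightarrow> FO (P1 P A A) (Id1 K A) = Id1 L (P0 P A)"
    and P_Cmp1: "\<And>A B C F G. A \<in> Obj0 K \<Longrightarrow> B \<in> Obj0 K \<Longrightarrow> C \<in> Obj0 K \<Longrightarrow>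
        F \<in> Obj (Hom K A B) \<Longrightarrow> G \<in> Obj (Hom K B C) \<Longrightarrow>
        FO (P1 P A C) (Cmp1 K A B C G F) =
        Cmp1 L (P0 P A) (P0 P B) (P0 P C) (FO (P1 P B C) G) (FO (P1 P A B) F)"
    and P_HCmp: "\<And>A B C x y. A \<in> Obj0 K \<Longrightarrow> B \<in> Obj0 K \<Longrightarrow> C \<in> Obj0 K \<Longrightarrow>
        x \<in> Arr (Hom K A B) \<Longrightarrow> y \<in> Arr (Hom K B C) \<Longrightarrow>
        FA (P1 P A C) (HCmp K A B C y x) =
        HCmp L (P0 P A) (P0 P B) (P0 P C) (FA (P1 P B C) y) (FA (P1 P A B) x)"
  shows "two_functor K L P"
proof -
  interpret L: two_category L by fact
  have homI: "x \<in> hom C (Dom C x) (Cod C x)" if "x \<in> Arr C" for x and C :: "('f, 't) cat"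
    using that by (simp add: hom_def)
  have arr: "x \<in> Arr C" if "x \<in> hom C a b" for x a b and C :: "('f, 't) cat"
    using that by (simp add: hom_def)
  have HCmp_arr: "HCmp K A B C y x \<in> Arr (Hom K A C)"
    if "A \<in> Obj0 K" "B \<in> Obj0 K" "C \<in> Obj0 K" "x \<in> Arr (Hom K A B)" "y \<in> Arr (Hom K B C)" for A B C x y
    using HCmp_in[OF that(1-3) homI[OF that(4)] homI[OF that(5)]] by (rule arr)
  have cat: "category (Hom K A B)" if "A \<in> Obj0 K" "B \<in> Obj0 K" for A B
    using P1[OF that] by (rule cfunctor.axioms(1))
  have FO_in: "F \<in> Obj (Hom K A B) \<Longrightarrow> FO (P1 P A B) F \<in> Obj (Hom L (P0 P A) (P0 P B))"
    and FA_in: "x \<in> hom (Hom K A B) F F' \<Longrightarrow> FA (P1 P A B) x \<in> hom (Hom L (P0 P A) (P0 P B)) (FO (P1 P A B) F) (FO (P1 P A B) F')"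
    and FA_ide: "F \<in> Obj (Hom K A B) \<Longrightarrow> FA (P1 P A B) (Ide (Hom K A B) F) = Ide (Hom L (P0 P A) (P0 P B)) (FO (P1 P A B) F)"
    and FA_arr: "x \<in> Arr (Hom K A B) \<Longrightarrow> FA (P1 P A B) x \<in> Arr (Hom L (P0 P A) (P0 P B))"
    and ide_arr: "F \<in> Obj (Hom K A B) \<Longrightarrow> Ide (Hom K A B) F \<in> Arr (Hom K A B)"
    if "A \<in> Obj0 K" "B \<in> Obj0 K" for A B F F' x
    using cfunctor.FO_in[OF P1[OF that]] cfunctor.FA_in[OF P1[OF that]] cfunctor.FA_ide[OF P1[OF that]]
      cfunctor.FA_arr(1)[OF P1[OF that]] category.ide_arr(1)[OF cat[OF that]] by auto
  have K: "two_category K"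
  proof (rule two_category.intro, goal_cases)
    case (1 A B) then show ?case by (rule cat)
  next
    case (2 A) then show ?case by (rule Id1_in)
  next
    case (3 A B C F G) then show ?case by (rule Cmp1_in)
  next
    case (4 A B C x F F' y G G') then show ?case by (rule HCmp_in)
  next
    case (5 A B C F G)
    note o = 5(1-3) and FG = 5(4,5)
    have i: "Ide (Hom K A B) F \<in> Arr (Hom K A B)" "Ide (Hom K B C) G \<in> Arr (Hom K B C)"
      using ide_arr o FG by auto
    show ?case
    proof (rule inj_onD[OF inj[OF o(1,3)] _ HCmp_arr[OF o i] ide_arr[OF o(1,3) Cmp1_in[OF o FG]]])
      show "FA (P1 P A C) (HCmp K A B C (Ide (Hom K B C) G) (Ide (Hom K A B) F)) =
        FA (P1 P A C) (Ide (Hom K A C) (Cmp1 K A B C G F))"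
        by (simp add: P_HCmp[OF o i] FA_ide[OF o(1,2) FG(1)] FA_ide[OF o(2,3) FG(2)]
          FA_ide[OF o(1,3) Cmp1_in[OF o FG]] P_Cmp1[OF o FG]
          L.HCmp_ide[OF P0[OF o(1)] P0[OF o(2)] P0[OF o(3)] FO_in[OF o(1,2) FG(1)] FO_in[OF o(2,3) FG(2)]])
    qed
  next
    case (6 A B C x F F' x' F'' y G G' y' G'')
    note o = 6(1-3) and h = 6(4-7)
    note cx = category.cmp_in[OF cat[OF o(1,2)] h(1,2)] and cy = category.cmp_in[OF cat[OF o(2,3)] h(3,4)]
    note h1 = HCmp_in[OF o h(1,3)] and h2 = HCmp_in[OF o h(2,4)]
    show ?case
    proof (rule inj_onD[OF inj[OF o(1,3)] _ HCmp_arr[OF o arr[OF cx] arr[OF cy]]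
          arr[OF category.cmp_in[OF cat[OF o(1,3)] h1 h2]]])
      show "FA (P1 P A C) (HCmp K A B C (y' \<cdot>\<^bsub>Hom K B C\<^esub> y) (x' \<cdot>\<^bsub>Hom K A B\<^esub> x)) =
        FA (P1 P A C) (HCmp K A B C y' x' \<cdot>\<^bsub>Hom K A C\<^esub> HCmp K A B C y x)"
        by (simp add: P_HCmp[OF o arr[OF cx] arr[OF cy]] P_HCmp[OF o arr[OF h(1)] arr[OF h(3)]]
          P_HCmp[OF o arr[OF h(2)] arr[OF h(4)]]
          cfunctor.FA_cmp[OF P1[OF o(1,2)] h(1,2)] cfunctor.FA_cmp[OF P1[OF o(2,3)] h(3,4)]
          cfunctor.FA_cmp[OF P1[OF o(1,3)] h1 h2]
          L.HCmp_interchange[OF P0[OF o(1)] P0[OF o(2)] P0[OF o(3)] FA_in[OF o(1,2) h(1)]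
            FA_in[OF o(1,2) h(2)] FA_in[OF o(2,3) h(3)] FA_in[OF o(2,3) h(4)]])
    qed
  next
    case (7 A B F)
    note o = 7(1,2)
    note c1 = Cmp1_in[OF o(1,1,2) Id1_in[OF o(1)] 7(3)] and c2 = Cmp1_in[OF o(1,2,2) 7(3) Id1_in[OF o(2)]]
    show ?case
      using L.Cmp1_unit[OF P0[OF o(1)] P0[OF o(2)] FO_in[OF o 7(3)]]
        P_Cmp1[OF o(1,1,2) Id1_in[OF o(1)] 7(3)] P_Cmp1[OF o(1,2,2) 7(3) Id1_in[OF o(2)]]
      by (auto simp: P_Id1 o intro!: inj_onD[OF inj0[OF o] _ c1 7(3)] inj_onD[OF inj0[OF o] _ c2 7(3)])
  next
    case (8 A B C D F G H)
    note o = 8(1-4) and f = 8(5-7)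
    note p = P0[OF o(1)] P0[OF o(2)] P0[OF o(3)] P0[OF o(4)]
    note GF = Cmp1_in[OF o(1-3) f(1,2)] and HG = Cmp1_in[OF o(2-4) f(2,3)]
    show ?case
      by (rule inj_onD[OF inj0[OF o(1,4)] _ Cmp1_in[OF o(1,2,4) f(1) HG] Cmp1_in[OF o(1,3,4) GF f(3)]])
         (simp only: P_Cmp1[OF o(1,2,4) f(1) HG] P_Cmp1[OF o(2-4) f(2,3)] P_Cmp1[OF o(1,3,4) GF f(3)]
           P_Cmp1[OF o(1-3) f(1,2)]
           L.Cmp1_assoc[OF p FO_in[OF o(1,2) f(1)] FO_in[OF o(2,3) f(2)] FO_in[OF o(3,4) f(3)]])
  next
    case (9 A B x)
    note o = 9(1,2)
    note i1 = ide_arr[OF o(1,1) Id1_in[OF o(1)]] and i2 = ide_arr[OF o(2,2) Id1_in[OF o(2)]]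
    note a1 = HCmp_arr[OF o(1,1,2) i1 9(3)] and a2 = HCmp_arr[OF o(1,2,2) 9(3) i2]
    show ?case
      using L.HCmp_unit[OF P0[OF o(1)] P0[OF o(2)] FA_arr[OF o 9(3)]]
        P_HCmp[OF o(1,1,2) i1 9(3)] P_HCmp[OF o(1,2,2) 9(3) i2]
      by (auto simp: P_Id1 o FA_ide[OF o(1,1) Id1_in[OF o(1)]] FA_ide[OF o(2,2) Id1_in[OF o(2)]]
          intro!: inj_onD[OF inj[OF o] _ a1 9(3)] inj_onD[OF inj[OF o] _ a2 9(3)])
  next
    case (10 A B C D x y z)
    note o = 10(1-4) and f = 10(5-7)
    note p = P0[OF o(1)] P0[OF o(2)] P0[OF o(3)] P0[OF o(4)]
    note yx = HCmp_arr[OF o(1-3) f(1,2)] and zy = HCmp_arr[OF o(2-4) f(2,3)]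
    show ?case
      by (rule inj_onD[OF inj[OF o(1,4)] _ HCmp_arr[OF o(1,2,4) f(1) zy] HCmp_arr[OF o(1,3,4) yx f(3)]])
         (simp only: P_HCmp[OF o(1,2,4) f(1) zy] P_HCmp[OF o(2-4) f(2,3)] P_HCmp[OF o(1,3,4) yx f(3)]
           P_HCmp[OF o(1-3) f(1,2)]
           L.HCmp_assoc[OF p FA_arr[OF o(1,2) f(1)] FA_arr[OF o(2,3) f(2)] FA_arr[OF o(3,4) f(3)]])
  qed
  show ?thesis
    by (intro two_functor.intro K L two_functor_axioms.intro P0 P1 P_Id1 P_Cmp1 P_HCmp)
qed

text \<open>A functor that is bijective on objects and on arrows is an equivalence.\<close>

lemma equivalence_of_bijective:
  assumes F: "cfunctor C D F"
    and inj0: "inj_on (FO F) (Obj C)" and inj: "inj_on (FA F) (Arr C)"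
    and surj0: "\<And>b. b \<in> Obj D \<Longrightarrow> \<exists>a \<in> Obj C. FO F a = b"
    and surj: "\<And>g. g \<in> Arr D \<Longrightarrow> \<exists>f \<in> Arr C. FA F f = g"
  shows "equivalence_of_categories C D F"
proof -
  interpret F: cfunctor C D F by fact
  define G where "G = \<lparr>FO = the_inv_into (Obj C) (FO F), FA = the_inv_into (Arr C) (FA F)\<rparr>"
  have bij0: "bij_betw (FO F) (Obj C) (Obj D)" and bij: "bij_betw (FA F) (Arr C) (Arr D)"
    using inj0 inj surj0 surj by (auto simp: bij_betw_def image_iff)
  have GO [simp]: "b \<in> Obj D \<Longrightarrow> FO G b \<in> Obj C" "b \<in> Obj D \<Longrightarrow> FO F (FO G b) = b"
    "a \<in> Obj C \<Longrightarrow> FO G (FO F a) = a" for a b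
    using bij_betwE[OF bij_betw_the_inv_into[OF bij0]] f_the_inv_into_f_bij_betw[OF bij0] the_inv_into_f_f[OF inj0]
    by (auto simp: G_def)
  have GA [simp]: "g \<in> Arr D \<Longrightarrow> FA G g \<in> Arr C" "g \<in> Arr D \<Longrightarrow> FA F (FA G g) = g"
    "f \<in> Arr C \<Longrightarrow> FA G (FA F f) = f" for f g
    using bij_betwE[OF bij_betw_the_inv_into[OF bij]] f_the_inv_into_f_bij_betw[OF bij] the_inv_into_f_f[OF inj]
    by (auto simp: G_def)
  have GA_dom [simp]: "Dom C (FA G g) = FO G (Dom D g)" "Cod C (FA G g) = FO G (Cod D g)" if "g \<in> Arr D" for g
    using F.FA_arr(2,3)[of "FA G g"] GO(3)[of "Dom C (FA G g)"] GO(3)[of "Cod C (FA G g)"] that by auto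
  have "cfunctor D C G"
  proof (unfold_locales, goal_cases)
    case (2 f a b) then show ?case by (auto simp: hom_def)
  next
    case (3 a)
    then show ?case using GA(3)[of "Ide C (FO G a)"] by simp
  next
    case (4 f a b g c)
    then show ?case using GA(3)[of "FA G g \<cdot>\<^bsub>C\<^esub> FA G f"] by (simp add: hom_def F.FA_cmp_arr)
  qed simp
  moreover have "nat_iso C C (fid C) (fcomp C G F) (Ide C)"
    unfolding nat_iso_def nat_trans_def is_iso_def fid_def fcomp_def
    by (auto simp: hom_def intro!: bexI[of _ "Ide C _"])
  moreover have "nat_iso D D (fcomp D F G) (fid D) (Ide D)"
    unfolding nat_iso_def nat_trans_def is_iso_def fid_def fcomp_def
    by (auto simp: hom_def intro!: bexI[of _ "Ide D _"])
  ultimately show ?thesis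
    unfolding equivalence_of_categories_def using F by blast
qed

section \<open>The 2-functor is locally an isomorphism\<close>

lemma hom_vmoncat_hom:
  "x \<in> hom (vmoncat_hom V A B) R S \<longleftrightarrow> (\<exists>\<theta>. x = Tag R S \<theta> \<and> lax_enriched_monoidal_functor V A B R \<and>
     lax_enriched_monoidal_functor V A B S \<and> graded_monoidal_nat_trans V A B R S \<theta>)"
  by (auto simp: hom_def vmoncat_hom_def)

context moncat_pair
begin

abbreviation "P2 \<equiv> P_2cell V A l B k"
abbreviation "H \<equiv> vmoncat_hom V A B"
abbreviation "H' \<equiv> modtens_hom V X Y"

lemma nat_PiE:
  "graded_monoidal_nat_trans V A B R S \<theta> \<Longrightarrow> \<theta> \<in> (\<Pi>\<^sub>E a \<in> vObj A. hom V \<one>\<^bsub>V\<^esub> (vHom B (vfO R a) (vfO S a)))"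
  by (simp add: graded_monoidal_nat_trans_def)

lemma P2_in:
  assumes "x \<in> hom H R S"
  shows "P2 x \<in> hom H' (PR R) (PR S)"
proof -
  obtain \<theta> where x: "x = Tag R S \<theta>" and R: "lax_enriched_monoidal_functor V A B R"
    and S: "lax_enriched_monoidal_functor V A B S" and \<theta>: "graded_monoidal_nat_trans V A B R S \<theta>"
    using assms by (auto simp: hom_vmoncat_hom)
  show ?thesis
    using P_2cell_iff[OF R S nat_PiE[OF \<theta>]] \<theta> P_1cell_in[OF R] P_1cell_in[OF S]
    by (simp add: hom_modtens_hom P_2cell_def x)
qed

lemma P2_reflect:
  assumes "P2 (Tag R S \<theta>) \<in> hom H' (PR R) (PR S)"
    and R: "lax_enriched_monoidal_functor V A B R" and S: "lax_enriched_monoidal_functor V A B S"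
    and "\<theta> \<in> (\<Pi>\<^sub>E a \<in> vObj A. hom V \<one>\<^bsub>V\<^esub> (vHom B (vfO R a) (vfO S a)))"
  shows "Tag R S \<theta> \<in> hom H R S"
  using assms P_2cell_iff[OF R S assms(4)]
  by (simp add: hom_vmoncat_hom hom_modtens_hom P_2cell_def)

lemma PR_inj: "inj_on PR (Obj H)"
  by (rule inj_onI) (auto simp: vmoncat_hom_def intro: P_1cell_inj)

lemma P2_inj: "inj_on P2 (Arr H)"
proof (rule inj_onI)
  fix x y assume "x \<in> Arr H" "y \<in> Arr H" and eq: "P2 x = P2 y"
  then obtain R S \<theta> R' S' \<theta>' where x: "x = Tag R S \<theta>" and y: "y = Tag R' S' \<theta>'"
    and lax: "lax_enriched_monoidal_functor V A B R" "lax_enriched_monoidal_functor V A B S"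
      "lax_enriched_monoidal_functor V A B R'" "lax_enriched_monoidal_functor V A B S'"
    and th: "graded_monoidal_nat_trans V A B R S \<theta>" "graded_monoidal_nat_trans V A B R' S' \<theta>'"
    by (auto simp: vmoncat_hom_def)
  have RS: "R = R'" "S = S'"
    using eq lax by (auto simp: x y P_2cell_def intro: P_1cell_inj)
  have "\<theta> = \<theta>'"
  proof (rule extensionalityI[of _ "vObj A"])
    show "\<theta> \<in> extensional (vObj A)" "\<theta>' \<in> extensional (vObj A)"
      using nat_PiE[OF th(1)] nat_PiE[OF th(2)] by (auto simp: PiE_iff)
    fix a assume "a \<in> vObj A"
    then show "\<theta> a = \<theta>' a"
      using eq by (auto simp: x y P_2cell_def dest!: fun_cong[where x = a])
  qed
  then show "x = y" by (simp add: x y RS)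
qed

lemma P2_surj:
  assumes "y \<in> Arr H'"
  shows "\<exists>x \<in> Arr H. P2 x = y"
proof -
  obtain Q Q' \<Theta> where y: "y = Tag Q Q' \<Theta>" and Q: "modtens_1cell V X Y Q" "modtens_1cell V X Y Q'"
    and \<Theta>: "modtens_2cell V X Y Q Q' \<Theta>"
    using assms by (auto simp: modtens_hom_def)
  obtain R S where R: "lax_enriched_monoidal_functor V A B R" and S: "lax_enriched_monoidal_functor V A B S"
    and RS: "Q = PR R" "Q' = PR S"
    using P_1cell_surj[OF Q(1)] P_1cell_surj[OF Q(2)] by blast
  have X: "mtCat X = underlying V A" "mtCat Y = underlying V B" by (simp_all add: P_0cell_def)
  define \<theta> where "\<theta> = (\<lambda>a\<in>vObj A. uelt (\<Theta> a))"
  note T = modtens_2cellD[OF \<Theta>]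
  have \<Theta>_eq: "\<Theta> a = Elt (vfO R a) (vfO S a) (\<theta> a)" "\<theta> a \<in> hom V \<one>\<^bsub>V\<^esub> (vHom B (vfO R a) (vfO S a))"
    if "a \<in> vObj A" for a
    using T(2-4)[of a] that by (auto simp: X RS underlying_def P_1cell_simps \<theta>_def)
  have th: "\<theta> \<in> (\<Pi>\<^sub>E a \<in> vObj A. hom V \<one>\<^bsub>V\<^esub> (vHom B (vfO R a) (vfO S a)))"
    using \<Theta>_eq(2) by (simp add: PiE_iff \<theta>_def)
  have \<Theta>': "(\<lambda>a\<in>vObj A. Elt (vfO R a) (vfO S a) (\<theta> a)) = \<Theta>"
    by (rule extensionalityI[of _ "vObj A"]) (use T(1) \<Theta>_eq in \<open>auto simp: X underlying_def\<close>)
  have "P2 (Tag R S \<theta>) = y"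
    by (simp add: P_2cell_def \<Theta>' y RS)
  moreover have "Tag R S \<theta> \<in> hom H R S"
    by (rule P2_reflect[OF _ R S th]) (use calculation y \<Theta> Q RS in \<open>simp add: hom_modtens_hom\<close>)
  ultimately show ?thesis by (auto simp: hom_def)
qed

lemma P2_ide:
  assumes "R \<in> Obj H"
  shows "P2 (Ide H R) = Ide H' (PR R)"
  by (auto simp: P_2cell_def vmoncat_hom_def modtens_hom_def P_0cell_def underlying_def P_1cell_def fun_eq_iff)

lemma P2_cmp:
  assumes "x \<in> hom H R S" "y \<in> hom H S Q"
  shows "P2 (y \<cdot>\<^bsub>H\<^esub> x) = P2 y \<cdot>\<^bsub>H'\<^esub> P2 x"
  using assms
  by (auto simp: hom_vmoncat_hom)
     (auto simp: P_2cell_def vmoncat_hom_def modtens_hom_def P_0cell_def underlying_def fun_eq_iff)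

lemma category_H': "category H'"
  by (rule category_modtens_hom[OF A.P_object B.P_object])

lemma category_H: "category H"
proof (rule category_reflect[OF category_H', where F = P2 and obj = PR])
  fix R assume R: "R \<in> Obj H"
  then have lax: "lax_enriched_monoidal_functor V A B R" by (simp add: vmoncat_hom_def)
  note [simp] = lax_enrichedD(6-16)[OF lax]
  have "Ide H' (PR R) \<in> hom H' (PR R) (PR R)"
    using category.ide_in[OF category_H', of "PR R"] P_1cell_in[OF lax] by (simp add: modtens_hom_def)
  then have "P2 (Tag R R (\<lambda>a\<in>vObj A. vId B (vfO R a))) \<in> hom H' (PR R) (PR R)"
    using P2_ide[OF R] by (simp add: vmoncat_hom_def)
  from P2_reflect[OF this lax lax] show "Ide H R \<in> hom H R R"
    by (simp add: vmoncat_hom_def hom_def)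
next
  fix x y R S Q assume x: "x \<in> hom H R S" and y: "y \<in> hom H S Q"
  then obtain \<theta> \<psi> where xy: "x = Tag R S \<theta>" "y = Tag S Q \<psi>"
    and lax: "lax_enriched_monoidal_functor V A B R" "lax_enriched_monoidal_functor V A B S"
      "lax_enriched_monoidal_functor V A B Q"
    and th: "graded_monoidal_nat_trans V A B R S \<theta>" "graded_monoidal_nat_trans V A B S Q \<psi>"
    by (auto simp: hom_vmoncat_hom)
  note [simp] = lax_enrichedD(6-16)[OF lax(1)] lax_enrichedD(6-16)[OF lax(2)] lax_enrichedD(6-16)[OF lax(3)]
  have [simp]: "\<theta> a \<in> Arr V" "Dom V (\<theta> a) = \<one>\<^bsub>V\<^esub>" "Cod V (\<theta> a) = vHom B (vfO R a) (vfO S a)"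
    "\<psi> a \<in> Arr V" "Dom V (\<psi> a) = \<one>\<^bsub>V\<^esub>" "Cod V (\<psi> a) = vHom B (vfO S a) (vfO Q a)" if "a \<in> vObj A" for a
    using nat_PiE[OF th(1)] nat_PiE[OF th(2)] that by (auto simp: PiE_iff hom_def)
  have eq: "y \<cdot>\<^bsub>H\<^esub> x = Tag R Q (\<lambda>a\<in>vObj A. ucmp V B (vfO R a) (vfO S a) (vfO Q a) (\<psi> a) (\<theta> a))"
    by (simp add: xy vmoncat_hom_def)
  have "P2 (y \<cdot>\<^bsub>H\<^esub> x) \<in> hom H' (PR R) (PR Q)"
    unfolding P2_cmp[OF x y] by (rule category.cmp_in[OF category_H' P2_in[OF x] P2_in[OF y]])
  from P2_reflect[OF this[unfolded eq] lax(1,3)] show "y \<cdot>\<^bsub>H\<^esub> x \<in> hom H R Q"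
    unfolding eq by (simp add: hom_def ucmp_def)
qed (auto simp: P2_in P2_ide P2_cmp P2_inj, auto simp: vmoncat_hom_def)

lemma cfunctor_P: "cfunctor H H' \<lparr>FO = PR, FA = P2\<rparr>"
  by (rule cfunctor.intro[OF category_H category_H'], unfold_locales)
     (auto simp: P2_in P2_ide P2_cmp P_1cell_in, auto simp: vmoncat_hom_def modtens_hom_def P_1cell_in)

lemma equivalence_P: "equivalence_of_categories H H' \<lparr>FO = PR, FA = P2\<rparr>"
proof (rule equivalence_of_bijective[OF cfunctor_P])
  show "\<exists>a\<in>Obj H. FO \<lparr>FO = PR, FA = P2\<rparr> a = b" if "b \<in> Obj H'" for b
    using P_1cell_surj[of b] that by (auto simp: vmoncat_hom_def modtens_hom_def)
qed (use PR_inj P2_inj P2_surj in auto)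

end

section \<open>Composition of enriched functors\<close>

context moncat_object
begin

lemma id1_in: "lax_enriched_monoidal_functor V A A (vmoncat_id1 V A)"
proof -
  interpret P: moncat_pair V A l A l ..
  have "strict_lax_monoidal_functor G G (fid G) (\<lambda>a\<in>Obj G. \<lambda>b\<in>Obj G. Ide G (a \<odot>\<^bsub>G\<^esub> b))"
    by (rule lax_functor_id[OF G.whisker_category_graded]) auto
  then have "P.graded_lax (fid G) (\<lambda>a\<in>Obj G. \<lambda>b\<in>Obj G. Ide G (a \<odot>\<^bsub>G\<^esub> b))"
    unfolding graded_lax_functor_def by (auto simp: fid_def)
  then show ?thesis
    by (rule P.enriched_of_graded(1))
       (auto simp: vmoncat_id1_def fid_def graded_cat_simps)
qed

lemma P_id1: "P_1cell V A l A l (vmoncat_id1 V A) = modtens_id1 V (P_0cell V A l)"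
proof -
  interpret P: moncat_pair V A l A l ..
  have "mtCoh (P.PR (vmoncat_id1 V A)) v = Ide G (FO (laF l) v)" if v [simp]: "v \<in> Obj V" for v
  proof -
    have "FA (graded_fun V (vmoncat_id1 V A)) (univ v) = univ v"
      by (simp add: univ_def vmoncat_id1_def)
    then show ?thesis
      using G.hat_eqI[of "univ v" "Ide G (FO (laF l) v)"] by (simp add: P.P_1cell_coh[OF id1_in])
  qed
  moreover have "mtF (P_0cell V A l) = laF l" "mtCat (P_0cell V A l) = G.pure"
    by (rule G.models_data[OF models_P])+
  ultimately have coh: "mtCoh (P.PR (vmoncat_id1 V A)) = mtCoh (modtens_id1 V (P_0cell V A l))"
    by (intro extensionalityI[of _ "Obj V"]) (auto simp: modtens_id1_def P.P_1cell_ext)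
  show ?thesis
  proof (rule mt1cell.equality)
    show "mtR (P.PR (vmoncat_id1 V A)) = mtR (modtens_id1 V (P_0cell V A l))"
      by (rule fctr.equality)
        (auto simp: P_1cell_def modtens_id1_def P_0cell_def fid_def vmoncat_id1_def underlying_def hom_def fun_eq_iff)
    show "mtLax (P.PR (vmoncat_id1 V A)) = mtLax (modtens_id1 V (P_0cell V A l))"
      by (auto simp: P_1cell_def modtens_id1_def P_0cell_def vmoncat_id1_def underlying_def fun_eq_iff)
  qed (simp_all add: coh)
qed

end

lemma (in moncat_pair) hat_on_eta:
  assumes R: "lax_enriched_monoidal_functor V A B R" and v: "v \<in> Obj V"
  shows "B.G.hat (on_eta R v) \<in> Arr B.G" "grade V (B.G.hat (on_eta R v)) = \<one>\<^bsub>V\<^esub>"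
    "Dom B.G (B.G.hat (on_eta R v)) = FO (laF k) v" "Cod B.G (B.G.hat (on_eta R v)) = vfO R (FO (laF l) v)"
    "B.G.hat (on_eta R v) \<cdot>\<^bsub>B.G\<^esub> B.univ v = on_eta R v"
proof -
  interpret R: pure_cell V A.G "grade V" "regrade V" "laF l" A.univ B.G "grade V" "regrade V" "laF k" B.univ
    "mtR (PR R)" "mtLax (PR R)" "on_eta R" by (rule P_1cell_pure_cell(1)[OF R])
  have "FO (laF l) v \<in> vObj A" using A.G.F_obj[OF v] by (simp add: graded_cat_simps(1))
  then show "B.G.hat (on_eta R v) \<in> Arr B.G" "grade V (B.G.hat (on_eta R v)) = \<one>\<^bsub>V\<^esub>"
    "Dom B.G (B.G.hat (on_eta R v)) = FO (laF k) v" "Cod B.G (B.G.hat (on_eta R v)) = vfO R (FO (laF l) v)"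
    "B.G.hat (on_eta R v) \<cdot>\<^bsub>B.G\<^esub> B.univ v = on_eta R v"
    using B.G.hat_arr[OF R.s_arr(1)[OF v]] B.G.hat_eta[OF R.s_arr(1)[OF v]] v
    by (simp_all add: R.s_arr P_1cell_simps)
qed

locale moncat_triple = AB: moncat_pair V A l B k + BC: moncat_pair V B k C m
  for V :: "('v, 'm) braided_moncat"
    and A :: "('a, 'v, 'm) vmoncat" and l :: "('v, 'm, 'a, 'h) ladj"
    and B :: "('a, 'v, 'm) vmoncat" and k :: "('v, 'm, 'a, 'h) ladj"
    and C :: "('a, 'v, 'm) vmoncat" and m :: "('v, 'm, 'a, 'h) ladj"
begin

sublocale AC: moncat_pair V A l C m ..

text \<open>
  Composites are formed among graded functors, where lax monoidal functors compose as usual.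
\<close>

lemma cmp1_in:
  assumes R: "lax_enriched_monoidal_functor V A B R" and S: "lax_enriched_monoidal_functor V B C S"
  shows "lax_enriched_monoidal_functor V A C (vmoncat_cmp1 V A B C S R)"
proof -
  note [simp] = lax_enrichedD(6-16)[OF R] lax_enrichedD(6-16)[OF S]
  let ?T = "fcomp AB.A.G (graded_fun V S) (graded_fun V R)"
  let ?\<rho> = "\<lambda>a\<in>Obj AB.A.G. \<lambda>b\<in>Obj AB.A.G. FA (graded_fun V S) (graded_laxitor A B R a b :: ('a, 'm, 'h) uarr) \<cdot>\<^bsub>BC.B.G\<^esub>
     graded_laxitor B C S (vfO R a) (vfO R b)"
  have "strict_lax_monoidal_functor AB.A.G AB.B.G (graded_fun V R) (graded_laxitor A B R)"
    using AB.graded_of_enriched[OF R] unfolding graded_lax_functor_def by blast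
  moreover have "strict_lax_monoidal_functor AB.B.G BC.B.G (graded_fun V S) (graded_laxitor B C S)"
    using BC.graded_of_enriched[OF S] unfolding graded_lax_functor_def by blast
  ultimately have "strict_lax_monoidal_functor AB.A.G BC.B.G ?T ?\<rho>"
    using lax_functor_fcomp[OF _ _ AB.A.G.whisker_category_graded AB.B.G.whisker_category_graded
          BC.B.G.whisker_category_graded] by fastforce
  then have "AC.graded_lax ?T ?\<rho>"
    unfolding graded_lax_functor_def
    by (auto simp: fcomp_def graded_cat_simps graded_laxitor_def elim!: Arr_graded_catE)
  then show ?thesis
    by (rule AC.enriched_of_graded(1))
       (auto simp: vmoncat_cmp1_def fcomp_def graded_cat_simps graded_laxitor_def ucmp_def)
qed

lemma P_cmp1:
  assumes R: "lax_enriched_monoidal_functor V A B R" and S: "lax_enriched_monoidal_functor V B C S"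
  shows "AC.PR (vmoncat_cmp1 V A B C S R) = modtens_cmp1 V AB.X AB.Y BC.Y (BC.PR S) (AB.PR R)"
    (is "?l = ?r")
proof -
  note [simp] = lax_enrichedD(6-16)[OF R] lax_enrichedD(6-16)[OF S]
  interpret S: lax_functor AB.B.G BC.B.G "graded_fun V S" "graded_laxitor B C S"
    using BC.graded_of_enriched[OF S] unfolding graded_lax_functor_def by (blast intro: lax_functorI)
  interpret S1: pure_cell V AB.B.G "grade V" "regrade V" "laF k" AB.B.univ BC.B.G "grade V" "regrade V" "laF m" BC.B.univ
    "mtR (BC.PR S)" "mtLax (BC.PR S)" "BC.on_eta S" by (rule BC.P_1cell_pure_cell(1)[OF S])
  have cat: "mtCat AB.X = underlying V A" "mtCat AB.Y = underlying V B" "mtCat BC.Y = underlying V C"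
    by (simp_all add: P_0cell_def)
  have cat': "mtCat BC.Y = BC.B.G.pure"
    by (rule BC.B.G.models_data[OF BC.B.models_P])
  have coh: "mtCoh ?l v = mtCoh ?r v" if v [simp]: "v \<in> Obj V" for v
  proof -
    have [simp]: "FO (laF l) v \<in> vObj A" using AB.A.G.F_obj[OF v] by (simp add: graded_cat_simps(1))
    let ?h = "AB.B.G.hat (AB.on_eta R v)" and ?g = "BC.B.G.hat (BC.on_eta S v)"
    note h = AB.hat_on_eta(1-4)[OF R v] and heta = AB.hat_on_eta(5)[OF R v]
    note g = BC.hat_on_eta(1-4)[OF S v] and geta = BC.hat_on_eta(5)[OF S v]
    have Sh: "FA (mtR (BC.PR S)) ?h = FA (graded_fun V S) ?h"
      using h by (simp add: BC.P_1cell_simps BC.Arr_underlying)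
    have Sh': "FA (graded_fun V S) ?h \<in> Arr BC.B.G" "grade V (FA (graded_fun V S) ?h) = \<one>\<^bsub>V\<^esub>"
      "Dom BC.B.G (FA (graded_fun V S) ?h) = vfO S (FO (laF k) v)"
      "Cod BC.B.G (FA (graded_fun V S) ?h) = vfO S (vfO R (FO (laF l) v))"
      using S1.R_arr[OF h(1,2)] h S.FA_arr[OF h(1)] by (simp_all add: Sh)
    have "(FA (graded_fun V S) ?h \<cdot>\<^bsub>BC.B.G\<^esub> ?g) \<cdot>\<^bsub>BC.B.G\<^esub> BC.B.univ v = FA (graded_fun V S) ?h \<cdot>\<^bsub>BC.B.G\<^esub> BC.on_eta S v"
      using Sh' g v by (simp add: geta)
    also have "\<dots> = FA (graded_fun V S) (AB.on_eta R v)"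
      using h heta by (simp flip: S.FA_cmp_arr)
    also have "\<dots> = AC.on_eta (vmoncat_cmp1 V A B C S R) v"
      by (simp add: vmoncat_cmp1_def AB.A.univ_def)
    finally have eq: "(FA (graded_fun V S) ?h \<cdot>\<^bsub>BC.B.G\<^esub> ?g) \<cdot>\<^bsub>BC.B.G\<^esub> BC.B.univ v = AC.on_eta (vmoncat_cmp1 V A B C S R) v" .
    interpret Q: pure_cell V AB.A.G "grade V" "regrade V" "laF l" AB.A.univ BC.B.G "grade V" "regrade V" "laF m" BC.B.univ
      "mtR ?l" "mtLax ?l" "AC.on_eta (vmoncat_cmp1 V A B C S R)" by (rule AC.P_1cell_pure_cell(1)[OF cmp1_in[OF R S]])
    have "BC.B.G.hat (AC.on_eta (vmoncat_cmp1 V A B C S R) v) = FA (graded_fun V S) ?h \<cdot>\<^bsub>BC.B.G\<^esub> ?g"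
      by (rule BC.B.G.hat_eqI)
         (use Sh' g eq Q.s_arr[OF v] in \<open>simp_all add: AC.P_1cell_simps vmoncat_cmp1_def\<close>)
    then show ?thesis
      by (simp add: AC.P_1cell_coh[OF cmp1_in[OF R S]] modtens_cmp1_def cat' AB.P_1cell_coh[OF R] BC.P_1cell_coh[OF S] Sh)
  qed
  show ?thesis
  proof (rule mt1cell.equality)
    show "mtR ?l = mtR ?r"
      by (rule fctr.equality)
        (auto simp: P_1cell_def modtens_cmp1_def P_0cell_def fcomp_def vmoncat_cmp1_def underlying_def hom_def fun_eq_iff)
    show "mtLax ?l = mtLax ?r"
      by (auto simp: P_1cell_def modtens_cmp1_def P_0cell_def vmoncat_cmp1_def underlying_def hom_def fun_eq_iff)
    show "mtCoh ?l = mtCoh ?r"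
      by (rule extensionalityI[of _ "Obj V"]) (auto simp: coh AC.P_1cell_ext modtens_cmp1_def)
  qed simp
qed

lemma P_hcmp:
  assumes "x \<in> Arr AB.H" "y \<in> Arr BC.H"
  shows "AC.P2 (vmoncat_hcmp V A B C y x) = modtens_hcmp V AB.X AB.Y BC.Y (BC.P2 y) (AB.P2 x)"
proof -
  obtain R S \<theta> where x: "x = Tag R S \<theta>"
    and R: "lax_enriched_monoidal_functor V A B R" and S: "lax_enriched_monoidal_functor V A B S"
    and th: "graded_monoidal_nat_trans V A B R S \<theta>"
    using assms(1) by (auto simp: vmoncat_hom_def)
  obtain R' S' \<psi> where y: "y = Tag R' S' \<psi>"
    and R': "lax_enriched_monoidal_functor V B C R'" and S': "lax_enriched_monoidal_functor V B C S'"
    using assms(2) by (auto simp: vmoncat_hom_def)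
  note [simp] = lax_enrichedD(6-16)[OF R] lax_enrichedD(6-16)[OF S] lax_enrichedD(6-16)[OF R'] lax_enrichedD(6-16)[OF S']
  have "\<theta> a \<in> Arr V" "Dom V (\<theta> a) = \<one>\<^bsub>V\<^esub>" "Cod V (\<theta> a) = vHom B (vfO R a) (vfO S a)" if "a \<in> vObj A" for a
    using AB.nat_PiE[OF th] that by (auto simp: PiE_iff hom_def)
  then show ?thesis
    using P_cmp1[OF R R'] P_cmp1[OF S S']
    by (auto simp: x y vmoncat_hcmp_def modtens_hcmp_def P_2cell_def Let_def fun_eq_iff)
       (auto simp: P_1cell_def P_0cell_def underlying_def vmoncat_cmp1_def hom_def)
qed

lemma hcmp_in:
  assumes x: "x \<in> hom AB.H R S" and y: "y \<in> hom BC.H R' S'"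
  shows "vmoncat_hcmp V A B C y x \<in> hom AC.H (vmoncat_cmp1 V A B C R' R) (vmoncat_cmp1 V A B C S' S)"
proof -
  obtain \<theta> where x': "x = Tag R S \<theta>"
    and R: "lax_enriched_monoidal_functor V A B R" and S: "lax_enriched_monoidal_functor V A B S"
    and th: "graded_monoidal_nat_trans V A B R S \<theta>"
    using x by (auto simp: hom_vmoncat_hom)
  obtain \<psi> where y': "y = Tag R' S' \<psi>"
    and R': "lax_enriched_monoidal_functor V B C R'" and S': "lax_enriched_monoidal_functor V B C S'"
    and ps: "graded_monoidal_nat_trans V B C R' S' \<psi>"
    using y by (auto simp: hom_vmoncat_hom)
  note [simp] = lax_enrichedD(6-16)[OF R] lax_enrichedD(6-16)[OF S] lax_enrichedD(6-16)[OF R'] lax_enrichedD(6-16)[OF S']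
  have [simp]: "\<theta> a \<in> Arr V" "Dom V (\<theta> a) = \<one>\<^bsub>V\<^esub>" "Cod V (\<theta> a) = vHom B (vfO R a) (vfO S a)" if "a \<in> vObj A" for a
    using AB.nat_PiE[OF th] that by (auto simp: PiE_iff hom_def)
  have [simp]: "\<psi> a \<in> Arr V" "Dom V (\<psi> a) = \<one>\<^bsub>V\<^esub>" "Cod V (\<psi> a) = vHom C (vfO R' a) (vfO S' a)" if "a \<in> vObj B" for a
    using BC.nat_PiE[OF ps] that by (auto simp: PiE_iff hom_def)
  have arr: "x \<in> Arr AB.H" "y \<in> Arr BC.H" using x y by (auto simp: hom_def)
  have 2: "AB.P2 x \<in> hom (modtens_hom V AB.X AB.Y) (AB.PR R) (AB.PR S)"
    "BC.P2 y \<in> hom (modtens_hom V AB.Y BC.Y) (BC.PR R') (BC.PR S')"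
    by (rule AB.P2_in[OF x], rule BC.P2_in[OF y])
  interpret L: two_category "VModTens V :: (('v, 'm, 'a, ('a, 'm, 'h) uarr) modtens, _, _) twocat"
    by (rule two_category_VModTens[OF AB.A.V.braided_monoidal_category_axioms])
  have ob: "AB.X \<in> Obj0 (VModTens V)" "AB.Y \<in> Obj0 (VModTens V)" "BC.Y \<in> Obj0 (VModTens V)"
    using AB.A.P_object AB.B.P_object BC.B.P_object
    by (simp_all add: VModTens_def modtens_object_def modtens_object_axioms_def)
  have "AC.P2 (vmoncat_hcmp V A B C y x) \<in> hom AC.H' (AC.PR (vmoncat_cmp1 V A B C R' R)) (AC.PR (vmoncat_cmp1 V A B C S' S))"
    unfolding P_hcmp[OF arr] P_cmp1[OF R R'] P_cmp1[OF S S']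
    using L.HCmp_in[OF ob, of "AB.P2 x" _ _ "BC.P2 y"] 2 by (simp add: VModTens_def)
  then show ?thesis
    using cmp1_in[OF R R'] cmp1_in[OF S S']
    unfolding vmoncat_hcmp_def x' y' Let_def tagged.sel
    by (rule AC.P2_reflect) (auto simp: vmoncat_cmp1_def ucmp_def hom_def)
qed

end

lemma moncat_object_VMonCat:
  fixes L :: "('a, 'v, 'm) vmoncat \<Rightarrow> ('v, 'm, 'a, 'h) ladj"
  assumes "braided_monoidal_category V" "chosen_left_adjoints V L" "A \<in> Obj0 (VMonCat V TYPE('h))"
  shows "moncat_object V A (L A)"
  using assms
  by (auto simp: moncat_object_def moncat_object_axioms_def enriched_def chosen_left_adjoints_def VMonCat_def vmoncat_0cell_def)

text \<open>
  The laws of a 2-category for enriched categories are reflected along \<open>P\<close>.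
\<close>

lemma two_functor_P:
  fixes V :: "('v, 'm) braided_moncat"
    and L :: "('a, 'v, 'm) vmoncat \<Rightarrow> ('v, 'm, 'a, 'h) ladj"
  assumes V: "braided_monoidal_category V" and L: "chosen_left_adjoints V L"
  shows "two_functor (VMonCat V TYPE('h)) (VModTens V) (P_functor V L)"
proof -
  let ?K = "VMonCat V TYPE('h) :: (('a, 'v, 'm) vmoncat, _, _) twocat"
  have pair: "moncat_pair V A (L A) B (L B)" if "A \<in> Obj0 ?K" "B \<in> Obj0 ?K" for A B
    using moncat_object_VMonCat[OF V L] that by (auto intro: moncat_pair.intro)
  have triple: "moncat_triple V A (L A) B (L B) C (L C)" if "A \<in> Obj0 ?K" "B \<in> Obj0 ?K" "C \<in> Obj0 ?K" for A B C
    using pair that by (auto intro: moncat_triple.intro)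
  note K = VMonCat_def P_functor_def VModTens_def
  note ob = moncat_object_VMonCat[OF V L]
  show ?thesis
  proof (rule two_functor_reflect[OF two_category_VModTens[OF V]], goal_cases)
    case (1 A)
    then show ?case
      using moncat_object.P_object[OF ob[OF 1]]
      by (simp add: K modtens_object_def modtens_object_axioms_def)
  next
    case (2 A B) then show ?case using moncat_pair.cfunctor_P[OF pair] by (simp add: K)
  next
    case (3 A B) then show ?case using moncat_pair.PR_inj[OF pair] by (simp add: K)
  next
    case (4 A B) then show ?case using moncat_pair.P2_inj[OF pair] by (simp add: K)
  next
    case (5 A) then show ?case using moncat_object.id1_in[OF ob[OF 5]] by (simp add: K vmoncat_hom_def)
  next
    case (6 A B C F G)
    then show ?case using moncat_triple.cmp1_in[OF triple[OF 6(1-3)]] by (simp add: K vmoncat_hom_def)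
  next
    case (7 A B C x y F F' G G')
    then show ?case using moncat_triple.hcmp_in[OF triple[OF 7(1-3)]] by (simp add: K)
  next
    case (8 A) then show ?case using moncat_object.P_id1[OF ob[OF 8]] by (simp add: K)
  next
    case (9 A B C F G)
    then show ?case using moncat_triple.P_cmp1[OF triple[OF 9(1-3)]] by (simp add: K vmoncat_hom_def)
  next
    case (10 A B C x y)
    then show ?case using moncat_triple.P_hcmp[OF triple[OF 10(1-3)]] by (simp add: K)
  qed
qed

section \<open>The graded category of a module tensor category\<close>

text \<open>
  A product of graded arrows is assembled from the two one-sided products with an object, in the
  order in which \<open>f \<otimes> g\<close> is first \<open>f\<close>, then \<open>g\<close>.  The interchange law then reduces to the
  exchange of one left and one right product, which costs one braiding.
\<close>

locale whiskered_graded = V: braided_monoidal_category V + category G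
  for V :: "('v, 'm) braided_moncat" and G :: "('a, 'g) moncat" (structure) +
  fixes gr :: "'g \<Rightarrow> 'v" and act :: "'g \<Rightarrow> 'm \<Rightarrow> 'g"  (infixl "\<lhd>" 80)
    and lw :: "'a \<Rightarrow> 'g \<Rightarrow> 'g" and rw :: "'g \<Rightarrow> 'a \<Rightarrow> 'g"
  assumes wunit_obj [simp]: "\<one> \<in> Obj G"
    and wtenO_obj [simp]: "a \<in> Obj G \<Longrightarrow> b \<in> Obj G \<Longrightarrow> a \<odot> b \<in> Obj G"
    and wtenO_assoc [simp]: "a \<in> Obj G \<Longrightarrow> b \<in> Obj G \<Longrightarrow> c \<in> Obj G \<Longrightarrow> (a \<odot> b) \<odot> c = a \<odot> (b \<odot> c)"
    and wtenO_unit [simp]: "a \<in> Obj G \<Longrightarrow> \<one> \<odot> a = a" "a \<in> Obj G \<Longrightarrow> a \<odot> \<one> = a"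
    and wgr_obj [simp]: "f \<in> Arr G \<Longrightarrow> gr f \<in> Obj V"
    and wgr_ide [simp]: "a \<in> Obj G \<Longrightarrow> gr (Ide G a) = \<one>\<^bsub>V\<^esub>"
    and wgr_cmp [simp]: "f \<in> Arr G \<Longrightarrow> g \<in> Arr G \<Longrightarrow> Cod G f = Dom G g \<Longrightarrow> gr (g \<cdot> f) = gr f \<odot>\<^bsub>V\<^esub> gr g"
    and wact_arr [simp]:
      "f \<in> Arr G \<Longrightarrow> p \<in> Arr V \<Longrightarrow> Cod V p = gr f \<Longrightarrow> f \<lhd> p \<in> Arr G"
      "f \<in> Arr G \<Longrightarrow> p \<in> Arr V \<Longrightarrow> Cod V p = gr f \<Longrightarrow> Dom G (f \<lhd> p) = Dom G f"
      "f \<in> Arr G \<Longrightarrow> p \<in> Arr V \<Longrightarrow> Cod V p = gr f \<Longrightarrow> Cod G (f \<lhd> p) = Cod G f"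
      "f \<in> Arr G \<Longrightarrow> p \<in> Arr V \<Longrightarrow> Cod V p = gr f \<Longrightarrow> gr (f \<lhd> p) = Dom V p"
    and wact_ide [simp]: "f \<in> Arr G \<Longrightarrow> gr f = v \<Longrightarrow> f \<lhd> Ide V v = f"
    and wact_act: "f \<in> Arr G \<Longrightarrow> p \<in> Arr V \<Longrightarrow> q \<in> Arr V \<Longrightarrow> Cod V p = gr f \<Longrightarrow> Cod V q = Dom V p \<Longrightarrow>
      f \<lhd> p \<lhd> q = f \<lhd> (p \<cdot>\<^bsub>V\<^esub> q)"
    and wcmp_act: "f \<in> Arr G \<Longrightarrow> g \<in> Arr G \<Longrightarrow> Cod G f = Dom G g \<Longrightarrow> p \<in> Arr V \<Longrightarrow> q \<in> Arr V \<Longrightarrow>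
      Cod V p = gr f \<Longrightarrow> Cod V q = gr g \<Longrightarrow> (g \<lhd> q) \<cdot> (f \<lhd> p) = (g \<cdot> f) \<lhd> (p \<otimes>\<^bsub>V\<^esub> q)"
    and lw_arr [simp]: "x \<in> Obj G \<Longrightarrow> f \<in> Arr G \<Longrightarrow> lw x f \<in> Arr G"
      "x \<in> Obj G \<Longrightarrow> f \<in> Arr G \<Longrightarrow> Dom G (lw x f) = x \<odot> Dom G f"
      "x \<in> Obj G \<Longrightarrow> f \<in> Arr G \<Longrightarrow> Cod G (lw x f) = x \<odot> Cod G f"
      "x \<in> Obj G \<Longrightarrow> f \<in> Arr G \<Longrightarrow> gr (lw x f) = gr f"
    and rw_arr [simp]: "x \<in> Obj G \<Longrightarrow> f \<in> Arr G \<Longrightarrow> rw f x \<in> Arr G"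
      "x \<in> Obj G \<Longrightarrow> f \<in> Arr G \<Longrightarrow> Dom G (rw f x) = Dom G f \<odot> x"
      "x \<in> Obj G \<Longrightarrow> f \<in> Arr G \<Longrightarrow> Cod G (rw f x) = Cod G f \<odot> x"
      "x \<in> Obj G \<Longrightarrow> f \<in> Arr G \<Longrightarrow> gr (rw f x) = gr f"
    and lw_ide [simp]: "x \<in> Obj G \<Longrightarrow> a \<in> Obj G \<Longrightarrow> lw x (Ide G a) = Ide G (x \<odot> a)"
    and rw_ide [simp]: "x \<in> Obj G \<Longrightarrow> a \<in> Obj G \<Longrightarrow> rw (Ide G a) x = Ide G (a \<odot> x)"
    and lw_cmp: "x \<in> Obj G \<Longrightarrow> f \<in> Arr G \<Longrightarrow> g \<in> Arr G \<Longrightarrow> Cod G f = Dom G g \<Longrightarrow> lw x (g \<cdot> f) = lw x g \<cdot> lw x f"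
    and rw_cmp: "x \<in> Obj G \<Longrightarrow> f \<in> Arr G \<Longrightarrow> g \<in> Arr G \<Longrightarrow> Cod G f = Dom G g \<Longrightarrow> rw (g \<cdot> f) x = rw g x \<cdot> rw f x"
    and lw_lw: "x \<in> Obj G \<Longrightarrow> y \<in> Obj G \<Longrightarrow> f \<in> Arr G \<Longrightarrow> lw x (lw y f) = lw (x \<odot> y) f"
    and rw_rw: "x \<in> Obj G \<Longrightarrow> y \<in> Obj G \<Longrightarrow> f \<in> Arr G \<Longrightarrow> rw (rw f x) y = rw f (x \<odot> y)"
    and lw_rw: "x \<in> Obj G \<Longrightarrow> y \<in> Obj G \<Longrightarrow> f \<in> Arr G \<Longrightarrow> rw (lw x f) y = lw x (rw f y)"
    and lw_unit [simp]: "f \<in> Arr G \<Longrightarrow> lw \<one> f = f" and rw_unit [simp]: "f \<in> Arr G \<Longrightarrow> rw f \<one> = f"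
    and lw_act: "x \<in> Obj G \<Longrightarrow> f \<in> Arr G \<Longrightarrow> p \<in> Arr V \<Longrightarrow> Cod V p = gr f \<Longrightarrow> lw x (f \<lhd> p) = lw x f \<lhd> p"
    and rw_act: "x \<in> Obj G \<Longrightarrow> f \<in> Arr G \<Longrightarrow> p \<in> Arr V \<Longrightarrow> Cod V p = gr f \<Longrightarrow> rw (f \<lhd> p) x = rw f x \<lhd> p"
    and exchange: "f \<in> Arr G \<Longrightarrow> g \<in> Arr G \<Longrightarrow>
      rw f (Cod G g) \<cdot> lw (Dom G f) g = (lw (Cod G f) g \<cdot> rw f (Dom G g)) \<lhd> Braid V (gr g) (gr f)"
    and wten: "f \<in> Arr G \<Longrightarrow> g \<in> Arr G \<Longrightarrow> f \<otimes> g = lw (Cod G f) g \<cdot> rw f (Dom G g)"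
begin

lemma whiskered_interchange:
  assumes [simp]: "f \<in> Arr G" "f' \<in> Arr G" "g \<in> Arr G" "g' \<in> Arr G" "Cod G f = Dom G f'" "Cod G g = Dom G g'"
  shows "(f' \<otimes> g') \<cdot> (f \<otimes> g) = ((f' \<cdot> f) \<otimes> (g' \<cdot> g)) \<lhd>
        (Ide V (gr f) \<otimes>\<^bsub>V\<^esub> Braid V (gr g) (gr f') \<otimes>\<^bsub>V\<^esub> Ide V (gr g'))"
proof -
  let ?c = "Cod G f'" and ?d = "Dom G g" and ?\<beta> = "Braid V (gr g) (gr f')"
  let ?E = "lw ?c g \<cdot> rw f' ?d" and ?D = "rw f ?d" and ?A = "lw ?c g'"
  have "(f' \<otimes> g') \<cdot> (f \<otimes> g) = ?A \<cdot> ((rw f' (Cod G g) \<cdot> lw (Dom G f') g) \<cdot> ?D)"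
    by (simp add: wten)
  also have "rw f' (Cod G g) \<cdot> lw (Dom G f') g = ?E \<lhd> ?\<beta>"
    by (rule exchange) simp_all
  also have "(?E \<lhd> ?\<beta>) \<cdot> ?D = (?E \<cdot> ?D) \<lhd> (Ide V (gr f) \<otimes>\<^bsub>V\<^esub> ?\<beta>)"
    using wcmp_act[of ?D ?E "Ide V (gr f)" ?\<beta>] by simp
  also have "?A \<cdot> \<dots> = (?A \<cdot> (?E \<cdot> ?D)) \<lhd> ((Ide V (gr f) \<otimes>\<^bsub>V\<^esub> ?\<beta>) \<otimes>\<^bsub>V\<^esub> Ide V (gr g'))"
    using wcmp_act[of "?E \<cdot> ?D" ?A "Ide V (gr f) \<otimes>\<^bsub>V\<^esub> ?\<beta>" "Ide V (gr g')"]
    by (simp del: V.tenM_assoc_arr)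
  also have "?A \<cdot> (?E \<cdot> ?D) = (f' \<cdot> f) \<otimes> (g' \<cdot> g)"
    by (simp add: wten lw_cmp rw_cmp)
  finally show ?thesis .
qed

lemma graded_monoidal: "graded_monoidal V G gr act"
proof (rule graded_monoidal.intro[OF V.braided_monoidal_category_axioms category_axioms], unfold_locales, goal_cases)
  case (14 f p q) then show ?case by (rule wact_act)
next
  case (15 f g p q) then show ?case by (rule wcmp_act)
next
  case (20 f g p q)
  then show ?case by (simp add: wten lw_act rw_act wcmp_act)
next
  case (22 f g h)
  then show ?case by (simp add: wten lw_cmp rw_cmp lw_lw rw_rw lw_rw)
next
  case (25 f f' g g') then show ?case by (rule whiskered_interchange)
qed (simp_all add: wten)

end

context modtens_object
begin

text \<open>
  The arrows \<open>a F(v) \<rightarrow> b\<close> graded by \<open>v\<close>, together with \<open>a\<close>, which is not determined by \<open>a F(v)\<close>.  Composition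
  splits \<open>F(u v)\<close> by the oplaxitor and applies \<open>f\<close> next to \<open>F(v)\<close>; the product first moves \<open>F(u)\<close> past \<open>b\<close>.
\<close>

definition M :: "('a, 'a \<times> 'v \<times> 'h) moncat" where
  "M = \<lparr>Obj = Obj A, Arr = {(a, v, f) | a v f. a \<in> Obj A \<and> v \<in> Obj V \<and> f \<in> Arr A \<and> Dom A f = a \<odot>\<^bsub>A\<^esub> F v},
    Dom = fst, Cod = (\<lambda>(a, v, f). Cod A f), Ide = (\<lambda>a. (a, \<one>\<^bsub>V\<^esub>, Ide A a)),
    Cmp = (\<lambda>(b, v, g) (a, u, f). (a, u \<odot>\<^bsub>V\<^esub> v, g \<cdot>\<^bsub>A\<^esub> ((f \<otimes>\<^bsub>A\<^esub> Ide A (F v)) \<cdot>\<^bsub>A\<^esub> (Ide A a \<otimes>\<^bsub>A\<^esub> \<mu> u v)))),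
    Unit = \<one>\<^bsub>A\<^esub>, TenO = TenO A,
    TenM = (\<lambda>(a, u, f) (b, v, g). (a \<odot>\<^bsub>A\<^esub> b, u \<odot>\<^bsub>V\<^esub> v, (Ide A (Cod A f) \<otimes>\<^bsub>A\<^esub> g) \<cdot>\<^bsub>A\<^esub>
      ((((f \<otimes>\<^bsub>A\<^esub> Ide A b) \<cdot>\<^bsub>A\<^esub> (Ide A a \<otimes>\<^bsub>A\<^esub> e b u)) \<otimes>\<^bsub>A\<^esub> Ide A (F v)) \<cdot>\<^bsub>A\<^esub> (Ide A (a \<odot>\<^bsub>A\<^esub> b) \<otimes>\<^bsub>A\<^esub> \<mu> u v))))\<rparr>"

definition mact :: "'a \<times> 'v \<times> 'h \<Rightarrow> 'm \<Rightarrow> 'a \<times> 'v \<times> 'h" where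
  "mact = (\<lambda>(a, v, f) p. (a, Dom V p, f \<cdot>\<^bsub>A\<^esub> (Ide A a \<otimes>\<^bsub>A\<^esub> FA (mtF X) p)))"

definition mlw :: "'a \<Rightarrow> 'a \<times> 'v \<times> 'h \<Rightarrow> 'a \<times> 'v \<times> 'h" where
  "mlw x = (\<lambda>(a, v, f). (x \<odot>\<^bsub>A\<^esub> a, v, Ide A x \<otimes>\<^bsub>A\<^esub> f))"

definition mrw :: "'a \<times> 'v \<times> 'h \<Rightarrow> 'a \<Rightarrow> 'a \<times> 'v \<times> 'h" where
  "mrw = (\<lambda>(a, v, f) x. (a \<odot>\<^bsub>A\<^esub> x, v, (f \<otimes>\<^bsub>A\<^esub> Ide A x) \<cdot>\<^bsub>A\<^esub> (Ide A a \<otimes>\<^bsub>A\<^esub> e x v)))"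

lemma M_simps [simp]:
  "Obj M = Obj A" "Dom M (a, v, f) = a" "Cod M (a, v, f) = Cod A f" "Ide M a = (a, \<one>\<^bsub>V\<^esub>, Ide A a)"
  "(b, v, g) \<cdot>\<^bsub>M\<^esub> (a, u, f) = (a, u \<odot>\<^bsub>V\<^esub> v, g \<cdot>\<^bsub>A\<^esub> ((f \<otimes>\<^bsub>A\<^esub> Ide A (F v)) \<cdot>\<^bsub>A\<^esub> (Ide A a \<otimes>\<^bsub>A\<^esub> \<mu> u v)))"
  "\<one>\<^bsub>M\<^esub> = \<one>\<^bsub>A\<^esub>" "a \<odot>\<^bsub>M\<^esub> b = a \<odot>\<^bsub>A\<^esub> b"
  "(a, v, f) \<in> Arr M \<longleftrightarrow> a \<in> Obj A \<and> v \<in> Obj V \<and> f \<in> Arr A \<and> Dom A f = a \<odot>\<^bsub>A\<^esub> F v"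
  "mact (a, v, f) p = (a, Dom V p, f \<cdot>\<^bsub>A\<^esub> (Ide A a \<otimes>\<^bsub>A\<^esub> FA (mtF X) p))"
  "mlw x (a, v, f) = (x \<odot>\<^bsub>A\<^esub> a, v, Ide A x \<otimes>\<^bsub>A\<^esub> f)"
  "mrw (a, v, f) x = (a \<odot>\<^bsub>A\<^esub> x, v, (f \<otimes>\<^bsub>A\<^esub> Ide A x) \<cdot>\<^bsub>A\<^esub> (Ide A a \<otimes>\<^bsub>A\<^esub> e x v))"
  by (simp_all add: M_def mact_def mlw_def mrw_def)

lemma M_ten:
  "(a, u, f) \<otimes>\<^bsub>M\<^esub> (b, v, g) = (a \<odot>\<^bsub>A\<^esub> b, u \<odot>\<^bsub>V\<^esub> v, (Ide A (Cod A f) \<otimes>\<^bsub>A\<^esub> g) \<cdot>\<^bsub>A\<^esub>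
      ((((f \<otimes>\<^bsub>A\<^esub> Ide A b) \<cdot>\<^bsub>A\<^esub> (Ide A a \<otimes>\<^bsub>A\<^esub> e b u)) \<otimes>\<^bsub>A\<^esub> Ide A (F v)) \<cdot>\<^bsub>A\<^esub> (Ide A (a \<odot>\<^bsub>A\<^esub> b) \<otimes>\<^bsub>A\<^esub> \<mu> u v)))"
  by (simp add: M_def)

lemma Arr_ME:
  assumes "t \<in> Arr M"
  obtains a v f where "t = (a, v, f)" "a \<in> Obj A" "v \<in> Obj V" "f \<in> Arr A" "Dom A f = a \<odot>\<^bsub>A\<^esub> F v"
  using assms by (auto simp: M_def)

lemma hom_ME:
  assumes "t \<in> hom M a b"
  obtains v f where "t = (a, v, f)" "a \<in> Obj A" "v \<in> Obj V" "f \<in> Arr A" "Dom A f = a \<odot>\<^bsub>A\<^esub> F v"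
    "Cod A f = b"
  using assms by (cases t) (auto simp: hom_def)

lemma slide:
  assumes "f \<in> Arr A" "g \<in> Arr A"
  shows "(Ide A (Cod A f) \<otimes>\<^bsub>A\<^esub> g) \<cdot>\<^bsub>A\<^esub> (f \<otimes>\<^bsub>A\<^esub> Ide A (Dom A g)) = (f \<otimes>\<^bsub>A\<^esub> Ide A (Cod A g)) \<cdot>\<^bsub>A\<^esub> (Ide A (Dom A f) \<otimes>\<^bsub>A\<^esub> g)"
  using assms by (simp add: A.ten_cmp)

lemma category_M: "category M"
proof (unfold_locales, goal_cases)
  case (1 f) then show ?case by (rule Arr_ME) simp
next
  case (2 f) then show ?case by (rule Arr_ME) simp
next
  case (3 a) then show ?case by (simp add: hom_def)
next
  case (4 f a b g c)
  then have f: "f \<in> Arr M" and g: "g \<in> Arr M" by (simp_all add: hom_def)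
  show ?case
    by (rule Arr_ME[OF f], rule Arr_ME[OF g]) (use 4 in \<open>simp add: hom_def\<close>)
next
  case (5 f a b)
  then have f: "f \<in> Arr M" by (simp add: hom_def)
  show ?case by (rule Arr_ME[OF f]) (use 5 in \<open>simp add: hom_def\<close>)
next
  case (6 f a b)
  then have f: "f \<in> Arr M" by (simp add: hom_def)
  show ?case by (rule Arr_ME[OF f]) (use 6 in \<open>auto simp: hom_def\<close>)
next
  case (7 f a b g c h d)
  obtain u f0 where [simp]: "f = (a, u, f0)" "a \<in> Obj A" "u \<in> Obj V" "f0 \<in> Arr A"
    "Dom A f0 = a \<odot>\<^bsub>A\<^esub> F u" "Cod A f0 = b"
    by (rule hom_ME[OF 7(1)])
  obtain v g0 where [simp]: "g = (b, v, g0)" "b \<in> Obj A" "v \<in> Obj V" "g0 \<in> Arr A"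
    "Dom A g0 = b \<odot>\<^bsub>A\<^esub> F v" "Cod A g0 = c"
    by (rule hom_ME[OF 7(2)])
  obtain w h0 where [simp]: "h = (c, w, h0)" "c \<in> Obj A" "w \<in> Obj V" "h0 \<in> Arr A"
    "Dom A h0 = c \<odot>\<^bsub>A\<^esub> F w" "Cod A h0 = d"
    by (rule hom_ME[OF 7(3)])
  let ?I = "Ide A"
  have "(?I b \<otimes>\<^bsub>A\<^esub> \<mu> v w) \<cdot>\<^bsub>A\<^esub> ((f0 \<otimes>\<^bsub>A\<^esub> ?I (F (v \<odot>\<^bsub>V\<^esub> w))) \<cdot>\<^bsub>A\<^esub> (?I a \<otimes>\<^bsub>A\<^esub> \<mu> u (v \<odot>\<^bsub>V\<^esub> w))) =
     (f0 \<otimes>\<^bsub>A\<^esub> ?I (F v \<odot>\<^bsub>A\<^esub> F w)) \<cdot>\<^bsub>A\<^esub> ((?I (a \<odot>\<^bsub>A\<^esub> F u) \<otimes>\<^bsub>A\<^esub> \<mu> v w) \<cdot>\<^bsub>A\<^esub> (?I a \<otimes>\<^bsub>A\<^esub> \<mu> u (v \<odot>\<^bsub>V\<^esub> w)))"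
    using slide[of f0 "\<mu> v w"] by (intro A.cmp_eq_extend) simp_all
  also have "(?I (a \<odot>\<^bsub>A\<^esub> F u) \<otimes>\<^bsub>A\<^esub> \<mu> v w) \<cdot>\<^bsub>A\<^esub> (?I a \<otimes>\<^bsub>A\<^esub> \<mu> u (v \<odot>\<^bsub>V\<^esub> w)) =
      ?I a \<otimes>\<^bsub>A\<^esub> ((?I (F u) \<otimes>\<^bsub>A\<^esub> \<mu> v w) \<cdot>\<^bsub>A\<^esub> \<mu> u (v \<odot>\<^bsub>V\<^esub> w))"
    using A.ten_cmp[of "?I a" "\<mu> u (v \<odot>\<^bsub>V\<^esub> w)" "?I a" "?I (F u) \<otimes>\<^bsub>A\<^esub> \<mu> v w"]
    by (simp add: A.tenM_ide_obj[symmetric] del: A.tenM_ide_obj)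
  also have "\<dots> = (?I a \<otimes>\<^bsub>A\<^esub> (\<mu> u v \<otimes>\<^bsub>A\<^esub> ?I (F w))) \<cdot>\<^bsub>A\<^esub> (?I a \<otimes>\<^bsub>A\<^esub> \<mu> (u \<odot>\<^bsub>V\<^esub> v) w)"
    by (simp add: mu_assoc A.ten_cmp)
  also have "(f0 \<otimes>\<^bsub>A\<^esub> ?I (F v \<odot>\<^bsub>A\<^esub> F w)) \<cdot>\<^bsub>A\<^esub> ((?I a \<otimes>\<^bsub>A\<^esub> (\<mu> u v \<otimes>\<^bsub>A\<^esub> ?I (F w))) \<cdot>\<^bsub>A\<^esub> (?I a \<otimes>\<^bsub>A\<^esub> \<mu> (u \<odot>\<^bsub>V\<^esub> v) w)) =
     (((f0 \<otimes>\<^bsub>A\<^esub> ?I (F v)) \<cdot>\<^bsub>A\<^esub> (?I a \<otimes>\<^bsub>A\<^esub> \<mu> u v)) \<otimes>\<^bsub>A\<^esub> ?I (F w)) \<cdot>\<^bsub>A\<^esub> (?I a \<otimes>\<^bsub>A\<^esub> \<mu> (u \<odot>\<^bsub>V\<^esub> v) w)"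
    using A.ten_cmp_extend[of "?I a \<otimes>\<^bsub>A\<^esub> \<mu> u v" "?I (F w)" "f0 \<otimes>\<^bsub>A\<^esub> ?I (F v)" "?I (F w)" "?I a \<otimes>\<^bsub>A\<^esub> \<mu> (u \<odot>\<^bsub>V\<^esub> v) w"]
    by (simp add: A.tenM_ide_obj[symmetric] del: A.tenM_ide_obj)
  finally have eq: "(?I b \<otimes>\<^bsub>A\<^esub> \<mu> v w) \<cdot>\<^bsub>A\<^esub> ((f0 \<otimes>\<^bsub>A\<^esub> ?I (F (v \<odot>\<^bsub>V\<^esub> w))) \<cdot>\<^bsub>A\<^esub> (?I a \<otimes>\<^bsub>A\<^esub> \<mu> u (v \<odot>\<^bsub>V\<^esub> w))) =
     (((f0 \<otimes>\<^bsub>A\<^esub> ?I (F v)) \<cdot>\<^bsub>A\<^esub> (?I a \<otimes>\<^bsub>A\<^esub> \<mu> u v)) \<otimes>\<^bsub>A\<^esub> ?I (F w)) \<cdot>\<^bsub>A\<^esub> (?I a \<otimes>\<^bsub>A\<^esub> \<mu> (u \<odot>\<^bsub>V\<^esub> v) w)" .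
  have s: "(g0 \<cdot>\<^bsub>A\<^esub> ((f0 \<otimes>\<^bsub>A\<^esub> ?I (F v)) \<cdot>\<^bsub>A\<^esub> (?I a \<otimes>\<^bsub>A\<^esub> \<mu> u v))) \<otimes>\<^bsub>A\<^esub> ?I (F w) =
     (g0 \<otimes>\<^bsub>A\<^esub> ?I (F w)) \<cdot>\<^bsub>A\<^esub> (((f0 \<otimes>\<^bsub>A\<^esub> ?I (F v)) \<cdot>\<^bsub>A\<^esub> (?I a \<otimes>\<^bsub>A\<^esub> \<mu> u v)) \<otimes>\<^bsub>A\<^esub> ?I (F w))"
    using A.ten_cmp[of "(f0 \<otimes>\<^bsub>A\<^esub> ?I (F v)) \<cdot>\<^bsub>A\<^esub> (?I a \<otimes>\<^bsub>A\<^esub> \<mu> u v)" "?I (F w)" g0 "?I (F w)"] by simp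
  show ?case by (simp add: eq s)
qed

text \<open>
  The exchange of a left and a right product is the compatibility of \<open>F\<close> with the braidings.
\<close>

lemma whiskered_M: "whiskered_graded V M (fst \<circ> snd) mact mlw mrw"
proof (rule whiskered_graded.intro[OF V.braided_monoidal_category_axioms category_M], unfold_locales, goal_cases)
  case (14 f p q)
  then show ?case by (cases f) (simp add: A.ten_cmp F.FA_cmp_arr)
next
  case (15 f g p q)
  then obtain a u f0 v g0 where [simp]: "f = (a, u, f0)" "g = (Cod A f0, v, g0)" "a \<in> Obj A" "u \<in> Obj V" "v \<in> Obj V"
    "f0 \<in> Arr A" "g0 \<in> Arr A" "Dom A f0 = a \<odot>\<^bsub>A\<^esub> F u" "Dom A g0 = Cod A f0 \<odot>\<^bsub>A\<^esub> F v" "p \<in> Arr V" "q \<in> Arr V" "Cod V p = u" "Cod V q = v"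
    by (cases f; cases g; auto)
  let ?I = "Ide A" and ?F = "FA (mtF X)"
  have "(?I (Cod A f0) \<otimes>\<^bsub>A\<^esub> ?F q) \<cdot>\<^bsub>A\<^esub> (((f0 \<cdot>\<^bsub>A\<^esub> (?I a \<otimes>\<^bsub>A\<^esub> ?F p)) \<otimes>\<^bsub>A\<^esub> ?I (F (Dom V q))) \<cdot>\<^bsub>A\<^esub> (?I a \<otimes>\<^bsub>A\<^esub> \<mu> (Dom V p) (Dom V q)))
    = (f0 \<otimes>\<^bsub>A\<^esub> ?I (F v)) \<cdot>\<^bsub>A\<^esub> ((?I a \<otimes>\<^bsub>A\<^esub> (?F p \<otimes>\<^bsub>A\<^esub> ?F q)) \<cdot>\<^bsub>A\<^esub> (?I a \<otimes>\<^bsub>A\<^esub> \<mu> (Dom V p) (Dom V q)))"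
    using A.ten_cmp_extend[of "?I a \<otimes>\<^bsub>A\<^esub> ?F p" "?F q" f0 "?I (F v)" "?I a \<otimes>\<^bsub>A\<^esub> \<mu> (Dom V p) (Dom V q)"]
    by (simp add: A.ten_cmp_extend)
  also have "(?I a \<otimes>\<^bsub>A\<^esub> (?F p \<otimes>\<^bsub>A\<^esub> ?F q)) \<cdot>\<^bsub>A\<^esub> (?I a \<otimes>\<^bsub>A\<^esub> \<mu> (Dom V p) (Dom V q)) =
      (?I a \<otimes>\<^bsub>A\<^esub> \<mu> u v) \<cdot>\<^bsub>A\<^esub> (?I a \<otimes>\<^bsub>A\<^esub> ?F (p \<otimes>\<^bsub>V\<^esub> q))"
    by (simp add: A.ten_cmp mu_nat)
  finally show ?case by simp
next
  case (26 x f g)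
  then obtain a u f0 v g0 where [simp]: "f = (a, u, f0)" "g = (Cod A f0, v, g0)" "a \<in> Obj A" "u \<in> Obj V" "v \<in> Obj V"
    "f0 \<in> Arr A" "g0 \<in> Arr A" "Dom A f0 = a \<odot>\<^bsub>A\<^esub> F u" "Dom A g0 = Cod A f0 \<odot>\<^bsub>A\<^esub> F v" "x \<in> Obj A"
    by (cases f; cases g; auto)
  let ?I = "Ide A"
  have "?I x \<otimes>\<^bsub>A\<^esub> (g0 \<cdot>\<^bsub>A\<^esub> ((f0 \<otimes>\<^bsub>A\<^esub> ?I (F v)) \<cdot>\<^bsub>A\<^esub> (?I a \<otimes>\<^bsub>A\<^esub> \<mu> u v))) =
    (?I x \<otimes>\<^bsub>A\<^esub> g0) \<cdot>\<^bsub>A\<^esub> ((?I x \<otimes>\<^bsub>A\<^esub> (f0 \<otimes>\<^bsub>A\<^esub> ?I (F v))) \<cdot>\<^bsub>A\<^esub> (?I x \<otimes>\<^bsub>A\<^esub> (?I a \<otimes>\<^bsub>A\<^esub> \<mu> u v)))"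
    by (simp add: A.ten_cmp)
  then show ?case by (simp add: A.tenM_ide_obj[symmetric] del: A.tenM_ide_obj)
next
  case (27 x f g)
  then obtain a u f0 v g0 where [simp]: "f = (a, u, f0)" "g = (Cod A f0, v, g0)" "a \<in> Obj A" "u \<in> Obj V" "v \<in> Obj V"
    "f0 \<in> Arr A" "g0 \<in> Arr A" "Dom A f0 = a \<odot>\<^bsub>A\<^esub> F u" "Dom A g0 = Cod A f0 \<odot>\<^bsub>A\<^esub> F v" "x \<in> Obj A"
    by (cases f; cases g; auto)
  let ?I = "Ide A" and ?b = "Cod A f0"
  have 1: "(g0 \<cdot>\<^bsub>A\<^esub> ((f0 \<otimes>\<^bsub>A\<^esub> ?I (F v)) \<cdot>\<^bsub>A\<^esub> (?I a \<otimes>\<^bsub>A\<^esub> \<mu> u v))) \<otimes>\<^bsub>A\<^esub> ?I x =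
    (g0 \<otimes>\<^bsub>A\<^esub> ?I x) \<cdot>\<^bsub>A\<^esub> ((f0 \<otimes>\<^bsub>A\<^esub> ?I (F v \<odot>\<^bsub>A\<^esub> x)) \<cdot>\<^bsub>A\<^esub> (?I a \<otimes>\<^bsub>A\<^esub> (\<mu> u v \<otimes>\<^bsub>A\<^esub> ?I x)))"
    using A.ten_cmp[of "(f0 \<otimes>\<^bsub>A\<^esub> ?I (F v)) \<cdot>\<^bsub>A\<^esub> (?I a \<otimes>\<^bsub>A\<^esub> \<mu> u v)" "?I x" g0 "?I x"]
      A.ten_cmp[of "?I a \<otimes>\<^bsub>A\<^esub> \<mu> u v" "?I x" "f0 \<otimes>\<^bsub>A\<^esub> ?I (F v)" "?I x"] by simp
  have 2: "(?I a \<otimes>\<^bsub>A\<^esub> (\<mu> u v \<otimes>\<^bsub>A\<^esub> ?I x)) \<cdot>\<^bsub>A\<^esub> (?I a \<otimes>\<^bsub>A\<^esub> e x (u \<odot>\<^bsub>V\<^esub> v)) =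
    (?I (a \<odot>\<^bsub>A\<^esub> F u) \<otimes>\<^bsub>A\<^esub> e x v) \<cdot>\<^bsub>A\<^esub> ((?I a \<otimes>\<^bsub>A\<^esub> (e x u \<otimes>\<^bsub>A\<^esub> ?I (F v))) \<cdot>\<^bsub>A\<^esub> (?I (a \<odot>\<^bsub>A\<^esub> x) \<otimes>\<^bsub>A\<^esub> \<mu> u v))"
    using A.ten_cmp[of "?I a" "e x (u \<odot>\<^bsub>V\<^esub> v)" "?I a" "\<mu> u v \<otimes>\<^bsub>A\<^esub> ?I x"]
      A.ten_cmp[of "?I a" "?I x \<otimes>\<^bsub>A\<^esub> \<mu> u v" "?I a" "e x u \<otimes>\<^bsub>A\<^esub> ?I (F v)"]
      A.ten_cmp[of "?I a" "(e x u \<otimes>\<^bsub>A\<^esub> ?I (F v)) \<cdot>\<^bsub>A\<^esub> (?I x \<otimes>\<^bsub>A\<^esub> \<mu> u v)" "?I a" "?I (F u) \<otimes>\<^bsub>A\<^esub> e x v"]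
      mu_central[of u v x]
    by (simp add: A.tenM_ide_obj[symmetric] del: A.tenM_ide_obj)
  have 3: "(f0 \<otimes>\<^bsub>A\<^esub> ?I (F v \<odot>\<^bsub>A\<^esub> x)) \<cdot>\<^bsub>A\<^esub> ((?I (a \<odot>\<^bsub>A\<^esub> F u) \<otimes>\<^bsub>A\<^esub> e x v) \<cdot>\<^bsub>A\<^esub> y) =
     (?I ?b \<otimes>\<^bsub>A\<^esub> e x v) \<cdot>\<^bsub>A\<^esub> ((f0 \<otimes>\<^bsub>A\<^esub> ?I (x \<odot>\<^bsub>A\<^esub> F v)) \<cdot>\<^bsub>A\<^esub> y)"
    if "y \<in> Arr A" "Cod A y = a \<odot>\<^bsub>A\<^esub> (F u \<odot>\<^bsub>A\<^esub> (x \<odot>\<^bsub>A\<^esub> F v))" for y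
    using slide[of f0 "e x v"] that by (intro A.cmp_eq_extend) simp_all
  have 4: "((f0 \<otimes>\<^bsub>A\<^esub> ?I x) \<cdot>\<^bsub>A\<^esub> (?I a \<otimes>\<^bsub>A\<^esub> e x u)) \<otimes>\<^bsub>A\<^esub> ?I (F v) =
     (f0 \<otimes>\<^bsub>A\<^esub> ?I (x \<odot>\<^bsub>A\<^esub> F v)) \<cdot>\<^bsub>A\<^esub> (?I a \<otimes>\<^bsub>A\<^esub> (e x u \<otimes>\<^bsub>A\<^esub> ?I (F v)))"
    using A.ten_cmp[of "?I a \<otimes>\<^bsub>A\<^esub> e x u" "?I (F v)" "f0 \<otimes>\<^bsub>A\<^esub> ?I x" "?I (F v)"] by simp
  show ?case by (simp add: 1 2 3 4)
next
  case (28 x y f)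
  then show ?case by (cases f) (simp add: A.tenM_ide_obj[symmetric] del: A.tenM_ide_obj)
next
  case (29 x y f)
  then obtain a u f0 where [simp]: "f = (a, u, f0)" "a \<in> Obj A" "u \<in> Obj V"
    "f0 \<in> Arr A" "Dom A f0 = a \<odot>\<^bsub>A\<^esub> F u" "x \<in> Obj A" "y \<in> Obj A"
    by (cases f; auto)
  let ?I = "Ide A"
  have "((f0 \<otimes>\<^bsub>A\<^esub> ?I x) \<cdot>\<^bsub>A\<^esub> (?I a \<otimes>\<^bsub>A\<^esub> e x u)) \<otimes>\<^bsub>A\<^esub> ?I y = (f0 \<otimes>\<^bsub>A\<^esub> ?I (x \<odot>\<^bsub>A\<^esub> y)) \<cdot>\<^bsub>A\<^esub> (?I a \<otimes>\<^bsub>A\<^esub> (e x u \<otimes>\<^bsub>A\<^esub> ?I y))"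
    using A.ten_cmp[of "?I a \<otimes>\<^bsub>A\<^esub> e x u" "?I y" "f0 \<otimes>\<^bsub>A\<^esub> ?I x" "?I y"] by simp
  moreover have "(?I a \<otimes>\<^bsub>A\<^esub> (e x u \<otimes>\<^bsub>A\<^esub> ?I y)) \<cdot>\<^bsub>A\<^esub> (?I (a \<odot>\<^bsub>A\<^esub> x) \<otimes>\<^bsub>A\<^esub> e y u) = ?I a \<otimes>\<^bsub>A\<^esub> e (x \<odot>\<^bsub>A\<^esub> y) u"
    using A.ten_cmp[of "?I a" "?I x \<otimes>\<^bsub>A\<^esub> e y u" "?I a" "e x u \<otimes>\<^bsub>A\<^esub> ?I y"]
    by (simp add: hb_mult A.tenM_ide_obj[symmetric] del: A.tenM_ide_obj)
  ultimately show ?case by simp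
next
  case (30 x y f)
  then obtain a u f0 where [simp]: "f = (a, u, f0)" "a \<in> Obj A" "u \<in> Obj V"
    "f0 \<in> Arr A" "Dom A f0 = a \<odot>\<^bsub>A\<^esub> F u" "x \<in> Obj A" "y \<in> Obj A"
    by (cases f; auto)
  show ?case
    using A.ten_cmp[of "Ide A x" "Ide A a \<otimes>\<^bsub>A\<^esub> e y u" "Ide A x" "f0 \<otimes>\<^bsub>A\<^esub> Ide A y"]
    by (simp add: A.tenM_ide_obj[symmetric] del: A.tenM_ide_obj)
next
  case (33 x f p)
  then obtain a u f0 where [simp]: "f = (a, u, f0)" "a \<in> Obj A" "u \<in> Obj V"
    "f0 \<in> Arr A" "Dom A f0 = a \<odot>\<^bsub>A\<^esub> F u" "x \<in> Obj A" "p \<in> Arr V" "Cod V p = u"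
    by (cases f; auto)
  show ?case
    using A.ten_cmp[of "Ide A x" "Ide A a \<otimes>\<^bsub>A\<^esub> FA (mtF X) p" "Ide A x" f0]
    by (simp add: A.tenM_ide_obj[symmetric] del: A.tenM_ide_obj)
next
  case (34 x f p)
  then obtain a u f0 where [simp]: "f = (a, u, f0)" "a \<in> Obj A" "u \<in> Obj V"
    "f0 \<in> Arr A" "Dom A f0 = a \<odot>\<^bsub>A\<^esub> F u" "x \<in> Obj A" "p \<in> Arr V" "Cod V p = u"
    by (cases f; auto)
  let ?I = "Ide A" and ?p = "FA (mtF X) p"
  have "(f0 \<cdot>\<^bsub>A\<^esub> (?I a \<otimes>\<^bsub>A\<^esub> ?p)) \<otimes>\<^bsub>A\<^esub> ?I x = (f0 \<otimes>\<^bsub>A\<^esub> ?I x) \<cdot>\<^bsub>A\<^esub> (?I a \<otimes>\<^bsub>A\<^esub> (?p \<otimes>\<^bsub>A\<^esub> ?I x))"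
    using A.ten_cmp[of "?I a \<otimes>\<^bsub>A\<^esub> ?p" "?I x" f0 "?I x"] by simp
  moreover have "(?I a \<otimes>\<^bsub>A\<^esub> (?p \<otimes>\<^bsub>A\<^esub> ?I x)) \<cdot>\<^bsub>A\<^esub> (?I a \<otimes>\<^bsub>A\<^esub> e x (Dom V p)) = (?I a \<otimes>\<^bsub>A\<^esub> e x u) \<cdot>\<^bsub>A\<^esub> (?I (a \<odot>\<^bsub>A\<^esub> x) \<otimes>\<^bsub>A\<^esub> ?p)"
    using F_central[of p "Dom V p" u x] A.ten_cmp[of "?I a" "?I x \<otimes>\<^bsub>A\<^esub> ?p" "?I a" "e x u"]
    by (simp add: A.ten_cmp A.tenM_ide_obj[symmetric] del: A.tenM_ide_obj)
  ultimately show ?case by simp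
next
  case (35 f g)
  then obtain a u f0 b v g0 where [simp]: "f = (a, u, f0)" "g = (b, v, g0)" "a \<in> Obj A" "b \<in> Obj A" "u \<in> Obj V" "v \<in> Obj V"
    "f0 \<in> Arr A" "g0 \<in> Arr A" "Dom A f0 = a \<odot>\<^bsub>A\<^esub> F u" "Dom A g0 = b \<odot>\<^bsub>A\<^esub> F v"
    by (cases f; cases g; auto)
  let ?I = "Ide A" and ?c = "Cod A f0" and ?d = "Cod A g0" and ?\<beta> = "FA (mtF X) (Braid V v u)"
  have "(?I a \<otimes>\<^bsub>A\<^esub> e ?d u) \<cdot>\<^bsub>A\<^esub> ((?I a \<otimes>\<^bsub>A\<^esub> (g0 \<otimes>\<^bsub>A\<^esub> ?I (F u))) \<cdot>\<^bsub>A\<^esub> (?I a \<otimes>\<^bsub>A\<^esub> (?I b \<otimes>\<^bsub>A\<^esub> \<mu> v u))) =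
    ?I a \<otimes>\<^bsub>A\<^esub> ((e ?d u \<cdot>\<^bsub>A\<^esub> (g0 \<otimes>\<^bsub>A\<^esub> ?I (F u))) \<cdot>\<^bsub>A\<^esub> (?I b \<otimes>\<^bsub>A\<^esub> \<mu> v u))"
    by (simp add: A.ten_cmp del: A.tenM_ide_obj)
  also have "(e ?d u \<cdot>\<^bsub>A\<^esub> (g0 \<otimes>\<^bsub>A\<^esub> ?I (F u))) \<cdot>\<^bsub>A\<^esub> (?I b \<otimes>\<^bsub>A\<^esub> \<mu> v u) =
     (?I (F u) \<otimes>\<^bsub>A\<^esub> g0) \<cdot>\<^bsub>A\<^esub> (e (b \<odot>\<^bsub>A\<^esub> F v) u \<cdot>\<^bsub>A\<^esub> (?I b \<otimes>\<^bsub>A\<^esub> \<mu> v u))"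
  proof -
    have "(e ?d u \<cdot>\<^bsub>A\<^esub> (g0 \<otimes>\<^bsub>A\<^esub> ?I (F u))) \<cdot>\<^bsub>A\<^esub> (?I b \<otimes>\<^bsub>A\<^esub> \<mu> v u) =
        ((?I (F u) \<otimes>\<^bsub>A\<^esub> g0) \<cdot>\<^bsub>A\<^esub> e (b \<odot>\<^bsub>A\<^esub> F v) u) \<cdot>\<^bsub>A\<^esub> (?I b \<otimes>\<^bsub>A\<^esub> \<mu> v u)"
      using hb_nat[of u g0 "b \<odot>\<^bsub>A\<^esub> F v" ?d] by (simp del: A.cmp_assoc_arr)
    then show ?thesis by simp
  qed
  also have "e (b \<odot>\<^bsub>A\<^esub> F v) u \<cdot>\<^bsub>A\<^esub> (?I b \<otimes>\<^bsub>A\<^esub> \<mu> v u) = (e b u \<otimes>\<^bsub>A\<^esub> ?I (F v)) \<cdot>\<^bsub>A\<^esub> (?I b \<otimes>\<^bsub>A\<^esub> (e (F v) u \<cdot>\<^bsub>A\<^esub> \<mu> v u))"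
    by (simp add: hb_mult A.ten_cmp)
  also have "e (F v) u \<cdot>\<^bsub>A\<^esub> \<mu> v u = \<mu> u v \<cdot>\<^bsub>A\<^esub> ?\<beta>"
    by (simp add: mu_braid)
  finally have 1: "(?I a \<otimes>\<^bsub>A\<^esub> e ?d u) \<cdot>\<^bsub>A\<^esub> ((?I a \<otimes>\<^bsub>A\<^esub> (g0 \<otimes>\<^bsub>A\<^esub> ?I (F u))) \<cdot>\<^bsub>A\<^esub> (?I a \<otimes>\<^bsub>A\<^esub> (?I b \<otimes>\<^bsub>A\<^esub> \<mu> v u))) =
     (?I a \<otimes>\<^bsub>A\<^esub> (?I (F u) \<otimes>\<^bsub>A\<^esub> g0)) \<cdot>\<^bsub>A\<^esub> ((?I a \<otimes>\<^bsub>A\<^esub> (e b u \<otimes>\<^bsub>A\<^esub> ?I (F v))) \<cdot>\<^bsub>A\<^esub> ((?I a \<otimes>\<^bsub>A\<^esub> (?I b \<otimes>\<^bsub>A\<^esub> \<mu> u v)) \<cdot>\<^bsub>A\<^esub> (?I a \<otimes>\<^bsub>A\<^esub> (?I b \<otimes>\<^bsub>A\<^esub> ?\<beta>))))"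
    by (simp add: A.ten_cmp del: A.tenM_ide_obj)
  have 2: "(f0 \<otimes>\<^bsub>A\<^esub> ?I ?d) \<cdot>\<^bsub>A\<^esub> ((?I (a \<odot>\<^bsub>A\<^esub> F u) \<otimes>\<^bsub>A\<^esub> g0) \<cdot>\<^bsub>A\<^esub> y) = (?I ?c \<otimes>\<^bsub>A\<^esub> g0) \<cdot>\<^bsub>A\<^esub> ((f0 \<otimes>\<^bsub>A\<^esub> ?I (b \<odot>\<^bsub>A\<^esub> F v)) \<cdot>\<^bsub>A\<^esub> y)"
    if "y \<in> Arr A" "Cod A y = a \<odot>\<^bsub>A\<^esub> (F u \<odot>\<^bsub>A\<^esub> (b \<odot>\<^bsub>A\<^esub> F v))" for y
    using slide[of f0 g0] that by (intro A.cmp_eq_extend) simp_all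
  have 3: "((f0 \<otimes>\<^bsub>A\<^esub> ?I b) \<cdot>\<^bsub>A\<^esub> (?I a \<otimes>\<^bsub>A\<^esub> e b u)) \<otimes>\<^bsub>A\<^esub> ?I (F v) = (f0 \<otimes>\<^bsub>A\<^esub> ?I (b \<odot>\<^bsub>A\<^esub> F v)) \<cdot>\<^bsub>A\<^esub> (?I a \<otimes>\<^bsub>A\<^esub> (e b u \<otimes>\<^bsub>A\<^esub> ?I (F v)))"
    using A.ten_cmp[of "?I a \<otimes>\<^bsub>A\<^esub> e b u" "?I (F v)" "f0 \<otimes>\<^bsub>A\<^esub> ?I b" "?I (F v)"] by simp
  have ab: "?I (a \<odot>\<^bsub>A\<^esub> b) = ?I a \<otimes>\<^bsub>A\<^esub> ?I b" "?I (a \<odot>\<^bsub>A\<^esub> F u) = ?I a \<otimes>\<^bsub>A\<^esub> ?I (F u)" by simp_all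
  show ?case
    using 1 2[unfolded ab] by (simp add: 3 ab del: A.tenM_ide_obj)
next
  case (36 f g)
  then show ?case by (auto simp: M_def mlw_def mrw_def)
qed auto

lemma graded_M: "graded_monoidal V M (fst \<circ> snd) mact"
  by (rule whiskered_graded.graded_monoidal[OF whiskered_M])

end

section \<open>Enriched categories from graded categories with hom objects\<close>

text \<open>
  \<open>H a b\<close> represents the arrows \<open>a \<rightarrow> b\<close> of all grades, with universal arrow \<open>\<epsilon> a b\<close>.  All structure
  maps of the enriched category classify composites and products of universal arrows, and its laws
  are those of the graded category evaluated on universal arrows.
\<close>

locale hom_represented = graded_monoidal V G gr act
  for V :: "('v, 'm) braided_moncat" and G :: "('a, 'g) moncat" (structure)
    and gr and act (infixl "\<lhd>" 80) +
  fixes H :: "'a \<Rightarrow> 'a \<Rightarrow> 'v" and \<epsilon> :: "'a \<Rightarrow> 'a \<Rightarrow> 'g"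
  assumes H_obj [simp]: "a \<in> Obj G \<Longrightarrow> b \<in> Obj G \<Longrightarrow> H a b \<in> Obj V"
    and eps_arr [simp]: "a \<in> Obj G \<Longrightarrow> b \<in> Obj G \<Longrightarrow> \<epsilon> a b \<in> Arr G"
      "a \<in> Obj G \<Longrightarrow> b \<in> Obj G \<Longrightarrow> Dom G (\<epsilon> a b) = a" "a \<in> Obj G \<Longrightarrow> b \<in> Obj G \<Longrightarrow> Cod G (\<epsilon> a b) = b"
      "a \<in> Obj G \<Longrightarrow> b \<in> Obj G \<Longrightarrow> gr (\<epsilon> a b) = H a b"
    and eps_ex1: "f \<in> Arr G \<Longrightarrow> \<exists>!p. p \<in> hom V (gr f) (H (Dom G f) (Cod G f)) \<and> \<epsilon> (Dom G f) (Cod G f) \<lhd> p = f"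
begin

definition cls :: "'g \<Rightarrow> 'm" where
  "cls f = (THE p. p \<in> hom V (gr f) (H (Dom G f) (Cod G f)) \<and> \<epsilon> (Dom G f) (Cod G f) \<lhd> p = f)"

lemma cls:
  assumes "f \<in> Arr G"
  shows cls_arr [simp]: "cls f \<in> Arr V" "Dom V (cls f) = gr f" "Cod V (cls f) = H (Dom G f) (Cod G f)"
    and eps_cls: "Dom G f = a \<Longrightarrow> Cod G f = b \<Longrightarrow> \<epsilon> a b \<lhd> cls f = f"
  using theI'[OF eps_ex1[OF assms], folded cls_def] by (auto simp: hom_def)

lemma eps_unique:
  assumes ab: "a \<in> Obj G" "b \<in> Obj G" and p: "p \<in> Arr V" "Cod V p = H a b" and q: "q \<in> Arr V" "Cod V q = H a b"
    and eq: "\<epsilon> a b \<lhd> p = \<epsilon> a b \<lhd> q"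
  shows "p = q"
proof -
  have d: "Dom V p = Dom V q"
    using arg_cong[OF eq, of gr] ab p q by simp
  show ?thesis
    using eps_ex1[of "\<epsilon> a b \<lhd> p"] ab p q eq d by (auto simp: hom_def)
qed

definition EC :: "('a, 'v, 'm) vmoncat" where
  "EC = \<lparr>vObj = Obj G, vHom = H, vId = (\<lambda>a. cls (Ide G a)), vCmp = (\<lambda>a b c. cls (\<epsilon> b c \<cdot> \<epsilon> a b)),
    vUnit = \<one>, vTenO = TenO G, vTenM = (\<lambda>a c b d. cls (\<epsilon> a c \<otimes> \<epsilon> b d))\<rparr>"

lemma EC_simps [simp]:
  "vObj EC = Obj G" "vHom EC = H" "vId EC a = cls (Ide G a)" "vCmp EC a b c = cls (\<epsilon> b c \<cdot> \<epsilon> a b)"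
  "vUnit EC = \<one>" "vTenO EC a b = a \<odot> b" "vTenM EC a c b d = cls (\<epsilon> a c \<otimes> \<epsilon> b d)"
  by (simp_all add: EC_def)

lemma act_cmp_eq:
  "f \<in> Arr G \<Longrightarrow> p \<in> Arr V \<Longrightarrow> q \<in> Arr V \<Longrightarrow> Cod V p = gr f \<Longrightarrow> Cod V q = Dom V p \<Longrightarrow>
     f \<lhd> (p \<cdot>\<^bsub>V\<^esub> q) = f \<lhd> p \<lhd> q"
  by (simp add: act_act)

lemma enriched_EC: "enriched_monoidal_category V EC"
proof (unfold_locales, goal_cases)
  case (4 a b) then show ?case
    by - (rule eps_unique[of a b], simp_all add: act_cmp_eq eps_cls flip: cmp_act)
next
  case (5 a b) then show ?case
    by - (rule eps_unique[of a b], simp_all add: act_cmp_eq eps_cls flip: cmp_act)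
next
  case (6 a b c d) then show ?case
    by - (rule eps_unique[of a d], simp_all add: act_cmp_eq eps_cls flip: cmp_act)
next
  case (13 a a' b b' c c') then show ?case
    by - (rule eps_unique[of "a \<odot> (b \<odot> c)" "a' \<odot> (b' \<odot> c')"], simp_all add: act_cmp_eq eps_cls flip: ten_act)
next
  case (14 a b) then show ?case
    by - (rule eps_unique[of a b], simp_all add: act_cmp_eq eps_cls flip: ten_act)
next
  case (15 a b) then show ?case
    by - (rule eps_unique[of a b], simp_all add: act_cmp_eq eps_cls flip: ten_act)
next
  case (16 a b) then show ?case
    by - (rule eps_unique[of "a \<odot> b" "a \<odot> b"], simp_all add: act_cmp_eq eps_cls flip: ten_act)
next
  case (17 a b c d e f)
  then have [simp]: "a \<in> Obj G" "b \<in> Obj G" "c \<in> Obj G" "d \<in> Obj G" "e \<in> Obj G" "f \<in> Obj G"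
    by simp_all
  let ?\<beta> = "Ide V (vHom EC a b) \<otimes>\<^bsub>V\<^esub> Braid V (vHom EC d e) (vHom EC b c) \<otimes>\<^bsub>V\<^esub> Ide V (vHom EC e f)"
  let ?l = "vCmp EC (vTenO EC a d) (vTenO EC b e) (vTenO EC c f)" and ?r = "vTenM EC a c d f"
  have l: "\<epsilon> (a \<odot> d) (c \<odot> f) \<lhd> (?l \<cdot>\<^bsub>V\<^esub> (vTenM EC a b d e \<otimes>\<^bsub>V\<^esub> vTenM EC b c e f)) =
    (\<epsilon> b c \<otimes> \<epsilon> e f) \<cdot> (\<epsilon> a b \<otimes> \<epsilon> d e)"
    by (simp add: act_cmp_eq eps_cls flip: cmp_act)
  have r: "\<epsilon> (a \<odot> d) (c \<odot> f) \<lhd> (?r \<cdot>\<^bsub>V\<^esub> (vCmp EC a b c \<otimes>\<^bsub>V\<^esub> vCmp EC d e f)) =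
    (\<epsilon> b c \<cdot> \<epsilon> a b) \<otimes> (\<epsilon> e f \<cdot> \<epsilon> d e)"
    by (simp add: act_cmp_eq eps_cls flip: ten_act)
  show ?case
  proof (rule eps_unique[of "a \<odot> d" "c \<odot> f"])
    have "\<epsilon> (a \<odot> d) (c \<odot> f) \<lhd> (?r \<cdot>\<^bsub>V\<^esub> (vCmp EC a b c \<otimes>\<^bsub>V\<^esub> vCmp EC d e f) \<cdot>\<^bsub>V\<^esub> ?\<beta>) =
      \<epsilon> (a \<odot> d) (c \<odot> f) \<lhd> (?r \<cdot>\<^bsub>V\<^esub> (vCmp EC a b c \<otimes>\<^bsub>V\<^esub> vCmp EC d e f)) \<lhd> ?\<beta>"
      by (rule act_cmp_eq) simp_all
    also have "\<dots> = (\<epsilon> b c \<otimes> \<epsilon> e f) \<cdot> (\<epsilon> a b \<otimes> \<epsilon> d e)"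
      unfolding r by (subst gr_interchange) simp_all
    finally show "\<epsilon> (a \<odot> d) (c \<odot> f) \<lhd> (?l \<cdot>\<^bsub>V\<^esub> (vTenM EC a b d e \<otimes>\<^bsub>V\<^esub> vTenM EC b c e f)) =
      \<epsilon> (a \<odot> d) (c \<odot> f) \<lhd> (?r \<cdot>\<^bsub>V\<^esub> (vCmp EC a b c \<otimes>\<^bsub>V\<^esub> vCmp EC d e f) \<cdot>\<^bsub>V\<^esub> ?\<beta>)"
      using l by simp
  qed simp_all
qed (simp_all add: hom_def)

sublocale E: enriched V EC
  by (intro enriched.intro V.braided_monoidal_category_axioms enriched_EC)

text \<open>
  The enriched category has the given graded category as its graded category: \<open>Phi\<close> is an isomorphism with
  inverse \<open>Psi\<close>.
\<close>

definition Phi :: "('a, 'm, 'h) uarr \<Rightarrow> 'g" where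
  "Phi t = \<epsilon> (usrc t) (utgt t) \<lhd> uelt t"

definition Psi :: "'g \<Rightarrow> ('a, 'm, 'h) uarr" where
  "Psi g = Elt (Dom G g) (Cod G g) (cls g)"

lemma Phi_arr [simp]:
  assumes "t \<in> Arr (graded_cat V EC)"
  shows "Phi t \<in> Arr G" "Dom G (Phi t) = usrc t" "Cod G (Phi t) = utgt t" "gr (Phi t) = grade V t"
  using assms by (auto simp: Phi_def elim!: Arr_graded_catE)

lemma Phi_ide: "a \<in> Obj G \<Longrightarrow> Phi (Ide (graded_cat V EC) a) = Ide G a"
  by (simp add: Phi_def graded_cat_simps eps_cls)

lemma Phi_cmp:
  assumes "t \<in> Arr (graded_cat V EC)" "t' \<in> Arr (graded_cat V EC)" "utgt t = usrc t'"
  shows "Phi (t' \<cdot>\<^bsub>graded_cat V EC\<^esub> t) = Phi t' \<cdot> Phi t"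
  using assms
  by (auto simp: Phi_def graded_cat_simps act_cmp_eq eps_cls elim!: Arr_graded_catE simp flip: cmp_act)

lemma Phi_ten:
  assumes "t \<in> Arr (graded_cat V EC)" "t' \<in> Arr (graded_cat V EC)"
  shows "Phi (t \<otimes>\<^bsub>graded_cat V EC\<^esub> t') = Phi t \<otimes> Phi t'"
  using assms
  by (auto simp: Phi_def graded_cat_simps act_cmp_eq eps_cls elim!: Arr_graded_catE simp flip: ten_act)

lemma Phi_act:
  assumes "t \<in> Arr (graded_cat V EC)" "p \<in> Arr V" "Cod V p = grade V t"
  shows "Phi (regrade V t p) = Phi t \<lhd> p"
  using assms by (auto simp: Phi_def act_cmp_eq elim!: Arr_graded_catE)

lemma Phi_inj:
  assumes "t \<in> Arr (graded_cat V EC)" "t' \<in> Arr (graded_cat V EC)" "Phi t = Phi t'"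
  shows "t = t'"
proof -
  obtain a b k where t: "t = Elt a b k" "a \<in> Obj G" "b \<in> Obj G" "k \<in> Arr V" "Cod V k = H a b"
    using assms(1) by (auto elim!: Arr_graded_catE)
  obtain a' b' k' where t': "t' = Elt a' b' k'" "a' \<in> Obj G" "b' \<in> Obj G" "k' \<in> Arr V" "Cod V k' = H a' b'"
    using assms(2) by (auto elim!: Arr_graded_catE)
  have "a = a'" "b = b'"
    using arg_cong[OF assms(3), of "Dom G"] arg_cong[OF assms(3), of "Cod G"] assms(1,2) t(1) t'(1) by simp_all
  then show ?thesis
    using assms(3) t t' eps_unique[of a b k k'] by (simp add: Phi_def)
qed

lemma Psi_arr [simp]:
  assumes "g \<in> Arr G"
  shows "Psi g \<in> Arr (graded_cat V EC)" "usrc (Psi g) = Dom G g" "utgt (Psi g) = Cod G g" "grade V (Psi g) = gr g"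
    "Phi (Psi g) = g"
  using assms by (simp_all add: Psi_def Phi_def graded_cat_simps eps_cls)

end

section \<open>Hom objects of a module tensor category\<close>

lemma adjunction_couniversal:
  assumes "adjunction C D F G \<eta> \<epsilon>" "c \<in> Obj C" "d \<in> Obj D" "g \<in> hom D (FO F c) d"
  shows "\<exists>!p. p \<in> hom C c (FO G d) \<and> \<epsilon> d \<cdot>\<^bsub>D\<^esub> FA F p = g"
proof -
  interpret adjunction C D F G \<eta> \<epsilon> by fact
  note [simp] = assms(2,3)
  have [simp]: "g \<in> Arr D" "Dom D g = FO F c" "Cod D g = d" using assms(4) by (auto simp: hom_def)
  have eta [simp]: "\<eta> x \<in> Arr C" "Dom C (\<eta> x) = x" "Cod C (\<eta> x) = FO G (FO F x)" if "x \<in> Obj C" for x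
    using unit_nat that by (auto simp: nat_trans_def fid_def fcomp_def hom_def)
  have eps [simp]: "\<epsilon> x \<in> Arr D" "Dom D (\<epsilon> x) = FO F (FO G x)" "Cod D (\<epsilon> x) = x" if "x \<in> Obj D" for x
    using counit_nat that by (auto simp: nat_trans_def fid_def fcomp_def hom_def)
  have eta_nat: "FA G (FA F k) \<cdot>\<^bsub>C\<^esub> \<eta> (Dom C k) = \<eta> (Cod C k) \<cdot>\<^bsub>C\<^esub> k" if "k \<in> Arr C" for k
    using unit_nat that by (auto simp: nat_trans_def fid_def fcomp_def)
  have eps_nat: "k \<cdot>\<^bsub>D\<^esub> \<epsilon> (Dom D k) = \<epsilon> (Cod D k) \<cdot>\<^bsub>D\<^esub> FA F (FA G k)" if "k \<in> Arr D" for k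
    using counit_nat that by (auto simp: nat_trans_def fid_def fcomp_def)
  show ?thesis
  proof (rule ex1I[of _ "FA G g \<cdot>\<^bsub>C\<^esub> \<eta> c"])
    have "\<epsilon> d \<cdot>\<^bsub>D\<^esub> (FA F (FA G g) \<cdot>\<^bsub>D\<^esub> FA F (\<eta> c)) = g \<cdot>\<^bsub>D\<^esub> (\<epsilon> (FO F c) \<cdot>\<^bsub>D\<^esub> FA F (\<eta> c))"
      using eps_nat[of g] by (intro F.D.cmp_eq_extend) simp_all
    then show "FA G g \<cdot>\<^bsub>C\<^esub> \<eta> c \<in> hom C c (FO G d) \<and> \<epsilon> d \<cdot>\<^bsub>D\<^esub> FA F (FA G g \<cdot>\<^bsub>C\<^esub> \<eta> c) = g"
      by (simp add: F.FA_cmp_arr hom_def triangle_left)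
  next
    fix p assume p: "p \<in> hom C c (FO G d) \<and> \<epsilon> d \<cdot>\<^bsub>D\<^esub> FA F p = g"
    then have [simp]: "p \<in> Arr C" "Dom C p = c" "Cod C p = FO G d" by (auto simp: hom_def)
    have "FA G g \<cdot>\<^bsub>C\<^esub> \<eta> c = FA G (\<epsilon> d) \<cdot>\<^bsub>C\<^esub> (FA G (FA F p) \<cdot>\<^bsub>C\<^esub> \<eta> c)"
    proof -
      have "FA G g = FA G (\<epsilon> d) \<cdot>\<^bsub>C\<^esub> FA G (FA F p)" using p by (simp flip: G.FA_cmp_arr)
      then show ?thesis by simp
    qed
    also have "\<dots> = FA G (\<epsilon> d) \<cdot>\<^bsub>C\<^esub> (\<eta> (FO G d) \<cdot>\<^bsub>C\<^esub> p)"
      using eta_nat[of p] by simp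
    also have "\<dots> = p"
      by (subst F.C.cmp_eq_extend1[OF triangle_right]) simp_all
    finally show "p = FA G g \<cdot>\<^bsub>C\<^esub> \<eta> c" by simp
  qed
qed

lemma (in strict_monoidal_category) dual_transpose:
  assumes [simp]: "a \<in> Obj C" "d \<in> Obj C" "x \<in> Obj C" "b \<in> Obj C"
    and [simp]: "ev \<in> Arr C" "Dom C ev = a \<odot> d" "Cod C ev = \<one>" "coev \<in> Arr C" "Dom C coev = \<one>" "Cod C coev = d \<odot> a"
  shows "f \<in> hom C (a \<odot> x) b \<Longrightarrow> (ev \<otimes> Ide C a) \<cdot> (Ide C a \<otimes> coev) = Ide C a \<Longrightarrow>
      (ev \<otimes> Ide C b) \<cdot> (Ide C a \<otimes> ((Ide C d \<otimes> f) \<cdot> (coev \<otimes> Ide C x))) = f"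
    and "k \<in> hom C x (d \<odot> b) \<Longrightarrow> (Ide C d \<otimes> ev) \<cdot> (coev \<otimes> Ide C d) = Ide C d \<Longrightarrow>
      (Ide C d \<otimes> ((ev \<otimes> Ide C b) \<cdot> (Ide C a \<otimes> k))) \<cdot> (coev \<otimes> Ide C x) = k"
proof -
  let ?I = "Ide C"
  assume "f \<in> hom C (a \<odot> x) b" and z: "(ev \<otimes> Ide C a) \<cdot> (Ide C a \<otimes> coev) = Ide C a"
  then have [simp]: "f \<in> Arr C" "Dom C f = a \<odot> x" "Cod C f = b" by (auto simp: hom_def)
  have "(ev \<otimes> ?I b) \<cdot> (?I a \<otimes> ((?I d \<otimes> f) \<cdot> (coev \<otimes> ?I x))) =
    (ev \<otimes> ?I b) \<cdot> ((?I (a \<odot> d) \<otimes> f) \<cdot> (?I a \<otimes> (coev \<otimes> ?I x)))"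
    using ten_cmp[of "?I a" "coev \<otimes> ?I x" "?I a" "?I d \<otimes> f"]
    by (simp add: tenM_ide_obj[symmetric] del: tenM_ide_obj)
  also have "\<dots> = (?I \<one> \<otimes> f) \<cdot> ((ev \<otimes> ?I (a \<odot> x)) \<cdot> (?I a \<otimes> (coev \<otimes> ?I x)))"
    using ten_cmp[of "?I (a \<odot> d)" f ev "?I b"] ten_cmp[of ev "?I (a \<odot> x)" "?I \<one>" f]
    by (intro cmp_eq_extend) simp_all
  also have "(ev \<otimes> ?I (a \<odot> x)) \<cdot> (?I a \<otimes> (coev \<otimes> ?I x)) = ((ev \<otimes> ?I a) \<cdot> (?I a \<otimes> coev)) \<otimes> ?I x"
    using ten_cmp[of "?I a \<otimes> coev" "?I x" "ev \<otimes> ?I a" "?I x"]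
    by (simp add: tenM_ide_obj[symmetric] del: tenM_ide_obj)
  finally show "(ev \<otimes> ?I b) \<cdot> (?I a \<otimes> ((?I d \<otimes> f) \<cdot> (coev \<otimes> ?I x))) = f"
    by (simp add: z)
next
  let ?I = "Ide C"
  assume "k \<in> hom C x (d \<odot> b)" and z: "(Ide C d \<otimes> ev) \<cdot> (coev \<otimes> Ide C d) = Ide C d"
  then have [simp]: "k \<in> Arr C" "Dom C k = x" "Cod C k = d \<odot> b" by (auto simp: hom_def)
  have "(?I d \<otimes> ((ev \<otimes> ?I b) \<cdot> (?I a \<otimes> k))) \<cdot> (coev \<otimes> ?I x) =
    (?I d \<otimes> (ev \<otimes> ?I b)) \<cdot> ((?I (d \<odot> a) \<otimes> k) \<cdot> (coev \<otimes> ?I x))"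
    using ten_cmp[of "?I d" "?I a \<otimes> k" "?I d" "ev \<otimes> ?I b", symmetric]
    by (simp add: tenM_ide_obj[symmetric] del: tenM_ide_obj)
  also have "(?I (d \<odot> a) \<otimes> k) \<cdot> (coev \<otimes> ?I x) = (coev \<otimes> ?I (d \<odot> b)) \<cdot> k"
    using ten_cmp[of coev "?I x" "?I (d \<odot> a)" k] ten_cmp[of "?I \<one>" k coev "?I (d \<odot> b)"] by simp
  also have "(?I d \<otimes> (ev \<otimes> ?I b)) \<cdot> ((coev \<otimes> ?I (d \<odot> b)) \<cdot> k) = (((?I d \<otimes> ev) \<cdot> (coev \<otimes> ?I d)) \<otimes> ?I b) \<cdot> k"
    using ten_cmp_extend[of "coev \<otimes> ?I d" "?I b" "?I d \<otimes> ev" "?I b" k]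
    by (simp add: tenM_ide_obj[symmetric] del: tenM_ide_obj)
  finally show "(?I d \<otimes> ((ev \<otimes> ?I b) \<cdot> (?I a \<otimes> k))) \<cdot> (coev \<otimes> ?I x) = k"
    by (simp add: z)
qed

context modtens_object
begin

text \<open>
  For a dual \<open>d\<close> of \<open>a\<close> and the right adjoint \<open>R\<close> of \<open>F\<close>, arrows \<open>a F(v) \<rightarrow> b\<close> correspond to arrows
  \<open>F(v) \<rightarrow> d b\<close> and these to morphisms \<open>v \<rightarrow> R(d b)\<close>.
\<close>

lemma hom_object_exists:
  assumes [simp]: "a \<in> Obj A" "b \<in> Obj A"
  shows "\<exists>H t. H \<in> Obj V \<and> t \<in> hom A (a \<odot>\<^bsub>A\<^esub> F H) b \<and>
    (\<forall>v \<in> Obj V. \<forall>f \<in> hom A (a \<odot>\<^bsub>A\<^esub> F v) b. \<exists>!p. p \<in> hom V v H \<and> t \<cdot>\<^bsub>A\<^esub> (Ide A a \<otimes>\<^bsub>A\<^esub> FA (mtF X) p) = f)"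
proof -
  obtain R \<eta> \<epsilon> where adj: "adjunction V A (mtF X) R \<eta> \<epsilon>"
    using cell by (auto simp: modtens_0cell_def has_right_adjoint_def)
  interpret J: adjunction V A "mtF X" R \<eta> \<epsilon> by (rule adj)
  obtain d ev coev where [simp]: "d \<in> Obj A" "ev \<in> Arr A" "Dom A ev = a \<odot>\<^bsub>A\<^esub> d" "Cod A ev = \<one>\<^bsub>A\<^esub>"
    "coev \<in> Arr A" "Dom A coev = \<one>\<^bsub>A\<^esub>" "Cod A coev = d \<odot>\<^bsub>A\<^esub> a" and
    z1: "(ev \<otimes>\<^bsub>A\<^esub> Ide A a) \<cdot>\<^bsub>A\<^esub> (Ide A a \<otimes>\<^bsub>A\<^esub> coev) = Ide A a" and
    z2: "(Ide A d \<otimes>\<^bsub>A\<^esub> ev) \<cdot>\<^bsub>A\<^esub> (coev \<otimes>\<^bsub>A\<^esub> Ide A d) = Ide A d"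
    using A.right_dual[of a] unfolding dual_pair_def hom_def by auto
  let ?I = "Ide A" and ?c = "d \<odot>\<^bsub>A\<^esub> b"
  let ?H = "FO R ?c"
  have eps [simp]: "\<epsilon> ?c \<in> Arr A" "Dom A (\<epsilon> ?c) = F ?H" "Cod A (\<epsilon> ?c) = ?c"
    using J.counit_nat by (auto simp: nat_trans_def fid_def fcomp_def hom_def)
  have H [simp]: "?H \<in> Obj V" by simp
  let ?t = "(ev \<otimes>\<^bsub>A\<^esub> ?I b) \<cdot>\<^bsub>A\<^esub> (?I a \<otimes>\<^bsub>A\<^esub> \<epsilon> ?c)"
  have t: "?t \<in> hom A (a \<odot>\<^bsub>A\<^esub> F ?H) b" by (simp add: hom_def)
  have "\<exists>!p. p \<in> hom V v ?H \<and> ?t \<cdot>\<^bsub>A\<^esub> (?I a \<otimes>\<^bsub>A\<^esub> FA (mtF X) p) = f"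
    if [simp]: "v \<in> Obj V" and f: "f \<in> hom A (a \<odot>\<^bsub>A\<^esub> F v) b" for v f
  proof -
    let ?g = "(?I d \<otimes>\<^bsub>A\<^esub> f) \<cdot>\<^bsub>A\<^esub> (coev \<otimes>\<^bsub>A\<^esub> ?I (F v))"
    have fa [simp]: "f \<in> Arr A" "Dom A f = a \<odot>\<^bsub>A\<^esub> F v" "Cod A f = b" using f by (auto simp: hom_def)
    have "\<epsilon> ?c \<cdot>\<^bsub>A\<^esub> FA (mtF X) p = ?g \<longleftrightarrow> ?t \<cdot>\<^bsub>A\<^esub> (?I a \<otimes>\<^bsub>A\<^esub> FA (mtF X) p) = f"
      if p: "p \<in> hom V v ?H" for p
    proof -
      have [simp]: "p \<in> Arr V" "Dom V p = v" "Cod V p = ?H" using p by (auto simp: hom_def)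
      let ?k = "\<epsilon> ?c \<cdot>\<^bsub>A\<^esub> FA (mtF X) p"
      have k: "?k \<in> hom A (F v) ?c" by (simp add: hom_def)
      have tk: "?t \<cdot>\<^bsub>A\<^esub> (?I a \<otimes>\<^bsub>A\<^esub> FA (mtF X) p) = (ev \<otimes>\<^bsub>A\<^esub> ?I b) \<cdot>\<^bsub>A\<^esub> (?I a \<otimes>\<^bsub>A\<^esub> ?k)"
        by (simp add: A.ten_cmp)
      have 1: "(ev \<otimes>\<^bsub>A\<^esub> ?I b) \<cdot>\<^bsub>A\<^esub> (?I a \<otimes>\<^bsub>A\<^esub> ?g) = f"
        by (rule A.dual_transpose(1)) (use z1 f in simp_all)
      have 2: "(?I d \<otimes>\<^bsub>A\<^esub> ((ev \<otimes>\<^bsub>A\<^esub> ?I b) \<cdot>\<^bsub>A\<^esub> (?I a \<otimes>\<^bsub>A\<^esub> ?k))) \<cdot>\<^bsub>A\<^esub> (coev \<otimes>\<^bsub>A\<^esub> ?I (F v)) = ?k"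
        by (rule A.dual_transpose(2)) (use z2 k in simp_all)
      show ?thesis
        unfolding tk using 1 2 by metis
    qed
    moreover have "\<exists>!p. p \<in> hom V v ?H \<and> \<epsilon> ?c \<cdot>\<^bsub>A\<^esub> FA (mtF X) p = ?g"
      by (rule adjunction_couniversal[OF adj]) (simp_all add: hom_def)
    ultimately show ?thesis by (simp cong: conj_cong)
  qed
  then show ?thesis using H t by blast
qed

lemma hom_represented_exists: "\<exists>H \<epsilon>. hom_represented V M (fst \<circ> snd) mact H \<epsilon>"
proof -
  let ?P = "\<lambda>a b H t. H \<in> Obj V \<and> t \<in> hom A (a \<odot>\<^bsub>A\<^esub> F H) b \<and>
    (\<forall>v \<in> Obj V. \<forall>f \<in> hom A (a \<odot>\<^bsub>A\<^esub> F v) b. \<exists>!p. p \<in> hom V v H \<and> t \<cdot>\<^bsub>A\<^esub> (Ide A a \<otimes>\<^bsub>A\<^esub> FA (mtF X) p) = f)"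
  have "\<forall>a b. \<exists>z. a \<in> Obj A \<and> b \<in> Obj A \<longrightarrow> ?P a b (fst z) (snd z)"
    using hom_object_exists by simp
  then obtain Z where Z: "\<And>a b. a \<in> Obj A \<Longrightarrow> b \<in> Obj A \<Longrightarrow> ?P a b (fst (Z a b)) (snd (Z a b))"
    by metis
  define H where "H a b = fst (Z a b)" for a b
  define t where "t a b = snd (Z a b)" for a b
  have H: "H a b \<in> Obj V" and t: "t a b \<in> Arr A" "Dom A (t a b) = a \<odot>\<^bsub>A\<^esub> F (H a b)" "Cod A (t a b) = b"
    and ex1: "\<And>v f. v \<in> Obj V \<Longrightarrow> f \<in> hom A (a \<odot>\<^bsub>A\<^esub> F v) b \<Longrightarrow>
      \<exists>!p. p \<in> hom V v (H a b) \<and> t a b \<cdot>\<^bsub>A\<^esub> (Ide A a \<otimes>\<^bsub>A\<^esub> FA (mtF X) p) = f"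
    if "a \<in> Obj A" "b \<in> Obj A" for a b
    using Z[OF that] by (auto simp: H_def t_def hom_def)
  have "hom_represented V M (fst \<circ> snd) mact H (\<lambda>a b. (a, H a b, t a b))"
  proof (rule hom_represented.intro[OF graded_M], unfold_locales, goal_cases)
    case (6 f)
    then obtain a v f0 where f: "f = (a, v, f0)" "a \<in> Obj A" "v \<in> Obj V" "f0 \<in> Arr A" "Dom A f0 = a \<odot>\<^bsub>A\<^esub> F v"
      by (rule Arr_ME)
    have b: "Cod A f0 \<in> Obj A" using f by simp
    have "\<exists>!p. p \<in> hom V v (H a (Cod A f0)) \<and> t a (Cod A f0) \<cdot>\<^bsub>A\<^esub> (Ide A a \<otimes>\<^bsub>A\<^esub> FA (mtF X) p) = f0"
      by (rule ex1[OF f(2) b]) (use f in \<open>auto simp: hom_def\<close>)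
    moreover have "mact (a, H a (Cod A f0), t a (Cod A f0)) p = f \<longleftrightarrow> t a (Cod A f0) \<cdot>\<^bsub>A\<^esub> (Ide A a \<otimes>\<^bsub>A\<^esub> FA (mtF X) p) = f0"
      if "p \<in> hom V v (H a (Cod A f0))" for p
      using that by (auto simp: f(1) hom_def)
    ultimately show ?case by (simp add: f(1) cong: conj_cong)
  qed (simp_all add: H t)
  then show ?thesis by blast
qed

end

section \<open>Every module tensor category comes from an enriched one\<close>

lemma adjunction_of_universal:
  assumes G: "cfunctor D C G"
    and F0: "\<And>c. c \<in> Obj C \<Longrightarrow> F0 c \<in> Obj D"
    and eta: "\<And>c. c \<in> Obj C \<Longrightarrow> \<eta> c \<in> hom C c (FO G (F0 c))"
    and univ: "\<And>c d f. c \<in> Obj C \<Longrightarrow> d \<in> Obj D \<Longrightarrow> f \<in> hom C c (FO G d) \<Longrightarrow>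
      \<exists>!g. g \<in> hom D (F0 c) d \<and> FA G g \<cdot>\<^bsub>C\<^esub> \<eta> c = f"
  shows "\<exists>F \<epsilon>. adjunction C D F G \<eta> \<epsilon>"
proof -
  interpret G: cfunctor D C G by fact
  have eta_arr [simp]: "\<eta> c \<in> Arr C" "Dom C (\<eta> c) = c" "Cod C (\<eta> c) = FO G (F0 c)" if "c \<in> Obj C" for c
    using eta[OF that] by (auto simp: hom_def)
  define tr where "tr c d f = (THE g. g \<in> hom D (F0 c) d \<and> FA G g \<cdot>\<^bsub>C\<^esub> \<eta> c = f)" for c d f
  have tr_arr [simp]: "tr c d f \<in> Arr D" "Dom D (tr c d f) = F0 c" "Cod D (tr c d f) = d"
    and tr_eta: "FA G (tr c d f) \<cdot>\<^bsub>C\<^esub> \<eta> c = f"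
    if "c \<in> Obj C" "d \<in> Obj D" "f \<in> Arr C" "Dom C f = c" "Cod C f = FO G d" for c d f
    using theI'[OF univ[of c d f], folded tr_def] that by (auto simp: hom_def)
  have tr_eq: "g = g'" if c: "c \<in> Obj C" and g: "g \<in> Arr D" "g' \<in> Arr D" "Dom D g = F0 c" "Dom D g' = F0 c" "Cod D g = Cod D g'"
    and eq: "FA G g \<cdot>\<^bsub>C\<^esub> \<eta> c = FA G g' \<cdot>\<^bsub>C\<^esub> \<eta> c" for c g g'
    using univ[of c "Cod D g" "FA G g \<cdot>\<^bsub>C\<^esub> \<eta> c"] c g eq by (auto simp: hom_def)
  define F where "F = \<lparr>FO = F0, FA = (\<lambda>f. tr (Dom C f) (F0 (Cod C f)) (\<eta> (Cod C f) \<cdot>\<^bsub>C\<^esub> f))\<rparr>"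
  define \<epsilon> where "\<epsilon> d = tr (FO G d) d (Ide C (FO G d))" for d
  have F_simps [simp]: "FO F c = F0 c" "FA F f = tr (Dom C f) (F0 (Cod C f)) (\<eta> (Cod C f) \<cdot>\<^bsub>C\<^esub> f)" for c f
    by (simp_all add: F_def)
  have F: "cfunctor C D F"
  proof (unfold_locales, goal_cases)
    case (3 a)
    then show ?case by (intro tr_eq[of a]) (simp_all add: F0 tr_eta)
  next
    case (4 f a b g c)
    then have [simp]: "f \<in> Arr C" "g \<in> Arr C" "Dom C f = a" "Cod C f = b" "Dom C g = b" "Cod C g = c"
      by (auto simp: hom_def)
    have [simp]: "a \<in> Obj C" "b \<in> Obj C" "c \<in> Obj C"
      using G.D.dom_in[of f] G.D.cod_in[of f] G.D.cod_in[of g] by simp_all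
    let ?g = "tr b (F0 c) (\<eta> c \<cdot>\<^bsub>C\<^esub> g)" and ?f = "tr a (F0 b) (\<eta> b \<cdot>\<^bsub>C\<^esub> f)"
    have "FA G ?g \<cdot>\<^bsub>C\<^esub> (FA G ?f \<cdot>\<^bsub>C\<^esub> \<eta> a) = FA G ?g \<cdot>\<^bsub>C\<^esub> (\<eta> b \<cdot>\<^bsub>C\<^esub> f)"
      by (simp add: tr_eta F0)
    also have "\<dots> = (\<eta> c \<cdot>\<^bsub>C\<^esub> g) \<cdot>\<^bsub>C\<^esub> f"
      by (rule G.D.cmp_eq_extend1) (simp_all add: tr_eta F0)
    finally show ?case
      by (intro tr_eq[of a]) (simp_all add: F0 tr_eta G.FA_cmp_arr)
  qed (auto simp: hom_def F0)
  interpret F: cfunctor C D F by (rule F)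
  have "adjunction C D F G \<eta> \<epsilon>"
  proof (rule adjunction.intro[OF F G], unfold_locales)
    show "nat_trans C C (fid C) (fcomp C G F) \<eta>"
      by (auto simp: nat_trans_def fid_def fcomp_def hom_def tr_eta F0)
    show "nat_trans D D (fcomp D F G) (fid D) \<epsilon>"
      unfolding nat_trans_def
    proof (intro conjI ballI)
      fix g assume [simp]: "g \<in> Arr D"
      let ?a = "FO G (Dom D g)" and ?b = "FO G (Cod D g)"
      let ?k = "tr ?a (F0 ?b) (\<eta> ?b \<cdot>\<^bsub>C\<^esub> FA G g)"
      have "FA G (\<epsilon> (Cod D g)) \<cdot>\<^bsub>C\<^esub> (FA G ?k \<cdot>\<^bsub>C\<^esub> \<eta> ?a) = FA G (\<epsilon> (Cod D g)) \<cdot>\<^bsub>C\<^esub> (\<eta> ?b \<cdot>\<^bsub>C\<^esub> FA G g)"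
        by (simp add: tr_eta F0)
      also have "\<dots> = Ide C ?b \<cdot>\<^bsub>C\<^esub> FA G g"
        by (rule G.D.cmp_eq_extend1) (simp_all add: tr_eta F0 \<epsilon>_def)
      finally have "FA G (\<epsilon> (Cod D g)) \<cdot>\<^bsub>C\<^esub> (FA G ?k \<cdot>\<^bsub>C\<^esub> \<eta> ?a) = FA G g" by simp
      then have "g \<cdot>\<^bsub>D\<^esub> \<epsilon> (Dom D g) = \<epsilon> (Cod D g) \<cdot>\<^bsub>D\<^esub> ?k"
        by (intro tr_eq[of ?a]) (simp_all add: F0 tr_eta G.FA_cmp_arr \<epsilon>_def)
      then show "FA (fid D) g \<cdot>\<^bsub>D\<^esub> \<epsilon> (Dom D g) = \<epsilon> (Cod D g) \<cdot>\<^bsub>D\<^esub> FA (fcomp D F G) g"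
        by (simp add: fid_def fcomp_def)
    qed (auto simp: fid_def fcomp_def hom_def \<epsilon>_def)
  next
    fix c assume [simp]: "c \<in> Obj C"
    let ?k = "tr c (F0 (FO G (F0 c))) (\<eta> (FO G (F0 c)) \<cdot>\<^bsub>C\<^esub> \<eta> c)"
    have [simp]: "F0 c \<in> Obj D" by (rule F0) simp
    have "FA G (\<epsilon> (F0 c)) \<cdot>\<^bsub>C\<^esub> (FA G ?k \<cdot>\<^bsub>C\<^esub> \<eta> c) = FA G (\<epsilon> (F0 c)) \<cdot>\<^bsub>C\<^esub> (\<eta> (FO G (F0 c)) \<cdot>\<^bsub>C\<^esub> \<eta> c)"
      by (simp add: tr_eta F0)
    also have "\<dots> = Ide C (FO G (F0 c)) \<cdot>\<^bsub>C\<^esub> \<eta> c"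
      by (rule G.D.cmp_eq_extend1) (simp_all add: tr_eta F0 \<epsilon>_def)
    finally have "FA G (\<epsilon> (F0 c)) \<cdot>\<^bsub>C\<^esub> (FA G ?k \<cdot>\<^bsub>C\<^esub> \<eta> c) = \<eta> c" by simp
    then have "\<epsilon> (F0 c) \<cdot>\<^bsub>D\<^esub> ?k = Ide D (F0 c)"
      by (intro tr_eq[of c]) (simp_all add: F0 G.FA_cmp_arr \<epsilon>_def)
    then show "\<epsilon> (FO F c) \<cdot>\<^bsub>D\<^esub> FA F (\<eta> c) = Ide D (FO F c)" by simp
  next
    fix d assume "d \<in> Obj D"
    then show "FA G (\<epsilon> d) \<cdot>\<^bsub>C\<^esub> \<eta> (FO G d) = Ide C (FO G d)" by (simp add: \<epsilon>_def tr_eta)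
  qed
  then show ?thesis by blast
qed

lemma (in enriched) from_unit_functor:
  "cfunctor (underlying V A :: ('a, ('a, 'm, 'h) uarr) moncat) V (from_unit V A)"
proof -
  let ?U = "underlying V A :: ('a, ('a, 'm, 'h) uarr) moncat"
  let ?G = "graded_cat V A :: ('a, ('a, 'm, 'h) uarr) moncat"
  interpret G: graded_monoidal V ?G "grade V" "regrade V" by (rule graded_monoidal)
  have cat: "category ?U"
    using G.strict_monoidal_pure unfolding pure_graded_cat by (rule strict_monoidal_category.axioms(1))
  let ?i = "\<lambda>a. Elt (vUnit A) a (Ide V (vHom A (vUnit A) a)) :: ('a, 'm, 'h) uarr"
  have U: "f \<in> hom ?U a b \<longleftrightarrow> f \<in> Arr ?G \<and> grade V f = \<one>\<^bsub>V\<^esub> \<and> usrc f = a \<and> utgt f = b"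
    for f :: "('a, 'm, 'h) uarr" and a b
    unfolding pure_graded_cat[symmetric] by (auto simp: hom_def graded_cat_simps)
  have fu: "FA (from_unit V A) f = uelt (f \<cdot>\<^bsub>?G\<^esub> ?i a)" "FA (from_unit V A) f \<in> hom V (vHom A (vUnit A) a) (vHom A (vUnit A) b)"
    if "f \<in> hom ?U a b" for f :: "('a, 'm, 'h) uarr" and a b
    using that[unfolded U] by (auto simp: from_unit_def graded_cat_simps hom_def elim!: Arr_graded_catE)
  show ?thesis
  proof (rule cfunctor.intro[OF cat V.category_axioms], unfold_locales, goal_cases)
    case (1 a) then show ?case by (simp add: underlying_def from_unit_def)
  next
    case (2 f a b) then show ?case using fu(2)[of f a b] by (simp add: from_unit_def)
  next
    case (3 a)
    then show ?case by (simp add: underlying_def from_unit_def vCmp_vId)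
  next
    case (4 f a b g c)
    have f: "f \<in> Arr ?G" "usrc f = a" "utgt f = b" "a \<in> vObj A" and g: "g \<in> Arr ?G" "usrc g = b" "utgt g = c"
      using 4(1,2)[unfolded U] by (auto elim!: Arr_graded_catE)
    have k: "Dom V (FA (from_unit V A) f) = vHom A (vUnit A) a" "Cod V (FA (from_unit V A) f) = vHom A (vUnit A) b" "FA (from_unit V A) f \<in> Arr V"
      using fu(2)[OF 4(1)] by (auto simp: hom_def)
    have gf: "g \<cdot>\<^bsub>?U\<^esub> f = g \<cdot>\<^bsub>?G\<^esub> f" by (simp add: graded_cat_def)
    have "FA (from_unit V A) (g \<cdot>\<^bsub>?U\<^esub> f) = uelt ((g \<cdot>\<^bsub>?G\<^esub> f) \<cdot>\<^bsub>?G\<^esub> ?i a)"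
      using fu(1)[OF category.cmp_in[OF cat 4]] by (simp only: gf)
    also have "(g \<cdot>\<^bsub>?G\<^esub> f) \<cdot>\<^bsub>?G\<^esub> ?i a = g \<cdot>\<^bsub>?G\<^esub> (f \<cdot>\<^bsub>?G\<^esub> ?i a)"
      by (rule G.cmp_assoc_arr) (use f g in \<open>auto simp: graded_cat_simps(2,3,9)\<close>)
    also have "f \<cdot>\<^bsub>?G\<^esub> ?i a = Elt (vUnit A) b (FA (from_unit V A) f)"
      using fu(1)[OF 4(1)] f by (simp add: graded_cat_simps)
    also have "uelt (g \<cdot>\<^bsub>?G\<^esub> Elt (vUnit A) b (FA (from_unit V A) f)) = FA (from_unit V A) g \<cdot>\<^bsub>V\<^esub> FA (from_unit V A) f"
    proof -
      obtain m where m: "g = Elt b c m" "b \<in> vObj A" "c \<in> vObj A" "m \<in> Arr V" "Dom V m = \<one>\<^bsub>V\<^esub>" "Cod V m = vHom A b c"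
        using 4(2)[unfolded U] by (auto elim!: Arr_graded_catE)
      show ?thesis
        using k m V.ten_cmp[of "FA (from_unit V A) f" "Ide V \<one>\<^bsub>V\<^esub>" "Ide V (vHom A (vUnit A) b)" m]
        by (simp add: graded_cat_simps from_unit_def[of V A])
    qed
    finally show ?case .
  qed
qed

text \<open>
  \<open>phi\<close> is the arrow \<open>a F(v) \<rightarrow> b\<close> of \<open>A\<close> that an arrow \<open>a \<rightarrow> b\<close> of grade \<open>v\<close> in the enriched category stands
  for, and \<open>psi\<close> inverts it on arrows of grade one, so it identifies the underlying category with \<open>A\<close>.
\<close>

locale hom_model = X: modtens_object V X +
    R: hom_represented V "modtens_object.M V X" "fst \<circ> snd" "modtens_object.mact V X" H \<epsilon>
  for V :: "('v, 'm) braided_moncat" and X :: "('v, 'm, 'a, ('a, 'm, 'h) uarr) modtens" and H \<epsilon>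
begin

abbreviation "A \<equiv> mtCat X"
abbreviation "GE \<equiv> graded_cat V R.EC :: ('a, ('a, 'm, 'h) uarr) moncat"
abbreviation "U \<equiv> underlying V R.EC :: ('a, ('a, 'm, 'h) uarr) moncat"

definition phi :: "('a, 'm, 'h) uarr \<Rightarrow> ('a, 'm, 'h) uarr" where
  "phi t = snd (snd (R.Phi t))"

definition psi :: "('a, 'm, 'h) uarr \<Rightarrow> ('a, 'm, 'h) uarr" where
  "psi f = R.Psi (Dom A f, \<one>\<^bsub>V\<^esub>, f)"

interpretation GE: graded_monoidal V GE "grade V" "regrade V"
  by (rule R.E.graded_monoidal)

lemma pure_U: "GE.pure = U"
  by (rule pure_graded_cat)

lemma GE_simps: "Obj GE = Obj A" "Dom GE = usrc" "Cod GE = utgt" "\<one>\<^bsub>GE\<^esub> = \<one>\<^bsub>A\<^esub>" "a \<odot>\<^bsub>GE\<^esub> b = a \<odot>\<^bsub>A\<^esub> b"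
  by (simp_all add: graded_cat_simps)

lemma Phi_phi:
  assumes "t \<in> Arr GE"
  shows "R.Phi t = (usrc t, grade V t, phi t)"
    and "usrc t \<in> Obj A" "utgt t \<in> Obj A" "grade V t \<in> Obj V"
    and "phi t \<in> Arr A" "Dom A (phi t) = usrc t \<odot>\<^bsub>A\<^esub> X.F (grade V t)" "Cod A (phi t) = utgt t"
proof -
  obtain a v f where t: "R.Phi t = (a, v, f)" by (cases "R.Phi t")
  have "(a, v, f) \<in> Arr X.M" "a = usrc t" "Cod A f = utgt t" "v = grade V t"
    using R.Phi_arr[OF assms] by (auto simp: t)
  moreover have "utgt t \<in> Obj A"
    using assms by (auto elim!: Arr_graded_catE)
  ultimately show "R.Phi t = (usrc t, grade V t, phi t)" "usrc t \<in> Obj A" "utgt t \<in> Obj A" "grade V t \<in> Obj V"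
    "phi t \<in> Arr A" "Dom A (phi t) = usrc t \<odot>\<^bsub>A\<^esub> X.F (grade V t)" "Cod A (phi t) = utgt t"
    by (auto simp: phi_def t)
qed

lemma phi_eqI:
  assumes "t \<in> Arr GE" "t' \<in> Arr GE" "usrc t = usrc t'" "grade V t = grade V t'" "phi t = phi t'"
  shows "t = t'"
  by (rule R.Phi_inj) (use assms in \<open>simp_all add: Phi_phi(1)\<close>)

lemma phi_ide [simp]: "a \<in> Obj A \<Longrightarrow> phi (Ide GE a) = Ide A a"
  by (simp add: phi_def R.Phi_ide)

lemma phi_cmp:
  assumes "t \<in> Arr GE" "t' \<in> Arr GE" "utgt t = usrc t'"
  shows "phi (t' \<cdot>\<^bsub>GE\<^esub> t) = phi t' \<cdot>\<^bsub>A\<^esub> ((phi t \<otimes>\<^bsub>A\<^esub> Ide A (X.F (grade V t'))) \<cdot>\<^bsub>A\<^esub> (Ide A (usrc t) \<otimes>\<^bsub>A\<^esub> X.\<mu> (grade V t) (grade V t')))"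
  using R.Phi_cmp[OF assms] assms(3)
  by (simp only: phi_def[of "t' \<cdot>\<^bsub>GE\<^esub> t"] Phi_phi(1)[OF assms(1)] Phi_phi(1)[OF assms(2)] X.M_simps snd_conv)

lemma phi_ten:
  assumes "t \<in> Arr GE" "t' \<in> Arr GE"
  shows "phi (t \<otimes>\<^bsub>GE\<^esub> t') = (Ide A (utgt t) \<otimes>\<^bsub>A\<^esub> phi t') \<cdot>\<^bsub>A\<^esub>
      ((((phi t \<otimes>\<^bsub>A\<^esub> Ide A (usrc t')) \<cdot>\<^bsub>A\<^esub> (Ide A (usrc t) \<otimes>\<^bsub>A\<^esub> X.e (usrc t') (grade V t))) \<otimes>\<^bsub>A\<^esub> Ide A (X.F (grade V t'))) \<cdot>\<^bsub>A\<^esub>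
        (Ide A (usrc t \<odot>\<^bsub>A\<^esub> usrc t') \<otimes>\<^bsub>A\<^esub> X.\<mu> (grade V t) (grade V t')))"
  using R.Phi_ten[OF assms]
  by (simp only: phi_def[of "t \<otimes>\<^bsub>GE\<^esub> t'"] Phi_phi(1)[OF assms(1)] Phi_phi(1)[OF assms(2)] Phi_phi(7)[OF assms(1)]
      X.M_ten snd_conv)

lemma phi_act:
  assumes "t \<in> Arr GE" "p \<in> Arr V" "Cod V p = grade V t"
  shows "phi (regrade V t p) = phi t \<cdot>\<^bsub>A\<^esub> (Ide A (usrc t) \<otimes>\<^bsub>A\<^esub> FA (mtF X) p)"
  using R.Phi_act[OF assms]
  by (simp only: phi_def[of "regrade V t p"] Phi_phi(1)[OF assms(1)] X.M_simps snd_conv)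

lemma phi_cmp_pure:
  assumes "t \<in> Arr GE" "t' \<in> Arr GE" "utgt t = usrc t'" "grade V t' = \<one>\<^bsub>V\<^esub>"
  shows "phi (t' \<cdot>\<^bsub>GE\<^esub> t) = phi t' \<cdot>\<^bsub>A\<^esub> phi t"
  using assms Phi_phi[OF assms(1)] Phi_phi[OF assms(2)] by (simp add: phi_cmp)

lemma phi_ten_left:
  assumes "t \<in> Arr GE" "a \<in> Obj A"
  shows "phi (Ide GE a \<otimes>\<^bsub>GE\<^esub> t) = Ide A a \<otimes>\<^bsub>A\<^esub> phi t"
  using assms Phi_phi[OF assms(1)] GE.ide_arr[of a] by (simp add: phi_ten GE_simps)

lemma phi_ten_right:
  assumes "t \<in> Arr GE" "a \<in> Obj A"
  shows "phi (t \<otimes>\<^bsub>GE\<^esub> Ide GE a) = (phi t \<otimes>\<^bsub>A\<^esub> Ide A a) \<cdot>\<^bsub>A\<^esub> (Ide A (usrc t) \<otimes>\<^bsub>A\<^esub> X.e a (grade V t))"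
  using assms Phi_phi[OF assms(1)] GE.ide_arr[of a] by (simp add: phi_ten GE_simps)

lemma phi_ten_pure:
  assumes "t \<in> Arr GE" "t' \<in> Arr GE" "grade V t = \<one>\<^bsub>V\<^esub>"  "grade V t' = \<one>\<^bsub>V\<^esub>"
  shows "phi (t \<otimes>\<^bsub>GE\<^esub> t') = phi t \<otimes>\<^bsub>A\<^esub> phi t'"
  using assms Phi_phi[OF assms(1)] Phi_phi[OF assms(2)] by (simp add: phi_ten X.A.ten_cmp)

lemma phi_ten_unit:
  assumes "t \<in> Arr GE" "t' \<in> Arr GE" "usrc t = \<one>\<^bsub>A\<^esub>" "usrc t' = \<one>\<^bsub>A\<^esub>"
  shows "phi (t \<otimes>\<^bsub>GE\<^esub> t') = (phi t \<otimes>\<^bsub>A\<^esub> phi t') \<cdot>\<^bsub>A\<^esub> X.\<mu> (grade V t) (grade V t')"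
  using assms Phi_phi[OF assms(1)] Phi_phi[OF assms(2)] by (simp add: phi_ten X.A.ten_cmp_extend)

lemma Psi_M:
  assumes "a \<in> Obj A" "v \<in> Obj V" "f \<in> Arr A" "Dom A f = a \<odot>\<^bsub>A\<^esub> X.F v"
  shows "R.Psi (a, v, f) \<in> Arr GE" "usrc (R.Psi (a, v, f)) = a" "utgt (R.Psi (a, v, f)) = Cod A f"
    "grade V (R.Psi (a, v, f)) = v" "phi (R.Psi (a, v, f)) = f"
proof -
  have m: "(a, v, f) \<in> Arr X.M" using assms by simp
  show "R.Psi (a, v, f) \<in> Arr GE" "usrc (R.Psi (a, v, f)) = a" "utgt (R.Psi (a, v, f)) = Cod A f"
    "grade V (R.Psi (a, v, f)) = v" "phi (R.Psi (a, v, f)) = f"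
    by (simp_all add: phi_def R.Psi_arr[OF m])
qed

lemma psi [simp]:
  assumes "f \<in> Arr A"
  shows "psi f \<in> Arr GE" "usrc (psi f) = Dom A f" "utgt (psi f) = Cod A f" "grade V (psi f) = \<one>\<^bsub>V\<^esub>" "phi (psi f) = f"
  using Psi_M[of "Dom A f" "\<one>\<^bsub>V\<^esub>" f] assms by (simp_all add: psi_def)

lemma psi_phi: "t \<in> Arr GE \<Longrightarrow> grade V t = \<one>\<^bsub>V\<^esub> \<Longrightarrow> psi (phi t) = t"
  by (rule phi_eqI) (simp_all add: Phi_phi)

lemma psi_ide: "a \<in> Obj A \<Longrightarrow> psi (Ide A a) = Ide GE a"
  by (rule phi_eqI) (use GE.ide_arr[of a] GE.gr_ide[of a] in \<open>simp_all add: GE_simps\<close>)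

lemma psi_cmp:
  assumes "f \<in> Arr A" "g \<in> Arr A" "Cod A f = Dom A g"
  shows "psi (g \<cdot>\<^bsub>A\<^esub> f) = psi g \<cdot>\<^bsub>GE\<^esub> psi f"
  by (rule phi_eqI) (use assms GE.cmp_arr[of "psi f" "psi g"] GE.gr_cmp[of "psi f" "psi g"] in \<open>simp_all add: GE_simps phi_cmp_pure\<close>)

lemma psi_ten:
  assumes "f \<in> Arr A" "g \<in> Arr A"
  shows "psi (f \<otimes>\<^bsub>A\<^esub> g) = psi f \<otimes>\<^bsub>GE\<^esub> psi g"
  by (rule phi_eqI) (use assms GE.ten_arr[of "psi f" "psi g"] in \<open>simp_all add: GE_simps phi_ten_pure\<close>)

lemma U_simps: "Obj U = Obj A" "Ide U = Ide GE" "g \<cdot>\<^bsub>U\<^esub> f = g \<cdot>\<^bsub>GE\<^esub> f" "f \<otimes>\<^bsub>U\<^esub> g = f \<otimes>\<^bsub>GE\<^esub> g"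
  "\<one>\<^bsub>U\<^esub> = \<one>\<^bsub>A\<^esub>" "a \<odot>\<^bsub>U\<^esub> b = a \<odot>\<^bsub>A\<^esub> b" "Dom U = usrc" "Cod U = utgt"
  unfolding pure_U[symmetric] by (simp_all add: GE_simps)

lemma Arr_U: "t \<in> Arr U \<longleftrightarrow> t \<in> Arr GE \<and> grade V t = \<one>\<^bsub>V\<^esub>"
  unfolding pure_U[symmetric] by simp

lemma dual_pair_U:
  assumes "dual_pair A d a" "d \<in> Obj A" "a \<in> Obj A"
  shows "dual_pair U d a"
proof -
  obtain ev coev where ev: "ev \<in> Arr A" "Dom A ev = d \<odot>\<^bsub>A\<^esub> a" "Cod A ev = \<one>\<^bsub>A\<^esub>"
    and coev: "coev \<in> Arr A" "Dom A coev = \<one>\<^bsub>A\<^esub>" "Cod A coev = a \<odot>\<^bsub>A\<^esub> d"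
    and z: "(Ide A a \<otimes>\<^bsub>A\<^esub> ev) \<cdot>\<^bsub>A\<^esub> (coev \<otimes>\<^bsub>A\<^esub> Ide A a) = Ide A a"
      "(ev \<otimes>\<^bsub>A\<^esub> Ide A d) \<cdot>\<^bsub>A\<^esub> (Ide A d \<otimes>\<^bsub>A\<^esub> coev) = Ide A d"
    using assms(1) unfolding dual_pair_def hom_def by auto
  have "(Ide GE a \<otimes>\<^bsub>GE\<^esub> psi ev) \<cdot>\<^bsub>GE\<^esub> (psi coev \<otimes>\<^bsub>GE\<^esub> Ide GE a) = Ide GE a"
    "(psi ev \<otimes>\<^bsub>GE\<^esub> Ide GE d) \<cdot>\<^bsub>GE\<^esub> (Ide GE d \<otimes>\<^bsub>GE\<^esub> psi coev) = Ide GE d"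
    using arg_cong[OF z(1), of psi] arg_cong[OF z(2), of psi] ev coev assms(2,3)
    by (simp_all add: psi_ide psi_cmp psi_ten)
  then show ?thesis
    unfolding dual_pair_def using ev coev
    by (intro bexI[of _ "psi ev"] bexI[of _ "psi coev"]) (auto simp: hom_def U_simps Arr_U)
qed

lemma rigid_U: "rigid_monoidal_category U"
proof (rule rigid_monoidal_category.intro)
  show "strict_monoidal_category U"
    using GE.strict_monoidal_pure unfolding pure_U .
  show "rigid_monoidal_category_axioms U"
    using X.A.left_dual X.A.right_dual dual_pair_U
    by (intro rigid_monoidal_category_axioms.intro) (simp_all add: U_simps, blast+)
qed

text \<open>\<open>uni v\<close> corresponds to the identity of \<open>F v\<close>, and it is universal among arrows out of the unit.\<close>

definition uni :: "'v \<Rightarrow> ('a, 'm, 'h) uarr" where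
  "uni v = R.Psi (\<one>\<^bsub>A\<^esub>, v, Ide A (X.F v))"

lemma uni [simp]:
  assumes "v \<in> Obj V"
  shows "uni v \<in> Arr GE" "usrc (uni v) = \<one>\<^bsub>A\<^esub>" "utgt (uni v) = X.F v" "grade V (uni v) = v" "phi (uni v) = Ide A (X.F v)"
  using Psi_M[of "\<one>\<^bsub>A\<^esub>" v "Ide A (X.F v)"] assms by (simp_all add: uni_def)

lemma uni_universal:
  assumes v [simp]: "v \<in> Obj V" and b: "b \<in> Obj A" and k: "k \<in> hom V v (H \<one>\<^bsub>A\<^esub> b)"
  shows "\<exists>!g. g \<in> hom U (X.F v) b \<and> FA (from_unit V R.EC) g \<cdot>\<^bsub>V\<^esub> uelt (uni v) = k"
proof -
  let ?k = "Elt \<one>\<^bsub>A\<^esub> b k :: ('a, 'm, 'h) uarr"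
  have k': "?k \<in> Arr GE" "grade V ?k = v" using k b by (auto simp: graded_cat_simps hom_def)
  have un: "uni v = Elt \<one>\<^bsub>A\<^esub> (X.F v) (uelt (uni v))" "uelt (uni v) \<in> Arr V" "Dom V (uelt (uni v)) = v"
    "Cod V (uelt (uni v)) = H \<one>\<^bsub>A\<^esub> (X.F v)"
    by (rule Arr_graded_catE[OF uni(1)[OF v]]; use uni(2-4)[OF v] in simp)+
  have eq: "FA (from_unit V R.EC) g \<cdot>\<^bsub>V\<^esub> uelt (uni v) = k \<longleftrightarrow> phi g = phi ?k" if g: "g \<in> hom U (X.F v) b" for g
  proof -
    have g': "g \<in> Arr GE" "grade V g = \<one>\<^bsub>V\<^esub>" "usrc g = X.F v" "utgt g = b"
      using g by (auto simp: hom_def Arr_U U_simps)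
    obtain m where m: "g = Elt (X.F v) b m" "m \<in> Arr V" "Dom V m = \<one>\<^bsub>V\<^esub>" "Cod V m = H (X.F v) b"
      using g' by (auto elim!: Arr_graded_catE)
    have "FA (from_unit V R.EC) g \<cdot>\<^bsub>V\<^esub> uelt (uni v) = uelt (g \<cdot>\<^bsub>GE\<^esub> uni v)"
    proof -
      define c where "c = vCmp R.EC \<one>\<^bsub>A\<^esub> (X.F v) b"
      have c: "c \<in> Arr V" "Dom V c = H \<one>\<^bsub>A\<^esub> (X.F v) \<odot>\<^bsub>V\<^esub> H (X.F v) b"
        unfolding c_def using b by (simp_all del: R.EC_simps(4) add: R.E.vCmp_arr)
      have "FA (from_unit V R.EC) g = c \<cdot>\<^bsub>V\<^esub> (Ide V (H \<one>\<^bsub>A\<^esub> (X.F v)) \<otimes>\<^bsub>V\<^esub> m)"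
        by (simp add: from_unit_def m(1) c_def)
      moreover have "uelt (g \<cdot>\<^bsub>GE\<^esub> uni v) = c \<cdot>\<^bsub>V\<^esub> (uelt (uni v) \<otimes>\<^bsub>V\<^esub> m)"
        using uni(2,3)[OF v] by (simp add: graded_cat_simps(5) m(1) c_def)
      moreover have "(Ide V (H \<one>\<^bsub>A\<^esub> (X.F v)) \<otimes>\<^bsub>V\<^esub> m) \<cdot>\<^bsub>V\<^esub> uelt (uni v) = uelt (uni v) \<otimes>\<^bsub>V\<^esub> m"
        using m un(2-4) b X.V.ten_cmp[of "uelt (uni v)" "Ide V \<one>\<^bsub>V\<^esub>" "Ide V (H \<one>\<^bsub>A\<^esub> (X.F v))" m] by simp
      ultimately show ?thesis
        using c m un(2-4) b by simp
    qed
    moreover obtain w where "g \<cdot>\<^bsub>GE\<^esub> uni v = Elt \<one>\<^bsub>A\<^esub> b w"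
      using g' by (simp add: graded_cat_simps(5))
    ultimately have "FA (from_unit V R.EC) g \<cdot>\<^bsub>V\<^esub> uelt (uni v) = k \<longleftrightarrow> g \<cdot>\<^bsub>GE\<^esub> uni v = ?k"
      by simp
    also have "\<dots> \<longleftrightarrow> phi (g \<cdot>\<^bsub>GE\<^esub> uni v) = phi ?k"
    proof
      have gu: "g \<cdot>\<^bsub>GE\<^esub> uni v \<in> Arr GE" "usrc (g \<cdot>\<^bsub>GE\<^esub> uni v) = \<one>\<^bsub>A\<^esub>" "grade V (g \<cdot>\<^bsub>GE\<^esub> uni v) = v"
        using GE.cmp_arr[of "uni v" g] GE.gr_cmp[of "uni v" g] g' by (simp_all add: GE_simps)
      show "g \<cdot>\<^bsub>GE\<^esub> uni v = ?k" if "phi (g \<cdot>\<^bsub>GE\<^esub> uni v) = phi ?k"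
        by (rule phi_eqI[OF gu(1) k'(1) _ _ that]) (use gu k' in simp_all)
    qed simp
    also have "phi (g \<cdot>\<^bsub>GE\<^esub> uni v) = phi g"
      using g' Phi_phi[OF g'(1)] by (simp add: phi_cmp_pure)
    finally show ?thesis .
  qed
  have ph: "phi ?k \<in> Arr A" "Dom A (phi ?k) = X.F v" "Cod A (phi ?k) = b"
    using Phi_phi[OF k'(1)] k'(2) by simp_all
  show ?thesis
  proof (rule ex1I[of _ "psi (phi ?k)"])
    show "psi (phi ?k) \<in> hom U (X.F v) b \<and> FA (from_unit V R.EC) (psi (phi ?k)) \<cdot>\<^bsub>V\<^esub> uelt (uni v) = k"
      using eq[of "psi (phi ?k)"] ph by (simp add: hom_def Arr_U U_simps)
    fix g assume g: "g \<in> hom U (X.F v) b \<and> FA (from_unit V R.EC) g \<cdot>\<^bsub>V\<^esub> uelt (uni v) = k"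
    then show "g = psi (phi ?k)"
      using eq[of g] psi_phi[of g] by (auto simp: hom_def Arr_U)
  qed
qed

lemma has_left_adjoint_U: "has_left_adjoint V U (from_unit V R.EC)"
proof -
  have 1: "X.F v \<in> Obj U" if "v \<in> Obj V" for v
    using that by (simp add: U_simps)
  have 2: "uelt (uni v) \<in> hom V v (FO (from_unit V R.EC) (X.F v))" if v: "v \<in> Obj V" for v
    by (rule Arr_graded_catE[OF uni(1)[OF v]]) (use uni(2-4)[OF v] in \<open>simp add: hom_def from_unit_def\<close>)
  have 3: "\<exists>!g. g \<in> hom U (X.F v) b \<and> FA (from_unit V R.EC) g \<cdot>\<^bsub>V\<^esub> uelt (uni v) = k"
    if "v \<in> Obj V" "b \<in> Obj U" "k \<in> hom V v (FO (from_unit V R.EC) b)" for v b k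
    using uni_universal[of v b k] that by (simp add: U_simps from_unit_def)
  have "\<exists>F \<epsilon>. adjunction V U F (from_unit V R.EC) (\<lambda>v. uelt (uni v)) \<epsilon>"
    by (rule adjunction_of_universal[OF R.E.from_unit_functor 1 2 3])
  then show ?thesis unfolding has_left_adjoint_def by blast
qed

lemma vmoncat_0cell_EC: "vmoncat_0cell V TYPE('h) R.EC"
  unfolding vmoncat_0cell_def using R.enriched_EC rigid_U has_left_adjoint_U by blast

end

text \<open>
  The chosen left adjoint of the enriched category and \<open>F\<close> itself both represent the arrows out of the
  unit, with universal arrows \<open>C.univ v\<close> and \<open>uni v\<close>.  The comparisons \<open>r\<close> and \<open>h\<close> between them are mutually
  inverse and make the identification of the underlying category with \<open>A\<close> an equivalence of module
  tensor categories.
\<close>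

locale modtens_model = hom_model V X H \<epsilon>
  for V :: "('v, 'm) braided_moncat" and X :: "('v, 'm, 'a, ('a, 'm, 'h) uarr) modtens" and H \<epsilon> +
  fixes l :: "('v, 'm, 'a, 'h) ladj"
  assumes model: "moncat_object V R.EC l"
begin

sublocale C: moncat_object V R.EC l by (rule model)

abbreviation "Y \<equiv> P_0cell V R.EC l"

definition r :: "'v \<Rightarrow> ('a, 'm, 'h) uarr" where
  "r v = phi (C.univ v)"

definition h :: "'v \<Rightarrow> ('a, 'm, 'h) uarr" where
  "h v = C.G.hat (uni v)"

lemma Y_data: "mtCat Y = U" "mtF Y = laF l"
  "a \<in> Obj A \<Longrightarrow> v \<in> Obj V \<Longrightarrow> mt_hb Y a v = C.G.hb a v"
  "u \<in> Obj V \<Longrightarrow> v \<in> Obj V \<Longrightarrow> mt_mu Y u v = C.G.oplaxitor u v"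
  using C.G.models_data[OF C.models_P] pure_graded_cat[of V R.EC] by (simp_all add: GE_simps)

lemma univ_facts:
  assumes v: "v \<in> Obj V"
  shows "C.univ v \<in> Arr GE" "usrc (C.univ v) = \<one>\<^bsub>A\<^esub>" "utgt (C.univ v) = FO (laF l) v" "grade V (C.univ v) = v"
    "FO (laF l) v \<in> Obj A"
  using C.G.eta_arr[OF v] C.G.F_obj[OF v] by (simp_all add: GE_simps)

lemma r_facts:
  assumes v: "v \<in> Obj V"
  shows "r v \<in> Arr A" "Dom A (r v) = X.F v" "Cod A (r v) = FO (laF l) v"
  using Phi_phi[OF univ_facts(1)[OF v]] univ_facts[OF v] v by (simp_all add: r_def)

lemma h_facts:
  assumes v: "v \<in> Obj V"
  shows "h v \<in> Arr GE" "grade V (h v) = \<one>\<^bsub>V\<^esub>" "usrc (h v) = FO (laF l) v" "utgt (h v) = X.F v"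
    "h v \<cdot>\<^bsub>GE\<^esub> C.univ v = uni v"
proof -
  have x: "Ide GE \<one>\<^bsub>A\<^esub> \<otimes>\<^bsub>GE\<^esub> C.univ v = C.univ v"
    using C.G.ten_unit(1)[OF univ_facts(1)[OF v]] by (simp add: GE_simps)
  show "h v \<in> Arr GE" "grade V (h v) = \<one>\<^bsub>V\<^esub>" "usrc (h v) = FO (laF l) v" "utgt (h v) = X.F v"
    "h v \<cdot>\<^bsub>GE\<^esub> C.univ v = uni v"
    using C.G.hat_arr[OF uni(1)[OF v]] C.G.hat_eta[OF uni(1)[OF v]] uni[OF v] univ_facts[OF v] v
    by (simp_all add: h_def GE_simps x)
qed

lemma phi_univ: "v \<in> Obj V \<Longrightarrow> phi (C.univ v) = r v"
  by (simp add: r_def)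

lemma phi_h_r: assumes v: "v \<in> Obj V" shows "phi (h v) \<cdot>\<^bsub>A\<^esub> r v = Ide A (X.F v)"
  using phi_cmp_pure[of "C.univ v" "h v"] h_facts[OF v] univ_facts[OF v] v by (simp add: phi_univ)

text \<open>
  Arrows of grade one out of \<open>a F(v)\<close> are tested after the universal arrow, and \<open>phi\<close> is faithful.
\<close>

lemma eta_eqI:
  assumes v: "v \<in> Obj V" and "f \<in> Arr GE" "f' \<in> Arr GE" "grade V f = \<one>\<^bsub>V\<^esub>" "grade V f' = \<one>\<^bsub>V\<^esub>"
    "usrc f = a \<odot>\<^bsub>A\<^esub> FO (laF l) v" "usrc f' = a \<odot>\<^bsub>A\<^esub> FO (laF l) v" "utgt f = utgt f'" "a \<in> Obj A"
    and "phi (f \<cdot>\<^bsub>GE\<^esub> (Ide GE a \<otimes>\<^bsub>GE\<^esub> C.univ v)) = phi (f' \<cdot>\<^bsub>GE\<^esub> (Ide GE a \<otimes>\<^bsub>GE\<^esub> C.univ v))"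
  shows "f = f'"
proof (rule C.G.whisker_eta_unique[of a v])
  let ?x = "Ide GE a \<otimes>\<^bsub>GE\<^esub> C.univ v"
  have x: "?x \<in> Arr GE" "usrc ?x = a" "utgt ?x = a \<odot>\<^bsub>A\<^esub> FO (laF l) v" "grade V ?x = v"
    using C.G.ten_arr[of "Ide GE a" "C.univ v"] C.G.ide_arr[of a] C.G.gr_ide[of a] univ_facts[OF v] v assms(9)
    by (simp_all add: GE_simps)
  show "f \<cdot>\<^bsub>GE\<^esub> ?x = f' \<cdot>\<^bsub>GE\<^esub> ?x"
    by (rule phi_eqI)
       (use assms x C.G.cmp_arr[of ?x f] C.G.cmp_arr[of ?x f'] C.G.gr_cmp[of ?x f] C.G.gr_cmp[of ?x f']
        in \<open>simp_all add: GE_simps\<close>)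
qed (use assms in \<open>simp_all add: GE_simps\<close>)

lemma psi_r_h:
  assumes v: "v \<in> Obj V"
  shows "psi (r v) \<cdot>\<^bsub>GE\<^esub> h v = Ide GE (FO (laF l) v)"
proof (rule eta_eqI[OF v, where a = "\<one>\<^bsub>A\<^esub>"])
  let ?F = "FO (laF l) v"
  note f = h_facts[OF v] r_facts[OF v] univ_facts[OF v] psi[OF r_facts(1)[OF v]]
  have x: "Ide GE \<one>\<^bsub>A\<^esub> \<otimes>\<^bsub>GE\<^esub> C.univ v = C.univ v"
    using C.G.ten_unit(1)[OF f(9)] by (simp add: GE_simps)
  have i: "Ide GE ?F \<cdot>\<^bsub>GE\<^esub> C.univ v = C.univ v"
    using C.G.ide_cod_cmp[OF f(9)] f by (simp add: GE_simps)
  have "(psi (r v) \<cdot>\<^bsub>GE\<^esub> h v) \<cdot>\<^bsub>GE\<^esub> C.univ v = psi (r v) \<cdot>\<^bsub>GE\<^esub> uni v"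
    using C.G.cmp_assoc_arr[of "C.univ v" "h v" "psi (r v)"] f by (simp add: GE_simps)
  then show "phi ((psi (r v) \<cdot>\<^bsub>GE\<^esub> h v) \<cdot>\<^bsub>GE\<^esub> (Ide GE \<one>\<^bsub>A\<^esub> \<otimes>\<^bsub>GE\<^esub> C.univ v)) =
    phi (Ide GE ?F \<cdot>\<^bsub>GE\<^esub> (Ide GE \<one>\<^bsub>A\<^esub> \<otimes>\<^bsub>GE\<^esub> C.univ v))"
    using phi_cmp_pure[of "uni v" "psi (r v)"] f uni[OF v] by (simp add: x i phi_univ v)
qed (use h_facts[OF v] r_facts[OF v] univ_facts[OF v] psi[OF r_facts(1)[OF v]]
    C.G.cmp_arr[of "h v" "psi (r v)"] C.G.gr_cmp[of "h v" "psi (r v)"] C.G.ide_arr[of "FO (laF l) v"]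
    C.G.gr_ide[of "FO (laF l) v"] v in \<open>simp_all add: GE_simps\<close>)

definition Q :: "('v, 'a, ('a, 'm, 'h) uarr) mt1cell" where
  "Q = \<lparr>mtR = \<lparr>FO = (\<lambda>a\<in>Obj A. a), FA = (\<lambda>t\<in>Arr U. phi t)\<rparr>,
        mtLax = (\<lambda>a\<in>Obj A. \<lambda>b\<in>Obj A. Ide A (a \<odot>\<^bsub>A\<^esub> b)), mtCoh = (\<lambda>v\<in>Obj V. r v)\<rparr>"

definition Q' :: "('v, 'a, ('a, 'm, 'h) uarr) mt1cell" where
  "Q' = \<lparr>mtR = \<lparr>FO = (\<lambda>a\<in>Obj A. a), FA = (\<lambda>f\<in>Arr A. psi f)\<rparr>,
        mtLax = (\<lambda>a\<in>Obj A. \<lambda>b\<in>Obj A. Ide GE (a \<odot>\<^bsub>A\<^esub> b)), mtCoh = (\<lambda>v\<in>Obj V. h v)\<rparr>"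

lemma phi_lax:
  "strict_lax_monoidal_functor U A \<lparr>FO = (\<lambda>a\<in>Obj A. a), FA = (\<lambda>t\<in>Arr U. phi t)\<rparr> (\<lambda>a\<in>Obj A. \<lambda>b\<in>Obj A. Ide A (a \<odot>\<^bsub>A\<^esub> b))"
proof -
  have U: "category U" using rigid_U by (simp add: rigid_monoidal_category_def strict_monoidal_category_def)
  have ph: "phi t \<in> Arr A" "Dom A (phi t) = usrc t" "Cod A (phi t) = utgt t" "usrc t \<in> Obj A" "utgt t \<in> Obj A"
    if "t \<in> Arr U" for t
    using Phi_phi[of t] that by (auto simp: Arr_U)
  have cmp: "phi (t' \<cdot>\<^bsub>GE\<^esub> t) = phi t' \<cdot>\<^bsub>A\<^esub> phi t" "t' \<cdot>\<^bsub>GE\<^esub> t \<in> Arr U"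
    if "t \<in> Arr U" "t' \<in> Arr U" "utgt t = usrc t'" for t t'
    using phi_cmp_pure[of t t'] C.G.cmp_arr[of t t'] C.G.gr_cmp[of t t'] that by (simp_all add: Arr_U GE_simps)
  have ten: "phi (t \<otimes>\<^bsub>GE\<^esub> t') = phi t \<otimes>\<^bsub>A\<^esub> phi t'" "t \<otimes>\<^bsub>GE\<^esub> t' \<in> Arr U" if "t \<in> Arr U" "t' \<in> Arr U" for t t'
    using phi_ten_pure[of t t'] C.G.ten_arr[of t t'] that by (simp_all add: Arr_U GE_simps)
  have ide: "Ide GE a \<in> Arr U" if "a \<in> Obj A" for a
    using C.G.ide_arr[of a] C.G.gr_ide[of a] that by (simp add: Arr_U GE_simps)
  have "cfunctor U A \<lparr>FO = (\<lambda>a\<in>Obj A. a), FA = (\<lambda>t\<in>Arr U. phi t)\<rparr>"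
    by (rule cfunctor.intro[OF U X.A.category_axioms], unfold_locales)
       (auto simp: hom_def U_simps(1-3,7,8) ph cmp ide)
  then show ?thesis
    by (auto simp: strict_lax_monoidal_functor_def U_simps hom_def ph ten)
qed

lemma psi_lax:
  "strict_lax_monoidal_functor A U \<lparr>FO = (\<lambda>a\<in>Obj A. a), FA = (\<lambda>f\<in>Arr A. psi f)\<rparr> (\<lambda>a\<in>Obj A. \<lambda>b\<in>Obj A. Ide GE (a \<odot>\<^bsub>A\<^esub> b))"
proof -
  have U: "strict_monoidal_category U" using rigid_U by (simp add: rigid_monoidal_category_def)
  interpret U: strict_monoidal_category U by (rule U)
  have ide: "Ide GE a \<in> Arr U" "usrc (Ide GE a) = a" "utgt (Ide GE a) = a" if "a \<in> Obj A" for a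
    using C.G.ide_arr[of a] C.G.gr_ide[of a] that by (simp_all add: Arr_U GE_simps)
  have ten: "Ide GE a \<otimes>\<^bsub>GE\<^esub> Ide GE b = Ide GE (a \<odot>\<^bsub>A\<^esub> b)" if "a \<in> Obj A" "b \<in> Obj A" for a b
    using C.G.ten_ide[of a b] that by (simp add: GE_simps)
  have unit: "Ide GE b \<cdot>\<^bsub>GE\<^esub> t = t" "t \<cdot>\<^bsub>GE\<^esub> Ide GE a = t" if "t \<in> Arr GE" "usrc t = a" "utgt t = b" for t a b
    using C.G.ide_cod_cmp[of t b] C.G.cmp_ide_dom[of t a] that by (simp_all add: GE_simps)
  have psi_t: "psi f \<otimes>\<^bsub>GE\<^esub> psi g \<in> Arr GE" "usrc (psi f \<otimes>\<^bsub>GE\<^esub> psi g) = Dom A f \<odot>\<^bsub>A\<^esub> Dom A g"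
    "utgt (psi f \<otimes>\<^bsub>GE\<^esub> psi g) = Cod A f \<odot>\<^bsub>A\<^esub> Cod A g" if "f \<in> Arr A" "g \<in> Arr A" for f g
    using C.G.ten_arr[of "psi f" "psi g"] that by (simp_all add: GE_simps)
  have "cfunctor A U \<lparr>FO = (\<lambda>a\<in>Obj A. a), FA = (\<lambda>f\<in>Arr A. psi f)\<rparr>"
    by (rule cfunctor.intro[OF X.A.category_axioms U.category_axioms], unfold_locales)
       (auto simp: hom_def U_simps(1-3,7,8) Arr_U psi_ide psi_cmp)
  moreover have "Ide GE a \<in> Arr GE" if "a \<in> Obj A" for a using ide[OF that] by (simp add: Arr_U)
  ultimately show ?thesis
    by (auto simp: strict_lax_monoidal_functor_def U_simps hom_def ide ten unit psi_ten psi_t)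
qed

lemma Q_1cell: "modtens_1cell V Y X Q"
proof (rule modtens_1cellI[OF C.P_object X.modtens_object_axioms], goal_cases)
  case 6 show ?case using phi_lax by (simp add: Y_data Q_def)
next
  case (7 v) then show ?case using r_facts[of v] univ_facts(5)[of v] by (simp add: Y_data Q_def hom_def)
next
  case (8 p)
  then have p [simp]: "p \<in> Arr V" .
  note u = univ_facts[of "Dom V p"] univ_facts[of "Cod V p"]
  have Fp: "FA (laF l) p \<in> Arr U" "usrc (FA (laF l) p) = FO (laF l) (Dom V p)"
    "FA (laF l) p \<in> Arr GE" "grade V (FA (laF l) p) = \<one>\<^bsub>V\<^esub>"
    using C.G.F_arr[OF p] by (simp_all add: Arr_U GE_simps)
  have "phi (FA (laF l) p \<cdot>\<^bsub>GE\<^esub> C.univ (Dom V p)) = phi (regrade V (C.univ (Cod V p)) p)"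
    using C.G.eta_nat[OF p] by simp
  then have "phi (FA (laF l) p) \<cdot>\<^bsub>A\<^esub> r (Dom V p) = r (Cod V p) \<cdot>\<^bsub>A\<^esub> FA (mtF X) p"
    using phi_cmp_pure[of "C.univ (Dom V p)" "FA (laF l) p"] phi_act[of "C.univ (Cod V p)" p] Fp u
    by (simp add: phi_univ)
  then show ?case using Fp by (simp add: Y_data Q_def)
next
  case 9 show ?case
    using C.G.eta_one phi_ide[of "\<one>\<^bsub>A\<^esub>"] by (simp add: Q_def r_def GE_simps)
next
  case (10 a v)
  then have [simp]: "a \<in> Obj A" "v \<in> Obj V" by (simp_all add: Y_data U_simps)
  note u = univ_facts[of v]
  have hb: "C.G.hb a v \<in> Arr GE" "grade V (C.G.hb a v) = \<one>\<^bsub>V\<^esub>" "usrc (C.G.hb a v) = a \<odot>\<^bsub>A\<^esub> FO (laF l) v"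
    "utgt (C.G.hb a v) = FO (laF l) v \<odot>\<^bsub>A\<^esub> a"
    using C.G.hb_arr[of a v] by (simp_all add: GE_simps)
  have x: "Ide GE a \<otimes>\<^bsub>GE\<^esub> C.univ v \<in> Arr GE" "utgt (Ide GE a \<otimes>\<^bsub>GE\<^esub> C.univ v) = a \<odot>\<^bsub>A\<^esub> FO (laF l) v"
    using C.G.ten_arr[of "Ide GE a" "C.univ v"] C.G.ide_arr[of a] u by (simp_all add: GE_simps)
  have "phi (C.G.hb a v \<cdot>\<^bsub>GE\<^esub> (Ide GE a \<otimes>\<^bsub>GE\<^esub> C.univ v)) = phi (C.univ v \<otimes>\<^bsub>GE\<^esub> Ide GE a)"
    using C.G.hb_eta[of a v] by (simp add: GE_simps)
  then have "phi (C.G.hb a v) \<cdot>\<^bsub>A\<^esub> (Ide A a \<otimes>\<^bsub>A\<^esub> r v) = (r v \<otimes>\<^bsub>A\<^esub> Ide A a) \<cdot>\<^bsub>A\<^esub> X.e a v"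
    using phi_cmp_pure[OF x(1) hb(1)] x hb u
    by (simp add: phi_ten_left phi_ten_right phi_univ)
  then show ?case
    using u r_facts[of v] hb by (simp add: Y_data Q_def Arr_U)
next
  case (11 u v)
  then have [simp]: "u \<in> Obj V" "v \<in> Obj V" .
  have uv: "u \<odot>\<^bsub>V\<^esub> v \<in> Obj V" by simp
  note n = univ_facts[of u] univ_facts[of v] univ_facts[OF uv]
  have m: "C.G.oplaxitor u v \<in> Arr GE" "grade V (C.G.oplaxitor u v) = \<one>\<^bsub>V\<^esub>" "usrc (C.G.oplaxitor u v) = FO (laF l) (u \<odot>\<^bsub>V\<^esub> v)"
    using C.G.oplaxitor_arr[of u v] by (simp_all add: GE_simps)
  have "phi (C.G.oplaxitor u v \<cdot>\<^bsub>GE\<^esub> C.univ (u \<odot>\<^bsub>V\<^esub> v)) = phi (C.univ u \<otimes>\<^bsub>GE\<^esub> C.univ v)"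
    by simp
  then have "phi (C.G.oplaxitor u v) \<cdot>\<^bsub>A\<^esub> r (u \<odot>\<^bsub>V\<^esub> v) = (r u \<otimes>\<^bsub>A\<^esub> r v) \<cdot>\<^bsub>A\<^esub> X.\<mu> u v"
    using phi_cmp_pure[of "C.univ (u \<odot>\<^bsub>V\<^esub> v)" "C.G.oplaxitor u v"] phi_ten_unit[of "C.univ u" "C.univ v"] n m
    by (simp add: phi_univ)
  then show ?case
    using n r_facts[of u] r_facts[of v] m by (simp add: Y_data Q_def Arr_U)
qed (simp_all add: Y_data Q_def U_simps)

lemma Q'_1cell: "modtens_1cell V X Y Q'"
proof (rule modtens_1cellI[OF X.modtens_object_axioms C.P_object], goal_cases)
  case 6 show ?case using psi_lax by (simp add: Y_data Q'_def)
next
  case (7 v) then show ?case using h_facts[of v] by (simp add: Y_data Q'_def hom_def Arr_U U_simps(7,8))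
next
  case (8 p)
  then have p [simp]: "p \<in> Arr V" .
  let ?u = "Dom V p" and ?v = "Cod V p" and ?Fp = "FA (mtF X) p"
  note n = univ_facts[of ?u] univ_facts[of ?v] h_facts[of ?u] h_facts[of ?v] uni[of ?u] uni[of ?v]
  have Fp: "FA (laF l) p \<in> Arr GE" "grade V (FA (laF l) p) = \<one>\<^bsub>V\<^esub>" "usrc (FA (laF l) p) = FO (laF l) ?u" "utgt (FA (laF l) p) = FO (laF l) ?v"
    using C.G.F_arr[OF p] by (simp_all add: GE_simps)
  have x: "Ide GE \<one>\<^bsub>A\<^esub> \<otimes>\<^bsub>GE\<^esub> C.univ ?u = C.univ ?u"
    using C.G.ten_unit(1)[of "C.univ ?u"] n by (simp add: GE_simps)
  have 1: "(psi ?Fp \<cdot>\<^bsub>GE\<^esub> h ?u) \<cdot>\<^bsub>GE\<^esub> C.univ ?u = psi ?Fp \<cdot>\<^bsub>GE\<^esub> uni ?u"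
    using C.G.cmp_assoc_arr[of "C.univ ?u" "h ?u" "psi ?Fp"] n by (simp add: GE_simps)
  have "(h ?v \<cdot>\<^bsub>GE\<^esub> FA (laF l) p) \<cdot>\<^bsub>GE\<^esub> C.univ ?u = h ?v \<cdot>\<^bsub>GE\<^esub> (FA (laF l) p \<cdot>\<^bsub>GE\<^esub> C.univ ?u)"
    using C.G.cmp_assoc_arr[of "C.univ ?u" "FA (laF l) p" "h ?v"] n Fp by (simp add: GE_simps)
  also have "\<dots> = h ?v \<cdot>\<^bsub>GE\<^esub> regrade V (C.univ ?v) p"
    by (simp add: C.G.eta_nat)
  also have "\<dots> = regrade V (uni ?v) p"
    using C.G.pure_cmp_act[of "C.univ ?v" "h ?v" p] n by (simp add: GE_simps)
  finally have 2: "(h ?v \<cdot>\<^bsub>GE\<^esub> FA (laF l) p) \<cdot>\<^bsub>GE\<^esub> C.univ ?u = regrade V (uni ?v) p" .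
  have "psi ?Fp \<cdot>\<^bsub>GE\<^esub> h ?u = h ?v \<cdot>\<^bsub>GE\<^esub> FA (laF l) p"
  proof (rule eta_eqI[where v = ?u and a = "\<one>\<^bsub>A\<^esub>"])
    show "phi ((psi ?Fp \<cdot>\<^bsub>GE\<^esub> h ?u) \<cdot>\<^bsub>GE\<^esub> (Ide GE \<one>\<^bsub>A\<^esub> \<otimes>\<^bsub>GE\<^esub> C.univ ?u)) =
      phi ((h ?v \<cdot>\<^bsub>GE\<^esub> FA (laF l) p) \<cdot>\<^bsub>GE\<^esub> (Ide GE \<one>\<^bsub>A\<^esub> \<otimes>\<^bsub>GE\<^esub> C.univ ?u))"
      unfolding x 1 2 using phi_cmp_pure[of "uni ?u" "psi ?Fp"] phi_act[of "uni ?v" p] n by simp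
  qed (use n Fp C.G.cmp_arr[of "h ?u" "psi ?Fp"] C.G.gr_cmp[of "h ?u" "psi ?Fp"]
      C.G.cmp_arr[of "FA (laF l) p" "h ?v"] C.G.gr_cmp[of "FA (laF l) p" "h ?v"] in \<open>simp_all add: GE_simps\<close>)
  then show ?case by (simp add: Y_data Q'_def U_simps(3))
next
  case 9
  have "h \<one>\<^bsub>V\<^esub> \<cdot>\<^bsub>GE\<^esub> C.univ \<one>\<^bsub>V\<^esub> = uni \<one>\<^bsub>V\<^esub>" by (rule h_facts) simp
  moreover have "C.univ \<one>\<^bsub>V\<^esub> = Ide GE \<one>\<^bsub>A\<^esub>" using C.G.eta_one by (simp add: GE_simps)
  moreover have "uni \<one>\<^bsub>V\<^esub> = Ide GE \<one>\<^bsub>A\<^esub>"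
    by (rule phi_eqI) (use uni[of "\<one>\<^bsub>V\<^esub>"] C.G.ide_arr[of "\<one>\<^bsub>A\<^esub>"] C.G.gr_ide[of "\<one>\<^bsub>A\<^esub>"] in \<open>simp_all add: GE_simps\<close>)
  moreover have "h \<one>\<^bsub>V\<^esub> \<cdot>\<^bsub>GE\<^esub> Ide GE \<one>\<^bsub>A\<^esub> = h \<one>\<^bsub>V\<^esub>"
    using C.G.cmp_ide_dom[of "h \<one>\<^bsub>V\<^esub>" "\<one>\<^bsub>A\<^esub>"] h_facts[of "\<one>\<^bsub>V\<^esub>"] C.G.F_one by (simp add: GE_simps)
  ultimately show ?case by (simp add: Y_data Q'_def U_simps)
next
  case (10 a v)
  then have [simp]: "a \<in> Obj A" "v \<in> Obj V" by simp_all
  note n = univ_facts[of v] h_facts[of v] uni[of v] r_facts[of v]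
  have I: "Ide GE a \<in> Arr GE" "grade V (Ide GE a) = \<one>\<^bsub>V\<^esub>" "usrc (Ide GE a) = a" "utgt (Ide GE a) = a"
    using C.G.ide_arr[of a] C.G.gr_ide[of a] by (simp_all add: GE_simps)
  have hb: "C.G.hb a v \<in> Arr GE" "grade V (C.G.hb a v) = \<one>\<^bsub>V\<^esub>" "usrc (C.G.hb a v) = a \<odot>\<^bsub>A\<^esub> FO (laF l) v"
    "utgt (C.G.hb a v) = FO (laF l) v \<odot>\<^bsub>A\<^esub> a"
    using C.G.hb_arr[of a v] by (simp_all add: GE_simps)
  let ?x = "Ide GE a \<otimes>\<^bsub>GE\<^esub> C.univ v" and ?ha = "h v \<otimes>\<^bsub>GE\<^esub> Ide GE a" and ?ah = "Ide GE a \<otimes>\<^bsub>GE\<^esub> h v"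
  have x: "?x \<in> Arr GE" "usrc ?x = a" "utgt ?x = a \<odot>\<^bsub>A\<^esub> FO (laF l) v" "grade V ?x = v"
    and ha: "?ha \<in> Arr GE" "usrc ?ha = FO (laF l) v \<odot>\<^bsub>A\<^esub> a" "utgt ?ha = X.F v \<odot>\<^bsub>A\<^esub> a" "grade V ?ha = \<one>\<^bsub>V\<^esub>"
    and ah: "?ah \<in> Arr GE" "usrc ?ah = a \<odot>\<^bsub>A\<^esub> FO (laF l) v" "utgt ?ah = a \<odot>\<^bsub>A\<^esub> X.F v" "grade V ?ah = \<one>\<^bsub>V\<^esub>"
    using C.G.ten_arr[of "Ide GE a" "C.univ v"] C.G.ten_arr[of "h v" "Ide GE a"] C.G.ten_arr[of "Ide GE a" "h v"] n I
    by (simp_all add: GE_simps)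
  have "(?ha \<cdot>\<^bsub>GE\<^esub> C.G.hb a v) \<cdot>\<^bsub>GE\<^esub> ?x = ?ha \<cdot>\<^bsub>GE\<^esub> (C.univ v \<otimes>\<^bsub>GE\<^esub> Ide GE a)"
    using C.G.cmp_assoc_arr[of ?x "C.G.hb a v" ?ha] C.G.hb_eta[of a v] x ha hb by (simp add: GE_simps)
  also have "\<dots> = uni v \<otimes>\<^bsub>GE\<^esub> Ide GE a"
    using C.G.ten_cmp_post[of "C.univ v" "h v" "Ide GE a" "Ide GE a"] C.G.cmp_ide_dom[of "Ide GE a" a] n I by (simp add: GE_simps)
  finally have 1: "(?ha \<cdot>\<^bsub>GE\<^esub> C.G.hb a v) \<cdot>\<^bsub>GE\<^esub> ?x = uni v \<otimes>\<^bsub>GE\<^esub> Ide GE a" .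
  have "(psi (X.e a v) \<cdot>\<^bsub>GE\<^esub> ?ah) \<cdot>\<^bsub>GE\<^esub> ?x = psi (X.e a v) \<cdot>\<^bsub>GE\<^esub> (?ah \<cdot>\<^bsub>GE\<^esub> ?x)"
    using C.G.cmp_assoc_arr[of ?x ?ah "psi (X.e a v)"] x ah by (simp add: GE_simps)
  also have "?ah \<cdot>\<^bsub>GE\<^esub> ?x = Ide GE a \<otimes>\<^bsub>GE\<^esub> uni v"
    using C.G.ten_cmp_post[of "Ide GE a" "Ide GE a" "C.univ v" "h v"] C.G.cmp_ide_dom[of "Ide GE a" a] n I by (simp add: GE_simps)
  finally have 2: "(psi (X.e a v) \<cdot>\<^bsub>GE\<^esub> ?ah) \<cdot>\<^bsub>GE\<^esub> ?x = psi (X.e a v) \<cdot>\<^bsub>GE\<^esub> (Ide GE a \<otimes>\<^bsub>GE\<^esub> uni v)" .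
  have y: "Ide GE a \<otimes>\<^bsub>GE\<^esub> uni v \<in> Arr GE" "utgt (Ide GE a \<otimes>\<^bsub>GE\<^esub> uni v) = a \<odot>\<^bsub>A\<^esub> X.F v"
    using C.G.ten_arr[of "Ide GE a" "uni v"] n I by (simp_all add: GE_simps)
  have eq: "?ha \<cdot>\<^bsub>GE\<^esub> C.G.hb a v = psi (X.e a v) \<cdot>\<^bsub>GE\<^esub> ?ah"
  proof (rule eta_eqI[where v = v and a = a])
    show "phi ((?ha \<cdot>\<^bsub>GE\<^esub> C.G.hb a v) \<cdot>\<^bsub>GE\<^esub> ?x) = phi ((psi (X.e a v) \<cdot>\<^bsub>GE\<^esub> ?ah) \<cdot>\<^bsub>GE\<^esub> ?x)"
      unfolding 1 2 using phi_cmp_pure[OF y(1), of "psi (X.e a v)"] y n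
      by (simp add: phi_ten_left phi_ten_right)
  qed (use n hb ha ah C.G.cmp_arr[of "C.G.hb a v" ?ha] C.G.gr_cmp[of "C.G.hb a v" ?ha]
      C.G.cmp_arr[of ?ah "psi (X.e a v)"] C.G.gr_cmp[of ?ah "psi (X.e a v)"] in \<open>simp_all add: GE_simps\<close>)
  have u: "Ide GE (X.F v \<odot>\<^bsub>A\<^esub> a) \<cdot>\<^bsub>GE\<^esub> (?ha \<cdot>\<^bsub>GE\<^esub> C.G.hb a v) = ?ha \<cdot>\<^bsub>GE\<^esub> C.G.hb a v"
    "Ide GE (a \<odot>\<^bsub>A\<^esub> X.F v) \<cdot>\<^bsub>GE\<^esub> ?ah = ?ah"
    using C.G.ide_cod_cmp[of "?ha \<cdot>\<^bsub>GE\<^esub> C.G.hb a v"] C.G.ide_cod_cmp[of ?ah] C.G.cmp_arr[of "C.G.hb a v" ?ha] ha ah hb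
    by (simp_all add: GE_simps)
  show ?case
    using u eq by (simp add: Y_data Q'_def U_simps(3,4) U_simps(2))
next
  case (11 u v)
  then have [simp]: "u \<in> Obj V" "v \<in> Obj V" .
  let ?w = "u \<odot>\<^bsub>V\<^esub> v"
  have w: "?w \<in> Obj V" by simp
  note n = univ_facts[of u] univ_facts[of v] univ_facts[OF w] h_facts[of u] h_facts[of v] h_facts[OF w] uni[of u] uni[of v] uni[OF w]
  have m: "C.G.oplaxitor u v \<in> Arr GE" "grade V (C.G.oplaxitor u v) = \<one>\<^bsub>V\<^esub>" "usrc (C.G.oplaxitor u v) = FO (laF l) ?w"
    "utgt (C.G.oplaxitor u v) = FO (laF l) u \<odot>\<^bsub>A\<^esub> FO (laF l) v"
    using C.G.oplaxitor_arr[of u v] by (simp_all add: GE_simps)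
  let ?hh = "h u \<otimes>\<^bsub>GE\<^esub> h v"
  have hh: "?hh \<in> Arr GE" "usrc ?hh = FO (laF l) u \<odot>\<^bsub>A\<^esub> FO (laF l) v" "utgt ?hh = X.F u \<odot>\<^bsub>A\<^esub> X.F v" "grade V ?hh = \<one>\<^bsub>V\<^esub>"
    using C.G.ten_arr[of "h u" "h v"] n by (simp_all add: GE_simps)
  have x: "Ide GE \<one>\<^bsub>A\<^esub> \<otimes>\<^bsub>GE\<^esub> C.univ ?w = C.univ ?w"
    using C.G.ten_unit(1)[of "C.univ ?w"] n by (simp add: GE_simps)
  have 1: "(psi (X.\<mu> u v) \<cdot>\<^bsub>GE\<^esub> h ?w) \<cdot>\<^bsub>GE\<^esub> C.univ ?w = psi (X.\<mu> u v) \<cdot>\<^bsub>GE\<^esub> uni ?w"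
    using C.G.cmp_assoc_arr[of "C.univ ?w" "h ?w" "psi (X.\<mu> u v)"] n by (simp add: GE_simps)
  have "(?hh \<cdot>\<^bsub>GE\<^esub> C.G.oplaxitor u v) \<cdot>\<^bsub>GE\<^esub> C.univ ?w = ?hh \<cdot>\<^bsub>GE\<^esub> (C.univ u \<otimes>\<^bsub>GE\<^esub> C.univ v)"
    using C.G.cmp_assoc_arr[of "C.univ ?w" "C.G.oplaxitor u v" ?hh] n m hh by (simp add: GE_simps)
  also have "\<dots> = uni u \<otimes>\<^bsub>GE\<^esub> uni v"
    using C.G.ten_cmp_post[of "C.univ u" "h u" "C.univ v" "h v"] n by (simp add: GE_simps)
  finally have 2: "(?hh \<cdot>\<^bsub>GE\<^esub> C.G.oplaxitor u v) \<cdot>\<^bsub>GE\<^esub> C.univ ?w = uni u \<otimes>\<^bsub>GE\<^esub> uni v" .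
  have eq: "psi (X.\<mu> u v) \<cdot>\<^bsub>GE\<^esub> h ?w = ?hh \<cdot>\<^bsub>GE\<^esub> C.G.oplaxitor u v"
  proof (rule eta_eqI[OF w, where a = "\<one>\<^bsub>A\<^esub>"])
    show "phi ((psi (X.\<mu> u v) \<cdot>\<^bsub>GE\<^esub> h ?w) \<cdot>\<^bsub>GE\<^esub> (Ide GE \<one>\<^bsub>A\<^esub> \<otimes>\<^bsub>GE\<^esub> C.univ ?w)) =
      phi ((?hh \<cdot>\<^bsub>GE\<^esub> C.G.oplaxitor u v) \<cdot>\<^bsub>GE\<^esub> (Ide GE \<one>\<^bsub>A\<^esub> \<otimes>\<^bsub>GE\<^esub> C.univ ?w))"
      unfolding x 1 2 using phi_cmp_pure[of "uni ?w" "psi (X.\<mu> u v)"] phi_ten_unit[of "uni u" "uni v"] n by simp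
  qed (use n m hh C.G.cmp_arr[of "h ?w" "psi (X.\<mu> u v)"] C.G.gr_cmp[of "h ?w" "psi (X.\<mu> u v)"]
      C.G.cmp_arr[of "C.G.oplaxitor u v" ?hh] C.G.gr_cmp[of "C.G.oplaxitor u v" ?hh] in \<open>simp_all add: GE_simps\<close>)
  have un: "Ide GE (X.F u \<odot>\<^bsub>A\<^esub> X.F v) \<cdot>\<^bsub>GE\<^esub> ?hh = ?hh"
    "Ide GE (X.F u \<odot>\<^bsub>A\<^esub> X.F v) \<cdot>\<^bsub>GE\<^esub> (?hh \<cdot>\<^bsub>GE\<^esub> C.G.oplaxitor u v) = ?hh \<cdot>\<^bsub>GE\<^esub> C.G.oplaxitor u v"
    using C.G.ide_cod_cmp[of ?hh] C.G.ide_cod_cmp[of "?hh \<cdot>\<^bsub>GE\<^esub> C.G.oplaxitor u v"]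
      C.G.cmp_arr[of "C.G.oplaxitor u v" ?hh] hh m by (simp_all add: GE_simps)
  show ?case using un eq by (simp add: Y_data Q'_def U_simps(3,4))
qed (simp_all add: Y_data Q'_def U_simps)

lemma Q_Q': "modtens_cmp1 V X Y X Q Q' = modtens_id1 V X"
proof -
  have "phi (h v) \<cdot>\<^bsub>A\<^esub> r v = Ide A (X.F v)" "h v \<in> Arr U" if "v \<in> Obj V" for v
    using phi_h_r[OF that] h_facts[OF that] by (simp_all add: Arr_U)
  moreover have "psi f \<in> Arr U" "Ide GE a \<in> Arr U" "phi (Ide GE a) = Ide A a" if "f \<in> Arr A" "a \<in> Obj A" for f a
    using psi[OF that(1)] C.G.ide_arr[of a] C.G.gr_ide[of a] that by (simp_all add: Arr_U GE_simps)
  moreover have "Ide GE a \<in> Arr U" if "a \<in> Obj A" for a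
    using C.G.ide_arr[of a] C.G.gr_ide[of a] that by (simp_all add: Arr_U GE_simps)
  ultimately show ?thesis
    by (auto simp: modtens_cmp1_def modtens_id1_def Q_def Q'_def fcomp_def fid_def fun_eq_iff Arr_U)
qed

lemma Q'_Q: "modtens_cmp1 V Y X Y Q' Q = modtens_id1 V Y"
proof -
  have "psi (r v) \<cdot>\<^bsub>GE\<^esub> h v = Ide GE (FO (laF l) v)" "r v \<in> Arr A" if "v \<in> Obj V" for v
    using psi_r_h[OF that] r_facts[OF that] by simp_all
  moreover have "phi t \<in> Arr A" "psi (phi t) = t" if "t \<in> Arr U" for t
    using Phi_phi[of t] psi_phi[of t] that by (auto simp: Arr_U)
  moreover have "Ide GE a \<cdot>\<^bsub>GE\<^esub> Ide GE a = Ide GE a" if "a \<in> Obj A" for a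
    using C.G.cmp_ide_dom[of "Ide GE a" a] C.G.ide_arr[of a] that by (simp add: GE_simps)
  ultimately show ?thesis
    by (auto simp: modtens_cmp1_def modtens_id1_def Q_def Q'_def fcomp_def fid_def fun_eq_iff Y_data U_simps psi_ide)
qed

lemma equivalent0_Y: "equivalent0 (VModTens V) X Y"
proof -
  have iso: "isomorphic (modtens_hom V Z Z) (modtens_id1 V Z) (modtens_id1 V Z)" if Z: "modtens_object V Z"
    for Z :: "('v, 'm, 'a, ('a, 'm, 'h) uarr) modtens"
  proof -
    interpret Z: category "modtens_hom V Z Z" by (rule category_modtens_hom[OF Z Z])
    have o: "modtens_id1 V Z \<in> Obj (modtens_hom V Z Z)"
      using modtens_arrow_id1[OF Z] by (simp add: modtens_hom_def)
    have "is_iso (modtens_hom V Z Z) (Ide (modtens_hom V Z Z) (modtens_id1 V Z))"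
      unfolding is_iso_def using o Z.ide_in[OF o]
      by (intro conjI bexI[of _ "Ide (modtens_hom V Z Z) (modtens_id1 V Z)"]) simp_all
    then show ?thesis unfolding isomorphic_def using Z.ide_in[OF o] by blast
  qed
  show ?thesis
    unfolding equivalent0_def VModTens_def twocat.simps
    using Q_1cell Q'_1cell iso[OF X.modtens_object_axioms] iso[OF C.P_object]
    by (intro bexI[of _ Q'] bexI[of _ Q]) (simp_all add: Q_Q' Q'_Q modtens_hom_def)
qed

end

lemma essentially_surjective_P:
  fixes V :: "('v, 'm) braided_moncat"
    and L :: "('a, 'v, 'm) vmoncat \<Rightarrow> ('v, 'm, 'a, 'h) ladj"
    and X :: "('v, 'm, 'a, ('a, 'm, 'h) uarr) modtens"
  assumes V: "braided_monoidal_category V" and L: "chosen_left_adjoints V L" and X: "modtens_0cell V X"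
  shows "\<exists>A \<in> Obj0 (VMonCat V TYPE('h)). equivalent0 (VModTens V) X (P_0cell V A (L A))"
proof -
  interpret X: modtens_object V X by (rule modtens_objectI[OF V X])
  obtain H \<epsilon> where "hom_represented V X.M (fst \<circ> snd) X.mact H \<epsilon>"
    using X.hom_represented_exists by blast
  then interpret R: hom_represented V X.M "fst \<circ> snd" X.mact H \<epsilon> .
  interpret M: hom_model V X H \<epsilon> ..
  have EC: "R.EC \<in> Obj0 (VMonCat V TYPE('h))"
    using M.vmoncat_0cell_EC by (simp add: VMonCat_def)
  interpret modtens_model V X H \<epsilon> "L R.EC"
    by (rule modtens_model.intro[OF M.hom_model_axioms
          modtens_model_axioms.intro[OF moncat_object_VMonCat[OF V L EC]]])
  show ?thesis using equivalent0_Y EC by blast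
qed

theorem theorem1p2:
  fixes V :: "('v, 'm) braided_moncat"
    and L :: "('a, 'v, 'm) vmoncat \<Rightarrow> ('v, 'm, 'a, 'h) ladj"
  assumes "rigid_braided_monoidal_category V"
    and "chosen_left_adjoints V L"
  shows "two_equivalence
           (VMonCat V TYPE('h) ::
              (('a, 'v, 'm) vmoncat, ('a, 'm) vfunctor, (('a, 'm) vfunctor, 'a \<Rightarrow> 'm) tagged) twocat)
           (VModTens V ::
              (('v, 'm, 'a, ('a, 'm, 'h) uarr) modtens,
               ('v, 'a, ('a, 'm, 'h) uarr) mt1cell,
               (('v, 'a, ('a, 'm, 'h) uarr) mt1cell, 'a \<Rightarrow> ('a, 'm, 'h) uarr) tagged) twocat)
           (P_functor V L)"
proof -
  have V: "braided_monoidal_category V"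
    using assms(1) by (simp add: rigid_braided_monoidal_category_def)
  show ?thesis
    unfolding two_equivalence_def
  proof (intro conjI ballI)
    show "two_functor (VMonCat V TYPE('h)) (VModTens V) (P_functor V L)"
      by (rule two_functor_P[OF V assms(2)])
  next
    fix X :: "('v, 'm, 'a, ('a, 'm, 'h) uarr) modtens"
    assume "X \<in> Obj0 (VModTens V)"
    then show "\<exists>A \<in> Obj0 (VMonCat V TYPE('h)). equivalent0 (VModTens V) X (P0 (P_functor V L) A)"
      using essentially_surjective_P[OF V assms(2)] by (simp add: VModTens_def P_functor_def)
  next
    fix A B :: "('a, 'v, 'm) vmoncat"
    assume "A \<in> Obj0 (VMonCat V TYPE('h))" "B \<in> Obj0 (VMonCat V TYPE('h))"
    then have "moncat_pair V A (L A) B (L B)"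
      using moncat_object_VMonCat[OF V assms(2)] by (auto intro: moncat_pair.intro)
    from moncat_pair.equivalence_P[OF this]
    show "equivalence_of_categories (Hom (VMonCat V TYPE('h)) A B)
        (Hom (VModTens V) (P0 (P_functor V L) A) (P0 (P_functor V L) B)) (P1 (P_functor V L) A B)"
      by (simp add: VMonCat_def VModTens_def P_functor_def)
  qed
qed

end
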